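(* Let $r\in\{6,7\}$, let $S_r$ be a smooth Del Pezzo surface of degree $9-r$ over $\mathbb{K}$ (the blow-up of $\mathbb{P}^2$ in $r$ points in general position), let $\mathbb{A}(S_r)=\operatorname{Spec}(\operatorname{Cox}(S_r))\subset\mathbb{A}_r$ be embedded by an arbitrary choice of generating sections of $\operatorname{Cox}(S_r)$, and let $H_r\subset\mathbb{A}'_r$ be the affine cone over the flag variety $G_r/P_r$. Then there exists an $(N_{r-2}+2)$-parameter family (that is, a $12$-parameter family for $r=6$ and an $18$-parameter family for $r=7$) of good rescalings $\phi_r:\mathbb{A}_r\to\mathbb{A}'_r$, i.e. rescalings which embed $\mathbb{A}(S_r)$ into $H_r$.
   Context: $\mathbb{K}$ is an algebraically closed field of characteristic $0$. **Del Pezzo surfaces.** $S_r$ is the blow-up of $\mathbb{P}^2$ in $r$ points $p_1,\dots,p_r$ in general position; for $r\le 7$ this means no three on a line and no six on a conic. $\operatorname{Pic}(S_r)\cong\mathbb{Z}^{r+1}$ is free on $H$ (pullback of a line) and the exceptional curves $E_1,\dots,E_r$, with intersection form $(\cdot,\cdot)$: $(H,H)=1$, $(E_i,E_i)=-1$, all other products of basis elements $0$; $-K_r=3H-\sum E_i$. A $(-1)$-curve is a curve $E$ on $S_r$ with $(E,E)=-1$ (identified with its class). Their numbers are $N_3=6,N_4=10,N_5=16,N_6=27,N_7=56$. For $r=6$ they are $E_i$, $m_{i,j}=H-E_i-E_j$ ($i<j$), $Q_i=2H-\sum_k E_k+E_i$. For $r=7$ they are $E_i$, $m_{i,j}=H-E_i-E_j$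 ($i<j$), $Q_{i,j}=2H-\sum_kE_k+E_i+E_j$ ($i<j$), $C_i=3H-\sum_kE_k-E_i$. **Cox ring.** For a basis $\mathcal{L}_0,\dots,\mathcal{L}_r$ of $\operatorname{Pic}(S_r)$, $\operatorname{Cox}(S_r)=\bigoplus_{\nu\in\mathbb{Z}^{r+1}}H^0(S_r,\mathcal{L}_0^{\otimes\nu_0}\otimes\dots\otimes\mathcal{L}_r^{\otimes\nu_r})$ with multiplication of sections. It is generated by $N_r$ sections, one nonzero section vanishing on $E$ for each $(-1)$-curve $E$, each unique up to a nonzero constant. Fixing any such choice, with $\xi(E)$ mapping to the section of $E$, gives a surjection $\mathbb{K}[\xi(E)]\to\operatorname{Cox}(S_r)$ and a closed embedding $\mathbb{A}(S_r):=\operatorname{Spec}(\operatorname{Cox}(S_r))\subset\mathbb{A}_r:=\operatorname{Spec}\mathbb{K}[\xi(E)\mid E\ \text{a }(-1)\text{-curve}]\cong\mathbb{A}^{N_r}$. **The cone $H_r$.** $G_6$, $G_7$ are the simply connected linear algebraic groups of type $\mathbf{E}_6$, $\mathbf{E}_7$; $\alpha_r$ is the simple root at the end of a long leg of the Dynkin diagram $\mathbf{E}_6$ ($r=6$), resp. of the longest leg of $\mathbf{E}_7$ ($r=7$); $\varpi_r$ is the associated fundamental weight; $P_r$ is the maximal parabolic subgroup corresponding to the set of all simple roots other than $\alpha_r$. The irreducible representation of highest weight $\varpi_r$ has dimension $N_r$, its weights are identified with the $(-1)$-curves, and $H_r$, the $G_r$-orbit of the weight space of $\varpi_r$, is the affine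 cone over $G_r/P_r$. Explicitly, $H_r\subset\mathbb{A}'_r:=\operatorname{Spec}\mathbb{K}[\xi'(E)\mid E\ \text{a }(-1)\text{-curve}]\cong\mathbb{A}^{N_r}$ is given as follows. *$r=6$.* Write $\eta'_i=\xi'(E_i)$, $\mu'_{i,j}=\xi'(m_{i,j})$, $\lambda'_i=\xi'(Q_i)$. $H_6$ is the common zero set of the 27 partial derivatives of $F=\det M_1+\det M_2+\det M_3-\operatorname{tr}(M_1M_2M_3)$, where $$M_1=\begin{pmatrix}\eta'_1&\lambda'_1&\mu'_{2,3}\\ \eta'_2&\lambda'_2&\mu'_{1,3}\\ \eta'_3&\lambda'_3&\mu'_{1,2}\end{pmatrix},\ M_2=\begin{pmatrix}\lambda'_4&\lambda'_5&\lambda'_6\\ \eta'_4&\eta'_5&\eta'_6\\ \mu'_{5,6}&\mu'_{4,6}&\mu'_{4,5}\end{pmatrix},\ M_3=\begin{pmatrix}\mu'_{1,4}&\mu'_{2,4}&\mu'_{3,4}\\ \mu'_{1,5}&\mu'_{2,5}&\mu'_{3,5}\\ \mu'_{1,6}&\mu'_{2,6}&\mu'_{3,6}\end{pmatrix}.$$ *$r=7$.* Write $\eta'_i=\xi'(E_i)=x^{i8}$, $\mu'_{k,l}=\xi'(m_{k,l})=y_{kl}$, $\nu'_{k,l}=\xi'(Q_{k,l})=x^{kl}$, $\lambda'_i=\xi'(C_i)=y_{i8}$ ($i,k,l\le 7$, $k<l$), and $x^{ba}=-x^{ab}$, $y_{ba}=-y_{ab}$. $H_7$ is the common zero set of $u^{ijkl}=x^{ij}x^{kl}-x^{ik}x^{jl}+x^{il}x^{jk}+\sigma(y_{ab}y_{cd}-y_{ac}y_{bd}+y_{ad}y_{bc})$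 for $i<j<k<l$, $a<b<c<d$ with $(i,j,k,l,a,b,c,d)$ a permutation of $(1,\dots,8)$ of sign $\sigma$; $v^i_j=\sum_{k\in\{1,\dots,8\}\setminus\{i,j\}}x^{ik}y_{kj}$ for $i\ne j$ in $\{1,\dots,8\}$; and $v^i_i=-\frac34\sum_{j\neq i}x^{ij}y_{ij}+\frac14\sum_{j<k,\ j,k\ne i}x^{jk}y_{jk}$ for $i\in\{1,\dots,8\}$. **Rescalings.** A rescaling is an isomorphism $\phi_r:\mathbb{A}_r\to\mathbb{A}'_r$ with $\phi_r^*(\xi'(E))=\xi''(E)\cdot\xi(E)$ for all $(-1)$-curves $E$, where $\xi''(E)\in\mathbb{K}^*$ are the rescaling factors. It is good if $\phi_r(\mathbb{A}(S_r))\subset H_r$. **Parameter family.** An $n$-parameter family of good rescalings means a family in which $n$ of the rescaling factors range freely over a non-empty Zariski-open subset of $\mathbb{A}^n$, the remaining factors being algebraic (rational) expressions in these $n$ parameters. *)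

theory Defs
  imports "HOL-Analysis.Analysis" "HOL-Library.Poly_Mapping" "HOL-Library.Function_Algebras"
    "HOL-Computational_Algebra.Polynomial" "HOL-Combinatorics.Permutations"
begin

section \<open>Polynomial and regular functions\<close>

text \<open>The \<open>K\<close>-algebra of functions generated by a set \<open>C\<close> of coordinate functions.\<close>

inductive_set polyfun :: "('b \<Rightarrow> 'a::comm_ring_1) set \<Rightarrow> ('b \<Rightarrow> 'a) set"
  for C :: "('b \<Rightarrow> 'a) set" where
  polyfun_const: "(\<lambda>_. c) \<in> polyfun C"
| polyfun_coord: "f \<in> C \<Longrightarrow> f \<in> polyfun C"
| polyfun_add: "f \<in> polyfun C \<Longrightarrow> g \<in> polyfun C \<Longrightarrow> (\<lambda>y. f y + g y) \<in> polyfun C"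
| polyfun_mult: "f \<in> polyfun C \<Longrightarrow> g \<in> polyfun C \<Longrightarrow> (\<lambda>y. f y * g y) \<in> polyfun C"

definition regular_on :: "('b \<Rightarrow> 'a::field) set \<Rightarrow> 'b set \<Rightarrow> ('b \<Rightarrow> 'a) \<Rightarrow> bool" where
  "regular_on C X s \<longleftrightarrow>
     (\<forall>y\<in>X. \<exists>P\<in>polyfun C. \<exists>Q\<in>polyfun C. Q y \<noteq> 0 \<and> (\<forall>z\<in>X. Q z \<noteq> 0 \<longrightarrow> s z = P z / Q z))"


section \<open>The Picard group and the $(-1)$-curves\<close>

text \<open>A class \<open>dH + n\<^sub>1E\<^sub>1 + \<dots> + n\<^sub>rE\<^sub>r\<close> is the finitely supported function with
  value \<open>d\<close> at \<open>0\<close> and \<open>n\<^sub>i\<close> at \<open>i\<close>.\<close>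

type_synonym pic = "nat \<Rightarrow>\<^sub>0 int"

definition Pic :: "nat \<Rightarrow> pic set" where
  "Pic r = {D. Poly_Mapping.keys D \<subseteq> {0..r}}"

definition hyp :: "int \<Rightarrow> pic" where
  "hyp d = Poly_Mapping.single 0 d"

definition exc :: "nat \<Rightarrow> pic" where
  "exc i = Poly_Mapping.single i 1"

definition exc_sum :: "nat set \<Rightarrow> pic" where
  "exc_sum A = (\<Sum>k\<in>A. exc k)"

definition m_class :: "nat \<Rightarrow> nat \<Rightarrow> pic" where
  "m_class i j = hyp 1 - exc i - exc j"

definition Q6_class :: "nat \<Rightarrow> pic" where
  "Q6_class i = hyp 2 - exc_sum {1..6} + exc i"

definition Q7_class :: "nat \<Rightarrow> nat \<Rightarrow> pic" where
  "Q7_class i j = hyp 2 - exc_sum {1..7} + exc i + exc j"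

definition C_class :: "nat \<Rightarrow> pic" where
  "C_class i = hyp 3 - exc_sum {1..7} - exc i"

text \<open>The classes of the $(-1)$-curves for \<open>3 \<le> r \<le> 7\<close>: exceptional curves and strict
  transforms of lines through two, conics through five, and cubics through seven of the points
  that are double in one of them. For \<open>r = 6, 7\<close> see \<open>neg_curves_6\<close> and \<open>neg_curves_7\<close> below.\<close>

definition neg_curves :: "nat \<Rightarrow> pic set" where
  "neg_curves r = exc ` {1..r}
     \<union> {hyp 1 - exc_sum A | A. A \<subseteq> {1..r} \<and> card A = 2}
     \<union> {hyp 2 - exc_sum A | A. A \<subseteq> {1..r} \<and> card A = 5}
     \<union> {hyp 3 - exc_sum A - exc i | A i. A \<subseteq> {1..r} \<and> card A = 7 \<and> i \<in> A}"

definition num_neg_curves :: "nat \<Rightarrow> nat" where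
  "num_neg_curves r = card (neg_curves r)"

lemma lookup_exc_sum: "finite A \<Longrightarrow> Poly_Mapping.lookup (exc_sum A) i = (if i \<in> A then 1 else 0)"
  by (simp add: exc_sum_def exc_def lookup_sum lookup_single when_def)

lemma lookup_hyp: "Poly_Mapping.lookup (hyp d) i = (if i = 0 then d else 0)"
  by (simp add: hyp_def lookup_single when_def)

lemmas lookup_class =
  lookup_hyp exc_def m_class_def Q6_class_def Q7_class_def C_class_def
  lookup_minus lookup_add lookup_single when_def lookup_exc_sum

lemma exc_sum_insert: "finite A \<Longrightarrow> i \<notin> A \<Longrightarrow> exc_sum (insert i A) = exc i + exc_sum A"
  by (simp add: exc_sum_def)

lemma exc_sum_pair: "i \<noteq> j \<Longrightarrow> hyp 1 - exc_sum {i, j} = m_class i j"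
  by (simp add: exc_sum_def m_class_def algebra_simps)

lemma line_classes:
  "{hyp 1 - exc_sum A | A. A \<subseteq> {1..r} \<and> card A = 2} = {m_class i j | i j. 1 \<le> i \<and> i < j \<and> j \<le> r}"
  (is "?L = ?R")
proof (intro equalityI subsetI)
  fix D assume "D \<in> ?L"
  then obtain A where A: "A \<subseteq> {1..r}" "card A = 2" "D = hyp 1 - exc_sum A" by auto
  from A(2) obtain a b where ab: "A = {a, b}" "a \<noteq> b" by (auto simp: card_2_iff)
  define i j where "i = min a b" and "j = max a b"
  have "A = {i, j}" "i < j" using ab by (auto simp: i_def j_def min_def max_def)
  then show "D \<in> ?R" using A exc_sum_pair[of i j] by auto
next
  fix D assume "D \<in> ?R"
  then obtain i j where ij: "1 \<le> i" "i < j" "j \<le> r" "D = m_class i j" by auto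
  then have "D = hyp 1 - exc_sum {i, j} \<and> {i, j} \<subseteq> {1..r} \<and> card {i, j} = 2"
    by (simp add: exc_sum_pair)
  then show "D \<in> ?L" by blast
qed

lemma exc_sum_Diff: "finite B \<Longrightarrow> A \<subseteq> B \<Longrightarrow> exc_sum (B - A) = exc_sum B - exc_sum A"
  by (simp add: exc_sum_def sum_diff)

lemma neg_curves_6:
  "neg_curves 6 = exc ` {1..6} \<union> {m_class i j | i j. 1 \<le> i \<and> i < j \<and> j \<le> 6} \<union> Q6_class ` {1..6}"
proof -
  have "{hyp 2 - exc_sum A | A. A \<subseteq> {1..6} \<and> card A = 5} = Q6_class ` {1..6}" (is "?L = ?R")
  proof (intro equalityI subsetI)
    fix D assume "D \<in> ?L"
    then obtain A where A: "A \<subseteq> {1..6}" "card A = 5" "D = hyp 2 - exc_sum A" by auto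
    have "card ({1..6} - A) = 1" using A by (simp add: card_Diff_subset finite_subset)
    then obtain i where i: "{1..6} - A = {i}" by (auto simp: card_1_singleton_iff)
    then have "i \<in> {1..6}" "A = {1..6} - {i}" using A(1) by auto
    then show "D \<in> ?R" using A(3) exc_sum_Diff[of "{1..6}" "{i}"]
      by (auto simp: Q6_class_def exc_sum_insert exc_sum_def)
  next
    fix D assume "D \<in> ?R"
    then obtain i where i: "i \<in> {1..6}" "D = Q6_class i" by auto
    then have "D = hyp 2 - exc_sum ({1..6} - {i}) \<and> {1..6} - {i} \<subseteq> {1..6} \<and> card ({1..6} - {i}) = 5"
      using exc_sum_Diff[of "{1..6}" "{i}"] by (simp add: Q6_class_def exc_sum_def)
    then show "D \<in> ?L" by blast
  qed
  moreover have "A \<subseteq> {1..6::nat} \<Longrightarrow> card A \<noteq> 7" for A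
    using card_mono[of "{1..6::nat}" A] by auto
  then have "{hyp 3 - exc_sum A - exc i | A i. A \<subseteq> {1..6} \<and> card A = 7 \<and> i \<in> A} = {}" by auto
  ultimately show ?thesis by (simp only: neg_curves_def line_classes Un_empty_right)
qed

lemma cubic_classes:
  "{hyp 3 - exc_sum A - exc i | A i. A \<subseteq> {1..7} \<and> card A = 7 \<and> i \<in> A} = C_class ` {1..7}"
proof -
  have "A \<subseteq> {1..7::nat} \<and> card A = 7 \<and> i \<in> A \<longleftrightarrow> A = {1..7} \<and> i \<in> {1..7}" for A i
    using card_subset_eq[of "{1..7::nat}" A] by auto
  then show ?thesis unfolding C_class_def by (simp only:) blast
qed

lemma neg_curves_7:
  "neg_curves 7 = exc ` {1..7} \<union> {m_class i j | i j. 1 \<le> i \<and> i < j \<and> j \<le> 7}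
     \<union> {Q7_class i j | i j. 1 \<le> i \<and> i < j \<and> j \<le> 7} \<union> C_class ` {1..7}"
proof -
  have "{hyp 2 - exc_sum A | A. A \<subseteq> {1..7} \<and> card A = 5} = {Q7_class i j | i j. 1 \<le> i \<and> i < j \<and> j \<le> 7}"
    (is "?L = ?R")
  proof (intro equalityI subsetI)
    fix D assume "D \<in> ?L"
    then obtain A where A: "A \<subseteq> {1..7}" "card A = 5" "D = hyp 2 - exc_sum A" by auto
    have "card ({1..7} - A) = 2" using A by (simp add: card_Diff_subset finite_subset)
    then obtain a b where ab: "{1..7} - A = {a, b}" "a \<noteq> b" by (auto simp: card_2_iff)
    define i j where "i = min a b" and "j = max a b"
    have ij: "{1..7} - A = {i, j}" "i < j" using ab by (auto simp: i_def j_def min_def max_def)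
    then have "1 \<le> i" "j \<le> 7" "A = {1..7} - {i, j}" using A(1) by auto
    moreover have "exc_sum A = exc_sum {1..7} - exc_sum {i, j}"
      using calculation ij by (subst \<open>A = {1..7} - {i, j}\<close>, subst exc_sum_Diff) auto
    moreover have "exc_sum {i, j} = exc i + exc j" using ij by (simp add: exc_sum_def)
    ultimately have "D = Q7_class i j" by (simp add: A(3) Q7_class_def)
    moreover note \<open>1 \<le> i\<close> \<open>j \<le> 7\<close>
    ultimately show "D \<in> ?R" using ij(2) by blast
  next
    fix D assume "D \<in> ?R"
    then obtain i j where ij: "1 \<le> i" "i < j" "j \<le> 7" "D = Q7_class i j" by auto
    then have "exc_sum {i, j} = exc i + exc j" "{i, j} \<subseteq> {1..7}" by (auto simp: exc_sum_def)
    then have "D = hyp 2 - exc_sum ({1..7} - {i, j})"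
      using exc_sum_Diff[of "{1..7}" "{i, j}"] ij(4) by (simp add: Q7_class_def)
    moreover have "card ({1..7} - {i, j}) = 5" using ij by (simp add: card_Diff_subset)
    ultimately have "D = hyp 2 - exc_sum ({1..7} - {i, j}) \<and> {1..7} - {i, j} \<subseteq> {1..7} \<and> card ({1..7} - {i, j}) = 5"
      by blast
    then show "D \<in> ?L" by blast
  qed
  then show ?thesis by (simp only: neg_curves_def line_classes cubic_classes)
qed

lemma card_classes:
  "card {hyp d - exc_sum A | A. A \<subseteq> {1..r} \<and> card A = k} = r choose k"
proof -
  have "{hyp d - exc_sum A | A. A \<subseteq> {1..r} \<and> card A = k}
      = (\<lambda>A. hyp d - exc_sum A) ` {A. A \<subseteq> {1..r} \<and> card A = k}" by auto
  moreover have "inj_on (\<lambda>A. hyp d - exc_sum A) {A. A \<subseteq> {1..r} \<and> card A = k}"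
  proof (rule inj_onI)
    fix A B assume AB: "A \<in> {A. A \<subseteq> {1..r} \<and> card A = k}" "B \<in> {A. A \<subseteq> {1..r} \<and> card A = k}"
      "hyp d - exc_sum A = hyp d - exc_sum B"
    then have "finite A" "finite B" by (auto intro: finite_subset)
    moreover have "Poly_Mapping.lookup (exc_sum A) i = Poly_Mapping.lookup (exc_sum B) i" for i
      using AB(3) by simp
    ultimately have "i \<in> A \<longleftrightarrow> i \<in> B" for i
      by (metis lookup_exc_sum zero_neq_one)
    then show "A = B" by blast
  qed
  ultimately show ?thesis using n_subsets[of "{1..r}" k] by (simp add: card_image)
qed

lemma finite_classes: "finite {hyp d - exc_sum A | A. A \<subseteq> {1..r} \<and> card A = k}"
proof -
  have "{hyp d - exc_sum A | A. A \<subseteq> {1..r} \<and> card A = k} \<subseteq> (\<lambda>A. hyp d - exc_sum A) ` Pow {1..r}" by auto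
  then show ?thesis by (rule finite_subset) simp
qed

lemma card_exc: "card (exc ` {1..r}) = r"
proof -
  have "inj_on exc {1..r}"
    by (rule inj_onI) (metis exc_def lookup_single_eq lookup_single_not_eq zero_neq_one)
  then show ?thesis by (simp add: card_image)
qed

lemma card_neg_curves:
  "card (neg_curves r) = r + (r choose 2) + (r choose 5) +
     card {hyp 3 - exc_sum A - exc i | A i. A \<subseteq> {1..r} \<and> card A = 7 \<and> i \<in> A}"
    (is "_ = _ + card ?C")
proof -
  let ?E = "exc ` {1..r}"
  let ?M = "{hyp 1 - exc_sum A | A. A \<subseteq> {1..r} \<and> card A = 2}"
  let ?Q = "{hyp 2 - exc_sum A | A. A \<subseteq> {1..r} \<and> card A = 5}"
  let ?deg = "\<lambda>D::pic. Poly_Mapping.lookup D (0::nat)"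
  have fA: "finite A \<and> 0 \<notin> A" if "A \<subseteq> {1..r}" for A using that by (auto intro: finite_subset)
  have 1: "?deg D = 0" if "D \<in> ?E" for D using that by (auto simp: lookup_class)
  have 2: "?deg D = 1" if "D \<in> ?M" for D using that fA by (auto simp: lookup_class)
  have 3: "?deg D = 2" if "D \<in> ?Q" for D using that fA by (auto simp: lookup_class)
  have 4: "?deg D = 3" if "D \<in> ?C" for D
  proof -
    from that obtain A i where "D = hyp 3 - exc_sum A - exc i" "A \<subseteq> {1..r}" "i \<in> A" by blast
    moreover from this have "i \<noteq> 0" using fA by metis
    ultimately show ?thesis using fA by (auto simp: lookup_class)
  qed
  have dis: "X \<inter> Y = {}"
    if "\<And>D. D \<in> X \<Longrightarrow> ?deg D < n" "\<And>D. D \<in> Y \<Longrightarrow> ?deg D = n" for X Y n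
  proof (rule equals0I)
    fix D assume D: "D \<in> X \<inter> Y"
    show False using that(1)[of D] that(2)[of D] D by (simp del: One_nat_def)
  qed
  have "?C \<subseteq> (\<lambda>(A, i). hyp 3 - exc_sum A - exc i) ` (Pow {1..r} \<times> {1..r})" by auto
  then have "finite ?C" by (rule finite_subset) simp
  note finite_C = this
  have "?deg D < 1" if "D \<in> ?E" for D using 1[OF that] by linarith
  then have d1: "?E \<inter> ?M = {}" using 2 by (rule dis)
  have "?deg D < 2" if "D \<in> ?E \<union> ?M" for D
    by (rule UnE[OF that]) (drule 1 2, linarith)+
  then have d2: "(?E \<union> ?M) \<inter> ?Q = {}" using 3 by (rule dis)
  have "?deg D < 3" if "D \<in> ?E \<union> ?M \<union> ?Q" for D
    by (rule UnE[OF that], erule UnE) (drule 1 2 3, linarith)+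
  then have d3: "(?E \<union> ?M \<union> ?Q) \<inter> ?C = {}" using 4 by (rule dis)
  have "finite ?E" by simp
  then have "card (?E \<union> ?M \<union> ?Q \<union> ?C) = card ?E + card ?M + card ?Q + card ?C"
    by (simp only: card_Un_disjoint finite_classes finite_UnI finite_C d1 d2 d3)
  then show ?thesis unfolding neg_curves_def card_classes card_exc .
qed

lemma num_neg_curves_values: "num_neg_curves 3 = 6" "num_neg_curves 4 = 10" "num_neg_curves 5 = 16"
  "num_neg_curves 6 = 27" "num_neg_curves 7 = 56"
proof -
  have choose: "(3::nat) choose 2 = 3" "(4::nat) choose 2 = 6" "(5::nat) choose 2 = 10"
    "(6::nat) choose 2 = 15" "(7::nat) choose 2 = 21" "(6::nat) choose 5 = 6" "(7::nat) choose 5 = 21"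
    by code_simp+
  have *: "num_neg_curves r = r + (r choose 2) + (r choose 5)" if "r < 7" for r
  proof -
    have "card A \<noteq> 7" if "A \<subseteq> {1..r}" for A
      using card_mono[OF _ that] \<open>r < 7\<close> by auto
    then have "{hyp 3 - exc_sum A - exc i | A i. A \<subseteq> {1..r} \<and> card A = 7 \<and> i \<in> A} = {}" by auto
    then show ?thesis unfolding num_neg_curves_def card_neg_curves by (metis add.right_neutral card.empty)
  qed
  show "num_neg_curves 3 = 6" "num_neg_curves 4 = 10" "num_neg_curves 5 = 16" "num_neg_curves 6 = 27"
    by (simp_all add: * choose)
  have "inj_on C_class {1..7}"
  proof (rule inj_onI)
    fix i j assume "C_class i = C_class j"
    then have "exc i = exc j" by (simp add: C_class_def)
    then show "i = j" by (metis exc_def lookup_single_eq lookup_single_not_eq zero_neq_one)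
  qed
  then show "num_neg_curves 7 = 56" unfolding num_neg_curves_def card_neg_curves cubic_classes
    by (simp add: card_image choose)
qed


section \<open>Blow-ups of the projective plane and their Cox rings\<close>

definition pair :: "'a::comm_ring_1^3 \<Rightarrow> 'a^3 \<Rightarrow> 'a" where
  "pair l x = (\<Sum>k\<in>UNIV. l $ k * x $ k)"

text \<open>The points are \<open>[p 1], \<dots>, [p r]\<close>. The first condition implies that the \<open>p i\<close> are nonzero
  and that the points are distinct, as \<open>r \<ge> 3\<close>.\<close>

definition general_position :: "nat \<Rightarrow> (nat \<Rightarrow> 'a::field^3) \<Rightarrow> bool" where
  "general_position r p \<longleftrightarrow>
     (\<forall>I\<subseteq>{1..r}. card I = 3 \<longrightarrow>
        \<not> (\<exists>l. l \<noteq> 0 \<and> (\<forall>i\<in>I. pair l (p i) = 0))) \<and>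
     (\<forall>I\<subseteq>{1..r}. card I = 6 \<longrightarrow>
        \<not> (\<exists>A::'a^3^3. A \<noteq> 0 \<and> transpose A = A \<and> (\<forall>i\<in>I. pair (p i) (A *v p i) = 0)))"

text \<open>The blow-up of the plane in \<open>p\<^sub>1, \<dots>, p\<^sub>r\<close> is
  \<open>S\<^sub>r = {([x],[l\<^sub>1],\<dots>,[l\<^sub>r]). l\<^sub>i is a line through p\<^sub>i and x}\<close>, a closed subvariety of the
  product of the plane and \<open>r\<close> copies of the dual plane. The following is the multicone over it:
  \<open>y 0 = x\<close> and \<open>y i = l\<^sub>i\<close>, all nonzero.\<close>

definition blowup_cone :: "nat \<Rightarrow> (nat \<Rightarrow> 'a::field^3) \<Rightarrow> (nat \<Rightarrow> 'a^3) set" where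
  "blowup_cone r p = {y. y 0 \<noteq> 0 \<and>
     (\<forall>i\<in>{1..r}. y i \<noteq> 0 \<and> pair (y i) (p i) = 0 \<and> pair (y i) (y 0) = 0) \<and> (\<forall>i>r. y i = 0)}"

definition cone_coords :: "((nat \<Rightarrow> 'a::field^3) \<Rightarrow> 'a) set" where
  "cone_coords = {(\<lambda>y. y i $ k) | i k. True}"

text \<open>Global sections of the line bundle of class \<open>D\<close>, as multihomogeneous regular functions on
  the multicone (extended by \<open>0\<close>). The pullback of \<open>O(1)\<close> is \<open>O(H)\<close> for the plane and
  \<open>O(H - E\<^sub>i)\<close> for the \<open>i\<close>-th dual plane, by projection from \<open>p\<^sub>i\<close>. These form a basis of the
  Picard group, and \<open>dH + \<Sum>n\<^sub>iE\<^sub>i = (d + \<Sum>n\<^sub>i)H + \<Sum>(-n\<^sub>i)(H - E\<^sub>i)\<close>.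
  See \<open>exc_section\<close> below for the section of \<open>O(E\<^sub>i)\<close>.\<close>

definition H0 :: "nat \<Rightarrow> (nat \<Rightarrow> 'a::field^3) \<Rightarrow> pic \<Rightarrow> ((nat \<Rightarrow> 'a^3) \<Rightarrow> 'a) set" where
  "H0 r p D = {s.
     (\<forall>y. y \<notin> blowup_cone r p \<longrightarrow> s y = 0) \<and>
     regular_on cone_coords (blowup_cone r p) s \<and>
     (\<forall>y\<in>blowup_cone r p. \<forall>c. (\<forall>i. c i \<noteq> 0) \<longrightarrow>
        s (\<lambda>i. c i *s y i) =
          c 0 powi (\<Sum>i=0..r. Poly_Mapping.lookup D i) *
          (\<Prod>i=1..r. c i powi (- Poly_Mapping.lookup D i)) * s y)}"

lemma exc_section:
  fixes p :: "nat \<Rightarrow> 'a::field^3"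
  assumes "i \<in> {1..r}" and "p i \<noteq> 0"
  shows "\<exists>e\<in>H0 r p (exc i). \<forall>y\<in>blowup_cone r p. e y = 0 \<longleftrightarrow> (\<exists>c. y 0 = c *s p i)"
proof -
  define w :: "(nat \<Rightarrow> 'a^3) \<Rightarrow> 'a^3" where "w y = vector
    [p i $ 2 * y 0 $ 3 - p i $ 3 * y 0 $ 2,
     p i $ 3 * y 0 $ 1 - p i $ 1 * y 0 $ 3,
     p i $ 1 * y 0 $ 2 - p i $ 2 * y 0 $ 1]" for y
  let ?X = "blowup_cone r p"
  define e where "e y = (if y \<in> ?X then let k = SOME k. y i $ k \<noteq> 0 in w y $ k / y i $ k else 0)" for y
  have w_simps [simp]: "w y $ 1 = p i $ 2 * y 0 $ 3 - p i $ 3 * y 0 $ 2"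
    "w y $ 2 = p i $ 3 * y 0 $ 1 - p i $ 1 * y 0 $ 3"
    "w y $ 3 = p i $ 1 * y 0 $ 2 - p i $ 2 * y 0 $ 1" for y
    by (simp_all add: w_def)
  have par: "w y $ j * y i $ k = w y $ k * y i $ j" if "y \<in> ?X" for y j k
  proof -
    have "pair (y i) (p i) = 0" "pair (y i) (y 0) = 0"
      using that assms(1) by (auto simp: blowup_cone_def)
    then have a: "y i $ 1 * p i $ 1 + y i $ 2 * p i $ 2 + y i $ 3 * p i $ 3 = 0"
      and b: "y i $ 1 * y 0 $ 1 + y i $ 2 * y 0 $ 2 + y i $ 3 * y 0 $ 3 = 0"
      by (simp_all add: pair_def sum_3)
    have 1: "w y $ 1 * y i $ 2 = w y $ 2 * y i $ 1" using a b by simp algebra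
    have 2: "w y $ 1 * y i $ 3 = w y $ 3 * y i $ 1" using a b by simp algebra
    have 3: "w y $ 2 * y i $ 3 = w y $ 3 * y i $ 2" using a b by simp algebra
    show ?thesis using exhaust_3[of j] exhaust_3[of k] 1 2 3 by (auto simp del: w_simps)
  qed
  have e: "e y = w y $ k / y i $ k" if "y \<in> ?X" "y i $ k \<noteq> 0" for y k
  proof -
    have "y i $ (SOME k. y i $ k \<noteq> 0) \<noteq> 0" using that(2) by (rule someI)
    then show ?thesis using that par[OF that(1)] by (simp add: e_def Let_def frac_eq_eq)
  qed
  have ex: "\<exists>k. y i $ k \<noteq> 0" if "y \<in> ?X" for y
    using that assms(1) by (auto simp: blowup_cone_def vec_eq_iff)
  have coord: "(\<lambda>y. y j $ k) \<in> polyfun cone_coords" for j k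
    by (rule polyfun_coord) (auto simp: cone_coords_def)
  have lin: "(\<lambda>y. a * y j $ k - b * y j' $ k') \<in> polyfun cone_coords" for a b :: 'a and j k j' k'
    using polyfun_add[OF polyfun_mult[OF polyfun_const coord] polyfun_mult[OF polyfun_const coord],
        of a j k "- b" j' k'] by simp
  have wp: "(\<lambda>y. w y $ k) \<in> polyfun cone_coords" for k
    using exhaust_3[of k] lin by auto
  have "regular_on cone_coords ?X e"
    unfolding regular_on_def
  proof
    fix y assume "y \<in> ?X"
    then obtain k where "y i $ k \<noteq> 0" using ex by blast
    then show "\<exists>P\<in>polyfun cone_coords. \<exists>Q\<in>polyfun cone_coords.
        Q y \<noteq> 0 \<and> (\<forall>z\<in>?X. Q z \<noteq> 0 \<longrightarrow> e z = P z / Q z)"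
      using e by (intro bexI[OF _ wp[of k]] bexI[OF _ coord[of i k]]) auto
  qed
  moreover have "e (\<lambda>j. c j *s y j) = c 0 powi (\<Sum>j=0..r. Poly_Mapping.lookup (exc i) j) *
      (\<Prod>j=1..r. c j powi (- Poly_Mapping.lookup (exc i) j)) * e y"
    if y: "y \<in> ?X" and c: "\<forall>j. c j \<noteq> 0" for y c
  proof -
    obtain k where k: "y i $ k \<noteq> 0" using ex y by blast
    have "pair (c j *s l) x = c j * pair l x" "pair l (c j *s x) = c j * pair l x" for j l x
      by (simp_all add: pair_def sum_distrib_left mult_ac)
    then have cy: "(\<lambda>j. c j *s y j) \<in> ?X"
      using y c by (auto simp: blowup_cone_def vector_mul_eq_0)
    have "w (\<lambda>j. c j *s y j) $ k = c 0 * w y $ k"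
      using exhaust_3[of k] by (auto simp: algebra_simps)
    then have "e (\<lambda>j. c j *s y j) = c 0 * inverse (c i) * e y"
      using e[OF cy, of k] e[OF y k] k c by (simp add: divide_inverse mult_ac)
    moreover have "(\<Sum>j=0..r. Poly_Mapping.lookup (exc i) j) = 1"
      using assms(1) by (simp add: exc_def lookup_single when_def)
    moreover have "(\<Prod>j=1..r. c j powi (- Poly_Mapping.lookup (exc i) j)) =
        (\<Prod>j=1..r. if i = j then inverse (c i) else 1)"
      by (rule prod.cong) (auto simp: exc_def lookup_single when_def power_int_minus)
    moreover have "\<dots> = inverse (c i)" using assms(1) by simp
    ultimately show ?thesis by simp
  qed
  ultimately have "e \<in> H0 r p (exc i)" by (auto simp: H0_def e_def)
  moreover have "e y = 0 \<longleftrightarrow> (\<exists>c. y 0 = c *s p i)" if y: "y \<in> ?X" for y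
  proof -
    obtain k where k: "y i $ k \<noteq> 0" using ex y by blast
    have "e y = 0 \<longleftrightarrow> w y $ k = 0" using e[OF y k] k by simp
    also have "\<dots> \<longleftrightarrow> (\<forall>j. w y $ j = 0)" using par[OF y, of _ k] k by (metis mult_eq_0_iff)
    also have "\<dots> \<longleftrightarrow> (\<exists>c. y 0 = c *s p i)"
    proof
      assume w: "\<forall>j. w y $ j = 0"
      have w1: "p i $ 2 * y 0 $ 3 = p i $ 3 * y 0 $ 2" using spec[OF w, of 1] by simp
      have w2: "p i $ 3 * y 0 $ 1 = p i $ 1 * y 0 $ 3" using spec[OF w, of 2] by simp
      have w3: "p i $ 1 * y 0 $ 2 = p i $ 2 * y 0 $ 1" using spec[OF w, of 3] by simp
      obtain m where m: "p i $ m \<noteq> 0" using assms(2) by (auto simp: vec_eq_iff)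
      have "y 0 $ j * p i $ m = y 0 $ m * p i $ j" for j
        using exhaust_3[of j] exhaust_3[of m] w1 w2 w3 by (auto simp: mult_ac)
      then have "y 0 = (y 0 $ m / p i $ m) *s p i" using m by (simp add: vec_eq_iff field_simps)
      then show "\<exists>c. y 0 = c *s p i" by blast
    next
      assume "\<exists>c. y 0 = c *s p i"
      then show "\<forall>j. w y $ j = 0" by (auto simp: forall_3)
    qed
    finally show ?thesis .
  qed
  ultimately show ?thesis by blast
qed

text \<open>The direct sum of all \<open>H0 r p D\<close>. Its ring operations are those of \<open>\<Rightarrow>\<^sub>0\<close>: the product
  is convolution, with pointwise multiplication of sections.\<close>

definition Cox :: "nat \<Rightarrow> (nat \<Rightarrow> 'a::field^3) \<Rightarrow> (pic \<Rightarrow>\<^sub>0 ((nat \<Rightarrow> 'a^3) \<Rightarrow> 'a)) set" where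
  "Cox r p = {F. Poly_Mapping.keys F \<subseteq> Pic r \<and> (\<forall>D\<in>Pic r. Poly_Mapping.lookup F D \<in> H0 r p D)}"

definition cox_const ::
    "nat \<Rightarrow> (nat \<Rightarrow> 'a::field^3) \<Rightarrow> 'a \<Rightarrow> (pic \<Rightarrow>\<^sub>0 ((nat \<Rightarrow> 'a^3) \<Rightarrow> 'a))" where
  "cox_const r p c = Poly_Mapping.single 0 (\<lambda>y. if y \<in> blowup_cone r p then c else 0)"

text \<open>The (closed) points of \<open>Spec (Cox r p)\<close> as \<open>K\<close>-algebra homomorphisms to \<open>K\<close>.\<close>

definition cox_points ::
    "nat \<Rightarrow> (nat \<Rightarrow> 'a::field^3) \<Rightarrow> ((pic \<Rightarrow>\<^sub>0 ((nat \<Rightarrow> 'a^3) \<Rightarrow> 'a)) \<Rightarrow> 'a) set" where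
  "cox_points r p = {\<phi>.
     (\<forall>c. \<phi> (cox_const r p c) = c) \<and>
     (\<forall>F\<in>Cox r p. \<forall>G\<in>Cox r p. \<phi> (F + G) = \<phi> F + \<phi> G \<and> \<phi> (F * G) = \<phi> F * \<phi> G)}"

text \<open>A choice of a nonzero section of \<open>O(E)\<close>, that is, of a section with zero divisor \<open>E\<close>,
  for each $(-1)$-curve \<open>E\<close>.\<close>

definition section_choice ::
    "nat \<Rightarrow> (nat \<Rightarrow> 'a::field^3) \<Rightarrow> (pic \<Rightarrow> (nat \<Rightarrow> 'a^3) \<Rightarrow> 'a) \<Rightarrow> bool" where
  "section_choice r p s \<longleftrightarrow> (\<forall>E\<in>neg_curves r. s E \<in> H0 r p E \<and> s E \<noteq> 0)"

text \<open>Points of the affine spaces are functions on the set of $(-1)$-curves, extended by \<open>0\<close>.\<close>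

definition A_S ::
    "nat \<Rightarrow> (nat \<Rightarrow> 'a::field^3) \<Rightarrow> (pic \<Rightarrow> (nat \<Rightarrow> 'a^3) \<Rightarrow> 'a) \<Rightarrow> (pic \<Rightarrow> 'a) set" where
  "A_S r p s = {(\<lambda>E. if E \<in> neg_curves r then \<phi> (Poly_Mapping.single E (s E)) else 0) | \<phi>.
     \<phi> \<in> cox_points r p}"


section \<open>The cones over the flag varieties\<close>

definition F6 :: "(pic \<Rightarrow> 'b::comm_ring_1) \<Rightarrow> 'b" where
  "F6 \<xi> = (let
     \<eta> = (\<lambda>i. \<xi> (exc i)); \<mu> = (\<lambda>i j. \<xi> (m_class i j)); \<kappa> = (\<lambda>i. \<xi> (Q6_class i));
     M1 = (vector [vector [\<eta> 1, \<kappa> 1, \<mu> 2 3],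
                   vector [\<eta> 2, \<kappa> 2, \<mu> 1 3],
                   vector [\<eta> 3, \<kappa> 3, \<mu> 1 2]] :: 'b^3^3);
     M2 = (vector [vector [\<kappa> 4, \<kappa> 5, \<kappa> 6],
                   vector [\<eta> 4, \<eta> 5, \<eta> 6],
                   vector [\<mu> 5 6, \<mu> 4 6, \<mu> 4 5]] :: 'b^3^3);
     M3 = (vector [vector [\<mu> 1 4, \<mu> 2 4, \<mu> 3 4],
                   vector [\<mu> 1 5, \<mu> 2 5, \<mu> 3 5],
                   vector [\<mu> 1 6, \<mu> 2 6, \<mu> 3 6]] :: 'b^3^3)
   in det M1 + det M2 + det M3 - trace (M1 ** M2 ** M3))"

text \<open>The partial derivative with respect to the variable of \<open>E\<close> is taken by evaluating the
  polynomial \<open>F6\<close> over \<open>'a poly\<close>, with that variable left indeterminate.\<close>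

definition partial_F6 :: "pic \<Rightarrow> (pic \<Rightarrow> 'a::field) \<Rightarrow> 'a" where
  "partial_F6 E \<xi> = poly (pderiv (F6 ((\<lambda>E'. [:\<xi> E':])(E := [:0, 1:])))) (\<xi> E)"

definition H6 :: "(pic \<Rightarrow> 'a::field) set" where
  "H6 = {\<xi>. \<forall>E\<in>neg_curves 6. partial_F6 E \<xi> = 0}"

definition x7 :: "(pic \<Rightarrow> 'a::field) \<Rightarrow> nat \<Rightarrow> nat \<Rightarrow> 'a" where
  "x7 \<xi> i j = (let x = (\<lambda>k l. if l = 8 then \<xi> (exc k) else \<xi> (Q7_class k l))
     in if i < j then x i j else if j < i then - x j i else 0)"

definition y7 :: "(pic \<Rightarrow> 'a::field) \<Rightarrow> nat \<Rightarrow> nat \<Rightarrow> 'a" where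
  "y7 \<xi> i j = (let y = (\<lambda>k l. if l = 8 then \<xi> (C_class k) else \<xi> (m_class k l))
     in if i < j then y i j else if j < i then - y j i else 0)"

definition pf4 :: "(nat \<Rightarrow> nat \<Rightarrow> 'a::field) \<Rightarrow> nat \<Rightarrow> nat \<Rightarrow> nat \<Rightarrow> nat \<Rightarrow> 'a" where
  "pf4 x i j k l = x i j * x k l - x i k * x j l + x i l * x j k"

text \<open>The permutation \<open>\<tau>\<close> is \<open>(i,j,k,l,a,b,c,d)\<close>.\<close>

definition u7 :: "(nat \<Rightarrow> nat) \<Rightarrow> (pic \<Rightarrow> 'a::field) \<Rightarrow> 'a" where
  "u7 \<tau> \<xi> = pf4 (x7 \<xi>) (\<tau> 1) (\<tau> 2) (\<tau> 3) (\<tau> 4)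
     + of_int (sign \<tau>) * pf4 (y7 \<xi>) (\<tau> 5) (\<tau> 6) (\<tau> 7) (\<tau> 8)"

definition v7 :: "nat \<Rightarrow> nat \<Rightarrow> (pic \<Rightarrow> 'a::field) \<Rightarrow> 'a" where
  "v7 i j \<xi> = (if i \<noteq> j then \<Sum>k\<in>{1..8} - {i, j}. x7 \<xi> i k * y7 \<xi> k j
     else - (3 / 4) * (\<Sum>j\<in>{1..8} - {i}. x7 \<xi> i j * y7 \<xi> i j)
       + (1 / 4) * (\<Sum>(j, k)\<in>{(j, k). j \<in> {1..8} - {i} \<and> k \<in> {1..8} - {i} \<and> j < k}.
           x7 \<xi> j k * y7 \<xi> j k))"

definition H7 :: "(pic \<Rightarrow> 'a::field) set" where
  "H7 = {\<xi>.
     (\<forall>\<tau>. \<tau> permutes {1..8} \<and> \<tau> 1 < \<tau> 2 \<and> \<tau> 2 < \<tau> 3 \<and> \<tau> 3 < \<tau> 4 \<and>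
        \<tau> 5 < \<tau> 6 \<and> \<tau> 6 < \<tau> 7 \<and> \<tau> 7 < \<tau> 8 \<longrightarrow> u7 \<tau> \<xi> = 0) \<and>
     (\<forall>i\<in>{1..8}. \<forall>j\<in>{1..8}. v7 i j \<xi> = 0)}"

definition H_cone :: "nat \<Rightarrow> (pic \<Rightarrow> 'a::field) set" where
  "H_cone r = (if r = 6 then H6 else H7)"


section \<open>Rescalings and families of rescalings\<close>

text \<open>A rescaling is given by its factors \<open>f E\<close>.\<close>

definition rescaling :: "nat \<Rightarrow> (pic \<Rightarrow> 'a::field) \<Rightarrow> bool" where
  "rescaling r f \<longleftrightarrow> (\<forall>E\<in>neg_curves r. f E \<noteq> 0)"

definition rescale :: "(pic \<Rightarrow> 'a::field) \<Rightarrow> (pic \<Rightarrow> 'a) \<Rightarrow> (pic \<Rightarrow> 'a)" where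
  "rescale f \<xi> = (\<lambda>E. f E * \<xi> E)"

definition good_rescaling ::
    "nat \<Rightarrow> (nat \<Rightarrow> 'a::field^3) \<Rightarrow> (pic \<Rightarrow> (nat \<Rightarrow> 'a^3) \<Rightarrow> 'a) \<Rightarrow> (pic \<Rightarrow> 'a) \<Rightarrow> bool" where
  "good_rescaling r p s f \<longleftrightarrow> rescaling r f \<and> rescale f ` A_S r p s \<subseteq> H_cone r"

definition affine_coords :: "'i set \<Rightarrow> (('i \<Rightarrow> 'a::field) \<Rightarrow> 'a) set" where
  "affine_coords T = {(\<lambda>t. t i) | i. i \<in> T}"

definition zariski_open :: "'i set \<Rightarrow> ('i \<Rightarrow> 'a::field) set \<Rightarrow> bool" where
  "zariski_open T U \<longleftrightarrow>
     (\<exists>\<F>\<subseteq>polyfun (affine_coords T). U = {t \<in> T \<rightarrow>\<^sub>E UNIV. \<exists>g\<in>\<F>. g t \<noteq> 0})"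

definition rational_on :: "'i set \<Rightarrow> ('i \<Rightarrow> 'a::field) set \<Rightarrow> (('i \<Rightarrow> 'a) \<Rightarrow> 'a) \<Rightarrow> bool" where
  "rational_on T U g \<longleftrightarrow> (\<exists>P\<in>polyfun (affine_coords T). \<exists>Q\<in>polyfun (affine_coords T).
     \<forall>t\<in>U. Q t \<noteq> 0 \<and> g t = P t / Q t)"

text \<open>The factors of the curves in \<open>T\<close> are the parameters; they range over the nonempty open
  subset \<open>U\<close> of affine \<open>n\<close>-space, and \<open>f t\<close> are the factors of the rescaling with parameters
  \<open>t \<in> U\<close>.\<close>

definition parameter_family ::
    "nat \<Rightarrow> nat \<Rightarrow> pic set \<Rightarrow> (pic \<Rightarrow> 'a::field) set \<Rightarrow> ((pic \<Rightarrow> 'a) \<Rightarrow> (pic \<Rightarrow> 'a)) \<Rightarrow> bool" where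
  "parameter_family n r T U f \<longleftrightarrow>
     T \<subseteq> neg_curves r \<and> finite T \<and> card T = n \<and> zariski_open T U \<and> U \<noteq> {} \<and>
     (\<forall>t\<in>U. \<forall>E\<in>T. f t E = t E) \<and>
     (\<forall>E\<in>neg_curves r - T. rational_on T U (\<lambda>t. f t E))"

end

theory Submission
  imports Defs
begin

text \<open>Why a good rescaling exists. The generators of the Cox ring restrict to honest plane curves: over a
general point \<open>x\<close> of the plane the section of \<open>E\<^sub>i\<close> is a nonzero constant and the other sections are
lines, conics and cubics evaluated at \<open>x\<close>. Every equation of \<open>H\<^sub>r\<close> is homogeneous for the grading by the
Picard group, so it holds on all of \<open>Spec (Cox S\<^sub>r)\<close> as soon as it holds at these values
(\<open>quad_transfer\<close>). What remains is to choose factors for which the values of the rescaled plane curves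
satisfy the equations at every general \<open>x\<close>.

Coordinates adapted to the subsystem \<open>A\<^sub>5 \<times> A\<^sub>1\<close> of \<open>E\<^sub>6\<close> make this possible. Write \<open>b\<^sub>i\<close>, \<open>a\<^sub>i\<close> and
\<open>y\<^sub>i\<^sub>j = - y\<^sub>j\<^sub>i\<close> (\<open>i, j \<le> 6\<close>) for the coordinates of \<open>E\<^sub>i\<close>, of the conic through the points \<open>1, \<dots>, 6\<close>
other than \<open>i\<close>, and of the line through the points \<open>i\<close> and \<open>j\<close>. Up to signs the cubic invariant of
\<open>E\<^sub>6\<close> is \<open>N = \<Sum> a\<^sub>j b\<^sub>k y\<^sub>k\<^sub>j + Pf y\<close>. Its partial derivatives form three families: \<open>b\<^sub>i a\<^sub>j - b\<^sub>j a\<^sub>i\<close>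
plus a signed \<open>4 \<times> 4\<close> Pfaffian, the row vector \<open>b y\<close>, and the row vector \<open>a y\<close>; the predicate
\<open>E6rel\<close> states that all of them vanish. Where a \<open>b\<^sub>i\<close> is nonzero, a few of these equations solve for
some coordinates in terms of the others and imply all the rest (\<open>E6_chart\<close>, \<open>H5_chart\<close>). In the same
way \<open>H\<^sub>7\<close> is, where \<open>e = x\<^sub>7\<^sub>8\<close> is nonzero, the graph of the derivatives of \<open>N\<close> and of \<open>N\<close> itself:
\<open>e x\<^sub>i\<^sub>j = - \<partial>N/\<partial>y\<^sub>i\<^sub>j\<close>, \<open>e y\<^sub>7\<^sub>j = - (b y)\<^sub>j\<close>, \<open>e y\<^sub>8\<^sub>j = (a y)\<^sub>j\<close>, \<open>e\<^sup>2 y\<^sub>7\<^sub>8 = - N\<close> (\<open>H7_of_chart\<close>).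

For \<open>r = 7\<close> the factors of all \<open>E\<^sub>i\<close>, of the lines \<open>m\<^sub>i\<^sub>j\<close> with \<open>i, j \<le> 5\<close> and of one conic are free.
The remaining lines and conics through the first six points are scaled by the chart of \<open>E\<^sub>6\<close> so that
\<open>E6rel\<close> holds at the single point \<open>p\<^sub>7\<close>. The curves of the other classes must then be the derivatives
of \<open>N\<close> and \<open>N\<close> itself, read as plane curves. By \<open>E6rel\<close> at \<open>p\<^sub>7\<close> the derivatives vanish at \<open>p\<^sub>7\<close> and
\<open>N\<close> is singular there, so each of them passes through the points of its class with the right
multiplicities and, such a curve being unique, is a multiple of the generator; this defines the last
factors.

For \<open>r = 6\<close> the same step happens one dimension lower. The factors of all \<open>E\<^sub>i\<close> and of \<open>m\<^sub>i\<^sub>j\<close> with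
\<open>i, j \<le> 4\<close> are free, the lines and conics left over are first scaled so that the equations hold at
\<open>p\<^sub>6\<close>, and then the equations solved for the curves through \<open>p\<^sub>6\<close>, and for the remaining conics, define
plane curves of the right classes, so that \<open>E6rel\<close> holds at every \<open>x\<close>.

All factors are polynomials in the parameters divided by powers of a product of two parameters. They
are nonzero on a dense open set because each of them is nonzero for some choice of parameters: the
lemmas ending in \<open>witness\<close> give sparse choices for which the formulas collapse to a single product.\<close>

section \<open>Alternating matrices of size six and the equations of the cone over the Cayley plane\<close>

text \<open>A numbering \<open>i, j, k, l, m, n\<close> of \<open>{1..6}\<close> together with its sign as a scalar. All identities
  between Pfaffians are proved for an arbitrary numbering, which avoids ordering the indices.\<close>

definition labelling :: "'a::comm_ring_1 \<Rightarrow> nat \<Rightarrow> nat \<Rightarrow> nat \<Rightarrow> nat \<Rightarrow> nat \<Rightarrow> nat \<Rightarrow> bool" where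
  "labelling \<sigma> i j k l m n \<longleftrightarrow> (\<exists>\<tau>. \<tau> permutes {1..6} \<and> \<sigma> = of_int (sign \<tau>) \<and>
     \<tau> 1 = i \<and> \<tau> 2 = j \<and> \<tau> 3 = k \<and> \<tau> 4 = l \<and> \<tau> 5 = m \<and> \<tau> 6 = n)"

lemma labelling_positions:
  assumes "\<tau> permutes {1..6}" "\<pi> permutes {1..6}" "\<sigma> = of_int (sign \<tau> * sign \<pi>)"
  shows "labelling \<sigma> (\<tau> (\<pi> 1)) (\<tau> (\<pi> 2)) (\<tau> (\<pi> 3)) (\<tau> (\<pi> 4)) (\<tau> (\<pi> 5)) (\<tau> (\<pi> 6))"
proof -
  have "permutation \<tau>" "permutation \<pi>" using assms(1,2) permutation_permutes by blast+
  then have "sign (\<tau> \<circ> \<pi>) = sign \<tau> * sign \<pi>" by (rule sign_compose)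
  then show ?thesis
    unfolding labelling_def using permutes_compose[OF assms(2,1)] assms(3)
    by (intro exI[of _ "\<tau> \<circ> \<pi>"]) simp
qed

lemma labelling_swap:
  assumes "labelling \<sigma> i j k l m n"
  shows "labelling (-\<sigma>) j i k l m n" "labelling (-\<sigma>) i k j l m n" "labelling (-\<sigma>) i j l k m n"
    "labelling (-\<sigma>) i j k m l n" "labelling (-\<sigma>) i j k l n m" "labelling (-\<sigma>) k j i l m n"
proof -
  obtain \<tau> where \<tau>: "\<tau> permutes {1..6}" "\<sigma> = of_int (sign \<tau>)"
     "\<tau> 1 = i" "\<tau> 2 = j" "\<tau> 3 = k" "\<tau> 4 = l" "\<tau> 5 = m" "\<tau> 6 = n"
    using assms unfolding labelling_def by blast
  have t: "Transposition.transpose a b permutes {1..6}" "sign (Transposition.transpose a b) = -1"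
    if "a \<in> {1..6}" "b \<in> {1..6}" "a \<noteq> b" for a b :: nat
    using that by (auto simp: permutes_swap_id sign_swap_id)
  note L = labelling_positions[OF \<tau>(1), of "Transposition.transpose _ _"]
  show "labelling (-\<sigma>) j i k l m n" using L[of 1 2 "-\<sigma>"] t[of 1 2] \<tau> by (simp add: Transposition.transpose_def)
  show "labelling (-\<sigma>) i k j l m n" using L[of 2 3 "-\<sigma>"] t[of 2 3] \<tau> by (simp add: Transposition.transpose_def)
  show "labelling (-\<sigma>) i j l k m n" using L[of 3 4 "-\<sigma>"] t[of 3 4] \<tau> by (simp add: Transposition.transpose_def)
  show "labelling (-\<sigma>) i j k m l n" using L[of 4 5 "-\<sigma>"] t[of 4 5] \<tau> by (simp add: Transposition.transpose_def)
  show "labelling (-\<sigma>) i j k l n m" using L[of 5 6 "-\<sigma>"] t[of 5 6] \<tau> by (simp add: Transposition.transpose_def)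
  show "labelling (-\<sigma>) k j i l m n" using L[of 1 3 "-\<sigma>"] t[of 1 3] \<tau> by (simp add: Transposition.transpose_def)
qed

lemma labelling_square: "labelling \<sigma> i j k l m n \<Longrightarrow> \<sigma> * \<sigma> = 1"
  unfolding labelling_def by (auto simp flip: of_int_mult)

lemma labelling_nonzero: "labelling (\<sigma>::'a::field) i j k l m n \<Longrightarrow> \<sigma> \<noteq> 0"
  using labelling_square by fastforce

lemma labelling_distinct:
  assumes "labelling \<sigma> i j k l m n"
  shows "distinct [i, j, k, l, m, n]"
proof -
  obtain \<tau> where \<tau>: "\<tau> permutes {1..6}"
     "\<tau> 1 = i" "\<tau> 2 = j" "\<tau> 3 = k" "\<tau> 4 = l" "\<tau> 5 = m" "\<tau> 6 = n"
    using assms unfolding labelling_def by blast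
  have "inj \<tau>" using \<tau>(1) by (simp add: permutes_inj)
  then have "distinct (map \<tau> [1,2,3,4,5,6])" by (simp add: inj_eq)
  then show ?thesis using \<tau> by simp
qed

lemma labelling_UN:
  assumes "labelling \<sigma> i j k l m n"
  shows "{1..6} = {i, j, k, l, m, n}"
proof -
  obtain \<tau> where \<tau>: "\<tau> permutes {1..6}"
     "\<tau> 1 = i" "\<tau> 2 = j" "\<tau> 3 = k" "\<tau> 4 = l" "\<tau> 5 = m" "\<tau> 6 = n"
    using assms unfolding labelling_def by blast
  have e: "{1..6::nat} = {1,2,3,4,5,6}" by auto
  have "\<tau> ` {1..6} = {i, j, k, l, m, n}" unfolding e using \<tau>(2-7) by (simp del: One_nat_def)
  then show ?thesis using permutes_image[OF \<tau>(1)] by metis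
qed

lemma labelling_range:
  assumes "labelling \<sigma> i j k l m n"
  shows "i \<in> {1..6}" "j \<in> {1..6}" "k \<in> {1..6}" "l \<in> {1..6}" "m \<in> {1..6}" "n \<in> {1..6}"
  using labelling_UN[OF assms] by simp_all

lemma labelling_sum:
  assumes "labelling \<sigma> i j k l m n"
  shows "(\<Sum>x\<in>{1..6}. f x) = f i + f j + f k + f l + f m + (f n::'b::comm_monoid_add)"
  using labelling_distinct[OF assms] unfolding labelling_UN[OF assms] by (simp add: add.assoc)

lemma labelling_exists:
  assumes "i \<in> {1..6}" "j \<in> {1..6}" "i \<noteq> j"
  obtains \<sigma> k l m n where "labelling (\<sigma>::'a::comm_ring_1) i j k l m n"
proof -
  define \<tau>1 where "\<tau>1 = Transposition.transpose 1 i"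
  define \<tau> where "\<tau> = Transposition.transpose (\<tau>1 2) j \<circ> \<tau>1"
  have p1: "\<tau>1 permutes {1..6}" unfolding \<tau>1_def using assms by (intro permutes_swap_id) auto
  then have "\<tau>1 2 \<in> {1..6}" by (subst permutes_in_image) auto
  then have "\<tau> permutes {1..6}" unfolding \<tau>_def using assms
    by (intro permutes_compose[OF p1] permutes_swap_id) auto
  moreover have "\<tau>1 1 = i" "\<tau>1 2 \<noteq> i" using permutes_inj[OF p1]
    by (auto simp: \<tau>1_def Transposition.transpose_def)
  then have "\<tau> 1 = i" "\<tau> 2 = j" using assms by (auto simp: \<tau>_def Transposition.transpose_def)
  ultimately show ?thesis by (intro that) (auto simp: labelling_def)
qed

definition alternating :: "(nat \<Rightarrow> nat \<Rightarrow> 'a::ab_group_add) \<Rightarrow> bool" where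
  "alternating y \<longleftrightarrow> (\<forall>i. y i i = 0) \<and> (\<forall>i j. y j i = - y i j)"

text \<open>A numbering may be rearranged so that a prescribed index comes last. The signed Pfaffian of the
  last four indices does not change, because the sign of the numbering and the Pfaffian are both
  alternating.\<close>

lemma labelling_last:
  assumes "labelling \<sigma> i j k l m n" "i \<noteq> q" "j \<noteq> q" "q \<in> {1..6}"
  obtains \<sigma>' k' l' m' where "labelling \<sigma>' i j k' l' m' q"
    "\<And>y::nat\<Rightarrow>nat\<Rightarrow>'a::field. alternating y \<Longrightarrow> \<sigma>' * pf4 y k' l' m' q = \<sigma> * pf4 y k l m n"
proof -
  note s = labelling_swap
  have alt: "- \<sigma> * pf4 y k l n m = \<sigma> * pf4 y k l m n"
       "\<sigma> * pf4 y k m n l = \<sigma> * pf4 y k l m n"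
       "-\<sigma> * pf4 y l m n k = \<sigma> * pf4 y k l m n" if "alternating y" for y :: "nat\<Rightarrow>nat\<Rightarrow>'a"
  proof -
    have a: "y j i = - y i j" for i j using that unfolding alternating_def by blast
    show "- \<sigma> * pf4 y k l n m = \<sigma> * pf4 y k l m n" "\<sigma> * pf4 y k m n l = \<sigma> * pf4 y k l m n"
       "-\<sigma> * pf4 y l m n k = \<sigma> * pf4 y k l m n"
      unfolding pf4_def a[of k l] a[of k m] a[of k n] a[of l m] a[of l n] a[of m n]
      by (simp_all add: algebra_simps)
  qed
  have "q \<in> {k,l,m,n}" using labelling_UN[OF assms(1)] assms(2-4) by auto
  then consider "q = n" | "q = m" | "q = l" | "q = k" by auto
  then show ?thesis
  proof cases
    case 1 then show ?thesis using assms(1) that by blast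
  next
    case 2 then show ?thesis using that[OF s(5)[OF assms(1), unfolded 2[symmetric]]] alt(1) by blast
  next
    case 3 show ?thesis using that[of \<sigma> k m n] s(5)[OF s(4)[OF assms(1)]] alt(2) 3 by (metis minus_minus)
  next
    case 4 show ?thesis using that[of "-\<sigma>" l m n] s(5)[OF s(4)[OF s(3)[OF assms(1)]]] alt(3) 4 by (metis minus_minus)
  qed
qed

lemma alternating_sum:
  fixes y :: "nat \<Rightarrow> nat \<Rightarrow> 'a::{comm_ring_1}"
  assumes "alternating y" "finite A"
  shows "(\<Sum>i\<in>A. \<Sum>k\<in>A. b i * b k * y k i) = 0"
  using assms(2)
proof (induction rule: finite_induct)
  case (insert x A)
  have a: "y j i = - y i j" "y i i = 0" for i j using assms(1) unfolding alternating_def by blast+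
  have "(\<Sum>i\<in>A. b i * b x * y x i) = - (\<Sum>i\<in>A. b x * b i * y i x)"
    unfolding sum_negf[symmetric] by (rule sum.cong) (use a(1)[of x] in \<open>simp_all add: mult.commute\<close>)
  then show ?case using insert by (simp add: sum.distrib a(2))
qed simp

text \<open>Since \<open>b y b\<^sup>T = 0\<close> for alternating \<open>y\<close>, the entries of the row vector \<open>b y\<close> are linearly dependent
  with coefficients \<open>b\<close>, so the one at an index with \<open>b\<^sub>q \<noteq> 0\<close> vanishes together with the others.\<close>

lemma alternating_kernel:
  fixes y :: "nat \<Rightarrow> nat \<Rightarrow> 'a::field"
  assumes "alternating y" "finite A" "q \<in> A" "b q \<noteq> 0" and bcol: "\<And>j. j \<in> A \<Longrightarrow> j \<noteq> q \<Longrightarrow> (\<Sum>k\<in>A. b k * y k j) = 0"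
    and "j \<in> A"
  shows "(\<Sum>k\<in>A. b k * y k j) = 0"
proof (cases "j = q")
  case True
  have "b q * (\<Sum>k\<in>A. b k * y k q) = (\<Sum>j\<in>A. b j * (\<Sum>k\<in>A. b k * y k j))"
    using assms(2,3) by (subst (2) sum.remove[of _ q]) (auto simp: bcol)
  also have "\<dots> = 0" using alternating_sum[OF assms(1,2), of b]
    by (simp add: sum_distrib_left mult.assoc)
  finally show ?thesis using assms(4) True by simp
qed (use bcol assms(6) in simp)

text \<open>The 27 partial derivatives of \<open>\<Sum> a\<^sub>j b\<^sub>k y\<^sub>k\<^sub>j + Pf y\<close>, with respect to the \<open>y\<^sub>i\<^sub>j\<close>, the \<open>a\<^sub>j\<close> and the \<open>b\<^sub>j\<close>:
  the equations of the cone over \<open>E\<^sub>6/P\<close>, the Cayley plane, in coordinates for \<open>A\<^sub>5 \<times> A\<^sub>1\<close>.\<close>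

definition E6rel :: "(nat \<Rightarrow> 'a::field) \<Rightarrow> (nat \<Rightarrow> 'a) \<Rightarrow> (nat \<Rightarrow> nat \<Rightarrow> 'a) \<Rightarrow> bool" where
  "E6rel b a y \<longleftrightarrow>
     (\<forall>\<sigma> i j k l m n. labelling \<sigma> i j k l m n \<longrightarrow> b i * a j - b j * a i + \<sigma> * pf4 y k l m n = 0) \<and>
     (\<forall>j\<in>{1..6}. (\<Sum>k\<in>{1..6}. b k * y k j) = 0) \<and> (\<forall>j\<in>{1..6}. (\<Sum>k\<in>{1..6}. a k * y k j) = 0)"

text \<open>Where \<open>b\<^sub>6 \<noteq> 0\<close> the equations can be solved for the \<open>y\<^sub>6\<^sub>j\<close> and for \<open>a\<^sub>1, \<dots>, a\<^sub>5\<close>. After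
  multiplication by a power of \<open>b\<^sub>6\<close>, every other equation is a combination of the solved ones.\<close>

lemma E6_chart:
  assumes y: "alternating y" and nz: "b 6 \<noteq> (0::'a::field)"
    and bcol: "\<And>j. j \<in> {1..6} \<Longrightarrow> j \<noteq> 6 \<Longrightarrow> (\<Sum>k\<in>{1..6}. b k * y k j) = 0"
    and ba: "\<And>\<sigma> i k l m n. labelling \<sigma> i 6 k l m n \<Longrightarrow> b i * a 6 - b 6 * a i + \<sigma> * pf4 y k l m n = 0"
  shows "E6rel b a y"
proof -
  have alt: "y j i = - y i j" "y i i = 0" for i j using y unfolding alternating_def by blast+
  note s = labelling_swap
  have by_all: "(\<Sum>k\<in>{1..6}. b k * y k j) = 0" if "j \<in> {1..6}" for j
    using alternating_kernel[OF y, of "{1..6}" 6 b j] nz bcol that by auto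
  have ba_all: "b i * a j - b j * a i + \<sigma> * pf4 y k l m n = 0" if L: "labelling \<sigma> i j k l m n" for \<sigma> i j k l m n
  proof -
    consider "j = 6" | "i = 6" | "i \<noteq> 6" "j \<noteq> 6" by blast
    then show ?thesis
    proof cases
      case 1 then show ?thesis using ba L by blast
    next
      case 2 then show ?thesis using ba[of "-\<sigma>" j k l m n] s(1)[OF L] by (auto simp: algebra_simps)
    next
      case 3
      obtain \<sigma>' k' l' m' where L': "labelling \<sigma>' i j k' l' m' 6"
        and e: "\<sigma>' * pf4 y k' l' m' 6 = \<sigma> * pf4 y k l m n"
        by (rule labelling_last[OF L 3]) (use y in auto)
      have "labelling \<sigma>' i 6 j k' l' m'" using s(2)[OF s(3)[OF s(4)[OF s(5)[OF L']]]] by simp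
      then have i: "b i * a 6 - b 6 * a i + \<sigma>' * pf4 y j k' l' m' = 0" by (rule ba)
      have "labelling (-\<sigma>') j 6 i k' l' m'" using s(2)[OF s(3)[OF s(4)[OF s(5)[OF s(1)[OF L']]]]] by simp
      then have j: "b j * a 6 - b 6 * a j + (-\<sigma>') * pf4 y i k' l' m' = 0" by (rule ba)
      have r: "k' \<in> {1..6}" "l' \<in> {1..6}" "m' \<in> {1..6}" using labelling_range[OF L'] by auto
      have S: "b i * y i x + b j * y j x + b k' * y k' x + b l' * y l' x + b m' * y m' x + b 6 * y 6 x = 0"
        if "x \<in> {1..6}" for x using by_all[OF that] unfolding labelling_sum[OF L'] .
      \<comment> \<open>Times \<open>b\<^sub>6\<close>, the equation is a combination of the solved ones and of entries of \<open>b y\<close>.\<close>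
      have "b 6 * (b i * a j - b j * a i + \<sigma>' * pf4 y k' l' m' 6) =
        b j * (b i * a 6 - b 6 * a i + \<sigma>' * pf4 y j k' l' m') - b i * (b j * a 6 - b 6 * a j + (-\<sigma>') * pf4 y i k' l' m')
        + \<sigma>' * (y k' m' * (b i * y i l' + b j * y j l' + b k' * y k' l' + b l' * y l' l' + b m' * y m' l' + b 6 * y 6 l') - y k' l' * (b i * y i m' + b j * y j m' + b k' * y k' m' + b l' * y l' m' + b m' * y m' m' + b 6 * y 6 m') - y l' m' * (b i * y i k' + b j * y j k' + b k' * y k' k' + b l' * y l' k' + b m' * y m' k' + b 6 * y 6 k'))"
        unfolding pf4_def alt(2) alt(1)[of k' 6] alt(1)[of l' 6] alt(1)[of m' 6] alt(1)[of k' l'] alt(1)[of k' m'] alt(1)[of l' m']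
        by (simp add: algebra_simps)
      then have "b 6 * (b i * a j - b j * a i + \<sigma>' * pf4 y k' l' m' 6) = 0"
        unfolding i j S[OF r(1)] S[OF r(2)] S[OF r(3)] by simp
      then show ?thesis using nz e by simp
    qed
  qed
  have ay5: "(\<Sum>k\<in>{1..6}. a k * y k j) = 0" if j: "j \<in> {1..6}" "j \<noteq> 6" for j
  proof -
    have "6 \<in> {1..6::nat}" "j \<in> {1..6}" "j \<noteq> 6" using j by auto
    then obtain \<sigma> k l m n where L: "labelling (\<sigma>::'a) j 6 k l m n" using labelling_exists by metis
    have e: "b j * a 6 - b 6 * a j + \<sigma> * pf4 y k l m n = 0" using ba L by blast
    have "labelling (-\<sigma>) k 6 j l m n" using s(6)[OF L] .
    then have ek: "b k * a 6 - b 6 * a k + (-\<sigma>) * pf4 y j l m n = 0" by (rule ba)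
    have "labelling \<sigma> l 6 j k m n" using s(6)[OF s(3)[OF L]] by simp
    then have el: "b l * a 6 - b 6 * a l + \<sigma> * pf4 y j k m n = 0" by (rule ba)
    have "labelling (-\<sigma>) m 6 j k l n" using s(6)[OF s(3)[OF s(4)[OF L]]] by simp
    then have em: "b m * a 6 - b 6 * a m + (-\<sigma>) * pf4 y j k l n = 0" by (rule ba)
    have "labelling \<sigma> n 6 j k l m" using s(6)[OF s(3)[OF s(4)[OF s(5)[OF L]]]] by simp
    then have en: "b n * a 6 - b 6 * a n + \<sigma> * pf4 y j k l m = 0" by (rule ba)
    have S: "b j * y j j + b 6 * y 6 j + b k * y k j + b l * y l j + b m * y m j + b n * y n j = 0"
      using by_all[of j] j unfolding labelling_sum[OF L] by auto
    have "b 6 * (a j * y j j + a 6 * y 6 j + a k * y k j + a l * y l j + a m * y m j + a n * y n j) = a 6 * (b j * y j j + b 6 * y 6 j + b k * y k j + b l * y l j + b m * y m j + b n * y n j)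
       - y k j * (b k * a 6 - b 6 * a k + (-\<sigma>) * pf4 y j l m n) - y l j * (b l * a 6 - b 6 * a l + \<sigma> * pf4 y j k m n) - y m j * (b m * a 6 - b 6 * a m + (-\<sigma>) * pf4 y j k l n) - y n j * (b n * a 6 - b 6 * a n + \<sigma> * pf4 y j k l m)"
      unfolding pf4_def alt(2) alt(1)[of k j] alt(1)[of l j] alt(1)[of m j] alt(1)[of n j] alt(1)[of 6 j]
      by (simp add: algebra_simps)
    then have "b 6 * (a j * y j j + a 6 * y 6 j + a k * y k j + a l * y l j + a m * y m j + a n * y n j) = 0" unfolding e ek el em en S by simp
    then show ?thesis using nz unfolding labelling_sum[OF L] by simp
  qed
  have ay6: "(\<Sum>k\<in>{1..6}. a k * y k 6) = 0"
  proof -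
    \<comment> \<open>The product \<open>a y b\<^sup>T\<close> vanishes as \<open>b y = 0\<close>, and all entries of \<open>a y\<close> but the last are known to be zero.\<close>
    have "(\<Sum>j\<in>{1..6}. b j * (\<Sum>k\<in>{1..6}. a k * y k j)) = (\<Sum>k\<in>{1..6}. - a k * (\<Sum>j\<in>{1..6}. b j * y j k))"
      unfolding sum_distrib_left by (subst sum.swap, intro sum.cong refl) (subst alt(1), simp)
    also have "\<dots> = 0" by (rule sum.neutral) (use by_all in simp)
    finally have "(\<Sum>j\<in>{1..6}. b j * (\<Sum>k\<in>{1..6}. a k * y k j)) = 0" .
    moreover have "(\<Sum>j\<in>{1..6} - {6}. b j * (\<Sum>k\<in>{1..6}. a k * y k j)) = 0" by (rule sum.neutral) (use ay5 in simp)
    ultimately have "b 6 * (\<Sum>k\<in>{1..6}. a k * y k 6) = 0"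
      using sum.remove[of "{1..6}" 6 "\<lambda>j. b j * (\<Sum>k\<in>{1..6}. a k * y k j)"] by simp
    then show ?thesis using nz by simp
  qed
  have "(\<Sum>k\<in>{1..6}. a k * y k j) = 0" if "j \<in> {1..6}" for j
  proof (cases "j = 6")
    case False then show ?thesis using that by (intro ay5) auto
  qed (use ay6 in simp)
  then show ?thesis unfolding E6rel_def using ba_all by_all by blast
qed

section \<open>The charts of the cones where one coordinate is nonzero\<close>

text \<open>The analogue of \<open>E6_chart\<close> at a point where the coordinates \<open>y\<^sub>k\<^sub>6\<close> and \<open>a\<^sub>1, \<dots>, a\<^sub>5\<close> vanish, such as
  \<open>p\<^sub>6\<close>: there one equation for \<open>a\<^sub>6\<close> implies the others. What is left is the cone over a spinor variety, with
  chart \<open>b\<^sub>5 \<noteq> 0\<close>.\<close>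

lemma H5_chart:
  assumes y: "alternating y" and y6: "\<And>k. y k 6 = 0" and nz: "b 5 \<noteq> (0::'a::field)"
    and bcol: "\<And>j. j \<in> {1..6} \<Longrightarrow> (\<Sum>k\<in>{1..6}. b k * y k j) = 0"
    and ba: "\<And>\<sigma> k l m n. labelling \<sigma> 5 6 k l m n \<Longrightarrow> b 5 * a6 + \<sigma> * pf4 y k l m n = 0"
    and L: "labelling \<sigma> i 6 k l m n"
  shows "b i * a6 + \<sigma> * pf4 y k l m n = 0"
proof -
  have alt: "y j i = - y i j" "y i i = 0" for i j using y unfolding alternating_def by blast+
  note s = labelling_swap
  show ?thesis
  proof (cases "i = 5")
    case False
    obtain \<sigma>' k' l' m' where L': "labelling \<sigma>' i 6 k' l' m' 5"
        and e: "\<sigma>' * pf4 y k' l' m' 5 = \<sigma> * pf4 y k l m n"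
      by (rule labelling_last[OF L False]) (use y in auto)
    have "labelling (-\<sigma>') 5 6 k' l' m' i"
      using s(5)[OF s(4)[OF s(3)[OF s(6)[OF s(3)[OF s(4)[OF s(5)[OF L']]]]]]] by simp
    then have h: "b 5 * a6 + (-\<sigma>') * pf4 y k' l' m' i = 0" by (rule ba)
    have S: "b i * y i x + b 6 * y 6 x + b k' * y k' x + b l' * y l' x + b m' * y m' x + b 5 * y 5 x = 0"
      if "x \<in> {1..6}" for x using bcol[OF that] unfolding labelling_sum[OF L'] .
    note r = labelling_range[OF L']
    have "b 5 * (b i * a6 + \<sigma>' * pf4 y k' l' m' 5) = b i * (b 5 * a6 + (-\<sigma>') * pf4 y k' l' m' i)
       + \<sigma>' * (y k' m' * (b i * y i l' + b 6 * y 6 l' + b k' * y k' l' + b l' * y l' l' + b m' * y m' l' + b 5 * y 5 l')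
          - y k' l' * (b i * y i m' + b 6 * y 6 m' + b k' * y k' m' + b l' * y l' m' + b m' * y m' m' + b 5 * y 5 m')
          - y l' m' * (b i * y i k' + b 6 * y 6 k' + b k' * y k' k' + b l' * y l' k' + b m' * y m' k' + b 5 * y 5 k'))"
      unfolding pf4_def alt(1)[of 6 k'] alt(1)[of 6 l'] alt(1)[of 6 m'] alt(1)[of k' 5] alt(1)[of l' 5] alt(1)[of m' 5]
        alt(1)[of k' i] alt(1)[of l' i] alt(1)[of m' i] alt(1)[of k' l'] alt(1)[of k' m'] alt(1)[of l' m'] y6 alt(2)
      by (simp add: algebra_simps)
    then have "b 5 * (b i * a6 + \<sigma>' * pf4 y k' l' m' 5) = 0"
      unfolding h S[OF r(3)] S[OF r(4)] S[OF r(5)] by simp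
    then show ?thesis using nz e by simp
  qed (use L ba in simp)
qed

text \<open>The last summand is the Pfaffian of \<open>y\<close>, expanded along its first row.\<close>

definition E7_cubic :: "(nat \<Rightarrow> 'a::comm_ring_1) \<Rightarrow> (nat \<Rightarrow> 'a) \<Rightarrow> (nat \<Rightarrow> nat \<Rightarrow> 'a) \<Rightarrow> 'a" where
  "E7_cubic b a y = (\<Sum>j\<in>{1..6}. \<Sum>k\<in>{1..6}. a j * b k * y k j)
     + (y 1 2 * (y 3 4 * y 5 6 - y 3 5 * y 4 6 + y 3 6 * y 4 5)
      - y 1 3 * (y 2 4 * y 5 6 - y 2 5 * y 4 6 + y 2 6 * y 4 5)
      + y 1 4 * (y 2 3 * y 5 6 - y 2 5 * y 3 6 + y 2 6 * y 3 5)
      - y 1 5 * (y 2 3 * y 4 6 - y 2 4 * y 3 6 + y 2 6 * y 3 4)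
      + y 1 6 * (y 2 3 * y 4 5 - y 2 4 * y 3 5 + y 2 5 * y 3 4))"

text \<open>The points with \<open>x\<^sub>7\<^sub>8 \<noteq> 0\<close> of the cone over the Freudenthal variety \<open>E\<^sub>7/P\<close>, as the graph of a cubic form
  and its partial derivatives.\<close>

locale H7_chart =
  fixes x y :: "nat \<Rightarrow> nat \<Rightarrow> 'a::field_char_0" and e :: 'a and a b :: "nat \<Rightarrow> 'a"
  assumes x_alt: "alternating x" and y_alt: "alternating y"
    and e: "x 7 8 = e" "e \<noteq> 0" and b: "x i 8 = b i" and a: "x i 7 = a i"
    and xij: "\<And>\<sigma> i j k l m n. labelling \<sigma> i j k l m n \<Longrightarrow> e * x i j = - (b i * a j - b j * a i + \<sigma> * pf4 y k l m n)"
    and y7: "\<And>j. j \<in> {1..6} \<Longrightarrow> e * y 7 j = - (\<Sum>k\<in>{1..6}. b k * y k j)"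
    and y8: "\<And>j. j \<in> {1..6} \<Longrightarrow> e * y 8 j = (\<Sum>k\<in>{1..6}. a k * y k j)"
    and y78: "e * (e * y 7 8) = - E7_cubic b a y"
begin

lemma alt: "x j i = - x i j" "x i i = 0" "y j i = - y i j" "y i i = 0"
  using x_alt y_alt unfolding alternating_def by blast+

lemma y7': "j \<in> {1..6} \<Longrightarrow> e * y j 7 = (\<Sum>k\<in>{1..6}. b k * y k j)"
  using y7[of j] alt(3)[of j 7] by (simp add: minus_equation_iff)

lemma y8': "j \<in> {1..6} \<Longrightarrow> e * y j 8 = - (\<Sum>k\<in>{1..6}. a k * y k j)"
  using y8[of j] alt(3)[of j 8] by simp

text \<open>The Pfaffian of \<open>y\<close> expanded along its row \<open>i\<close>, with the cofactors expressed by the coordinates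
  \<open>x\<^sub>i\<^sub>z\<close>; \<open>row_eq\<close> shows that the rows agree.\<close>

definition row :: "nat \<Rightarrow> 'a" where
  "row i = (\<Sum>z\<in>{1..6} - {i}. (- (e * x i z) - b i * a z + b z * a i) * y i z)"

lemma pf_row:
  assumes L: "labelling \<sigma> i j k l m n"
  shows "row i = \<sigma> * (y i j * pf4 y k l m n - y i k * pf4 y j l m n + y i l * pf4 y j k m n
                     - y i m * pf4 y j k l n + y i n * pf4 y j k l m)"
proof -
  note s = labelling_swap
  have "{1..6} - {i} = {j, k, l, m, n}" using labelling_distinct[OF L] labelling_UN[OF L] by auto
  then have "row i = (\<Sum>z\<in>{j, k, l, m, n}. (- (e * x i z) - b i * a z + b z * a i) * y i z)" by (simp add: row_def)
  also have "\<dots> = (- (e * x i j) - b i * a j + b j * a i) * y i j + (- (e * x i k) - b i * a k + b k * a i) * y i k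
     + (- (e * x i l) - b i * a l + b l * a i) * y i l + (- (e * x i m) - b i * a m + b m * a i) * y i m
     + (- (e * x i n) - b i * a n + b n * a i) * y i n" using labelling_distinct[OF L] by (simp add: add.assoc)
  finally show ?thesis
    unfolding xij[OF L] xij[OF s(2)[OF L]] xij[OF s(2)[OF s(3)[OF L]]] xij[OF s(2)[OF s(3)[OF s(4)[OF L]]]]
       xij[OF s(2)[OF s(3)[OF s(4)[OF s(5)[OF L]]]]]
    by (simp add: algebra_simps)
qed

lemma row_1: "row 1 = (y 1 2 * (y 3 4 * y 5 6 - y 3 5 * y 4 6 + y 3 6 * y 4 5)
      - y 1 3 * (y 2 4 * y 5 6 - y 2 5 * y 4 6 + y 2 6 * y 4 5)
      + y 1 4 * (y 2 3 * y 5 6 - y 2 5 * y 3 6 + y 2 6 * y 3 5)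
      - y 1 5 * (y 2 3 * y 4 6 - y 2 4 * y 3 6 + y 2 6 * y 3 4)
      + y 1 6 * (y 2 3 * y 4 5 - y 2 4 * y 3 5 + y 2 5 * y 3 4))"
proof -
  have "labelling (1::'a) 1 2 3 4 5 6" unfolding labelling_def by (rule exI[of _ id]) (simp add: permutes_id)
  from pf_row[OF this] show ?thesis unfolding pf4_def by simp
qed

lemma row_eq: assumes "i \<in> {1..6}" shows "row i = row 1"
proof (cases "i = 1")
  case False
  then obtain \<sigma> k l m n where L: "labelling (\<sigma>::'a) i 1 k l m n" using assms labelling_exists[of i 1] by (metis atLeastAtMost_iff one_le_numeral order_refl)
  show ?thesis unfolding pf_row[OF L] pf_row[OF labelling_swap(1)[OF L]] unfolding pf4_def alt(3)[of 1 i]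
    by (simp add: algebra_simps)
qed simp

lemma y78_labelling:
  assumes L: "labelling \<sigma> i j k l m n"
  shows "e * (e * y 7 8) = - (\<Sum>j\<in>{1..6}. \<Sum>k\<in>{1..6}. a j * b k * y k j)
    - \<sigma> * (y i j * pf4 y k l m n - y i k * pf4 y j l m n + y i l * pf4 y j k m n
                     - y i m * pf4 y j k l n + y i n * pf4 y j k l m)"
  unfolding y78 E7_cubic_def row_1[symmetric] using row_eq[OF labelling_range(1)[OF L]] pf_row[OF L]
  by simp

lemma alt_labelling:
  "labelling \<sigma> i j k l m n \<Longrightarrow> y j i = - y i j \<and> y k i = - y i k \<and> y l i = - y i l \<and> y m i = - y i m \<and> y n i = - y i n
   \<and> y k j = - y j k \<and> y l j = - y j l \<and> y m j = - y j m \<and> y n j = - y j n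
   \<and> y l k = - y k l \<and> y m k = - y k m \<and> y n k = - y k n
   \<and> y m l = - y l m \<and> y n l = - y l n \<and> y n m = - y m n"
  by (intro conjI alt(3))

lemma pf4_repeated: "pf4 y z z m n = 0" "pf4 y m w m n = 0" "pf4 y n w m n = 0" "pf4 y z m m n = 0" "pf4 y z n m n = 0"
  unfolding pf4_def alt(4) alt(3)[of m w] alt(3)[of n w] alt(3)[of n m] by (simp_all add: algebra_simps)

lemma pf4_swap: "pf4 y j i m n = - pf4 y i j m n"
  unfolding pf4_def alt(3)[of i j] by (simp add: algebra_simps)

text \<open>A Pluecker type relation: it trades the quadratic terms in the cofactors, which come from the \<open>x\<^sub>i\<^sub>j\<close>,
  for the Pfaffian, which comes from \<open>y\<^sub>7\<^sub>8\<close>.\<close>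

lemma pf4_pf4:
  assumes L: "labelling \<sigma> i j k l m n"
  shows "pf4 y k l m n * pf4 y i j m n - pf4 y j l m n * pf4 y i k m n + pf4 y j k m n * pf4 y i l m n =
    y m n * (y i j * pf4 y k l m n - y i k * pf4 y j l m n + y i l * pf4 y j k m n
                     - y i m * pf4 y j k l n + y i n * pf4 y j k l m)"
  unfolding pf4_def by (simp add: algebra_simps)

text \<open>All terms are multiplied by \<open>e\<^sup>2\<close> and expressed by \<open>a\<close>, \<open>b\<close> and \<open>y\<close>. The terms of degree two in the
  Pfaffians cancel by \<open>pf4_pf4\<close>, the mixed ones because a double sum of Pfaffians over all pairs
  \<open>z, w\<close> keeps only the pairs outside \<open>m, n\<close>.\<close>

lemma u_without_7_8:
  assumes L: "labelling \<sigma> i j k l m n"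
  shows "pf4 x i j k l + \<sigma> * pf4 y m n 7 8 = 0"
proof -
  note s = labelling_swap and r = labelling_range[OF L]
  have "labelling \<sigma> k l i j m n" using s(2)[OF s(1)[OF s(3)[OF s(2)[OF L]]]] by simp
  note kl = xij[OF this]
  have "labelling (-\<sigma>) j l i k m n" using s(2)[OF s(1)[OF s(3)[OF L]]] by simp
  note jl = xij[OF this]
  have "labelling \<sigma> j k i l m n" using s(2)[OF s(1)[OF L]] by simp
  note jk = xij[OF this]
  note ij = xij[OF L] and ik = xij[OF s(2)[OF L]] and il = xij[OF s(2)[OF s(3)[OF L]]]
  let ?Pf = "y i j * pf4 y k l m n - y i k * pf4 y j l m n + y i l * pf4 y j k m n
                     - y i m * pf4 y j k l n + y i n * pf4 y j k l m"
  let ?S = "\<Sum>w\<in>{1..6}. \<Sum>z\<in>{1..6}. a w * b z * pf4 y z w m n"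
  have "y m n * (\<Sum>w\<in>{1..6}. \<Sum>z\<in>{1..6}. a w * b z * y z w)
     - (\<Sum>z\<in>{1..6}. b z * y z m) * (\<Sum>w\<in>{1..6}. a w * y w n)
     + (\<Sum>w\<in>{1..6}. a w * y w m) * (\<Sum>z\<in>{1..6}. b z * y z n)
     = (\<Sum>w\<in>{1..6}. \<Sum>z\<in>{1..6}. y m n * (a w * b z * y z w)) - (\<Sum>w\<in>{1..6}. \<Sum>z\<in>{1..6}. (b z * y z m) * (a w * y w n))
      + (\<Sum>w\<in>{1..6}. \<Sum>z\<in>{1..6}. (a w * y w m) * (b z * y z n))"
    (is "?A1 - ?A2 + ?A3 = ?B1 - ?B2 + ?B3")
  proof -
    have "?A2 = (\<Sum>z\<in>{1..6}. \<Sum>w\<in>{1..6}. (b z * y z m) * (a w * y w n))" by (rule sum_product)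
    also have "\<dots> = ?B2" by (rule sum.swap)
    finally have "?A2 = ?B2" .
    moreover have "?A1 = ?B1" by (simp only: sum_distrib_left)
    moreover have "?A3 = ?B3" by (rule sum_product)
    ultimately show ?thesis by simp
  qed
  also have "\<dots> = ?S"
    unfolding sum_subtractf[symmetric] sum.distrib[symmetric]
    by (intro sum.cong refl) (simp add: pf4_def algebra_simps)
  also have "\<dots> = (b i * a j - b j * a i) * pf4 y i j m n + (b i * a k - b k * a i) * pf4 y i k m n
     + (b i * a l - b l * a i) * pf4 y i l m n + (b j * a k - b k * a j) * pf4 y j k m n
     + (b j * a l - b l * a j) * pf4 y j l m n + (b k * a l - b l * a k) * pf4 y k l m n"
    unfolding labelling_sum[OF L] pf4_repeated pf4_swap[of j i] pf4_swap[of k i] pf4_swap[of l i]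
       pf4_swap[of k j] pf4_swap[of l j] pf4_swap[of l k] by (simp add: algebra_simps)
  finally have S: "y m n * (\<Sum>w\<in>{1..6}. \<Sum>z\<in>{1..6}. a w * b z * y z w) = \<dots>
     + (\<Sum>z\<in>{1..6}. b z * y z m) * (\<Sum>w\<in>{1..6}. a w * y w n)
     - (\<Sum>w\<in>{1..6}. a w * y w m) * (\<Sum>z\<in>{1..6}. b z * y z n)" by (simp add: algebra_simps)
  have P: "y m n * ?Pf = pf4 y k l m n * pf4 y i j m n - pf4 y j l m n * pf4 y i k m n + pf4 y j k m n * pf4 y i l m n"
    using pf4_pf4[OF L] by simp
  have "y m n * (e * (e * y 7 8)) = - (y m n * (\<Sum>w\<in>{1..6}. \<Sum>z\<in>{1..6}. a w * b z * y z w)) - \<sigma> * (y m n * ?Pf)"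
    unfolding y78_labelling[OF L] by (simp only: right_diff_distrib mult_minus_right mult.left_commute[of "y m n" \<sigma>])
  note Y = this[unfolded S P]
  have "e * (e * (pf4 x i j k l + \<sigma> * pf4 y m n 7 8)) =
     (e * x i j) * (e * x k l) - (e * x i k) * (e * x j l) + (e * x i l) * (e * x j k)
     + \<sigma> * (y m n * (e * (e * y 7 8)) - (e * y m 7) * (e * y n 8) + (e * y m 8) * (e * y n 7))"
    unfolding pf4_def by (simp add: algebra_simps)
  also have "\<dots> = 0"
    unfolding ij kl ik jl il jk Y y7'[OF r(5)] y7'[OF r(6)] y8'[OF r(5)] y8'[OF r(6)]
    by algebra
  finally show ?thesis using e by simp
qed

lemma pf4_sum:
  fixes c :: "nat \<Rightarrow> 'a"
  shows "y l m * (\<Sum>z\<in>{1..6}. c z * y z n) - y l n * (\<Sum>z\<in>{1..6}. c z * y z m) + (\<Sum>z\<in>{1..6}. c z * y z l) * y m n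
   = (\<Sum>z\<in>{1..6}. c z * pf4 y z l m n)"
  unfolding sum_distrib_left sum_distrib_right sum_subtractf[symmetric] sum.distrib[symmetric]
  by (intro sum.cong refl) (simp add: pf4_def algebra_simps)

lemma pf4_sum_labelling:
  fixes c :: "nat \<Rightarrow> 'a"
  assumes L: "labelling \<sigma> i j k l m n"
  shows "(\<Sum>z\<in>{1..6}. c z * pf4 y z l m n) = c i * pf4 y i l m n + c j * pf4 y j l m n + c k * pf4 y k l m n"
proof -
  have "pf4 y l l m n = 0" "pf4 y m l m n = 0" "pf4 y n l m n = 0" by (simp_all add: pf4_repeated)
  then show ?thesis unfolding labelling_sum[OF L] by simp
qed

lemma u_with_7_or_8:
  assumes L: "labelling \<sigma> i j k l m n"
  shows "pf4 x i j k 8 + \<sigma> * pf4 y l m n 7 = 0" "pf4 x i j k 7 - \<sigma> * pf4 y l m n 8 = 0"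
proof -
  note s = labelling_swap and r = labelling_range[OF L]
  have "labelling \<sigma> j k i l m n" using s(2)[OF s(1)[OF L]] by simp
  note jk = xij[OF this]
  note ij = xij[OF L] and ik = xij[OF s(2)[OF L]]
  have "e * (pf4 x i j k 8 + \<sigma> * pf4 y l m n 7) = (e * x i j) * b k - (e * x i k) * b j + b i * (e * x j k)
     + \<sigma> * (y l m * (e * y n 7) - y l n * (e * y m 7) + (e * y l 7) * y m n)"
    unfolding pf4_def b by (simp add: algebra_simps)
  also have "\<dots> = 0"
    unfolding ij ik jk y7'[OF r(4)] y7'[OF r(5)] y7'[OF r(6)] pf4_sum pf4_sum_labelling[OF L]
    by (simp add: algebra_simps)
  finally show "pf4 x i j k 8 + \<sigma> * pf4 y l m n 7 = 0" using e by simp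
  have "e * (pf4 x i j k 7 - \<sigma> * pf4 y l m n 8) = (e * x i j) * a k - (e * x i k) * a j + a i * (e * x j k)
     - \<sigma> * (y l m * (e * y n 8) - y l n * (e * y m 8) + (e * y l 8) * y m n)"
    unfolding pf4_def a by (simp add: algebra_simps)
  also have "\<dots> = (e * x i j) * a k - (e * x i k) * a j + a i * (e * x j k)
     + \<sigma> * (\<Sum>z\<in>{1..6}. a z * pf4 y z l m n)"
    unfolding y8'[OF r(4)] y8'[OF r(5)] y8'[OF r(6)] pf4_sum[symmetric] by (simp add: algebra_simps)
  also have "\<dots> = 0"
    unfolding ij ik jk pf4_sum_labelling[OF L] by (simp add: algebra_simps)
  finally show "pf4 x i j k 7 - \<sigma> * pf4 y l m n 8 = 0" using e by simp
qed

text \<open>The \<open>(i, z)\<close> entry of the matrix of signed Pfaffian cofactors of \<open>y\<close>, that is, of \<open>Pf y\<close> times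
  the transpose of the inverse of \<open>y\<close>.\<close>

definition pf_cofactor :: "nat \<Rightarrow> nat \<Rightarrow> 'a" where
  "pf_cofactor i z = - (e * x i z) - b i * a z + b z * a i"

text \<open>Expanding the Pfaffian of a matrix with two equal rows gives zero.\<close>

lemma pf_cofactor_orthogonal:
  assumes "i \<in> {1..6}" "w \<in> {1..6}" "w \<noteq> i"
  shows "(\<Sum>z\<in>{1..6}. pf_cofactor i z * y w z) = 0"
proof -
  note s = labelling_swap
  obtain \<sigma> k l m n where L: "labelling (\<sigma>::'a) i w k l m n" using labelling_exists assms by metis
  have "pf_cofactor i i = 0" by (simp add: pf_cofactor_def alt(2))
  then show ?thesis
    unfolding labelling_sum[OF L] alt(4) \<open>pf_cofactor i i = 0\<close>
    unfolding pf_cofactor_def xij[OF s(2)[OF L]] xij[OF s(2)[OF s(3)[OF L]]] xij[OF s(2)[OF s(3)[OF s(4)[OF L]]]]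
       xij[OF s(2)[OF s(3)[OF s(4)[OF s(5)[OF L]]]]]
    unfolding pf4_def by (simp add: algebra_simps alt_labelling[OF L])
qed

lemma pf_cofactor_row:
  assumes "i \<in> {1..6}"
  shows "(\<Sum>z\<in>{1..6}. pf_cofactor i z * (\<Sum>w\<in>{1..6}. c w * y w z)) = c i * row i"
proof -
  have "(\<Sum>z\<in>{1..6}. pf_cofactor i z * y i z) = row i"
    unfolding row_def pf_cofactor_def[symmetric]
    by (rule sum.mono_neutral_right) (use assms in \<open>auto simp: alt(2,4)\<close>)
  then have "(\<Sum>z\<in>{1..6}. pf_cofactor i z * y w z) = (if w = i then row i else 0)" if "w \<in> {1..6}" for w
    using pf_cofactor_orthogonal[OF assms that] by simp
  then have "(\<Sum>w\<in>{1..6}. c w * (\<Sum>z\<in>{1..6}. pf_cofactor i z * y w z)) = (\<Sum>w\<in>{1..6}. if w = i then c w * row i else 0)"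
    by (intro sum.cong refl) simp
  then have "c i * row i = (\<Sum>w\<in>{1..6}. c w * (\<Sum>z\<in>{1..6}. pf_cofactor i z * y w z))"
    using assms by simp
  also have "\<dots> = (\<Sum>w\<in>{1..6}. \<Sum>z\<in>{1..6}. pf_cofactor i z * (c w * y w z))"
    by (simp add: sum_distrib_left mult_ac)
  also have "\<dots> = (\<Sum>z\<in>{1..6}. pf_cofactor i z * (\<Sum>w\<in>{1..6}. c w * y w z))"
    by (subst sum.swap) (simp add: sum_distrib_left)
  finally show ?thesis by simp
qed

lemma x_pf_cofactor: "e * x i z = - pf_cofactor i z - b i * a z + b z * a i"
  by (simp add: pf_cofactor_def)

lemma y78_row: "i \<in> {1..6} \<Longrightarrow> e * (e * y 7 8) = - (\<Sum>j\<in>{1..6}. a j * (\<Sum>k\<in>{1..6}. b k * y k j)) - row i"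
  unfolding y78 E7_cubic_def row_1[symmetric] row_eq by (simp add: sum_distrib_left mult_ac)

lemma x_sum: "(\<Sum>z\<in>{1..6}. e * x i z * f z) = - (\<Sum>z\<in>{1..6}. pf_cofactor i z * f z)
   - b i * (\<Sum>z\<in>{1..6}. a z * f z) + a i * (\<Sum>z\<in>{1..6}. b z * f z)"
  unfolding x_pf_cofactor sum_distrib_left sum_negf[symmetric] sum_subtractf[symmetric] sum.distrib[symmetric]
  by (intro sum.cong refl) (simp add: algebra_simps)

lemma v_sum: "(\<Sum>k\<in>{1..8} - {i, j}. x i k * y k j) = (\<Sum>k\<in>{1..6}. x i k * y k j) + x i 7 * y 7 j + x i 8 * y 8 j"
proof -
  have "(\<Sum>k\<in>{1..8} - {i, j}. x i k * y k j) = (\<Sum>k\<in>{1..8}. x i k * y k j)"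
    by (rule sum.mono_neutral_left) (auto simp: alt(2,4))
  also have "\<dots> = (\<Sum>k\<in>insert 7 (insert 8 {1..6::nat}). x i k * y k j)" by (rule sum.cong) auto
  finally show ?thesis by (simp add: ac_simps)
qed

lemma a7: "a 7 = 0" "a 8 = - e" "b 8 = 0" "b 7 = e"
  using alt(2)[of 7] alt(2)[of 8] alt(1)[of 8 7] e a[of 7] a[of 8] b[of 7] b[of 8] by auto

lemma y_ab: "(\<Sum>z\<in>{1..6}. b z * (\<Sum>k\<in>{1..6}. a k * y k z)) = - (\<Sum>z\<in>{1..6}. a z * (\<Sum>k\<in>{1..6}. b k * y k z))"
proof -
    have "(\<Sum>z\<in>{1..6}. b z * (\<Sum>k\<in>{1..6}. a k * y k z)) = (\<Sum>z\<in>{1..6}. \<Sum>k\<in>{1..6}. b z * (a k * y k z))"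
      by (simp only: sum_distrib_left)
    also have "\<dots> = (\<Sum>k\<in>{1..6}. \<Sum>z\<in>{1..6}. b z * (a k * y k z))" by (rule sum.swap)
    also have "\<dots> = (\<Sum>k\<in>{1..6}. \<Sum>z\<in>{1..6}. - (a k * (b z * y z k)))"
      by (intro sum.cong refl) (subst alt(3), simp add: algebra_simps)
    finally show ?thesis by (simp only: sum_distrib_left sum_negf)
qed

text \<open>Away from the diagonal the matrix product \<open>x y\<close> vanishes: for \<open>i, j \<le> 6\<close> by orthogonality of rows and
  cofactors, in the last two rows and columns by the defining equations of the \<open>y\<^sub>7\<^sub>j\<close>, \<open>y\<^sub>8\<^sub>j\<close> and
  \<open>\<Sum> b\<^sub>j b\<^sub>k y\<^sub>k\<^sub>j = 0\<close>.\<close>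

lemma v_ij:
  assumes "i \<in> {1..8}" "j \<in> {1..8}" "i \<noteq> j"
  shows "(\<Sum>k\<in>{1..8} - {i, j}. x i k * y k j) = 0"
proof -
  note s = labelling_swap
  have six: "i \<in> {1..6} \<or> i = 7 \<or> i = 8" "j \<in> {1..6} \<or> j = 7 \<or> j = 8" using assms(1,2) by auto
  have x7: "x 7 k = - a k" "x 8 k = - b k" for k unfolding a[symmetric] b[symmetric] by (rule alt(1))+
  have y_aa: "(\<Sum>j\<in>{1..6}. \<Sum>k\<in>{1..6}. a j * a k * y k j) = 0" "(\<Sum>j\<in>{1..6}. \<Sum>k\<in>{1..6}. b j * b k * y k j) = 0"
    using alternating_sum[OF y_alt] by auto
  note y_aa' = y_aa[unfolded mult.assoc, folded sum_distrib_left]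
  from six consider (1) "i \<in> {1..6}" "j \<in> {1..6}" | (2) "i = 7" "j \<in> {1..6}" | (3) "i = 8" "j \<in> {1..6}"
    | (4) "i \<in> {1..6}" "j = 7" | (5) "i \<in> {1..6}" "j = 8" | (6) "i = 7" "j = 8" | (7) "i = 8" "j = 7"
    using assms(3) by blast
  then show ?thesis
  proof cases
    case 1
    have "(\<Sum>z\<in>{1..6}. pf_cofactor i z * y z j) = - (\<Sum>z\<in>{1..6}. pf_cofactor i z * y j z)"
      unfolding sum_negf[symmetric] alt(3)[of _ j] by simp
    also have "\<dots> = 0" using pf_cofactor_orthogonal[OF 1] assms(3) by simp
    finally have P: "(\<Sum>z\<in>{1..6}. pf_cofactor i z * y z j) = 0" .
    have "e * ((\<Sum>k\<in>{1..6}. x i k * y k j) + x i 7 * y 7 j + x i 8 * y 8 j) =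
       (\<Sum>k\<in>{1..6}. e * x i k * y k j) + a i * (e * y 7 j) + b i * (e * y 8 j)"
      unfolding a b by (simp add: algebra_simps sum_distrib_left)
    also have "\<dots> = 0" unfolding x_sum P y7[OF 1(2)] y8[OF 1(2)] by simp
    finally show ?thesis unfolding v_sum using e by simp
  next
    case 2
    then show ?thesis unfolding v_sum using y8[of j] by (simp add: x7 a7 sum_negf e)
  next
    case 3
    then show ?thesis unfolding v_sum using y7[of j] by (simp add: x7 a7 sum_negf e)
  next
    case 4
    have "e * (e * ((\<Sum>k\<in>{1..6}. x i k * y k 7) + x i 7 * y 7 7 + x i 8 * y 8 7)) =
      (\<Sum>k\<in>{1..6}. e * x i k * (e * y k 7)) - b i * (e * (e * y 7 8))"
      unfolding b alt(3)[of 8 7] by (simp add: algebra_simps alt(4) sum_distrib_left)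
    also have "(\<Sum>k\<in>{1..6}. e * x i k * (e * y k 7)) = (\<Sum>z\<in>{1..6}. e * x i z * (\<Sum>k\<in>{1..6}. b k * y k z))"
      by (intro sum.cong refl) (simp only: y7')
    finally have "e * (e * ((\<Sum>k\<in>{1..6}. x i k * y k 7) + x i 7 * y 7 7 + x i 8 * y 8 7)) = 0"
      unfolding x_sum pf_cofactor_row[OF 4(1)] y78_row[OF 4(1)] y_aa' by (simp add: algebra_simps)
    then show ?thesis unfolding v_sum 4 using e(2) by (simp only: mult_eq_0_iff) simp
  next
    case 5
    have "e * (e * ((\<Sum>k\<in>{1..6}. x i k * y k 8) + x i 7 * y 7 8 + x i 8 * y 8 8)) =
      (\<Sum>k\<in>{1..6}. e * x i k * (e * y k 8)) + a i * (e * (e * y 7 8))"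
      unfolding a by (simp add: algebra_simps alt(4) sum_distrib_left)
    also have "(\<Sum>k\<in>{1..6}. e * x i k * (e * y k 8)) = - (\<Sum>z\<in>{1..6}. e * x i z * (\<Sum>k\<in>{1..6}. a k * y k z))"
      unfolding sum_negf[symmetric] by (intro sum.cong refl) (simp only: y8' mult_minus_right)
    finally have "e * (e * ((\<Sum>k\<in>{1..6}. x i k * y k 8) + x i 7 * y 7 8 + x i 8 * y 8 8)) = 0"
      unfolding x_sum pf_cofactor_row[OF 5(1)] y78_row[OF 5(1)] y_aa' y_ab by (simp add: algebra_simps)
    then show ?thesis unfolding v_sum 5 using e(2) by (simp only: mult_eq_0_iff) simp
  next
    case 6
    have "e * (\<Sum>k\<in>{1..6}. x 7 k * y k 8) = (\<Sum>j\<in>{1..6}. - a j * (e * y j 8))"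
      by (simp add: x7 sum_distrib_left mult_ac)
    also have "\<dots> = (\<Sum>j\<in>{1..6}. \<Sum>k\<in>{1..6}. a j * a k * y k j)"
      by (intro sum.cong refl) (simp only: y8' minus_mult_minus sum_distrib_left mult.assoc)
    finally show ?thesis unfolding v_sum 6 y_aa using e by (simp add: alt(2,4))
  next
    case 7
    have "e * (\<Sum>k\<in>{1..6}. x 8 k * y k 7) = (\<Sum>j\<in>{1..6}. - b j * (e * y j 7))"
      by (simp add: x7 sum_distrib_left mult_ac)
    also have "\<dots> = - (\<Sum>j\<in>{1..6}. \<Sum>k\<in>{1..6}. b j * b k * y k j)"
      unfolding sum_negf[symmetric] by (intro sum.cong refl) (simp only: y7' mult_minus_left sum_distrib_left mult.assoc sum_negf)
    finally show ?thesis unfolding v_sum 7 y_aa using e by (simp add: alt(2,4))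
  qed
qed

lemma row_x:
  assumes "i \<in> {1..6}"
  shows "e * (\<Sum>z\<in>{1..8}. x i z * y i z) = - row i"
proof -
  have "{1..8} = insert 7 (insert 8 {1..6::nat})" by auto
  then have "e * (\<Sum>z\<in>{1..8}. x i z * y i z) = (\<Sum>z\<in>{1..6}. e * x i z * y i z) + a i * (e * y i 7) + b i * (e * y i 8)"
    by (simp add: a b algebra_simps sum_distrib_left)
  moreover have "(\<Sum>z\<in>{1..6}. pf_cofactor i z * y i z) = row i"
    unfolding row_def pf_cofactor_def[symmetric]
    by (rule sum.mono_neutral_right) (use assms in \<open>auto simp: alt(2,4)\<close>)
  moreover have "(\<Sum>z\<in>{1..6}. c z * y i z) = - (\<Sum>z\<in>{1..6}. c z * y z i)" for c
    unfolding sum_negf[symmetric] by (intro sum.cong refl) (subst alt(3), simp)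
  ultimately show ?thesis unfolding x_sum y7'[OF assms] y8'[OF assms] by simp
qed

lemma row_x_78: "e * (\<Sum>z\<in>{1..8}. x 7 z * y 7 z) = - row 1" "e * (\<Sum>z\<in>{1..8}. x 8 z * y 8 z) = - row 1"
proof -
  have eight: "{1..8} = insert 7 (insert 8 {1..6::nat})" by auto
  have r: "e * (e * y 7 8) = - (\<Sum>j\<in>{1..6}. a j * (\<Sum>k\<in>{1..6}. b k * y k j)) - row 1"
    by (rule y78_row) simp
  have "e * (\<Sum>z\<in>{1..8}. x 7 z * y 7 z) = e * (e * y 7 8) + (\<Sum>z\<in>{1..6}. a z * - (e * y 7 z))"
    unfolding eight using e(1) by (simp add: a7 alt(2) alt(1)[of 7] a algebra_simps sum_distrib_left sum_negf)
  also have "(\<Sum>z\<in>{1..6}. a z * - (e * y 7 z)) = (\<Sum>j\<in>{1..6}. a j * (\<Sum>k\<in>{1..6}. b k * y k j))"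
    by (intro sum.cong refl) (simp only: y7 minus_minus)
  finally show "e * (\<Sum>z\<in>{1..8}. x 7 z * y 7 z) = - row 1" unfolding r by simp
  have "e * (\<Sum>z\<in>{1..8}. x 8 z * y 8 z) = e * (e * y 7 8) - (\<Sum>z\<in>{1..6}. b z * (e * y 8 z))"
    unfolding eight using e(1)
    by (simp add: a7 alt(2) alt(1)[of 8] alt(3)[of 8 7] b algebra_simps sum_distrib_left sum_negf)
  also have "(\<Sum>z\<in>{1..6}. b z * (e * y 8 z)) = (\<Sum>j\<in>{1..6}. b j * (\<Sum>k\<in>{1..6}. a k * y k j))"
    by (intro sum.cong refl) (simp only: y8)
  finally show "e * (\<Sum>z\<in>{1..8}. x 8 z * y 8 z) = - row 1" unfolding r y_ab by simp
qed

text \<open>All rows \<open>i\<close> have the same value \<open>R\<close> of \<open>\<Sum>\<^sub>j x\<^sub>i\<^sub>j y\<^sub>i\<^sub>j\<close>, namely minus the Pfaffian divided by \<open>e\<close>. Hence the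
  sum over all pairs is \<open>4 R\<close>, that over the pairs avoiding \<open>i\<close> is \<open>3 R\<close>, and \<open>- 3/4 + 3/4 = 0\<close>.\<close>

lemma v_ii:
  assumes "i \<in> {1..8}"
  shows "- (3 / 4) * (\<Sum>j\<in>{1..8} - {i}. x i j * y i j)
       + (1 / 4) * (\<Sum>(j, k)\<in>{(j, k). j \<in> {1..8} - {i} \<and> k \<in> {1..8} - {i} \<and> j < k}. x j k * y j k) = 0"
proof -
  let ?P = "\<lambda>j k. x j k * y j k" and ?A = "{1..8} - {i}"
  define R where "R = - row 1 / e"
  have R: "(\<Sum>z\<in>{1..8}. ?P j z) = R" if "j \<in> {1..8}" for j
  proof -
    have "j \<in> {1..6} \<or> j = 7 \<or> j = 8" using that by auto
    then have "e * (\<Sum>z\<in>{1..8}. ?P j z) = - row 1" using row_x[of j] row_eq[of j] row_x_78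
      by (elim disjE) simp_all
    then show ?thesis using e(2) unfolding R_def by (metis nonzero_mult_div_cancel_left)
  qed
  have sym: "?P j k = ?P k j" for j k using alt(1)[of j k] alt(3)[of j k] by simp
  have P0: "?P j j = 0" for j by (simp add: alt(2))
  have RA: "(\<Sum>z\<in>?A. ?P j z) = R - ?P j i" if "j \<in> {1..8}" for j
    using R[OF that] assms by (simp add: sum_diff1)
  have "(\<Sum>j\<in>?A. \<Sum>k\<in>?A. ?P j k) = (\<Sum>j\<in>?A. R - ?P i j)"
    by (intro sum.cong refl) (use RA sym in auto)
  also have "\<dots> = 7 * R - (R - ?P i i)"
    unfolding sum_subtractf RA[OF assms] using assms by simp
  finally have "(\<Sum>j\<in>?A. \<Sum>k\<in>?A. ?P j k) = 6 * R" unfolding P0 by simp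
  moreover have "(\<Sum>j\<in>?A. \<Sum>k\<in>?A. ?P j k) = 2 * (\<Sum>(j, k)\<in>{(j, k). j \<in> ?A \<and> k \<in> ?A \<and> j < k}. ?P j k)"
  proof -
    let ?U = "{(j, k). j \<in> ?A \<and> k \<in> ?A \<and> j < k}" and ?D = "{(j, k). j \<in> ?A \<and> k \<in> ?A \<and> k < j}"
      and ?E = "{(j, k). j \<in> ?A \<and> k \<in> ?A \<and> k = j}"
    have fin: "finite ?U" "finite ?D" "finite ?E"
      by (rule finite_subset[of _ "?A \<times> ?A"]; auto)+
    have "(\<Sum>j\<in>?A. \<Sum>k\<in>?A. ?P j k) = (\<Sum>(j, k)\<in>?A \<times> ?A. ?P j k)" by (rule sum.cartesian_product)
    also have "?A \<times> ?A = ?U \<union> ?D \<union> ?E" by auto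
    also have "(\<Sum>(j, k)\<in>?U \<union> ?D \<union> ?E. ?P j k) = (\<Sum>(j, k)\<in>?U. ?P j k) + (\<Sum>(j, k)\<in>?D. ?P j k) + (\<Sum>(j, k)\<in>?E. ?P j k)"
      using fin by (subst sum.union_disjoint, auto simp del: sum.union_disjoint)+
    also have "(\<Sum>(j, k)\<in>?E. ?P j k) = 0" by (rule sum.neutral) (use P0 in auto)
    also have "(\<Sum>(j, k)\<in>?D. ?P j k) = (\<Sum>(j, k)\<in>?U. ?P j k)"
      by (rule sum.reindex_bij_witness[of _ prod.swap prod.swap]) (use sym in auto)
    finally show ?thesis by simp
  qed
  ultimately have "(\<Sum>(j, k)\<in>{(j, k). j \<in> ?A \<and> k \<in> ?A \<and> j < k}. ?P j k) = 3 * R" by simp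
  moreover have "(\<Sum>z\<in>?A. ?P i z) = R" using RA[OF assms] P0 by simp
  ultimately show ?thesis by (simp only:) (simp add: field_simps)
qed

end

lemma x7_alternating: "alternating (x7 \<xi>)" and y7_alternating: "alternating (y7 \<xi>)"
  unfolding alternating_def x7_def y7_def by (auto simp: Let_def)

lemma labelling_of_permutation:
  assumes "\<tau> permutes {1..8}" "\<pi> permutes {1..8}" "\<tau> (\<pi> 7) = 7" "\<tau> (\<pi> 8) = 8"
  shows "labelling (of_int (sign \<tau> * sign \<pi>)) (\<tau> (\<pi> 1)) (\<tau> (\<pi> 2)) (\<tau> (\<pi> 3)) (\<tau> (\<pi> 4)) (\<tau> (\<pi> 5)) (\<tau> (\<pi> 6))"
proof -
  have "permutation \<tau>" "permutation \<pi>" using assms(1,2) permutation_permutes by blast+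
  then have "sign (\<tau> \<circ> \<pi>) = sign \<tau> * sign \<pi>" by (rule sign_compose)
  moreover have "\<tau> \<circ> \<pi> permutes {1..6}"
  proof (rule permutes_superset[OF permutes_compose[OF assms(2,1)]])
    fix k :: nat assume "k \<in> {1..8} - {1..6}"
    then have "k = 7 \<or> k = 8" by auto
    then show "(\<tau> \<circ> \<pi>) k = k" using assms(3,4) by auto
  qed
  ultimately show ?thesis unfolding labelling_def by (intro exI[of _ "\<tau> \<circ> \<pi>"]) simp
qed

text \<open>The increasing permutations in the definition of \<open>H7\<close> fall into four cases, according to which of
  the two blocks of indices contain 7 and 8.\<close>

lemma H7_of_chart:
  assumes "H7_chart (x7 \<xi>) (y7 \<xi>) e a b"
  shows "\<xi> \<in> H7"
proof -
  interpret H7_chart "x7 \<xi>" "y7 \<xi>" e a b by fact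
  have "v7 i j \<xi> = 0" if "i \<in> {1..8}" "j \<in> {1..8}" for i j
  proof (cases "i = j")
    case True then show ?thesis using v_ii[OF that(1)] unfolding v7_def by (simp only: if_False simp_thms)
  next
    case False then show ?thesis using v_ij[OF that] unfolding v7_def by (simp only: if_True simp_thms)
  qed
  moreover have "u7 \<tau> \<xi> = 0" if \<tau>: "\<tau> permutes {1..8}" "\<tau> 1 < \<tau> 2" "\<tau> 2 < \<tau> 3" "\<tau> 3 < \<tau> 4"
        "\<tau> 5 < \<tau> 6" "\<tau> 6 < \<tau> 7" "\<tau> 7 < \<tau> 8" for \<tau>
  proof -
    have rng: "\<tau> q \<le> 8" if "q \<in> {1..8}" for q using that permutes_in_image[OF \<tau>(1), of q] by simp
    have b8: "\<tau> 2 \<le> 8" "\<tau> 3 \<le> 8" "\<tau> 4 \<le> 8" "\<tau> 6 \<le> 8" "\<tau> 7 \<le> 8" "\<tau> 8 \<le> 8" by (rule rng; simp)+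
    have ex: "z = \<tau> 1 \<or> z = \<tau> 2 \<or> z = \<tau> 3 \<or> z = \<tau> 4 \<or> z = \<tau> 5 \<or> z = \<tau> 6 \<or> z = \<tau> 7 \<or> z = \<tau> 8" if "z \<in> {1..8}" for z
    proof -
      have e8: "{1..8} = {1,2,3,4,5,6,7,8::nat}" by auto
      have "z \<in> \<tau> ` {1,2,3,4,5,6,7,8}" using that permutes_image[OF \<tau>(1)] unfolding e8 by blast
      then show ?thesis by blast
    qed
    have "8 = \<tau> 4 \<or> 8 = \<tau> 8" using ex[of 8] \<tau>(2-) b8 by (auto simp del: One_nat_def)
    moreover have "7 = \<tau> 3 \<and> \<tau> 4 = 8 \<or> 7 = \<tau> 4 \<or> 7 = \<tau> 7 \<and> \<tau> 8 = 8 \<or> 7 = \<tau> 8"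
      using ex[of 7] \<tau>(2-) b8 by (auto simp del: One_nat_def)
    ultimately consider (A) "\<tau> 3 = 7" "\<tau> 4 = 8" | (B) "\<tau> 7 = 7" "\<tau> 8 = 8" | (C) "\<tau> 4 = 8" "\<tau> 8 = 7" | (D) "\<tau> 4 = 7" "\<tau> 8 = 8"
      by (metis (no_types) numeral_eq_iff semiring_norm(89,90) num.inject(1,2) num.distinct)
    then show ?thesis
    proof cases
      case A
      define \<pi> :: "nat \<Rightarrow> nat" where "\<pi> = Transposition.transpose 3 5 \<circ> (Transposition.transpose 5 7 \<circ>
         (Transposition.transpose 4 6 \<circ> Transposition.transpose 6 8))"
      have "\<pi> permutes {1..8}" unfolding \<pi>_def by (intro permutes_compose permutes_swap_id) auto
      moreover have "sign \<pi> = 1" unfolding \<pi>_def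
        by (simp add: sign_compose sign_swap_id permutation_compose permutation_swap_id)
      ultimately have L: "labelling (of_int (sign \<tau>) :: 'a) (\<tau> 1) (\<tau> 2) (\<tau> 5) (\<tau> 6) (\<tau> 7) (\<tau> 8)"
        using labelling_of_permutation[OF \<tau>(1), of \<pi>] A by (simp add: \<pi>_def Transposition.transpose_def)
      show ?thesis using xij[OF L] unfolding u7_def A
        unfolding pf4_def[of "x7 \<xi>"] a b e(1) alt(1)[of 8 _] alt(1)[of 7 _] by (simp add: a7 algebra_simps)
    next
      case B
      have L: "labelling (of_int (sign \<tau>) :: 'a) (\<tau> 1) (\<tau> 2) (\<tau> 3) (\<tau> 4) (\<tau> 5) (\<tau> 6)"
        using labelling_of_permutation[OF \<tau>(1), of id] B by (simp add: permutes_id)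
      show ?thesis using u_without_7_8[OF L] unfolding u7_def B .
    next
      case C
      define \<pi> :: "nat \<Rightarrow> nat" where "\<pi> = Transposition.transpose 4 5 \<circ> (Transposition.transpose 5 6 \<circ>
         (Transposition.transpose 6 7 \<circ> Transposition.transpose 7 8))"
      have "\<pi> permutes {1..8}" unfolding \<pi>_def by (intro permutes_compose permutes_swap_id) auto
      moreover have "sign \<pi> = 1" unfolding \<pi>_def
        by (simp add: sign_compose sign_swap_id permutation_compose permutation_swap_id)
      ultimately have L: "labelling (of_int (sign \<tau>) :: 'a) (\<tau> 1) (\<tau> 2) (\<tau> 3) (\<tau> 5) (\<tau> 6) (\<tau> 7)"
        using labelling_of_permutation[OF \<tau>(1), of \<pi>] C by (simp add: \<pi>_def Transposition.transpose_def)
      show ?thesis using u_with_7_or_8(1)[OF L] unfolding u7_def C .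
    next
      case D
      define \<pi> :: "nat \<Rightarrow> nat" where "\<pi> = Transposition.transpose 4 5 \<circ> (Transposition.transpose 5 6 \<circ>
         Transposition.transpose 6 7)"
      have "\<pi> permutes {1..8}" unfolding \<pi>_def by (intro permutes_compose permutes_swap_id) auto
      moreover have "sign \<pi> = -1" unfolding \<pi>_def
        by (simp add: sign_compose sign_swap_id permutation_compose permutation_swap_id)
      ultimately have L: "labelling (- of_int (sign \<tau>) :: 'a) (\<tau> 1) (\<tau> 2) (\<tau> 3) (\<tau> 5) (\<tau> 6) (\<tau> 7)"
        using labelling_of_permutation[OF \<tau>(1), of \<pi>] D by (simp add: \<pi>_def Transposition.transpose_def)
      show ?thesis using u_with_7_or_8(2)[OF L] unfolding u7_def D by simp
    qed
  qed
  ultimately show ?thesis unfolding H7_def by blast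
qed

section \<open>Plane curves through points in general position\<close>

text \<open>Homogeneous polynomial functions of degree \<open>d\<close> in three variables.\<close>

inductive ternary_form :: "nat \<Rightarrow> ('a::field^3 \<Rightarrow> 'a) \<Rightarrow> bool" where
  form_const: "ternary_form 0 (\<lambda>_. c)"
| form_coord: "ternary_form 1 (\<lambda>x. x $ k)"
| form_add: "ternary_form d f \<Longrightarrow> ternary_form d g \<Longrightarrow> ternary_form d (\<lambda>x. f x + g x)"
| form_mult: "ternary_form d f \<Longrightarrow> ternary_form e g \<Longrightarrow> ternary_form (d + e) (\<lambda>x. f x * g x)"

lemma form_scale: "ternary_form d f \<Longrightarrow> ternary_form d (\<lambda>x. c * f x)"
  using form_mult[OF form_const] by fastforce

lemma form_minus: "ternary_form d f \<Longrightarrow> ternary_form d (\<lambda>x. - f x)"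
  using form_scale[of d f "-1"] by simp

lemma form_diff: "ternary_form d f \<Longrightarrow> ternary_form d g \<Longrightarrow> ternary_form d (\<lambda>x. f x - g x)"
  using form_add[of d f "\<lambda>x. - g x"] form_minus[of d g] by simp

lemma form_zero: "ternary_form d (\<lambda>_. 0)"
proof (induction d)
  case (Suc d)
  from form_mult[OF form_coord Suc] show ?case by simp
qed (rule form_const)

lemma form_sum: "(\<And>i. i \<in> A \<Longrightarrow> ternary_form d (f i)) \<Longrightarrow> ternary_form d (\<lambda>x. \<Sum>i\<in>A. f i x)"
  by (induction A rule: infinite_finite_induct) (auto intro: form_zero form_add)

lemma form_pair: "ternary_form 1 (pair l)"
  unfolding pair_def[abs_def] by (intro form_sum form_scale form_coord)

lemma form_homogeneous: "ternary_form d f \<Longrightarrow> f (c *s x) = c ^ d * f x"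
  by (induction arbitrary: rule: ternary_form.induct) (auto simp: algebra_simps power_add)

lemma form_line:
  assumes "ternary_form d f"
  obtains R where "\<And>t. f (a + t *s v) = poly R t"
proof -
  have "\<exists>R. \<forall>t. f (a + t *s v) = poly R t"
    using assms
  proof induction
    case (form_const c)
    show ?case by (rule exI[of _ "[:c:]"]) simp
  next
    case (form_coord k)
    show ?case by (rule exI[of _ "[:a $ k, v $ k:]"]) simp
  next
    case (form_add d f g)
    then obtain R S where "\<forall>t. f (a + t *s v) = poly R t" "\<forall>t. g (a + t *s v) = poly S t" by blast
    then show ?case by (intro exI[of _ "R + S"]) simp
  next
    case (form_mult d f e g)
    then obtain R S where "\<forall>t. f (a + t *s v) = poly R t" "\<forall>t. g (a + t *s v) = poly S t" by blast
    then show ?case by (intro exI[of _ "R * S"]) simp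
  qed
  then show ?thesis using that by blast
qed

lemma form_0: "ternary_form d f \<Longrightarrow> d = 0 \<Longrightarrow> \<exists>c. \<forall>x. f x = c"
  by (induction rule: ternary_form.induct) auto

text \<open>Used to write a form in terms of an arbitrary basis of the space, by repeated extraction of linear
  factors.\<close>

lemma form_Suc:
  assumes "ternary_form n f" "n = Suc d"
  shows "\<exists>g. (\<forall>k. ternary_form d (g k)) \<and> (\<forall>x. f x = (\<Sum>k\<in>UNIV. x $ k * g k x))"
  using assms
proof (induction arbitrary: d rule: ternary_form.induct)
  case (form_coord k)
  have "x $ k = (\<Sum>j\<in>UNIV. x $ j * (if j = k then 1 else 0))" for x :: "'a^3"
  proof -
    have "(\<Sum>j\<in>UNIV. x $ j * (if j = k then 1 else 0)) = (\<Sum>j\<in>UNIV. if k = j then x $ j else 0)"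
      by (rule sum.cong) auto
    then show ?thesis by (simp add: sum.delta)
  qed
  note coord = this
  have "d = 0" using form_coord by simp
  show ?case unfolding \<open>d = 0\<close>
    by (intro exI[of _ "\<lambda>j _. if j = k then 1 else 0"] conjI allI)
      (rule ternary_form.form_const, rule coord)
next
  case (form_add n f g)
  then obtain f' g' where "(\<forall>k. ternary_form d (f' k)) \<and> (\<forall>x. f x = (\<Sum>k\<in>UNIV. x $ k * f' k x))"
    "(\<forall>k. ternary_form d (g' k)) \<and> (\<forall>x. g x = (\<Sum>k\<in>UNIV. x $ k * g' k x))" by blast
  then show ?case
    by (intro exI[of _ "\<lambda>k x. f' k x + g' k x"]) (auto intro: ternary_form.form_add simp: distrib_left sum.distrib)
next
  case (form_mult n f e g)
  show ?case
  proof (cases n)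
    case 0
    then obtain c where c: "\<And>x. f x = c" using form_0[OF form_mult.hyps(1)] by blast
    obtain g' where "(\<forall>k. ternary_form d (g' k)) \<and> (\<forall>x. g x = (\<Sum>k\<in>UNIV. x $ k * g' k x))"
      using form_mult.IH(2)[of d] form_mult.prems 0 by auto
    then show ?thesis
      by (intro exI[of _ "\<lambda>k x. c * g' k x"]) (auto intro: form_scale simp: c sum_distrib_left mult_ac)
  next
    case (Suc n')
    obtain f' where "(\<forall>k. ternary_form n' (f' k)) \<and> (\<forall>x. f x = (\<Sum>k\<in>UNIV. x $ k * f' k x))"
      using form_mult.IH(1) Suc by blast
    moreover have "d = n' + e" using Suc form_mult.prems by simp
    ultimately show ?thesis using form_mult.hyps(2)
      by (intro exI[of _ "\<lambda>k x. f' k x * g x"]) (auto intro!: ternary_form.form_mult simp: sum_distrib_right mult.assoc)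
  qed
qed simp

lemma form_basis:
  assumes "ternary_form (Suc d) f"
  obtains g1 g2 g3 where "ternary_form d g1" "ternary_form d g2" "ternary_form d g3"
    "\<And>X Y Z. f (X *s e1 + Y *s e2 + Z *s e3) = X * g1 (X *s e1 + Y *s e2 + Z *s e3)
       + Y * g2 (X *s e1 + Y *s e2 + Z *s e3) + Z * g3 (X *s e1 + Y *s e2 + Z *s e3)"
proof -
  obtain g where g: "\<And>k. ternary_form d (g k)" "\<And>x. f x = (\<Sum>k\<in>UNIV. x $ k * g k x)"
    using form_Suc[OF assms refl] by blast
  define G where "G e x = (\<Sum>k\<in>UNIV. e $ k * g k x)" for e x
  have "ternary_form d (G e)" for e unfolding G_def[abs_def] by (intro form_sum form_scale g(1))
  then show ?thesis
    by (intro that[of "G e1" "G e2" "G e3"])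
      (simp_all add: g(2) G_def sum.distrib[symmetric] sum_distrib_left algebra_simps)
qed

lemma form1_basis:
  assumes "ternary_form 1 f"
  shows "f (X *s e1 + Y *s e2 + Z *s e3) = X * f e1 + Y * f e2 + Z * f e3"
proof -
  obtain g1 g2 g3 where g: "ternary_form 0 g1" "ternary_form 0 g2" "ternary_form 0 g3"
    "\<And>X Y Z. f (X *s e1 + Y *s e2 + Z *s e3) = X * g1 (X *s e1 + Y *s e2 + Z *s e3)
       + Y * g2 (X *s e1 + Y *s e2 + Z *s e3) + Z * g3 (X *s e1 + Y *s e2 + Z *s e3)"
    using form_basis[OF assms[unfolded One_nat_def], where ?e1.0 = e1 and ?e2.0 = e2 and ?e3.0 = e3] by blast
  obtain c1 c2 c3 where c: "\<And>x. g1 x = c1" "\<And>x. g2 x = c2" "\<And>x. g3 x = c3"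
    using form_0[OF g(1)] form_0[OF g(2)] form_0[OF g(3)] by blast
  have f: "f (X *s e1 + Y *s e2 + Z *s e3) = X * c1 + Y * c2 + Z * c3" for X Y Z using g(4) c by simp
  show ?thesis using f[of X Y Z] f[of 1 0 0] f[of 0 1 0] f[of 0 0 1] by simp
qed

lemma form2_basis:
  assumes "ternary_form 2 f"
  obtains c12 c13 c23 where "\<And>X Y Z. f (X *s e1 + Y *s e2 + Z *s e3) =
     X * X * f e1 + Y * Y * f e2 + Z * Z * f e3 + X * Y * c12 + X * Z * c13 + Y * Z * c23"
proof -
  have "ternary_form (Suc 1) f" using assms by (simp add: numeral_2_eq_2)
  from form_basis[OF this, where ?e1.0 = e1 and ?e2.0 = e2 and ?e3.0 = e3]
  obtain g1 g2 g3 where g: "ternary_form 1 g1" "ternary_form 1 g2" "ternary_form 1 g3"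
    "\<And>X Y Z. f (X *s e1 + Y *s e2 + Z *s e3) = X * g1 (X *s e1 + Y *s e2 + Z *s e3)
       + Y * g2 (X *s e1 + Y *s e2 + Z *s e3) + Z * g3 (X *s e1 + Y *s e2 + Z *s e3)"
    by blast
  have f: "f (X *s e1 + Y *s e2 + Z *s e3) = X * (X * g1 e1 + Y * g1 e2 + Z * g1 e3)
     + Y * (X * g2 e1 + Y * g2 e2 + Z * g2 e3) + Z * (X * g3 e1 + Y * g3 e2 + Z * g3 e3)" for X Y Z
    unfolding g(4) form1_basis[OF g(1)] form1_basis[OF g(2)] form1_basis[OF g(3)] ..
  show ?thesis
    by (rule that[of "g1 e2 + g2 e1" "g1 e3 + g3 e1" "g2 e3 + g3 e2"], unfold f)
      (use f[of 1 0 0] f[of 0 1 0] f[of 0 0 1] in \<open>simp add: algebra_simps\<close>)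
qed

lemma form3_basis:
  assumes "ternary_form 3 f"
  obtains c112 c113 c122 c133 c223 c233 c123 where "\<And>X Y Z. f (X *s e1 + Y *s e2 + Z *s e3) =
     X * X * X * f e1 + Y * Y * Y * f e2 + Z * Z * Z * f e3
     + X * X * Y * c112 + X * X * Z * c113 + X * Y * Y * c122 + X * Z * Z * c133
     + Y * Y * Z * c223 + Y * Z * Z * c233 + X * Y * Z * c123"
proof -
  have "ternary_form (Suc 2) f" using assms by (simp add: numeral_3_eq_3)
  from form_basis[OF this, where ?e1.0 = e1 and ?e2.0 = e2 and ?e3.0 = e3]
  obtain g1 g2 g3 where g: "ternary_form 2 g1" "ternary_form 2 g2" "ternary_form 2 g3"
    "\<And>X Y Z. f (X *s e1 + Y *s e2 + Z *s e3) = X * g1 (X *s e1 + Y *s e2 + Z *s e3)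
       + Y * g2 (X *s e1 + Y *s e2 + Z *s e3) + Z * g3 (X *s e1 + Y *s e2 + Z *s e3)"
    by blast
  obtain a12 a13 a23 where a: "\<And>X Y Z. g1 (X *s e1 + Y *s e2 + Z *s e3) =
     X * X * g1 e1 + Y * Y * g1 e2 + Z * Z * g1 e3 + X * Y * a12 + X * Z * a13 + Y * Z * a23"
    using form2_basis[OF g(1)] by blast
  obtain b12 b13 b23 where b: "\<And>X Y Z. g2 (X *s e1 + Y *s e2 + Z *s e3) =
     X * X * g2 e1 + Y * Y * g2 e2 + Z * Z * g2 e3 + X * Y * b12 + X * Z * b13 + Y * Z * b23"
    using form2_basis[OF g(2)] by blast
  obtain c12 c13 c23 where c: "\<And>X Y Z. g3 (X *s e1 + Y *s e2 + Z *s e3) =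
     X * X * g3 e1 + Y * Y * g3 e2 + Z * Z * g3 e3 + X * Y * c12 + X * Z * c13 + Y * Z * c23"
    using form2_basis[OF g(3)] by blast
  note f = g(4)[unfolded a b c]
  show ?thesis
    by (rule that[of "g2 e1 + a12" "g3 e1 + a13" "g1 e2 + b12" "g1 e3 + c13" "g3 e2 + b23" "g2 e3 + c23" "a23 + b13 + c12"], unfold f)
      (use f[of 1 0 0] f[of 0 1 0] f[of 0 0 1] in \<open>simp add: algebra_simps\<close>)
qed

lemma form2_matrix:
  fixes f :: "'a::field_char_0^3 \<Rightarrow> 'a"
  assumes "ternary_form 2 f"
  obtains A where "transpose A = A" "\<And>x. f x = pair x (A *v x)"
proof -
  have "ternary_form (Suc 1) f" using assms by (simp add: numeral_2_eq_2)
  from form_Suc[OF this refl] obtain g where g: "\<And>k. ternary_form 1 (g k)" "\<And>x. f x = (\<Sum>k\<in>UNIV. x $ k * g k x)"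
    by blast
  have "\<exists>l. \<forall>x. g k x = (\<Sum>j\<in>UNIV. x $ j * l j)" for k
  proof -
    obtain h where h: "\<And>j. ternary_form 0 (h j)" "\<And>x. g k x = (\<Sum>j\<in>UNIV. x $ j * h j x)"
      using form_Suc[OF g(1)[of k, unfolded One_nat_def] refl] by blast
    have "\<exists>c. \<forall>x. h j x = c" for j using form_0[OF h(1)] by blast
    then obtain c where "\<And>j x. h j x = c j" by metis
    then show ?thesis using h(2) by auto
  qed
  then obtain l where l: "\<And>k x. g k x = (\<Sum>j\<in>UNIV. x $ j * l k j)" by metis
  define A where "A = (\<chi> i j. (l i j + l j i) / 2)"
  have "transpose A = A" by (simp add: A_def transpose_def vec_eq_iff add.commute)
  moreover have "f x = pair x (A *v x)" for x
    unfolding g(2) l pair_def A_def matrix_vector_mult_def by (simp add: sum_3 field_simps)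
  ultimately show ?thesis using that by blast
qed

definition cross :: "'a::comm_ring_1^3 \<Rightarrow> 'a^3 \<Rightarrow> 'a^3" where
  "cross a b = vector [a $ 2 * b $ 3 - a $ 3 * b $ 2, a $ 3 * b $ 1 - a $ 1 * b $ 3, a $ 1 * b $ 2 - a $ 2 * b $ 1]"

text \<open>The determinant of three vectors.\<close>

definition tri :: "'a::comm_ring_1^3 \<Rightarrow> 'a^3 \<Rightarrow> 'a^3 \<Rightarrow> 'a" where
  "tri a b c = pair (cross a b) c"

lemmas tri_expand = tri_def cross_def pair_def sum_3 vector_3

lemma pair_cross [simp]: "pair (cross a b) a = 0" "pair (cross a b) b = 0"
  by (simp_all add: tri_expand algebra_simps)

lemma tri_zero [simp]: "tri a b a = 0" "tri a b b = 0" "tri a a b = 0"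
  by (simp_all add: tri_expand algebra_simps)

lemma tri_rotate: "tri a b c = tri b c a" "tri a b c = - tri b a c" "tri a b c = - tri a c b"
  by (simp_all add: tri_expand algebra_simps)

lemma tri_cramer: "tri a b c *s x = tri x b c *s a + tri a x c *s b + tri a b x *s c"
  by (simp add: vec_eq_iff forall_3 tri_expand algebra_simps)

lemma form_tri: "ternary_form 1 (\<lambda>x. tri a b x)" "ternary_form 1 (\<lambda>x. tri a x b)" "ternary_form 1 (\<lambda>x. tri x a b)"
proof -
  show *: "ternary_form 1 (\<lambda>x. tri a b x)" for a b :: "'a::field^3" unfolding tri_def by (rule form_pair)
  show "ternary_form 1 (\<lambda>x. tri a x b)" unfolding tri_rotate(3)[of a _ b] by (rule form_minus[OF *])
  show "ternary_form 1 (\<lambda>x. tri x a b)" unfolding tri_rotate(1)[of _ a b] by (rule *)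
qed

lemma tri_basis:
  assumes "tri a b c \<noteq> (0::'a::field)"
  shows "x = (tri x b c / tri a b c) *s a + (tri a x c / tri a b c) *s b + (tri a b x / tri a b c) *s c"
proof -
  have "x = inverse (tri a b c) *s (tri a b c *s x)" using assms by (simp add: vector_smult_assoc)
  also have "\<dots> = (tri x b c / tri a b c) *s a + (tri a x c / tri a b c) *s b + (tri a b x / tri a b c) *s c"
    by (subst tri_cramer) (simp add: vector_add_ldistrib vector_smult_assoc divide_inverse mult.commute)
  finally show ?thesis .
qed

lemma tri_zero_imp_line:
  fixes a :: "'a::field^3"
  assumes "tri a b c = 0"
  obtains l where "l \<noteq> 0" "pair l a = 0" "pair l b = 0" "pair l c = 0"
proof -
  define A where "A = (vector [a, b, c] :: 'a^3^3)"
  have "det A = tri a b c" unfolding A_def det_3 by (simp add: tri_expand algebra_simps)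
  then have "\<not> (\<exists>B. B ** A = mat 1)" using assms
    by (metis invertible_det_nz invertible_left_inverse)
  then obtain l where l: "A *v l = 0" "l \<noteq> 0" unfolding matrix_left_invertible_ker by blast
  have "(A *v l) $ k = pair l (A $ k)" for k by (simp add: matrix_vector_mult_def pair_def mult.commute)
  then have "pair l (A $ k) = 0" for k using l(1) by simp
  from this[of 1] this[of 2] this[of 3] show ?thesis using that[of l] l(2) unfolding A_def by simp
qed

locale points =
  fixes r :: nat and p :: "nat \<Rightarrow> ('a::{alg_closed_field, field_char_0})^3"
  assumes gp: "general_position r p" and r6: "6 \<le> r"
begin

lemma tri_nz:
  assumes "i \<in> {1..r}" "j \<in> {1..r}" "k \<in> {1..r}" "i \<noteq> j" "i \<noteq> k" "j \<noteq> k"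
  shows "tri (p i) (p j) (p k) \<noteq> 0"
proof
  assume "tri (p i) (p j) (p k) = 0"
  then obtain l where "l \<noteq> 0" "\<forall>q\<in>{i, j, k}. pair l (p q) = 0" using tri_zero_imp_line by (metis insertE singletonD)
  moreover have "card {i, j, k} = 3" "{i, j, k} \<subseteq> {1..r}" using assms by auto
  ultimately show False using gp unfolding general_position_def by blast
qed

lemma form1_zero:
  assumes "ternary_form 1 f" "i \<in> {1..r}" "j \<in> {1..r}" "k \<in> {1..r}" "i \<noteq> j" "i \<noteq> k" "j \<noteq> k"
    and "f (p i) = 0" "f (p j) = 0" "f (p k) = 0"
  shows "f x = 0"
  by (subst tri_basis[OF tri_nz[OF assms(2-7)]], subst form1_basis[OF assms(1)]) (simp add: assms(8-10))

lemma form2_zero: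
  assumes "ternary_form 2 f" "I \<subseteq> {1..r}" "card I = 6" "\<And>i. i \<in> I \<Longrightarrow> f (p i) = 0"
  shows "f x = 0"
proof -
  obtain A where A: "transpose A = A" "\<And>x. f x = pair x (A *v x)" using form2_matrix[OF assms(1)] by blast
  then have "A = 0" using gp assms(2-4) unfolding general_position_def by metis
  then show ?thesis by (simp add: A(2) pair_def)
qed

text \<open>There is only one line through two points: the difference of the two sides vanishes at both points and
  at a third one, hence everywhere.\<close>

lemma line_unique:
  assumes f: "ternary_form 1 f" "f (p i) = 0" "f (p j) = 0" and g: "ternary_form 1 g" "g (p i) = 0" "g (p j) = 0"
    and ij: "i \<in> {1..r}" "j \<in> {1..r}" "i \<noteq> j" and nz: "g z \<noteq> 0"
  shows "f x = f z / g z * g x"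
proof -
  obtain k where k: "k \<in> {1..r}" "k \<noteq> i" "k \<noteq> j"
  proof -
    have "card {i, j} < card {1..r}" using r6 ij by simp
    then have "{1..r} - {i, j} \<noteq> {}" by (metis Diff_eq_empty_iff card_mono finite.emptyI finite.insertI leD)
    then show ?thesis using that by blast
  qed
  have "g (p k) * f x - f (p k) * g x = 0" for x
    by (rule form1_zero[of "\<lambda>x. g (p k) * f x - f (p k) * g x" i j k])
      (use f g ij k in \<open>auto intro!: form_diff form_scale\<close>)
  note * = this
  have "g (p k) \<noteq> 0" using form1_zero[of g i j k z] g ij k nz by auto
  then have "f x = f (p k) / g (p k) * g x" for x using *[of x] by (simp add: field_simps)
  from this[of x] this[of z] show ?thesis using nz by simp
qed

lemma line_nz:
  assumes "ternary_form 1 g" "g (p i) = 0" "g (p j) = 0" "g z \<noteq> 0"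
    "i \<in> {1..r}" "j \<in> {1..r}" "i \<noteq> j" "k \<in> {1..r}" "k \<noteq> i" "k \<noteq> j"
  shows "g (p k) \<noteq> 0"
  using form1_zero[of g i j k z] assms by auto

lemma conic_nz:
  assumes "ternary_form 2 g" "\<And>i. i \<in> I \<Longrightarrow> g (p i) = 0" "g z \<noteq> 0"
    "I \<subseteq> {1..r}" "card I = 5" "k \<in> {1..r}" "k \<notin> I"
  shows "g (p k) \<noteq> 0"
proof
  assume "g (p k) = 0"
  moreover have "finite I" using assms(4) finite_subset by blast
  ultimately show False using form2_zero[of g "insert k I" z] assms by auto
qed

text \<open>The difference of the two sides is a conic through the five points and, after adjusting the scalar, a
  sixth one; no conic passes through six of the points.\<close>

lemma conic_unique:
  assumes f: "ternary_form 2 f" "\<And>i. i \<in> I \<Longrightarrow> f (p i) = 0" and g: "ternary_form 2 g" "\<And>i. i \<in> I \<Longrightarrow> g (p i) = 0"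
    and I: "I \<subseteq> {1..r}" "card I = 5" and nz: "g z \<noteq> 0"
  shows "f x = f z / g z * g x"
proof -
  have fin: "finite I" using I(1) finite_subset by blast
  obtain k where k: "k \<in> {1..r}" "k \<notin> I"
  proof -
    have "card I < card {1..r}" using r6 I by simp
    then show ?thesis using that fin by (metis card_mono leD subsetI)
  qed
  have "g (p k) * f x - f (p k) * g x = 0" for x
    by (rule form2_zero[of "\<lambda>x. g (p k) * f x - f (p k) * g x" "insert k I"])
      (use f g I k fin in \<open>auto intro!: form_diff form_scale\<close>)
  note * = this
  have "g (p k) \<noteq> 0" using conic_nz[OF g(1,2) nz I k] by auto
  then have "f x = f (p k) / g (p k) * g x" for x using *[of x] by (simp add: field_simps)
  from this[of x] this[of z] show ?thesis using nz by simp
qed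

text \<open>A conic through five points has only two points on the line joining two of them. Otherwise it would
  contain that line, and the residual line would contain the three other points.\<close>

lemma conic_no_line:
  assumes g: "ternary_form 2 g" "\<And>i. i \<in> I \<Longrightarrow> g (p i) = 0" and nz: "g z \<noteq> 0"
    and I: "I \<subseteq> {1..r}" "card I = 5" and ij: "i \<in> I" "j \<in> I" "i \<noteq> j" and ne: "\<alpha> \<noteq> 0" "\<beta> \<noteq> 0"
  shows "g (\<alpha> *s p i + \<beta> *s p j) \<noteq> 0"
proof
  assume g0: "g (\<alpha> *s p i + \<beta> *s p j) = 0"
  have fin: "finite I" using I(1) finite_subset by blast
  have "card (I - {i, j}) = 3" using I ij fin by (simp add: card_Diff_subset)
  then obtain k l m where klm: "I - {i, j} = {k, l, m}" "k \<noteq> l" "k \<noteq> m" "l \<noteq> m"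
    by (auto simp: card_3_iff)
  have sub: "k \<in> I - {i, j}" "l \<in> I - {i, j}" "m \<in> I - {i, j}" unfolding klm(1) by simp_all
  have in_r: "i \<in> {1..r}" "j \<in> {1..r}" "k \<in> {1..r}" "l \<in> {1..r}" "m \<in> {1..r}" using sub I(1) ij by blast+
  have ne': "k \<noteq> i" "k \<noteq> j" "l \<noteq> i" "l \<noteq> j" "m \<noteq> i" "m \<noteq> j" using sub by blast+
  have gI: "g (p i) = 0" "g (p j) = 0" "g (p k) = 0" "g (p l) = 0" "g (p m) = 0" using g(2) sub ij by blast+
  let ?D = "tri (p i) (p j) (p k)"
  have D: "?D \<noteq> 0" by (rule tri_nz[OF in_r(1,2,3) ij(3) ne'(1)[symmetric] ne'(2)[symmetric]])
  obtain c12 c13 c23 where c: "\<And>X Y Z. g (X *s p i + Y *s p j + Z *s p k) =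
     X * X * g (p i) + Y * Y * g (p j) + Z * Z * g (p k) + X * Y * c12 + X * Z * c13 + Y * Z * c23"
    using form2_basis[OF g(1), of "p i" "p j" "p k"] by blast
  have "c12 = 0" using c[of \<alpha> \<beta> 0] g0 gI ne by simp
  define L where "L x = tri x (p j) (p k) * c13 + tri (p i) x (p k) * c23" for x
  have L: "ternary_form 1 L" unfolding L_def[abs_def] mult.commute[of _ c13] mult.commute[of _ c23]
    by (intro form_add form_scale form_tri)
  have gL: "?D * ?D * g x = tri (p i) (p j) x * L x" for x
  proof -
    have "g x = tri x (p j) (p k) / ?D * (tri (p i) (p j) x / ?D) * c13 + tri (p i) x (p k) / ?D * (tri (p i) (p j) x / ?D) * c23"
      by (subst tri_basis[OF D, of x], subst c) (simp add: gI \<open>c12 = 0\<close>)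
    then show ?thesis using D by (simp add: L_def field_simps)
  qed
  have "L (p k) = 0" unfolding L_def by simp
  moreover have "L (p l) = 0" using gL[of "p l"] gI tri_nz[of i j l] in_r ij ne' by auto
  moreover have "L (p m) = 0" using gL[of "p m"] gI tri_nz[of i j m] in_r ij ne' by auto
  ultimately have "L z = 0" using form1_zero[OF L, of k l m z] in_r klm by blast
  then show False using gL[of z] D nz by simp
qed

text \<open>Vanishing to second order along every line through \<open>a\<close>.\<close>

definition double_at :: "('a^3 \<Rightarrow> 'a) \<Rightarrow> 'a^3 \<Rightarrow> bool" where
  "double_at f a \<longleftrightarrow> (\<forall>v. \<exists>R. \<forall>t. f (a + t *s v) = t ^ 2 * poly R t)"

lemma double_at_zero: "double_at f a \<Longrightarrow> f a = 0"
proof -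
  assume "double_at f a"
  then obtain R where "\<forall>t. f (a + t *s 0) = t ^ 2 * poly R t" unfolding double_at_def by blast
  from this[rule_format, of 0] show ?thesis by simp
qed

lemma double_at_scale: "double_at f a \<Longrightarrow> double_at (\<lambda>x. c * f x) a"
  unfolding double_at_def
proof
  fix v assume "\<forall>v. \<exists>R. \<forall>t. f (a + t *s v) = t\<^sup>2 * poly R t"
  then obtain R where "\<forall>t. f (a + t *s v) = t\<^sup>2 * poly R t" by blast
  then show "\<exists>R. \<forall>t. c * f (a + t *s v) = t\<^sup>2 * poly R t" by (intro exI[of _ "smult c R"]) simp
qed

lemma double_at_add: "double_at f a \<Longrightarrow> double_at g a \<Longrightarrow> double_at (\<lambda>x. f x + g x) a"
  unfolding double_at_def
proof
  fix v assume "\<forall>v. \<exists>R. \<forall>t. f (a + t *s v) = t\<^sup>2 * poly R t" "\<forall>v. \<exists>R. \<forall>t. g (a + t *s v) = t\<^sup>2 * poly R t"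
  then obtain R S where "\<forall>t. f (a + t *s v) = t\<^sup>2 * poly R t" "\<forall>t. g (a + t *s v) = t\<^sup>2 * poly S t" by blast
  then show "\<exists>R. \<forall>t. f (a + t *s v) + g (a + t *s v) = t\<^sup>2 * poly R t"
    by (intro exI[of _ "R + S"]) (simp add: algebra_simps)
qed

lemma double_at_sum: "(\<And>i. i \<in> A \<Longrightarrow> double_at (f i) a) \<Longrightarrow> double_at (\<lambda>x. \<Sum>i\<in>A. f i x) a"
proof (induction A rule: infinite_finite_induct)
  have "double_at (\<lambda>_. 0) a" unfolding double_at_def by (auto intro: exI[of _ 0])
  then show "double_at (\<lambda>x. \<Sum>i\<in>{}. f i x) a" "infinite A \<Longrightarrow> double_at (\<lambda>x. \<Sum>i\<in>A. f i x) a" for A by simp_all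
qed (auto intro: double_at_add)

lemma form_zero_line:
  assumes "ternary_form d f" "f a = 0"
  obtains R where "\<And>t. f (a + t *s v) = t * poly R t"
proof -
  obtain R where R: "\<And>t. f (a + t *s v) = poly R t" using form_line[OF assms(1)] by blast
  then have "poly R 0 = 0" using R[of 0] assms(2) by simp
  then obtain S where "R = [:0, 1:] * S" using poly_eq_0_iff_dvd[of R 0] by (auto simp: dvd_def)
  then show ?thesis using that[of S] R by simp
qed

lemma double_at_mult:
  assumes "ternary_form d f" "ternary_form e g" "f a = 0" "g a = 0"
  shows "double_at (\<lambda>x. f x * g x) a"
  unfolding double_at_def
proof
  fix v
  obtain R where "\<And>t. f (a + t *s v) = t * poly R t" using form_zero_line[OF assms(1,3)] by blast
  moreover obtain S where "\<And>t. g (a + t *s v) = t * poly S t" using form_zero_line[OF assms(2,4)] by blast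
  ultimately show "\<exists>R. \<forall>t. f (a + t *s v) * g (a + t *s v) = t\<^sup>2 * poly R t"
    by (intro exI[of _ "R * S"]) (simp add: power2_eq_square)
qed

text \<open>A cubic that is double at \<open>p\<^sub>i\<close> and passes through \<open>p\<^sub>j\<close> meets their joining line three times. One
  more point on the line makes the line a component; the residual conic contains six of the points, which
  is impossible.\<close>

lemma cubic_zero:
  assumes f: "ternary_form 3 f" "double_at f (p i)" "\<And>q. q \<in> I \<Longrightarrow> f (p q) = 0" "f (p i + p j) = 0"
    and I: "I \<subseteq> {1..r}" "card I = 7" "i \<in> I" "j \<in> I" "i \<noteq> j"
  shows "f x = 0"
proof -
  have fin: "finite I" using I(1) finite_subset by blast
  have "card (I - {i, j}) = 5" using I fin by (simp add: card_Diff_subset)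
  then obtain k where k: "k \<in> I - {i, j}" by (metis all_not_in_conv card.empty zero_neq_numeral)
  have in_r: "i \<in> {1..r}" "j \<in> {1..r}" "k \<in> {1..r}" using I k by auto
  let ?D = "tri (p i) (p j) (p k)"
  have D: "?D \<noteq> 0" by (rule tri_nz) (use in_r I k in auto)
  have f0: "f (p i) = 0" "f (p j) = 0" "f (p k) = 0" using f(3) I k by auto
  obtain c112 c113 c122 c133 c223 c233 c123 where c: "\<And>X Y Z. f (X *s p i + Y *s p j + Z *s p k) =
     X * X * X * f (p i) + Y * Y * Y * f (p j) + Z * Z * Z * f (p k)
     + X * X * Y * c112 + X * X * Z * c113 + X * Y * Y * c122 + X * Z * Z * c133
     + Y * Y * Z * c223 + Y * Z * Z * c233 + X * Y * Z * c123"
    using form3_basis[OF f(1), of "p i" "p j" "p k"] by blast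
  have lin: "u = 0" if "\<forall>t. t * u + t ^ 2 * w = t\<^sup>2 * poly R t" for u w :: 'a and R
  proof -
    have "poly ([:0, u, w:] - [:0, 0, 1:] * R) t = 0" for t
      using that[rule_format, of t] by (simp add: power2_eq_square algebra_simps)
    then have "[:0, u, w:] = [:0, 0, 1:] * R" using poly_all_0_iff_0 by (metis eq_iff_diff_eq_0)
    then show ?thesis by simp
  qed
  obtain R where R: "\<forall>t. f (p i + t *s p j) = t\<^sup>2 * poly R t" using f(2) unfolding double_at_def by blast
  have "c112 = 0" by (rule lin[of _ c122 R]) (use R c[of 1 _ 0] f0 in \<open>simp add: power2_eq_square\<close>)
  obtain S where S: "\<forall>t. f (p i + t *s p k) = t\<^sup>2 * poly S t" using f(2) unfolding double_at_def by blast
  have "c113 = 0" by (rule lin[of _ c133 S]) (use S c[of 1 0] f0 in \<open>simp add: power2_eq_square\<close>)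
  have "c122 = 0" using c[of 1 1 0] f(4) f0 \<open>c112 = 0\<close> by simp
  let ?X = "\<lambda>x. tri x (p j) (p k)" and ?Y = "\<lambda>x. tri (p i) x (p k)" and ?Z = "\<lambda>x. tri (p i) (p j) x"
  define q where "q x = c133 * (?X x * ?Z x) + c223 * (?Y x * ?Y x) + c233 * (?Y x * ?Z x) + c123 * (?X x * ?Y x)" for x
  have q: "ternary_form 2 q"
  proof -
    have t: "ternary_form 2 (\<lambda>x. g x * h x)" if "ternary_form 1 g" "ternary_form 1 h" for g h :: "'a^3 \<Rightarrow> 'a"
      using form_mult[OF that] by (simp only: one_add_one)
    show ?thesis unfolding q_def[abs_def] by (intro form_add form_scale t form_tri)
  qed
  have fq: "?D * ?D * ?D * f x = ?Z x * q x" for x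
  proof -
    have "f x = (?X x / ?D) * (?Z x / ?D) * (?Z x / ?D) * c133 + (?Y x / ?D) * (?Y x / ?D) * (?Z x / ?D) * c223
      + (?Y x / ?D) * (?Z x / ?D) * (?Z x / ?D) * c233 + (?X x / ?D) * (?Y x / ?D) * (?Z x / ?D) * c123"
      by (subst tri_basis[OF D, of x], subst c) (simp add: f0 \<open>c112 = 0\<close> \<open>c113 = 0\<close> \<open>c122 = 0\<close>)
    then show ?thesis using D by (simp add: q_def field_simps)
  qed
  have "q (p l) = 0" if "l \<in> I - {j}" for l
  proof (cases "l = i")
    case True then show ?thesis by (simp add: q_def)
  next
    case False
    then have "?Z (p l) \<noteq> 0" using tri_nz[of i j l] that I in_r by blast
    then show ?thesis using fq[of "p l"] f(3)[of l] that by simp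
  qed
  moreover have "card (I - {j}) = 6" "I - {j} \<subseteq> {1..r}" using I by auto
  ultimately have "q x = 0" using form2_zero[OF q] by metis
  then show ?thesis using fq[of x] D by simp
qed

lemma cubic_unique:
  assumes f: "ternary_form 3 f" "double_at f (p i)" "\<And>q. q \<in> I \<Longrightarrow> f (p q) = 0"
    and g: "ternary_form 3 g" "double_at g (p i)" "\<And>q. q \<in> I \<Longrightarrow> g (p q) = 0"
    and I: "I \<subseteq> {1..r}" "card I = 7" "i \<in> I" and nz: "g z \<noteq> 0"
  shows "f x = f z / g z * g x"
proof -
  have "card (I - {i}) = 6" using I by simp
  then obtain j where j: "j \<in> I" "i \<noteq> j" by (metis DiffE all_not_in_conv card.empty insertI1 zero_neq_numeral)
  let ?w = "p i + p j"
  have "double_at (\<lambda>x. g ?w * f x - f ?w * g x) (p i)"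
    using double_at_add[OF double_at_scale[OF f(2), of "g ?w"] double_at_scale[OF g(2), of "- f ?w"]] by simp
  note d = this
  have *: "g ?w * f x - f ?w * g x = 0" for x
  proof (rule cubic_zero[where f = "\<lambda>x. g ?w * f x - f ?w * g x", OF _ d _ _ I j])
    show "ternary_form 3 (\<lambda>x. g ?w * f x - f ?w * g x)" by (intro form_diff form_scale f(1) g(1))
  qed (use f(3) g(3) in simp_all)
  have "g ?w \<noteq> 0" using cubic_zero[OF g _ I j, of z] nz by auto
  then have "f x = f ?w / g ?w * g x" for x using *[of x] by (simp add: field_simps)
  from this[of x] this[of z] show ?thesis using nz by simp
qed

end

section \<open>Functions that are polynomial on every line\<close>

lemma poly_eqI_cofinite:
  fixes P Q :: "'a::{field_char_0} poly"
  assumes "finite {t. poly P t \<noteq> poly Q t}"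
  shows "P = Q"
proof (rule ccontr)
  assume "P \<noteq> Q"
  then have "finite {t. poly (P - Q) t = 0}" by (intro poly_roots_finite) simp
  then have "finite ({t. poly P t \<noteq> poly Q t} \<union> {t. poly (P - Q) t = 0})" using assms by simp
  moreover have "{t. poly P t \<noteq> poly Q t} \<union> {t. poly (P - Q) t = 0} = UNIV" by auto
  ultimately show False using infinite_UNIV_char_0 by metis
qed

text \<open>A regular function on the affine line is a polynomial. Choose a fraction that represents \<open>h\<close> up to
  finitely many points with a denominator of least degree. A root of that denominator would be a common
  root of numerator and denominator, by comparison with a fraction that is defined there.\<close>

lemma locally_rational_imp_poly:
  fixes h :: "'a::{alg_closed_field, field_char_0} \<Rightarrow> 'a"
  assumes "\<And>\<tau>. \<exists>P Q. poly Q \<tau> \<noteq> 0 \<and> (\<forall>t. poly Q t \<noteq> 0 \<longrightarrow> h t = poly P t / poly Q t)"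
  obtains R where "\<And>t. h t = poly R t"
proof -
  define good where "good n P Q \<longleftrightarrow> degree Q = n \<and> Q \<noteq> 0 \<and> finite {t. h t * poly Q t \<noteq> poly P t}"
    for n :: nat and P Q :: "'a poly"
  have loc: "\<exists>P Q. poly Q \<tau> \<noteq> 0 \<and> (\<forall>t. poly Q t \<noteq> 0 \<longrightarrow> h t * poly Q t = poly P t)" for \<tau>
  proof -
    obtain P Q where "poly Q \<tau> \<noteq> 0" "\<forall>t. poly Q t \<noteq> 0 \<longrightarrow> h t = poly P t / poly Q t" using assms by blast
    then show ?thesis by (intro exI[of _ P] exI[of _ Q]) simp
  qed
  have fin: "finite {t. h t * poly Q t \<noteq> poly P t}" if "Q \<noteq> 0" "\<forall>t. poly Q t \<noteq> 0 \<longrightarrow> h t * poly Q t = poly P t" for P Q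
    by (rule finite_subset[OF _ poly_roots_finite[OF that(1)]]) (use that(2) in auto)
  have "\<exists>n P Q. good n P Q"
  proof -
    obtain P Q where PQ: "poly Q 0 \<noteq> 0" "\<forall>t. poly Q t \<noteq> 0 \<longrightarrow> h t * poly Q t = poly P t" using loc[of 0] by blast
    then have "Q \<noteq> 0" by auto
    then show ?thesis using fin[OF _ PQ(2)] unfolding good_def by blast
  qed
  then obtain n where n: "\<exists>P Q. good n P Q" and least: "\<And>m. m < n \<Longrightarrow> \<not> (\<exists>P Q. good m P Q)"
    using exists_least_iff[of "\<lambda>n. \<exists>P Q. good n P Q"] by blast
  then obtain P Q where g: "good n P Q" by blast
  have cross: "P * Q1 = P1 * Q" if "\<forall>t. poly Q1 t \<noteq> 0 \<longrightarrow> h t * poly Q1 t = poly P1 t" "Q1 \<noteq> 0" for P1 Q1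
  proof (rule poly_eqI_cofinite)
    have "poly P t * poly Q1 t = poly P1 t * poly Q t"
      if "h t * poly Q t = poly P t" "h t * poly Q1 t = poly P1 t" for t
      using that by (metis mult.assoc mult.commute)
    then have "{t. poly (P * Q1) t \<noteq> poly (P1 * Q) t} \<subseteq> {t. h t * poly Q t \<noteq> poly P t} \<union> {t. h t * poly Q1 t \<noteq> poly P1 t}"
      by auto
    then show "finite {t. poly (P * Q1) t \<noteq> poly (P1 * Q) t}"
      using g fin[OF that(2,1)] unfolding good_def by (meson finite_UnI finite_subset)
  qed
  have "n = 0"
  proof (rule ccontr)
    assume "n \<noteq> 0"
    then have "degree Q \<noteq> 0" using g unfolding good_def by simp
    then obtain \<tau> where \<tau>: "poly Q \<tau> = 0" using alg_closed_imp_poly_has_root by blast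
    obtain P1 Q1 where PQ: "poly Q1 \<tau> \<noteq> 0" "\<forall>t. poly Q1 t \<noteq> 0 \<longrightarrow> h t * poly Q1 t = poly P1 t" using loc[of \<tau>] by blast
    then have "Q1 \<noteq> 0" by auto
    have "poly (P * Q1) \<tau> = poly (P1 * Q) \<tau>" using cross[OF PQ(2) \<open>Q1 \<noteq> 0\<close>] by simp
    then have "poly P \<tau> = 0" using PQ(1) \<tau> by simp
    then obtain P' where P': "P = [:-\<tau>, 1:] * P'" unfolding poly_eq_0_iff_dvd by (auto simp: dvd_def)
    obtain Q' where Q': "Q = [:-\<tau>, 1:] * Q'" using \<tau> unfolding poly_eq_0_iff_dvd by (auto simp: dvd_def)
    have "Q' \<noteq> 0" using g Q' unfolding good_def by auto
    then have "degree Q = Suc (degree Q')" unfolding Q' by (subst degree_mult_eq) simp_all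
    then have deg: "degree Q' < n" using g unfolding good_def by simp
    have "{t. h t * poly Q' t \<noteq> poly P' t} \<subseteq> insert \<tau> {t. h t * poly Q t \<noteq> poly P t}"
    proof
      fix x assume "x \<in> {t. h t * poly Q' t \<noteq> poly P' t}"
      then have "(x - \<tau>) * (h x * poly Q' x) \<noteq> (x - \<tau>) * poly P' x" if "x \<noteq> \<tau>" using that by simp
      moreover have "poly P x = (x - \<tau>) * poly P' x" "h x * poly Q x = (x - \<tau>) * (h x * poly Q' x)"
        unfolding P' Q' by (simp_all add: algebra_simps)
      ultimately show "x \<in> insert \<tau> {t. h t * poly Q t \<noteq> poly P t}" by auto
    qed
    \<comment> \<open>Cancelling the common root \<open>\<tau>\<close> costs at most one more exceptional point.\<close>
    then have "good (degree Q') P' Q'" using g \<open>Q' \<noteq> 0\<close> unfolding good_def by (meson finite_insert finite_subset)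
    then show False using least[OF deg] by blast
  qed
  then obtain c where c: "Q = [:c:]" "c \<noteq> 0" using g unfolding good_def by (metis degree_eq_zeroE pCons_0_0)
  have "h \<tau> = poly (smult (inverse c) P) \<tau>" for \<tau>
  proof -
    obtain P1 Q1 where PQ: "poly Q1 \<tau> \<noteq> 0" "\<forall>t. poly Q1 t \<noteq> 0 \<longrightarrow> h t * poly Q1 t = poly P1 t" using loc[of \<tau>] by blast
    then have "Q1 \<noteq> 0" by auto
    have "poly (P * Q1) \<tau> = poly (P1 * Q) \<tau>" using cross[OF PQ(2) \<open>Q1 \<noteq> 0\<close>] by simp
    then have "poly P \<tau> * poly Q1 \<tau> = h \<tau> * poly Q1 \<tau> * c" using PQ c by simp
    then have "poly P \<tau> = h \<tau> * c" using PQ(1) by simp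
    then show ?thesis using c(2) by simp
  qed
  then show ?thesis using that by blast
qed

text \<open>A form of degree \<open>d\<close> restricted to a line has at most degree \<open>d\<close>: the other end of the projective line
  is covered by the second polynomial.\<close>

lemma degree_le_of_homogeneous:
  fixes R S :: "'a::field_char_0 poly"
  assumes "\<And>t. t \<noteq> 0 \<Longrightarrow> poly R t = t ^ d * poly S (inverse t)"
  shows "degree R \<le> d"
proof (cases "R = 0")
  case False
  have "R * monom 1 (degree S) = monom 1 d * reflect_poly S"
  proof (rule poly_eqI_cofinite)
    have "poly (R * monom 1 (degree S)) t = poly (monom 1 d * reflect_poly S) t" if "t \<noteq> 0" for t
      using assms[OF that] poly_reflect_poly_nz[OF that, of S] by (simp add: poly_monom mult_ac)
    then have "{t. poly (R * monom 1 (degree S)) t \<noteq> poly (monom 1 d * reflect_poly S) t} \<subseteq> {0}" by blast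
    then show "finite {t. poly (R * monom 1 (degree S)) t \<noteq> poly (monom 1 d * reflect_poly S) t}"
      by (rule finite_subset) simp
  qed
  moreover have "degree (R * monom 1 (degree S)) = degree R + degree S"
    using False by (subst degree_mult_eq) (simp_all add: degree_monom_eq)
  ultimately have "degree R + degree S \<le> d + degree (reflect_poly S)"
    using degree_mult_le[of "monom (1::'a) d" "reflect_poly S"] by (simp add: degree_monom_eq)
  then show ?thesis using degree_reflect_poly_le[of S] by linarith
qed simp

definition lagrange :: "nat \<Rightarrow> nat \<Rightarrow> 'a::field_char_0 poly" where
  "lagrange d k = (\<Prod>j\<in>{..d} - {k}. smult (inverse (of_nat k - of_nat j)) [:- of_nat j, 1:])"

lemma lagrange_interpolation:
  fixes R :: "'a::field_char_0 poly"
  assumes "degree R \<le> d"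
  shows "poly R t = (\<Sum>k\<le>d. poly (lagrange d k) t * poly R (of_nat k))"
proof -
  have deg: "degree (lagrange d k :: 'a poly) \<le> d" if "k \<le> d" for k
  proof -
    have "degree (lagrange d k :: 'a poly) \<le> (\<Sum>j\<in>{..d} - {k}. degree (smult (inverse (of_nat k - of_nat j)) [:- of_nat j, 1:] :: 'a poly))"
      unfolding lagrange_def by (rule order.trans[OF degree_prod_sum_le]) auto
    also have "\<dots> \<le> (\<Sum>j\<in>{..d} - {k}. 1)" by (rule sum_mono) (simp add: degree_smult_le)
    finally show ?thesis using that by simp
  qed
  have val: "poly (lagrange d k) (of_nat m :: 'a) = (if m = k then 1 else 0)" if "m \<le> d" "k \<le> d" for m k
  proof (cases "m = k")
    case True
    have "poly (smult (inverse (of_nat k - of_nat j)) [:- of_nat j, 1:]) (of_nat k :: 'a) = 1" if "j \<noteq> k" for j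
    proof -
      have "poly [:- of_nat j, 1:] (of_nat k :: 'a) = of_nat k - of_nat j" by simp
      then show ?thesis using that unfolding poly_smult by (metis left_inverse of_nat_eq_iff right_minus_eq)
    qed
    then have "(\<Prod>j\<in>{..d} - {k}. poly (smult (inverse (of_nat k - of_nat j)) [:- of_nat j, 1:]) (of_nat k :: 'a)) = 1"
      by (intro prod.neutral) blast
    then show ?thesis using True unfolding lagrange_def poly_prod by simp
  next
    case False
    then show ?thesis using that unfolding lagrange_def poly_prod by (auto intro!: prod_zero)
  qed
  have "R = (\<Sum>k\<le>d. smult (poly R (of_nat k)) (lagrange d k))"
  proof (rule poly_eqI_degree)
    fix x :: 'a assume "x \<in> of_nat ` {..d}"
    then obtain m where "x = of_nat m" "m \<le> d" by auto
    then have "poly (\<Sum>k\<le>d. smult (poly R (of_nat k)) (lagrange d k)) x = (\<Sum>k\<le>d. if m = k then poly R (of_nat m) else 0)"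
      unfolding poly_sum by (intro sum.cong) (auto simp: val)
    then show "poly R x = poly (\<Sum>k\<le>d. smult (poly R (of_nat k)) (lagrange d k)) x"
      using \<open>x = of_nat m\<close> \<open>m \<le> d\<close> by simp
  next
    have c: "card (of_nat ` {..d} :: 'a set) = Suc d" by (subst card_image) (auto simp: inj_on_def)
    then show "degree R < card (of_nat ` {..d} :: 'a set)" using assms by simp
    have "degree (\<Sum>k\<le>d. smult (poly R (of_nat k)) (lagrange d k)) \<le> d"
      by (rule degree_sum_le) (use deg in auto)
    then show "degree (\<Sum>k\<le>d. smult (poly R (of_nat k)) (lagrange d k)) < card (of_nat ` {..d} :: 'a set)" using c by simp
  qed
  then have "poly R t = poly (\<Sum>k\<le>d. smult (poly R (of_nat k)) (lagrange d k)) t" by simp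
  then show ?thesis by (simp add: poly_sum mult.commute)
qed

text \<open>Polynomial functions in three variables, as finite sums of forms.\<close>

definition ternary_poly :: "('a::field^3 \<Rightarrow> 'a) \<Rightarrow> bool" where
  "ternary_poly f \<longleftrightarrow> (\<exists>n F. (\<forall>e. ternary_form e (F e)) \<and> (\<forall>e>n. \<forall>x. F e x = 0) \<and> (\<forall>x. f x = (\<Sum>e\<le>n. F e x)))"

lemma ternary_poly_form: assumes "ternary_form d f" shows "ternary_poly f"
  unfolding ternary_poly_def
proof (intro exI conjI allI impI)
  show "ternary_form e (if e = d then f else (\<lambda>_. 0))" for e using assms by (auto intro: form_zero)
  show "(if e = d then f else (\<lambda>_. 0)) x = 0" if "e > d" for e x using that by simp
  show "f x = (\<Sum>e\<le>d. (if e = d then f else (\<lambda>_. 0)) x)" for x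
    by (simp add: if_distribR)
qed

lemma ternary_poly_mult: assumes "ternary_poly f" "ternary_poly g" shows "ternary_poly (\<lambda>x. f x * g x)"
proof -
  obtain n F where F: "\<And>e. ternary_form e (F e)" "\<And>e x. e > n \<Longrightarrow> F e x = 0" "\<And>x. f x = (\<Sum>e\<le>n. F e x)"
    using assms(1) unfolding ternary_poly_def by blast
  obtain m G where G: "\<And>e. ternary_form e (G e)" "\<And>e x. e > m \<Longrightarrow> G e x = 0" "\<And>x. g x = (\<Sum>e\<le>m. G e x)"
    using assms(2) unfolding ternary_poly_def by blast
  have "ternary_form e (\<lambda>x. \<Sum>k\<le>e. F k x * G (e - k) x)" for e
  proof (rule form_sum)
    fix k assume "k \<in> {..e}"
    then show "ternary_form e (\<lambda>x. F k x * G (e - k) x)" using form_mult[OF F(1) G(1), of k "e - k"] by simp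
  qed
  moreover have "(\<Sum>k\<le>e. F k x * G (e - k) x) = 0" if "e > n + m" for e x
  proof (rule sum.neutral, rule ballI)
    fix k assume "k \<in> {..e}"
    then have "k > n \<or> e - k > m" using that by auto
    then show "F k x * G (e - k) x = 0" using F(2) G(2) by auto
  qed
  moreover have "f x * g x = (\<Sum>e\<le>n + m. \<Sum>k\<le>e. F k x * G (e - k) x)" for x
    unfolding F(3) G(3) using polynomial_product[of n "\<lambda>e. F e x" m "\<lambda>e. G e x" 1] F(2) G(2) by simp
  ultimately show ?thesis unfolding ternary_poly_def
    by (intro exI[of _ "n + m"] exI[of _ "\<lambda>e x. \<Sum>k\<le>e. F k x * G (e - k) x"]) simp
qed

lemma ternary_poly_add: assumes "ternary_poly f" "ternary_poly g" shows "ternary_poly (\<lambda>x. f x + g x)"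
proof -
  obtain n F where F: "\<And>e. ternary_form e (F e)" "\<And>e x. e > n \<Longrightarrow> F e x = 0" "\<And>x. f x = (\<Sum>e\<le>n. F e x)"
    using assms(1) unfolding ternary_poly_def by blast
  obtain m G where G: "\<And>e. ternary_form e (G e)" "\<And>e x. e > m \<Longrightarrow> G e x = 0" "\<And>x. g x = (\<Sum>e\<le>m. G e x)"
    using assms(2) unfolding ternary_poly_def by blast
  have "f x + g x = (\<Sum>e\<le>max n m. F e x + G e x)" for x
  proof -
    have "(\<Sum>e\<le>n. F e x) = (\<Sum>e\<le>max n m. F e x)" by (rule sum.mono_neutral_left) (auto simp: F(2))
    moreover have "(\<Sum>e\<le>m. G e x) = (\<Sum>e\<le>max n m. G e x)" by (rule sum.mono_neutral_left) (auto simp: G(2))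
    ultimately show ?thesis unfolding F(3) G(3) by (simp add: sum.distrib)
  qed
  moreover have "ternary_form e (\<lambda>x. F e x + G e x)" for e using F(1) G(1) by (rule form_add)
  moreover have "F e x + G e x = 0" if "e > max n m" for e x using F(2) G(2) that by simp
  ultimately show ?thesis unfolding ternary_poly_def
    by (intro exI[of _ "max n m"] exI[of _ "\<lambda>e x. F e x + G e x"]) simp
qed

lemma ternary_poly_sum: "(\<And>i. i \<in> A \<Longrightarrow> ternary_poly (f i)) \<Longrightarrow> ternary_poly (\<lambda>x. \<Sum>i\<in>A. f i x)"
proof (induction A rule: infinite_finite_induct)
  case (insert i A) then show ?case by (auto intro: ternary_poly_add)
qed (auto intro: ternary_poly_form form_zero)

lemma ternary_poly_poly: "ternary_poly f \<Longrightarrow> ternary_poly (\<lambda>x. poly P (f x))"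
proof (induction P)
  case (pCons a P)
  then show ?case by (auto intro!: ternary_poly_add ternary_poly_mult intro: ternary_poly_form form_const)
qed (auto intro: ternary_poly_form form_zero)

lemma ternary_poly_homogeneous:
  fixes f :: "'a::field_char_0^3 \<Rightarrow> 'a"
  assumes "ternary_poly f" "\<And>c x. c \<noteq> 0 \<Longrightarrow> f (c *s x) = c ^ d * f x"
  shows "ternary_form d f"
proof -
  obtain n F where F: "\<And>e. ternary_form e (F e)" "\<And>e x. e > n \<Longrightarrow> F e x = 0" "\<And>x. f x = (\<Sum>e\<le>n. F e x)"
    using assms(1) unfolding ternary_poly_def by blast
  have "f x = F d x" for x
  proof -
    have "(\<Sum>e\<le>n. monom (F e x) e) = monom (f x) d"
    proof (rule poly_eqI_cofinite)
      have "poly (\<Sum>e\<le>n. monom (F e x) e) c = poly (monom (f x) d) c" if "c \<noteq> 0" for c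
        using assms(2)[OF that, of x] unfolding F(3)[of "c *s x"] form_homogeneous[OF F(1)]
        by (simp add: poly_sum poly_monom mult.commute)
      then have "{c. poly (\<Sum>e\<le>n. monom (F e x) e) c \<noteq> poly (monom (f x) d) c} \<subseteq> {0}" by blast
      then show "finite {c. poly (\<Sum>e\<le>n. monom (F e x) e) c \<noteq> poly (monom (f x) d) c}"
        by (rule finite_subset) simp
    qed
    then have "coeff (\<Sum>e\<le>n. monom (F e x) e) d = f x" by simp
    then show ?thesis using F(2)[of d x] by (simp add: coeff_sum) (metis linorder_not_le)
  qed
  then have "f = F d" by blast
  then show ?thesis using F(1) by simp
qed

text \<open>A homogeneous function that is polynomial on every line is a form. The degrees on the lines are
  bounded by \<open>d\<close>, so Lagrange interpolation in each of the three coordinates recovers the function from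
  its values at finitely many points.\<close>

lemma form_of_lines:
  fixes f :: "'a::field_char_0^3 \<Rightarrow> 'a"
  assumes lines: "\<And>a v. \<exists>R. \<forall>t. f (a + t *s v) = poly R t"
    and hom: "\<And>c x. c \<noteq> 0 \<Longrightarrow> f (c *s x) = c ^ d * f x"
  shows "ternary_form d f"
proof (rule ternary_poly_homogeneous[OF _ hom])
  have deg: "\<exists>R. degree R \<le> d \<and> (\<forall>t. f (a + t *s v) = poly R t)" for a v
  proof -
    obtain R where R: "\<And>t. f (a + t *s v) = poly R t" using lines by metis
    obtain S where S: "\<And>t. f (v + t *s a) = poly S t" using lines by metis
    have "poly R t = t ^ d * poly S (inverse t)" if "t \<noteq> 0" for t
    proof -
      have "a + t *s v = t *s (v + inverse t *s a)" using that by (simp add: vec_eq_iff field_simps)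
      then show ?thesis using R[of t] S[of "inverse t"] hom[OF that, of "v + inverse t *s a"] by metis
    qed
    then show ?thesis using R degree_le_of_homogeneous by blast
  qed
  let ?v = "\<lambda>x y z. vector [x, y, z] :: 'a^3"
  have step: "f (a + t *s v) = (\<Sum>k\<le>d. poly (lagrange d k) t * f (a + of_nat k *s v))" for a t v
  proof -
    obtain R where R: "degree R \<le> d" "\<And>t. f (a + t *s v) = poly R t" using deg[of a v] by blast
    show ?thesis unfolding R(2) by (rule lagrange_interpolation[OF R(1)])
  qed
  have s1: "f (?v x y z) = (\<Sum>k\<le>d. poly (lagrange d k) x * f (?v (of_nat k) y z))" for x y z
  proof -
    have e: "?v x y z = ?v 0 y z + x *s ?v 1 0 0" for x by (simp add: vec_eq_iff forall_3)
    show ?thesis using step[of "?v 0 y z" x "?v 1 0 0"] unfolding e[symmetric] .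
  qed
  have s2: "f (?v x y z) = (\<Sum>k\<le>d. poly (lagrange d k) y * f (?v x (of_nat k) z))" for x y z
  proof -
    have e: "?v x y z = ?v x 0 z + y *s ?v 0 1 0" for y by (simp add: vec_eq_iff forall_3)
    show ?thesis using step[of "?v x 0 z" y "?v 0 1 0"] unfolding e[symmetric] .
  qed
  have s3: "f (?v x y z) = (\<Sum>k\<le>d. poly (lagrange d k) z * f (?v x y (of_nat k)))" for x y z
  proof -
    have e: "?v x y z = ?v x y 0 + z *s ?v 0 0 1" for z by (simp add: vec_eq_iff forall_3)
    show ?thesis using step[of "?v x y 0" z "?v 0 0 1"] unfolding e[symmetric] .
  qed
  have "f x = (\<Sum>i\<le>d. poly (lagrange d i) (x $ 1) * (\<Sum>j\<le>d. poly (lagrange d j) (x $ 2) *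
     (\<Sum>k\<le>d. poly (lagrange d k) (x $ 3) * f (?v (of_nat i) (of_nat j) (of_nat k)))))" for x
  proof -
    have "x = ?v (x $ 1) (x $ 2) (x $ 3)" by (simp add: vec_eq_iff forall_3)
    then have "f x = f (?v (x $ 1) (x $ 2) (x $ 3))" by simp
    also have "\<dots> = (\<Sum>i\<le>d. poly (lagrange d i) (x $ 1) * f (?v (of_nat i) (x $ 2) (x $ 3)))" by (rule s1)
    also have "\<dots> = (\<Sum>i\<le>d. poly (lagrange d i) (x $ 1) * (\<Sum>j\<le>d. poly (lagrange d j) (x $ 2) *
        f (?v (of_nat i) (of_nat j) (x $ 3))))"
      by (intro sum.cong refl arg_cong2[where f = "(*)"]) (rule s2)
    also have "\<dots> = (\<Sum>i\<le>d. poly (lagrange d i) (x $ 1) * (\<Sum>j\<le>d. poly (lagrange d j) (x $ 2) *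
     (\<Sum>k\<le>d. poly (lagrange d k) (x $ 3) * f (?v (of_nat i) (of_nat j) (of_nat k)))))"
      by (intro sum.cong refl arg_cong2[where f = "(*)"]) (rule s3)
    finally show ?thesis .
  qed
  note expand = ext[of f, OF this]
  show "ternary_poly f"
    by (subst expand) (intro ternary_poly_sum ternary_poly_mult ternary_poly_poly ternary_poly_form[OF form_coord]
        ternary_poly_form[OF form_const])
qed

section \<open>Sections on the blow-up restricted to lines\<close>

abbreviation (input) cf :: "pic \<Rightarrow> nat \<Rightarrow> int" where "cf \<equiv> Poly_Mapping.lookup"

lemma cross_simps: "cross a a = 0" "cross (c *s a) b = c *s cross a b" "cross a (c *s b) = c *s cross a b"
  "cross (a + b) d = cross a d + cross b d" "cross 0 a = 0" "cross a 0 = 0"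
  by (simp_all add: cross_def vec_eq_iff forall_3 vector_3 algebra_simps)

lemma pair_simps: "pair (c *s a) b = c * pair a b" "pair a (c *s b) = c * pair a b"
  "pair a (b + d) = pair a b + pair a d" "pair (a + b) d = pair a d + pair b d" "pair a 0 = 0" "pair 0 a = 0"
  by (simp_all add: pair_def sum_3 algebra_simps)

lemma cross_eq_0D:
  fixes a :: "'a::field^3"
  assumes "cross a b = 0" "a \<noteq> 0"
  obtains c where "b = c *s a"
proof -
  have e: "a $ 2 * b $ 3 = a $ 3 * b $ 2" "a $ 3 * b $ 1 = a $ 1 * b $ 3" "a $ 1 * b $ 2 = a $ 2 * b $ 1"
    using assms(1) by (simp_all add: cross_def vec_eq_iff forall_3 vector_3)
  obtain m where m: "a $ m \<noteq> 0" using assms(2) by (auto simp: vec_eq_iff)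
  have "b $ j * a $ m = b $ m * a $ j" for j
    using exhaust_3[of j] exhaust_3[of m] e by (auto simp: mult_ac)
  then have "b = (b $ m / a $ m) *s a" using m by (simp add: vec_eq_iff field_simps)
  then show ?thesis using that by blast
qed

lemma cross_parallel:
  fixes a :: "'a::field^3"
  assumes "pair y a = 0" "pair y b = 0" "cross a b \<noteq> 0"
  obtains c where "y = c *s cross a b"
proof -
  have "cross (cross a b) y = pair y a *s b - pair y b *s a"
    by (simp add: cross_def pair_def sum_3 vec_eq_iff forall_3 vector_3 algebra_simps)
  then have "cross (cross a b) y = 0" using assms(1,2) by (simp add: vec_eq_iff)
  then show ?thesis using cross_eq_0D assms(3) that by blast
qed

lemma cross_solve:
  fixes a :: "'a::field^3"
  assumes "a \<noteq> 0" "pair l a = 0"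
  obtains b where "cross a b = l"
proof -
  have l: "l $ 1 * a $ 1 + l $ 2 * a $ 2 + l $ 3 * a $ 3 = 0" using assms(2) by (simp add: pair_def sum_3)
  consider "a $ 1 \<noteq> 0" | "a $ 2 \<noteq> 0" | "a $ 3 \<noteq> 0" using assms(1) by (auto simp: vec_eq_iff forall_3)
  then show ?thesis
  proof cases
    case 1
    have "- (a $ 2 * l $ 2) - a $ 3 * l $ 3 = l $ 1 * a $ 1" using l by algebra
    then have "cross a (vector [0, l $ 3 / a $ 1, - (l $ 2 / a $ 1)]) = l"
      using 1 by (simp add: cross_def vec_eq_iff forall_3 vector_3 field_simps)
    then show ?thesis using that by blast
  next
    case 2
    have "- (a $ 1 * l $ 1) - a $ 3 * l $ 3 = l $ 2 * a $ 2" using l by algebra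
    then have "cross a (vector [- (l $ 3 / a $ 2), 0, l $ 1 / a $ 2]) = l"
      using 2 by (simp add: cross_def vec_eq_iff forall_3 vector_3 field_simps) (use l in algebra)?
    then show ?thesis using that by blast
  next
    case 3
    have "- (a $ 1 * l $ 1) - a $ 2 * l $ 2 = l $ 3 * a $ 3" using l by algebra
    then have "cross a (vector [l $ 2 / a $ 3, - (l $ 1 / a $ 3), 0]) = l"
      using 3 by (simp add: cross_def vec_eq_iff forall_3 vector_3 field_simps) (use l in algebra)?
    then show ?thesis using that by blast
  qed
qed

lemma span_of_tri_zero:
  fixes a :: "'a::field^3"
  assumes "cross a b \<noteq> 0" "pair (cross a b) q = 0"
  obtains \<alpha> \<beta> where "q = \<alpha> *s a + \<beta> *s b"
proof -
  obtain k where k: "cross a b $ k \<noteq> 0" using assms(1) by (auto simp: vec_eq_iff)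
  have "pair (cross a b) (axis k 1) = cross a b $ k"
    by (simp add: pair_def axis_def if_distrib cong: if_cong)
  then have nz: "tri a b (axis k 1) \<noteq> 0" using k by (simp add: tri_def)
  have "tri a b q = 0" using assms(2) by (simp add: tri_def)
  then show ?thesis using tri_basis[OF nz, of q] by (intro that) simp
qed

lemma pair_cross_line: "pair (cross a b) (a + t *s b) = 0"
  by (simp add: pair_simps)

lemma cross_line: "cross (a + t *s b) (\<alpha> *s a + \<beta> *s b) = (\<beta> - t * \<alpha>) *s cross a b"
  by (simp add: cross_def vec_eq_iff forall_3 vector_3 algebra_simps)

lemma line_nonzero: "cross a b \<noteq> 0 \<Longrightarrow> a + t *s b \<noteq> 0"
proof
  assume "cross a b \<noteq> 0" "a + t *s b = 0"
  moreover have "cross (a + t *s b) b = cross a b" by (simp add: cross_simps)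
  ultimately show False by (simp add: cross_simps)
qed

text \<open>A point of the cone over the blow-up that lies over \<open>x\<close>. Away from the \<open>p\<^sub>i\<close>, the coordinate at \<open>i\<close> is
  the line joining \<open>x\<close> and \<open>p\<^sub>i\<close>; if \<open>x\<close> is proportional to \<open>p\<^sub>i\<close> it is the tangent direction \<open>l\<close>.\<close>

definition lift :: "nat \<Rightarrow> (nat \<Rightarrow> 'a::field^3) \<Rightarrow> 'a^3 \<Rightarrow> 'a^3 \<Rightarrow> nat \<Rightarrow> 'a^3" where
  "lift r p x l i = (if i = 0 then x else if i \<le> r then (if cross x (p i) = 0 then l else cross x (p i)) else 0)"

lemma lift_in_cone:
  assumes "x \<noteq> 0" "l \<noteq> 0" "pair l x = 0"
  shows "lift r p x l \<in> blowup_cone r p"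
proof -
  have "pair l (p i) = 0" if "cross x (p i) = 0" for i
    using cross_eq_0D[OF that assms(1)] assms(3) by (metis pair_simps(2) mult_zero_right)
  then show ?thesis using assms by (auto simp: blowup_cone_def lift_def)
qed

lemma H0_scale:
  assumes "s \<in> H0 r p D" "\<And>i. c i \<noteq> 0" "y \<in> blowup_cone r p"
  shows "s (\<lambda>i. c i *s y i) = c 0 powi (\<Sum>i=0..r. cf D i) * (\<Prod>i=1..r. c i powi (- cf D i)) * s y"
  using assms unfolding H0_def by blast

lemma H0_outside: "s \<in> H0 r p D \<Longrightarrow> y \<notin> blowup_cone r p \<Longrightarrow> s y = 0"
  unfolding H0_def by blast

lemma section_on_curve:
  fixes A B :: "nat \<Rightarrow> ('a::{alg_closed_field, field_char_0})^3"
  assumes s: "s \<in> H0 r p D" and AB: "\<And>t. (\<lambda>i. A i + t *s B i) \<in> blowup_cone r p"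
  obtains R where "\<And>t. s (\<lambda>i. A i + t *s B i) = poly R t"
proof -
  have pf: "\<exists>P. \<forall>t. f (\<lambda>i. A i + t *s B i) = poly P t" if "f \<in> polyfun cone_coords" for f
    using that
  proof induction
    case (polyfun_const c) then show ?case by (intro exI[of _ "[:c:]"]) simp
  next
    case (polyfun_coord f)
    then obtain i k where "f = (\<lambda>y. y i $ k)" unfolding cone_coords_def by blast
    then show ?case by (intro exI[of _ "[:A i $ k, B i $ k:]"]) simp
  next
    case (polyfun_add f g)
    then obtain P Q where "\<forall>t. f (\<lambda>i. A i + t *s B i) = poly P t" "\<forall>t. g (\<lambda>i. A i + t *s B i) = poly Q t" by blast
    then show ?case by (intro exI[of _ "P + Q"]) simp
  next
    case (polyfun_mult f g)
    then obtain P Q where "\<forall>t. f (\<lambda>i. A i + t *s B i) = poly P t" "\<forall>t. g (\<lambda>i. A i + t *s B i) = poly Q t" by blast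
    then show ?case by (intro exI[of _ "P * Q"]) simp
  qed
  have reg: "regular_on cone_coords (blowup_cone r p) s" using s unfolding H0_def by blast
  show ?thesis
  proof (rule locally_rational_imp_poly[of "\<lambda>t. s (\<lambda>i. A i + t *s B i)"])
    fix \<tau>
    obtain P Q where PQ: "P \<in> polyfun cone_coords" "Q \<in> polyfun cone_coords" "Q (\<lambda>i. A i + \<tau> *s B i) \<noteq> 0"
      "\<forall>z\<in>blowup_cone r p. Q z \<noteq> 0 \<longrightarrow> s z = P z / Q z"
      using reg AB[of \<tau>] unfolding regular_on_def by blast
    obtain P' Q' where "\<forall>t. P (\<lambda>i. A i + t *s B i) = poly P' t" "\<forall>t. Q (\<lambda>i. A i + t *s B i) = poly Q' t"
      using pf[OF PQ(1)] pf[OF PQ(2)] by blast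
    then show "\<exists>P Q. poly Q \<tau> \<noteq> 0 \<and> (\<forall>t. poly Q t \<noteq> 0 \<longrightarrow> s (\<lambda>i. A i + t *s B i) = poly P t / poly Q t)"
      using PQ(3) PQ(4)[rule_format, OF AB] by (intro exI[of _ P'] exI[of _ Q']) simp
  qed (rule that)
qed

text \<open>Let \<open>x\<close> run through the line \<open>l\<close>. For the \<open>p\<^sub>k\<close> off this line, joining \<open>x\<close> to \<open>p\<^sub>k\<close> is linear in the
  parameter; for those on it, the join is a linear function \<open>c\<^sub>k\<close> times the constant \<open>l\<close>. Dividing by the
  \<open>c\<^sub>k\<close> with the torus action gives a curve in the cone, on which the section is polynomial.\<close>

lemma section_on_line:
  fixes p :: "nat \<Rightarrow> ('a::{alg_closed_field, field_char_0})^3"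
  assumes s: "s \<in> H0 r p D" and l: "cross a b = l" "l \<noteq> 0" and pnz: "\<And>i. i \<in> {1..r} \<Longrightarrow> p i \<noteq> 0"
  obtains R c where
    "\<And>k. k \<in> {1..r} \<Longrightarrow> pair l (p k) = 0 \<Longrightarrow> c k \<noteq> 0 \<and> (\<forall>t. cross (a + t *s b) (p k) = poly (c k) t *s l)"
    "\<And>t. s (lift r p (a + t *s b) l) =
      (\<Prod>k\<in>{k\<in>{1..r}. pair l (p k) = 0}. if poly (c k) t = 0 then 1 else poly (c k) t powi (- cf D k)) * poly R t"
proof -
  define I where "I = {k\<in>{1..r}. pair l (p k) = 0}"
  have "\<exists>c. c \<noteq> 0 \<and> (\<forall>t. cross (a + t *s b) (p k) = poly c t *s l)" if k: "k \<in> I" for k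
  proof -
    have "cross a b \<noteq> 0" "pair (cross a b) (p k) = 0" using k l by (auto simp: I_def)
    then obtain \<alpha> \<beta> where ab: "p k = \<alpha> *s a + \<beta> *s b" using span_of_tri_zero by metis
    have "p k \<noteq> 0" using pnz k by (auto simp: I_def)
    then have "[:\<beta>, - \<alpha>:] \<noteq> 0" using ab by auto
    then show ?thesis using l by (intro exI[of _ "[:\<beta>, - \<alpha>:]"]) (simp add: ab cross_line)
  qed
  then obtain c where c: "\<And>k. k \<in> I \<Longrightarrow> c k \<noteq> 0" "\<And>k t. k \<in> I \<Longrightarrow> cross (a + t *s b) (p k) = poly (c k) t *s l"
    by metis
  define A where "A i = (if i = 0 then a else if i \<le> r then (if i \<in> I then l else cross a (p i)) else 0)" for i
  define B where "B i = (if i = 0 then b else if i \<le> r \<and> i \<notin> I then cross b (p i) else 0)" for i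
  let ?x = "\<lambda>t. a + t *s b"
  have xnz: "?x t \<noteq> 0" for t using line_nonzero l by metis
  have lx: "pair l (?x t) = 0" for t using pair_cross_line l by metis
  have notI: "cross (?x t) (p i) \<noteq> 0" if "i \<in> {1..r}" "i \<notin> I" for i t
  proof
    assume "cross (?x t) (p i) = 0"
    then obtain e where "p i = e *s ?x t" using cross_eq_0D xnz by metis
    then have "pair l (p i) = 0" using lx[of t] by (simp only: pair_simps(2)) simp
    then show False using that by (auto simp: I_def)
  qed
  have Y: "A i + t *s B i = (if i = 0 then ?x t else if i \<le> r then (if i \<in> I then l else cross (?x t) (p i)) else 0)" for i t
    by (simp add: A_def B_def I_def cross_simps)
  have inX: "(\<lambda>i. A i + t *s B i) \<in> blowup_cone r p" for t
    unfolding blowup_cone_def Y using xnz lx notI l by (auto simp: I_def)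
  obtain R where R: "\<And>t. s (\<lambda>i. A i + t *s B i) = poly R t" using section_on_curve[OF s inX] by blast
  have "s (lift r p (?x t) l) = (\<Prod>k\<in>I. if poly (c k) t = 0 then 1 else poly (c k) t powi (- cf D k)) * poly R t" for t
  proof -
    \<comment> \<open>Where \<open>c\<^sub>i\<close> vanishes, \<open>x\<close> is \<open>p\<^sub>i\<close> and the lift already has the coordinate \<open>l\<close>.\<close>
    define C where "C i = (if i \<in> I \<and> poly (c i) t \<noteq> 0 then poly (c i) t else 1)" for i
    have I0: "0 \<notin> I" by (auto simp: I_def)
    have "lift r p (?x t) l = (\<lambda>i. C i *s (A i + t *s B i))"
    proof
      fix i
      have "cross (?x t) (p i) \<noteq> 0" if "i \<noteq> 0" "i \<le> r" "i \<notin> I" using notI[of i t] that by (simp add: Suc_le_eq)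
      then show "lift r p (?x t) l i = C i *s (A i + t *s B i)"
        unfolding Y using c(2)[of i t] l(2) I0 by (auto simp: lift_def C_def)
    qed
    then have "s (lift r p (?x t) l) = C 0 powi (\<Sum>i=0..r. cf D i) * (\<Prod>i=1..r. C i powi (- cf D i)) * poly R t"
      using H0_scale[OF s _ inX, of C t] R by (auto simp: C_def)
    also have "C 0 = 1" using I0 by (simp add: C_def)
    also have "(\<Prod>i=1..r. C i powi (- cf D i)) = (\<Prod>i\<in>I. C i powi (- cf D i))"
      by (rule prod.mono_neutral_right) (auto simp: I_def C_def)
    also have "\<dots> = (\<Prod>k\<in>I. if poly (c k) t = 0 then 1 else poly (c k) t powi (- cf D k))"
      by (rule prod.cong) (auto simp: C_def)
    finally show ?thesis by simp
  qed
  then show ?thesis using that[of c R] c unfolding I_def by blast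
qed

text \<open>Up to the torus action every point of the cone is a lift of its image in the plane.\<close>

lemma cone_point:
  assumes y: "y \<in> blowup_cone r p"
    and dist: "\<And>i j. i \<in> {1..r} \<Longrightarrow> j \<in> {1..r} \<Longrightarrow> i \<noteq> j \<Longrightarrow> cross (p i) (p j) \<noteq> 0"
  obtains l c where "l \<noteq> 0" "pair l (y 0) = 0" "\<And>i. c i \<noteq> 0" "y = (\<lambda>i. c i *s lift r p (y 0) l i)"
proof -
  let ?x = "y 0"
  have x: "?x \<noteq> 0" using y by (simp add: blowup_cone_def)
  obtain l where l: "l \<noteq> 0" "pair l ?x = 0" "\<And>i. i \<in> {1..r} \<Longrightarrow> cross ?x (p i) = 0 \<Longrightarrow> y i = l"
  proof (cases "\<exists>i\<in>{1..r}. cross ?x (p i) = 0")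
    case True
    then obtain i where i: "i \<in> {1..r}" "cross ?x (p i) = 0" by blast
    have "j = i" if j: "j \<in> {1..r}" "cross ?x (p j) = 0" for j
    proof (rule ccontr)
      assume "j \<noteq> i"
      obtain c where "p i = c *s ?x" using cross_eq_0D[OF i(2) x] by blast
      moreover obtain c' where "p j = c' *s ?x" using cross_eq_0D[OF j(2) x] by blast
      ultimately show False using dist[OF i(1) j(1)] \<open>j \<noteq> i\<close> by (simp add: cross_simps)
    qed
    moreover have "y i \<noteq> 0" "pair (y i) ?x = 0" using y i(1) by (simp_all add: blowup_cone_def)
    ultimately show ?thesis using that[of "y i"] by blast
  next
    case False
    have "tri ?x ?x ?x = 0" by simp
    then obtain l where "l \<noteq> 0" "pair l ?x = 0" by (rule tri_zero_imp_line)
    then show ?thesis using that False by blast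
  qed
  have "\<exists>c. c \<noteq> 0 \<and> y i = c *s lift r p ?x l i" for i
  proof -
    consider "i = 0" | "i > r" | "i \<in> {1..r}" "cross ?x (p i) = 0" | "i \<in> {1..r}" "cross ?x (p i) \<noteq> 0" by force
    then show ?thesis
    proof cases
      case 1 then show ?thesis by (intro exI[of _ 1]) (simp add: lift_def)
    next
      case 2 then show ?thesis using y by (intro exI[of _ 1]) (simp add: lift_def blowup_cone_def)
    next
      case 3 then show ?thesis using l(3) by (intro exI[of _ 1]) (simp add: lift_def)
    next
      case 4
      have "pair (y i) ?x = 0" "pair (y i) (p i) = 0" "y i \<noteq> 0" using y 4(1) by (auto simp: blowup_cone_def)
      then obtain c where "y i = c *s cross ?x (p i)" using cross_parallel 4(2) by metis
      then show ?thesis using 4 \<open>y i \<noteq> 0\<close> by (intro exI[of _ c]) (auto simp: lift_def)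
    qed
  qed
  then obtain c where "\<And>i. c i \<noteq> 0" "\<And>i. y i = c i *s lift r p ?x l i" by metis
  then show ?thesis using that[of l c] l by blast
qed

context points begin

abbreviation X where "X \<equiv> blowup_cone r p"

text \<open>The points outside the exceptional locus.\<close>

definition generic :: "'a^3 \<Rightarrow> bool" where
  "generic x \<longleftrightarrow> x \<noteq> 0 \<and> (\<forall>i\<in>{1..r}. cross x (p i) \<noteq> 0)"

lemma cross_p: assumes "i \<in> {1..r}" "j \<in> {1..r}" "i \<noteq> j" shows "cross (p i) (p j) \<noteq> 0"
proof
  assume c: "cross (p i) (p j) = 0"
  have "card {i, j} < card {1..r}" using r6 assms by simp
  then have "{1..r} - {i, j} \<noteq> {}" by (metis Diff_eq_empty_iff card_mono finite.emptyI finite.insertI leD)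
  then obtain k where "k \<in> {1..r}" "k \<noteq> i" "k \<noteq> j" by blast
  then have "tri (p i) (p j) (p k) \<noteq> 0" using assms by (intro tri_nz) auto
  then show False using c by (simp add: tri_def pair_simps)
qed

lemma p_nz: assumes "i \<in> {1..r}" shows "p i \<noteq> 0"
proof
  assume "p i = 0"
  moreover obtain j where "j \<in> {1..r}" "j \<noteq> i" using r6 by (metis atLeastAtMost_iff le_trans one_le_numeral order_refl numeral_le_iff num.distinct(1) one_eq_numeral_iff le_num_One_iff)
  ultimately show False using cross_p[of i j] assms by (simp add: cross_simps)
qed

lemma generic_cofinite:
  assumes "cross a b \<noteq> 0"
  shows "finite {t. \<not> generic (a + t *s b)}"
proof -
  have "finite {t. cross (a + t *s b) (p i) = 0}" if i: "i \<in> {1..r}" for i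
  proof -
    have "t = t'" if tt: "cross (a + t *s b) (p i) = 0" "cross (a + t' *s b) (p i) = 0" for t t'
    proof -
      obtain c where c1: "p i = c *s (a + t *s b)" using cross_eq_0D[OF tt(1) line_nonzero[OF assms]] by blast
      obtain c' where c2: "p i = c' *s (a + t' *s b)" using cross_eq_0D[OF tt(2) line_nonzero[OF assms]] by blast
      note c = c1 c2
      then have "c \<noteq> 0" using p_nz[OF i] by auto
      have "cross (p i) (p i) = (c * c') *s cross (a + t *s b) (a + t' *s b)"
        by (subst c(1), subst c(2)) (simp only: cross_simps(2,3) vector_smult_assoc mult.commute)
      moreover have "c' \<noteq> 0" using c p_nz[OF i] by auto
      ultimately have "cross (a + t *s b) (1 *s a + t' *s b) = 0" using \<open>c \<noteq> 0\<close>
        by (simp add: cross_simps(1) vector_mul_eq_0)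
      then show ?thesis using assms unfolding cross_line by (simp add: vector_mul_eq_0)
    qed
    then have "\<exists>u. {t. cross (a + t *s b) (p i) = 0} \<subseteq> {u}" by blast
    then show ?thesis using finite_subset by blast
  qed
  then have "finite (\<Union>i\<in>{1..r}. {t. cross (a + t *s b) (p i) = 0})" by blast
  moreover have "{t. \<not> generic (a + t *s b)} \<subseteq> (\<Union>i\<in>{1..r}. {t. cross (a + t *s b) (p i) = 0})"
    using line_nonzero[OF assms] by (auto simp: generic_def)
  ultimately show ?thesis by (rule finite_subset[rotated])
qed

text \<open>A section is determined by its values over the complement of the exceptional curves: join a special
  point to generic ones along a line in the prescribed direction and use \<open>section_on_line\<close>.\<close>

lemma section_density:
  assumes s: "s \<in> H0 r p D" and z: "\<And>x l. generic x \<Longrightarrow> l \<noteq> 0 \<Longrightarrow> pair l x = 0 \<Longrightarrow> s (lift r p x l) = 0"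
  shows "s = 0"
proof
  fix y
  show "s y = 0 y"
  proof (cases "y \<in> X")
    case True
    obtain l c where l: "l \<noteq> 0" "pair l (y 0) = 0" "\<And>i. c i \<noteq> 0" "y = (\<lambda>i. c i *s lift r p (y 0) l i)"
      by (rule cone_point[OF True]) (use cross_p in blast)+
    have y0: "y 0 \<noteq> 0" using True by (simp add: blowup_cone_def)
    obtain b where b: "cross (y 0) b = l" using cross_solve[OF y0 l(2)] by blast
    obtain R c' where c': "\<And>k. k \<in> {1..r} \<Longrightarrow> pair l (p k) = 0 \<Longrightarrow> c' k \<noteq> 0 \<and> (\<forall>t. cross (y 0 + t *s b) (p k) = poly (c' k) t *s l)"
      and R: "\<And>t. s (lift r p (y 0 + t *s b) l) =
      (\<Prod>k\<in>{k\<in>{1..r}. pair l (p k) = 0}. if poly (c' k) t = 0 then 1 else poly (c' k) t powi (- cf D k)) * poly R t"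
      by (rule section_on_line[OF s b l(1), OF p_nz]) blast+
    have "R = 0"
    proof (rule poly_eqI_cofinite)
      have "poly R t = 0" if "generic (y 0 + t *s b)" for t
      proof -
        have "s (lift r p (y 0 + t *s b) l) = 0" using z[OF that l(1)] pair_cross_line[of "y 0" b t] unfolding b .
        moreover have "(\<Prod>k\<in>{k\<in>{1..r}. pair l (p k) = 0}. if poly (c' k) t = 0 then 1 else poly (c' k) t powi (- cf D k)) \<noteq> 0"
        proof -
          have h: "(if u = 0 then 1 else u powi n) \<noteq> (0::'a)" for u :: 'a and n by simp
          have fin: "finite {k\<in>{1..r}. pair l (p k) = 0}" by simp
          show ?thesis unfolding prod_zero_iff[OF fin] using h by blast
        qed
        ultimately show ?thesis unfolding R[of t] mult_eq_0_iff by blast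
      qed
      then have "{t. poly R t \<noteq> poly 0 t} \<subseteq> {t. \<not> generic (y 0 + t *s b)}" by auto
      then show "finite {t. poly R t \<noteq> poly 0 t}" using generic_cofinite[of "y 0" b] b l(1) finite_subset by blast
    qed
    then have "s (lift r p (y 0) l) = 0" using R[of 0] by simp
    moreover have "lift r p (y 0) l \<in> X" by (rule lift_in_cone[OF y0 l(1,2)])
    ultimately show ?thesis using H0_scale[OF s, of c "lift r p (y 0) l"] l(3) by (subst l(4)) simp
  next
    case False then show ?thesis using H0_outside[OF s] by simp
  qed
qed

end

section \<open>Sections as plane curves\<close>

context points begin

text \<open>This is 0 or 1: it is 0 where \<open>x\<close> is proportional to one of the points with a negative coefficient in \<open>D\<close>, at which
  the plane curve of a section of \<open>D\<close> must vanish.\<close>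

definition point_factor :: "pic \<Rightarrow> 'a^3 \<Rightarrow> 'a" where
  "point_factor D x = (\<Prod>k\<in>{1..r}. if cross x (p k) = 0 then 0 ^ nat (- cf D k) else 1)"

lemma point_factor_nz: "point_factor D x \<noteq> 0 \<Longrightarrow> k \<in> {1..r} \<Longrightarrow> cross x (p k) = 0 \<Longrightarrow> cf D k \<ge> 0"
proof (rule ccontr)
  assume a: "point_factor D x \<noteq> 0" "k \<in> {1..r}" "cross x (p k) = 0" "\<not> cf D k \<ge> 0"
  then have "(if cross x (p k) = 0 then 0 ^ nat (- cf D k) else (1::'a)) = 0" by simp
  then have "point_factor D x = 0" unfolding point_factor_def using a(2) by (intro prod_zero) blast+
  then show False using a(1) by simp
qed

text \<open>The plane curve of a section, as a function on all of the affine cone over the plane.\<close>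

definition ext :: "pic \<Rightarrow> ((nat \<Rightarrow> 'a^3) \<Rightarrow> 'a) \<Rightarrow> 'a^3 \<Rightarrow> 'a" where
  "ext D s x = point_factor D x * s (lift r p x (SOME l. l \<noteq> 0 \<and> pair l x = 0))"

lemma orthogonal_exists: "\<exists>l. l \<noteq> 0 \<and> pair l (x :: 'a^3) = 0"
proof -
  have "tri x x x = 0" by simp
  then obtain l where "l \<noteq> 0" "pair l x = 0" by (rule tri_zero_imp_line)
  then show ?thesis by blast
qed

lemma lift_line_scale:
  assumes s: "s \<in> H0 r p D" and x: "x \<noteq> 0" and l: "l \<noteq> 0" "pair l x = 0" and c: "c \<noteq> 0"
    and D: "\<And>k. k \<in> {1..r} \<Longrightarrow> cross x (p k) = 0 \<Longrightarrow> cf D k = 0"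
  shows "s (lift r p x (c *s l)) = s (lift r p x l)"
proof -
  define C where "C i = (if i \<in> {1..r} \<and> cross x (p i) = 0 then c else 1)" for i
  have "lift r p x (c *s l) = (\<lambda>i. C i *s lift r p x l i)" by (rule ext) (auto simp: lift_def C_def)
  moreover have "C i \<noteq> 0" for i using c by (simp add: C_def)
  ultimately have "s (lift r p x (c *s l)) = C 0 powi (\<Sum>i=0..r. cf D i) * (\<Prod>i=1..r. C i powi (- cf D i)) * s (lift r p x l)"
    using H0_scale[OF s _ lift_in_cone[OF x l], of C] by simp
  also have "(\<Prod>i=1..r. C i powi (- cf D i)) = 1" by (rule prod.neutral) (use D in \<open>auto simp: C_def\<close>)
  finally show ?thesis by (simp add: C_def)
qed

lemma lift_line_poly:
  assumes s: "s \<in> H0 r p D" and x: "x \<noteq> 0" and l: "pair l x = 0" "pair l' x = 0" "cross l l' \<noteq> 0"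
  obtains R where "\<And>t. s (lift r p x (l + t *s l')) = poly R t"
proof -
  define A where "A = lift r p x l"
  define B where "B i = (if i \<in> {1..r} \<and> cross x (p i) = 0 then l' else 0)" for i
  have e: "lift r p x (l + t *s l') = (\<lambda>i. A i + t *s B i)" for t
    by (rule ext) (auto simp: lift_def A_def B_def)
  have inX: "(\<lambda>i. A i + t *s B i) \<in> X" for t
    unfolding e[symmetric] by (rule lift_in_cone[OF x line_nonzero[OF l(3)]]) (simp add: pair_simps l)
  then obtain R where "\<And>t. s (\<lambda>i. A i + t *s B i) = poly R t" using section_on_curve[OF s inX] by blast
  then show ?thesis using that e by simp
qed

text \<open>If \<open>D\<close> does not meet \<open>E\<^sub>k\<close>, a section of \<open>D\<close> is constant along \<open>E\<^sub>k\<close>. Indeed, it is a polynomial of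
  degree 0 on the pencil of directions.\<close>

lemma lift_line_indep:
  assumes s: "s \<in> H0 r p D" and x: "x \<noteq> 0" and l: "l \<noteq> 0" "pair l x = 0" and l': "l' \<noteq> 0" "pair l' x = 0"
    and D: "\<And>k. k \<in> {1..r} \<Longrightarrow> cross x (p k) = 0 \<Longrightarrow> cf D k = 0"
  shows "s (lift r p x l) = s (lift r p x l')"
proof (cases "cross l l' = 0")
  case True
  then obtain c where c: "l' = c *s l" using cross_eq_0D[OF _ l(1)] by blast
  then have "c \<noteq> 0" using l'(1) by auto
  then show ?thesis unfolding c using lift_line_scale[OF s x l _ D] by simp
next
  case False
  have *: "\<exists>R. degree R \<le> 0 \<and> (\<forall>t. s (lift r p x (l + t *s l')) = poly R t)"
    if ll: "pair l x = 0" "pair l' x = 0" "cross l l' \<noteq> 0" for l l'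
  proof -
    obtain R where R: "\<And>t. s (lift r p x (l + t *s l')) = poly R t" using lift_line_poly[OF s x ll] by blast
    have ll': "cross l' l \<noteq> 0"
    proof
      assume "cross l' l = 0"
      then have "cross l l' = 0" by (auto simp: cross_def vec_eq_iff forall_3 vector_3 algebra_simps)
      then show False using ll(3) by simp
    qed
    obtain S where S: "\<And>t. s (lift r p x (l' + t *s l)) = poly S t" using lift_line_poly[OF s x ll(2,1) ll'] by blast
    have "poly R t = t ^ 0 * poly S (inverse t)" if t: "t \<noteq> 0" for t
    proof -
      have e: "l + t *s l' = t *s (l' + inverse t *s l)" using t by (simp add: vec_eq_iff field_simps)
      have "s (lift r p x (t *s (l' + inverse t *s l))) = s (lift r p x (l' + inverse t *s l))"
        by (rule lift_line_scale[OF s x line_nonzero[OF ll'] _ t D]) (simp_all add: pair_simps ll)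
      then show ?thesis unfolding R[symmetric] S[symmetric] e by simp
    qed
    then show ?thesis using R degree_le_of_homogeneous[of R 0 S] by blast
  qed
  obtain R where R: "degree R \<le> 0" "\<And>t. s (lift r p x (l + t *s l')) = poly R t" using *[OF l(2) l'(2) False] by blast
  have ll': "cross l' l \<noteq> 0"
  proof
    assume "cross l' l = 0"
    then have "cross l l' = 0" by (auto simp: cross_def vec_eq_iff forall_3 vector_3 algebra_simps)
    then show False using False by simp
  qed
  obtain S where S: "degree S \<le> 0" "\<And>t. s (lift r p x (l' + t *s l)) = poly S t" using *[OF l'(2) l(2) ll'] by blast
  obtain c where c: "R = [:c:]" using R(1) by (auto elim: degree_eq_zeroE)
  obtain c' where c': "S = [:c':]" using S(1) by (auto elim: degree_eq_zeroE)
  have "c = c'" using R(2)[of 1] S(2)[of 1] c c' by (simp add: add.commute)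
  then show ?thesis using R(2)[of 0] S(2)[of 0] c c' by simp
qed

lemma ext_eq:
  assumes s: "s \<in> H0 r p D" and x: "x \<noteq> 0" and l: "l \<noteq> 0" "pair l x = 0"
    and D: "\<And>k. k \<in> {1..r} \<Longrightarrow> cf D k \<le> 0"
  shows "ext D s x = point_factor D x * s (lift r p x l)"
proof (cases "point_factor D x = 0")
  case False
  note some = someI_ex[OF orthogonal_exists[of x]]
  have "cf D k = 0" if "k \<in> {1..r}" "cross x (p k) = 0" for k
    using point_factor_nz[OF False that] D[OF that(1)] by simp
  then show ?thesis unfolding ext_def using lift_line_indep[OF s x conjunct1[OF some] conjunct2[OF some] l] by simp
qed (simp add: ext_def)

lemma ext_generic:
  assumes s: "s \<in> H0 r p D" and x: "generic x" and l: "l \<noteq> 0" "pair l x = 0"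
    and D: "\<And>k. k \<in> {1..r} \<Longrightarrow> cf D k \<le> 0"
  shows "s (lift r p x l) = ext D s x"
proof -
  have "point_factor D x = 1" unfolding point_factor_def by (rule prod.neutral) (use x in \<open>auto simp: generic_def\<close>)
  then show ?thesis using ext_eq[OF s _ l D] x by (simp add: generic_def)
qed

lemma ext_0: "s \<in> H0 r p D \<Longrightarrow> ext D s 0 = 0"
  using H0_outside[of s r p D] by (simp add: ext_def blowup_cone_def lift_def)

lemma prod_powi: "finite A \<Longrightarrow> (c::'a) \<noteq> 0 \<Longrightarrow> (\<Prod>i\<in>A. c powi f i) = c powi (\<Sum>i\<in>A. f i)"
  by (induction A rule: finite_induct) (auto simp: power_int_add)

lemma ext_homogeneous:
  assumes s: "s \<in> H0 r p D" and D: "\<And>k. k \<in> {1..r} \<Longrightarrow> cf D k \<le> 0" "cf D 0 \<ge> 0" and c: "c \<noteq> 0"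
  shows "ext D s (c *s x) = c ^ nat (cf D 0) * ext D s x"
proof (cases "x = 0")
  case True then show ?thesis using ext_0[OF s] by simp
next
  case False
  obtain l where l: "l \<noteq> 0" "pair l x = 0" using orthogonal_exists by blast
  have pfe: "point_factor D (c *s x) = point_factor D x"
    unfolding point_factor_def using c by (simp add: cross_simps vector_mul_eq_0)
  have "ext D s (c *s x) = point_factor D x * s (lift r p (c *s x) l)"
    using ext_eq[OF s _ l(1) _ D(1), of "c *s x"] False c l pfe by (simp add: pair_simps vector_mul_eq_0)
  also have "\<dots> = point_factor D x * (c ^ nat (cf D 0) * s (lift r p x l))"
  proof (cases "point_factor D x = 0")
    case nz: False
    have D0: "cf D k = 0" if "k \<in> {1..r}" "cross x (p k) = 0" for k
      using point_factor_nz[OF nz that] D(1)[OF that(1)] by simp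
    define C where "C i = (if i \<in> {1..r} \<and> cross x (p i) = 0 then 1 else c)" for i
    have "lift r p (c *s x) l = (\<lambda>i. C i *s lift r p x l i)"
      using c by (intro ext) (auto simp: lift_def C_def cross_simps vector_mul_eq_0)
    moreover have "C i \<noteq> 0" for i using c by (simp add: C_def)
    ultimately have "s (lift r p (c *s x) l) = C 0 powi (\<Sum>i=0..r. cf D i) * (\<Prod>i=1..r. C i powi (- cf D i)) * s (lift r p x l)"
      using H0_scale[OF s _ lift_in_cone[OF False l], of C] by simp
    also have "(\<Prod>i=1..r. C i powi (- cf D i)) = (\<Prod>i=1..r. c powi (- cf D i))"
      by (rule prod.cong) (use D0 in \<open>auto simp: C_def\<close>)
    also have "\<dots> = c powi (\<Sum>i=1..r. - cf D i)" using c by (intro prod_powi) auto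
    also have "C 0 = c" by (simp add: C_def)
    also have "c powi (\<Sum>i=0..r. cf D i) * c powi (\<Sum>i=1..r. - cf D i) = c powi ((\<Sum>i=0..r. cf D i) + (\<Sum>i=1..r. - cf D i))"
      using c by (simp add: power_int_add)
    also have "(\<Sum>i=0..r. cf D i) + (\<Sum>i=1..r. - cf D i) = cf D 0"
      by (simp add: sum.atLeast_Suc_atMost[of 0 r] sum_negf)
    also have "c powi cf D 0 = c ^ nat (cf D 0)" using D(2) by (simp add: power_int_def)
    finally show ?thesis by simp
  qed simp
  finally show ?thesis using ext_eq[OF s False l(1,2) D(1)] by simp
qed

text \<open>The factor \<open>c\<^sub>k ^ (- cf D k)\<close> accounts for the order of vanishing at \<open>p\<^sub>k\<close>.\<close>

lemma ext_line:
  assumes s: "s \<in> H0 r p D" and D: "\<And>k. k \<in> {1..r} \<Longrightarrow> cf D k \<le> 0" and ab: "cross a b \<noteq> 0"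
  obtains R c where
    "\<And>k t. k \<in> {1..r} \<Longrightarrow> pair (cross a b) (p k) = 0 \<Longrightarrow> cross (a + t *s b) (p k) = poly (c k) t *s cross a b"
    "\<And>t. ext D s (a + t *s b) = (\<Prod>k\<in>{k\<in>{1..r}. pair (cross a b) (p k) = 0}. poly (c k) t ^ nat (- cf D k)) * poly R t"
proof -
  let ?l = "cross a b" and ?x = "\<lambda>t. a + t *s b" and ?I = "{k\<in>{1..r}. pair (cross a b) (p k) = 0}"
  obtain R c where c: "\<And>k. k \<in> {1..r} \<Longrightarrow> pair ?l (p k) = 0 \<Longrightarrow> c k \<noteq> 0 \<and> (\<forall>t. cross (a + t *s b) (p k) = poly (c k) t *s ?l)"
    and R: "\<And>t. s (lift r p (?x t) ?l) = (\<Prod>k\<in>?I. if poly (c k) t = 0 then 1 else poly (c k) t powi (- cf D k)) * poly R t"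
    by (rule section_on_line[OF s refl ab, OF p_nz]) blast+
  have "ext D s (?x t) = (\<Prod>k\<in>?I. poly (c k) t ^ nat (- cf D k)) * poly R t" for t
  proof -
    have nz: "?x t \<noteq> 0" using line_nonzero[OF ab] .
    have "point_factor D (?x t) = (\<Prod>k\<in>?I. if cross (?x t) (p k) = 0 then 0 ^ nat (- cf D k) else 1)"
      unfolding point_factor_def
    proof (rule prod.mono_neutral_right)
      show "\<forall>i\<in>{1..r} - ?I. (if cross (?x t) (p i) = 0 then 0 ^ nat (- cf D i) else (1::'a)) = 1"
      proof
        fix i assume i: "i \<in> {1..r} - ?I"
        have "cross (?x t) (p i) \<noteq> 0"
        proof
          assume "cross (?x t) (p i) = 0"
          then obtain e where e: "p i = e *s ?x t" using cross_eq_0D[OF _ nz] by blast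
          have "pair ?l (p i) = 0" unfolding e pair_simps(2) by (simp add: pair_cross_line)
          then show False using i by blast
        qed
        then show "(if cross (?x t) (p i) = 0 then 0 ^ nat (- cf D i) else (1::'a)) = 1" by simp
      qed
    qed auto
    then have "ext D s (?x t) = (\<Prod>k\<in>?I. (if cross (?x t) (p k) = 0 then 0 ^ nat (- cf D k) else 1)
        * (if poly (c k) t = 0 then 1 else poly (c k) t powi (- cf D k))) * poly R t"
      using ext_eq[OF s nz ab pair_cross_line D] R[of t] by (simp add: prod.distrib mult.assoc)
    also have "(\<Prod>k\<in>?I. (if cross (?x t) (p k) = 0 then 0 ^ nat (- cf D k) else 1)
        * (if poly (c k) t = 0 then 1 else poly (c k) t powi (- cf D k))) = (\<Prod>k\<in>?I. poly (c k) t ^ nat (- cf D k))"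
    proof (rule prod.cong)
      fix k assume k: "k \<in> ?I"
      then have "cross (?x t) (p k) = poly (c k) t *s ?l" using c by blast
      then have "cross (?x t) (p k) = 0 \<longleftrightarrow> poly (c k) t = 0" using ab by (simp add: vector_mul_eq_0)
      moreover have "- cf D k \<ge> 0" using D k by simp
      ultimately show "(if cross (?x t) (p k) = 0 then 0 ^ nat (- cf D k) else 1)
        * (if poly (c k) t = 0 then 1 else poly (c k) t powi (- cf D k)) = poly (c k) t ^ nat (- cf D k)"
        by (auto simp: power_int_def)
    qed simp
    finally show ?thesis .
  qed
  then show ?thesis using that[of c R] c by blast
qed

lemma ext_form:
  assumes s: "s \<in> H0 r p D" and D: "\<And>k. k \<in> {1..r} \<Longrightarrow> cf D k \<le> 0" "cf D 0 > 0"
  shows "ternary_form (nat (cf D 0)) (ext D s)"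
proof (rule form_of_lines)
  have hom: "ext D s (c *s x) = c ^ nat (cf D 0) * ext D s x" for c x
    using ext_homogeneous[OF s D(1), of c x] D(2) ext_0[OF s] by (cases "c = 0") auto
  then show "ext D s (c *s x) = c ^ nat (cf D 0) * ext D s x" for c x .
  fix a v
  show "\<exists>R. \<forall>t. ext D s (a + t *s v) = poly R t"
  proof (cases "cross a v = 0")
    case False
    obtain R c where "\<And>t. ext D s (a + t *s v) = (\<Prod>k\<in>{k\<in>{1..r}. pair (cross a v) (p k) = 0}. poly (c k) t ^ nat (- cf D k)) * poly R t"
      by (rule ext_line[OF s D(1) False]) blast+
    then show ?thesis by (intro exI[of _ "(\<Prod>k\<in>{k\<in>{1..r}. pair (cross a v) (p k) = 0}. c k ^ nat (- cf D k)) * R"])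
        (simp add: poly_prod)
  next
    case True
    show ?thesis
    proof (cases "v = 0")
      case True then show ?thesis by (intro exI[of _ "[:ext D s a:]"]) simp
    next
      case nz: False
      have "cross v a = 0" using True by (auto simp: cross_def vec_eq_iff forall_3 vector_3 algebra_simps)
      then obtain \<alpha> where \<alpha>: "a = \<alpha> *s v" using cross_eq_0D[OF _ nz] by blast
      have "\<alpha> *s v + t *s v = (\<alpha> + t) *s v" for t by (simp add: vec_eq_iff algebra_simps)
      then have "ext D s (a + t *s v) = (\<alpha> + t) ^ nat (cf D 0) * ext D s v" for t
        unfolding \<alpha> by (simp only: hom)
      then show ?thesis by (intro exI[of _ "smult (ext D s v) ([:\<alpha>, 1:] ^ nat (cf D 0))"]) (simp add: mult.commute)
    qed
  qed
qed

lemma ext_vanish: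
  assumes "k \<in> {1..r}" "cf D k < 0"
  shows "ext D s (p k) = 0"
proof -
  have "point_factor D (p k) = 0" using point_factor_nz[of D "p k" k] assms by (auto simp: cross_simps)
  then show ?thesis by (simp add: ext_def)
qed

lemma ext_double:
  assumes s: "s \<in> H0 r p D" and D: "\<And>k. k \<in> {1..r} \<Longrightarrow> cf D k \<le> 0" "cf D 0 > 0" and k: "k \<in> {1..r}" "cf D k = - 2"
  shows "double_at (ext D s) (p k)"
  unfolding double_at_def
proof
  fix v
  show "\<exists>R. \<forall>t. ext D s (p k + t *s v) = t\<^sup>2 * poly R t"
  proof (cases "cross (p k) v = 0")
    case False
    let ?I = "{i\<in>{1..r}. pair (cross (p k) v) (p i) = 0}"
    obtain R c where c: "\<And>i t. i \<in> {1..r} \<Longrightarrow> pair (cross (p k) v) (p i) = 0 \<Longrightarrow> cross (p k + t *s v) (p i) = poly (c i) t *s cross (p k) v"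
      and R: "\<And>t. ext D s (p k + t *s v) = (\<Prod>i\<in>?I. poly (c i) t ^ nat (- cf D i)) * poly R t"
      by (rule ext_line[OF s D(1) False]) blast+
    have ckt: "poly (c k) t = - t" for t
    proof -
      have "poly (c k) t *s cross (p k) v = (- t) *s cross (p k) v"
        using c[OF k(1), of t] cross_line[of "p k" t v 1 0] by simp
      then show ?thesis using False by (simp only: vector_mul_rcancel) simp
    qed
    have kI: "k \<in> ?I" using k by simp
    have "ext D s (p k + t *s v) = t\<^sup>2 * poly ((\<Prod>i\<in>?I - {k}. c i ^ nat (- cf D i)) * R) t" for t
      unfolding R using prod.remove[OF _ kI, of "\<lambda>i. poly (c i) t ^ nat (- cf D i)"] k(2)
      by (simp add: poly_prod ckt)
    then show ?thesis by blast
  next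
    case True
    then obtain e where e: "v = e *s p k" using cross_eq_0D[OF _ p_nz[OF k(1)]] by blast
    have z: "ext D s (p k) = 0" using ext_vanish k by simp
    have "ext D s (p k + t *s v) = 0" for t
    proof -
      have "p k + t *s v = (1 + t * e) *s p k" unfolding e by (simp add: vec_eq_iff algebra_simps)
      then show ?thesis using z ext_homogeneous[OF s D(1), of "1 + t * e" "p k"] D(2) ext_0[OF s]
        by (cases "1 + t * e = 0") auto
    qed
    then show ?thesis by (intro exI[of _ 0]) simp
  qed
qed

text \<open>A section of \<open>dH - \<Sum> n\<^sub>k E\<^sub>k\<close> with \<open>d > 0\<close>, \<open>n\<^sub>k \<ge> 0\<close> is a plane curve of degree \<open>d\<close> that
  passes through the \<open>p\<^sub>k\<close> with multiplicity \<open>n\<^sub>k\<close>, as far as multiplicities one and two are concerned.\<close>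

lemma section_form:
  assumes s: "s \<in> H0 r p D" "s \<noteq> 0" and D: "\<And>k. k \<in> {1..r} \<Longrightarrow> cf D k \<le> 0" "cf D 0 > 0"
  obtains g where "ternary_form (nat (cf D 0)) g" "\<And>k. k \<in> {1..r} \<Longrightarrow> cf D k < 0 \<Longrightarrow> g (p k) = 0"
    "\<And>k. k \<in> {1..r} \<Longrightarrow> cf D k = -2 \<Longrightarrow> double_at g (p k)"
    "\<exists>z. g z \<noteq> 0" "\<And>x l. generic x \<Longrightarrow> l \<noteq> 0 \<Longrightarrow> pair l x = 0 \<Longrightarrow> s (lift r p x l) = g x"
proof (rule that[of "ext D s"])
  show "\<exists>z. ext D s z \<noteq> 0"
  proof (rule ccontr)
    assume z: "\<not> (\<exists>z. ext D s z \<noteq> 0)"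
    have "s = 0"
    proof (rule section_density[OF s(1)])
      fix x l assume "generic x" "l \<noteq> 0" "pair l x = 0"
      from ext_generic[OF s(1) this D(1)] show "s (lift r p x l) = 0" using z by simp
    qed
    then show False using s(2) by simp
  qed
qed (use ext_form[OF s(1) D] ext_vanish ext_double[OF s(1) D] ext_generic[OF s(1) _ _ _ D(1)] in auto)

end

lemma regular_mult:
  assumes "regular_on C Y s" "regular_on C Y s'"
  shows "regular_on C Y (\<lambda>y. s y * s' y)"
  unfolding regular_on_def
proof
  fix y assume y: "y \<in> Y"
  obtain P Q where PQ: "P \<in> polyfun C" "Q \<in> polyfun C" "Q y \<noteq> 0" "\<forall>z\<in>Y. Q z \<noteq> 0 \<longrightarrow> s z = P z / Q z"
    using assms(1)[unfolded regular_on_def, rule_format, OF y] by blast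
  obtain P' Q' where PQ': "P' \<in> polyfun C" "Q' \<in> polyfun C" "Q' y \<noteq> 0" "\<forall>z\<in>Y. Q' z \<noteq> 0 \<longrightarrow> s' z = P' z / Q' z"
    using assms(2)[unfolded regular_on_def, rule_format, OF y] by blast
  show "\<exists>P\<in>polyfun C. \<exists>Q\<in>polyfun C. Q y \<noteq> 0 \<and> (\<forall>z\<in>Y. Q z \<noteq> 0 \<longrightarrow> s z * s' z = P z / Q z)"
    by (intro bexI[OF _ polyfun_mult[OF PQ(1) PQ'(1)]] bexI[OF _ polyfun_mult[OF PQ(2) PQ'(2)]])
      (simp add: PQ(3,4) PQ'(3,4))
qed

lemma regular_add:
  assumes "regular_on C Y s" "regular_on C Y s'"
  shows "regular_on C Y (\<lambda>y. s y + s' y)"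
  unfolding regular_on_def
proof
  fix y assume y: "y \<in> Y"
  obtain P Q where PQ: "P \<in> polyfun C" "Q \<in> polyfun C" "Q y \<noteq> 0" "\<forall>z\<in>Y. Q z \<noteq> 0 \<longrightarrow> s z = P z / Q z"
    using assms(1)[unfolded regular_on_def, rule_format, OF y] by blast
  obtain P' Q' where PQ': "P' \<in> polyfun C" "Q' \<in> polyfun C" "Q' y \<noteq> 0" "\<forall>z\<in>Y. Q' z \<noteq> 0 \<longrightarrow> s' z = P' z / Q' z"
    using assms(2)[unfolded regular_on_def, rule_format, OF y] by blast
  show "\<exists>P\<in>polyfun C. \<exists>Q\<in>polyfun C. Q y \<noteq> 0 \<and> (\<forall>z\<in>Y. Q z \<noteq> 0 \<longrightarrow> s z + s' z = P z / Q z)"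
    by (intro bexI[OF _ polyfun_add[OF polyfun_mult[OF PQ(1) PQ'(2)] polyfun_mult[OF PQ'(1) PQ(2)]]]
         bexI[OF _ polyfun_mult[OF PQ(2) PQ'(2)]])
      (simp add: PQ(3,4) PQ'(3,4) add_frac_eq)
qed

lemma regular_polyfun: "f \<in> polyfun C \<Longrightarrow> (\<And>y. y \<in> Y \<Longrightarrow> s y = f y) \<Longrightarrow> regular_on C Y s"
  unfolding regular_on_def by (intro ballI bexI[of _ f] bexI[OF _ polyfun_const[of 1]]) auto

lemma H0_mult:
  assumes s: "s \<in> H0 r p A" and s': "s' \<in> H0 r p B"
  shows "(\<lambda>y. s y * s' y) \<in> H0 r p (A + B)"
proof -
  have "s (\<lambda>i. c i *s y i) * s' (\<lambda>i. c i *s y i) = c 0 powi (\<Sum>i=0..r. cf (A + B) i) * (\<Prod>i=1..r. c i powi (- cf (A + B) i)) * (s y * s' y)"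
    if y: "y \<in> blowup_cone r p" and c: "\<forall>i. c i \<noteq> 0" for y c
  proof -
    have "(\<Prod>i=1..r. c i powi (- cf (A + B) i)) = (\<Prod>i=1..r. c i powi (- cf A i)) * (\<Prod>i=1..r. c i powi (- cf B i))"
      unfolding prod.distrib[symmetric] using c power_int_add[of "c _"] by (intro prod.cong) (simp_all add: lookup_add flip: power_int_add)
    moreover have "c 0 powi (\<Sum>i=0..r. cf (A + B) i) = c 0 powi (\<Sum>i=0..r. cf A i) * c 0 powi (\<Sum>i=0..r. cf B i)"
      using c by (simp add: lookup_add sum.distrib power_int_add)
    ultimately show ?thesis using H0_scale[OF s _ y, of c] H0_scale[OF s' _ y, of c] c by simp
  qed
  then show ?thesis using s s' unfolding H0_def by (auto intro: regular_mult)
qed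

lemma H0_add:
  assumes s: "s \<in> H0 r p A" and s': "s' \<in> H0 r p A"
  shows "(\<lambda>y. s y + s' y) \<in> H0 r p A"
  using assms unfolding H0_def by (auto intro: regular_add simp: distrib_left)

lemma H0_const: "(\<lambda>y. if y \<in> blowup_cone r p then c else 0) \<in> H0 r p 0"
proof -
  have "regular_on cone_coords (blowup_cone r p) (\<lambda>y. if y \<in> blowup_cone r p then c else 0)"
    by (rule regular_polyfun[OF polyfun_const[of c]]) simp
  moreover have "(\<lambda>i. d i *s y i) \<in> blowup_cone r p" if "y \<in> blowup_cone r p" "\<forall>i. d i \<noteq> 0" for y d
    using that by (auto simp: blowup_cone_def pair_simps vector_mul_eq_0)
  ultimately show ?thesis by (auto simp: H0_def)
qed

lemma H0_zero: "(0 :: (nat \<Rightarrow> 'a::field^3) \<Rightarrow> 'a) \<in> H0 r p D"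
proof -
  have "regular_on cone_coords (blowup_cone r p) (0 :: (nat \<Rightarrow> 'a^3) \<Rightarrow> 'a)"
    by (rule regular_polyfun[OF polyfun_const[of 0]]) simp
  then show ?thesis by (auto simp: H0_def)
qed

section \<open>Homogeneous quadrics on the spectrum of the Cox ring\<close>

text \<open>Quadratic polynomials in the generators all of whose terms have the same degree \<open>D\<close> in the Picard
  group.\<close>

inductive quad_rel :: "nat \<Rightarrow> pic \<Rightarrow> ((pic \<Rightarrow> 'a::field) \<Rightarrow> 'a) \<Rightarrow> bool" for r D where
  quad_term: "A \<in> neg_curves r \<Longrightarrow> B \<in> neg_curves r \<Longrightarrow> A + B = D \<Longrightarrow> quad_rel r D (\<lambda>\<xi>. c * (\<xi> A * \<xi> B))"
| quad_add: "quad_rel r D Q \<Longrightarrow> quad_rel r D Q' \<Longrightarrow> quad_rel r D (\<lambda>\<xi>. Q \<xi> + Q' \<xi>)"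

text \<open>The classes other than the exceptional curves are those of plane curves.\<close>

lemma neg_curve_cases:
  assumes "E \<in> neg_curves r"
  obtains i where "i \<in> {1..r}" "E = exc i" | "cf E 0 > 0" "\<And>k. k \<noteq> 0 \<Longrightarrow> cf E k \<le> 0"
proof -
  have fA: "finite A \<and> 0 \<notin> A" if "A \<subseteq> {1..r}" for A using that by (auto intro: finite_subset)
  consider "E \<in> exc ` {1..r}" | d A where "A \<subseteq> {1..r}" "E = hyp d - exc_sum A" "d > 0"
    | A i where "A \<subseteq> {1..r}" "E = hyp 3 - exc_sum A - exc i" "i \<in> A"
    using assms unfolding neg_curves_def by force
  then show ?thesis
  proof cases
    case 1 then show ?thesis using that(1) by blast
  next
    case (2 d A)
    then show ?thesis using that(2) fA[OF 2(1)] by (simp add: lookup_class)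
  next
    case (3 A i)
    then have "i \<noteq> 0" using fA by metis
    with 3 show ?thesis using that(2) fA[OF 3(1)] by (simp add: lookup_class)
  qed
qed

lemma Pic_add: "A \<in> Pic r \<Longrightarrow> B \<in> Pic r \<Longrightarrow> A + B \<in> Pic r"
  using keys_add[of A B] unfolding Pic_def by blast

lemma Pic_diff: "A \<in> Pic r \<Longrightarrow> B \<in> Pic r \<Longrightarrow> A - B \<in> Pic r"
  unfolding Pic_def using keys_diff[of A B] by blast

lemma Pic_exc_sum: "A \<subseteq> {1..r} \<Longrightarrow> exc_sum A \<in> Pic r"
proof -
  assume A: "A \<subseteq> {1..r}"
  then have "finite A" using finite_subset by blast
  then show ?thesis using A unfolding Pic_def by (auto simp: in_keys_iff lookup_exc_sum split: if_splits)
qed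

lemma neg_curves_Pic: "neg_curves r \<subseteq> Pic r"
proof
  fix E assume E: "E \<in> neg_curves r"
  have h: "hyp d \<in> Pic r" for d by (auto simp: Pic_def in_keys_iff lookup_hyp split: if_splits)
  have e: "exc i \<in> Pic r" if "i \<in> {1..r}" for i
    using that by (auto simp: Pic_def in_keys_iff exc_def lookup_single when_def split: if_splits)
  show "E \<in> Pic r" using E unfolding neg_curves_def by (auto intro!: Pic_diff Pic_exc_sum h e)
qed

locale sections = points +
  fixes s :: "pic \<Rightarrow> (nat \<Rightarrow> 'a^3) \<Rightarrow> 'a"
  assumes sc: "section_choice r p s"
begin

lemma s_H0: "E \<in> neg_curves r \<Longrightarrow> s E \<in> H0 r p E" and s_nz: "E \<in> neg_curves r \<Longrightarrow> s E \<noteq> 0"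
  using sc unfolding section_choice_def by blast+

lemma generic_on_line:
  assumes "i \<in> {1..r}" "j \<in> {1..r}" "i \<noteq> j" "\<tau> \<noteq> 0"
  shows "generic (p i + \<tau> *s p j)"
  unfolding generic_def
proof (intro conjI ballI)
  show "p i + \<tau> *s p j \<noteq> 0" by (rule line_nonzero[OF cross_p[OF assms(1-3)]])
  fix k assume k: "k \<in> {1..r}"
  show "cross (p i + \<tau> *s p j) (p k) \<noteq> 0"
  proof
    assume z: "cross (p i + \<tau> *s p j) (p k) = 0"
    consider "k = i" | "k = j" | "k \<noteq> i" "k \<noteq> j" by blast
    then show False
    proof cases
      case 1
      then have "\<tau> *s cross (p j) (p i) = 0" using z by (simp add: cross_simps)
      then show False using cross_p[of j i] assms by (simp add: vector_mul_eq_0)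
    next
      case 2
      then show False using z cross_p[of i j] assms by (simp add: cross_simps)
    next
      case 3
      have "tri (p i + \<tau> *s p j) (p k) (p j) = 0" using z by (simp add: tri_def pair_simps)
      moreover have "tri (p i + \<tau> *s p j) (p k) (p j) = tri (p i) (p k) (p j)"
        by (simp add: tri_expand algebra_simps)
      ultimately show False using tri_nz[of i k j] assms k 3 by metis
    qed
  qed
qed

text \<open>The section of \<open>E\<^sub>i\<close> is not the section of a plane curve. Multiplied by the coordinate of \<open>E\<^sub>i\<close> in the
  direction of another point \<open>p\<^sub>j\<close>, it becomes a section of \<open>H\<close>, thus a line, and this line is the one
  through \<open>p\<^sub>i\<close> and \<open>p\<^sub>j\<close>. Hence the quotient is a constant off that line; comparison of two choices
  of \<open>j\<close> removes the exception.\<close>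

lemma exc_section_constant:
  assumes i: "i \<in> {1..r}"
  obtains c where "c \<noteq> 0" "\<And>x l. generic x \<Longrightarrow> l \<noteq> 0 \<Longrightarrow> pair l x = 0 \<Longrightarrow> s (exc i) (lift r p x l) = c"
proof -
  have E: "exc i \<in> neg_curves r" using i unfolding neg_curves_def by blast
  have coef: "\<exists>c. \<forall>x l. generic x \<longrightarrow> l \<noteq> 0 \<longrightarrow> pair l x = 0 \<longrightarrow> tri (p i) (p j) x \<noteq> 0 \<longrightarrow> s (exc i) (lift r p x l) = c"
    if j: "j \<in> {1..r}" "j \<noteq> i" for j
  proof -
    define \<sigma> :: "(nat \<Rightarrow> 'a^3) \<Rightarrow> 'a" where "\<sigma> y = (if y \<in> X then pair (y i) (p j) else 0)" for y
    have "\<sigma> \<in> H0 r p (hyp 1 - exc i)"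
    proof -
      have "(\<lambda>y. \<Sum>k\<in>UNIV. y i $ k * p j $ k) \<in> polyfun cone_coords"
      proof -
        have c: "(\<lambda>y. y i $ k * p j $ k) \<in> polyfun cone_coords" for k
          by (rule polyfun_mult[OF polyfun_coord polyfun_const]) (auto simp: cone_coords_def)
        show ?thesis unfolding sum_3 by (intro polyfun_add c)
      qed
      then have "regular_on cone_coords X \<sigma>" by (rule regular_polyfun) (simp add: \<sigma>_def pair_def)
      moreover have "\<sigma> (\<lambda>k. c k *s y k) = c 0 powi (\<Sum>k=0..r. cf (hyp 1 - exc i) k) *
          (\<Prod>k=1..r. c k powi (- cf (hyp 1 - exc i) k)) * \<sigma> y" if y: "y \<in> X" and c: "\<forall>k. c k \<noteq> 0" for y c
      proof -
        have "(\<lambda>k. c k *s y k) \<in> X" using y c by (auto simp: blowup_cone_def pair_simps vector_mul_eq_0)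
        then have "\<sigma> (\<lambda>k. c k *s y k) = c i * \<sigma> y" using y by (simp add: \<sigma>_def pair_simps)
        moreover have "(\<Sum>k=0..r. cf (hyp 1 - exc i) k) = 0"
        proof -
          have "(\<Sum>k=0..r. cf (hyp 1 - exc i) k) = (\<Sum>k=0..r. if k = 0 then 1 else 0) - (\<Sum>k=0..r. if k = i then 1 else 0)"
            unfolding sum_subtractf[symmetric] by (rule sum.cong) (auto simp: lookup_class)
          then show ?thesis using i by simp
        qed
        moreover have "(\<Prod>k=1..r. c k powi (- cf (hyp 1 - exc i) k)) = (\<Prod>k=1..r. if k = i then c i else 1)"
          by (rule prod.cong) (auto simp: lookup_class)
        ultimately show ?thesis using i by simp
      qed
      ultimately show ?thesis unfolding H0_def by (auto simp: \<sigma>_def)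
    qed
    from H0_mult[OF s_H0[OF E] this] have H: "(\<lambda>y. s (exc i) y * \<sigma> y) \<in> H0 r p (hyp 1)" by simp
    define g where "g = ext (hyp 1) (\<lambda>y. s (exc i) y * \<sigma> y)"
    have D: "cf (hyp 1) k \<le> 0" if "k \<in> {1..r}" for k using that by (simp add: lookup_hyp)
    have g1: "ternary_form 1 g" using ext_form[OF H D] by (simp add: g_def lookup_hyp)
    have eq: "s (exc i) (lift r p x l) * tri x (p i) (p j) = g x" if x: "generic x" "l \<noteq> 0" "pair l x = 0" for x l
    proof -
      have "\<sigma> (lift r p x l) = tri x (p i) (p j)"
        using x i lift_in_cone[of x l r p] by (auto simp: \<sigma>_def lift_def generic_def tri_def)
      then show ?thesis using ext_generic[OF H x D] by (simp add: g_def)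
    qed
    have z: "g (p i + \<tau> *s p j) = 0" if "\<tau> \<noteq> 0" for \<tau>
    proof -
      obtain l where "l \<noteq> 0" "pair l (p i + \<tau> *s p j) = 0" using orthogonal_exists by blast
      moreover have "tri (p i + \<tau> *s p j) (p i) (p j) = 0" by (simp add: tri_expand algebra_simps)
      ultimately show ?thesis using eq[OF generic_on_line[OF i j(1) j(2)[symmetric] that]] by auto
    qed
    have lin: "g (p i + \<tau> *s p j) = g (p i) + \<tau> * g (p j)" for \<tau>
      using form1_basis[OF g1, of 1 "p i" \<tau> "p j" 0 0] by simp
    have "g (p i) + g (p j) = 0" "g (p i) + 2 * g (p j) = 0" using z[of 1] z[of 2] lin[of 1] lin[of 2] by simp_all
    then have "g (p j) = 0" by algebra
    moreover have "g (p i) = 0" using z[of 1] lin[of 1] calculation by simp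
    moreover obtain w where w: "tri (p i) (p j) w \<noteq> 0"
    proof -
      have "card {i, j} < card {1..r}" using r6 i j by simp
      then have "{1..r} - {i, j} \<noteq> {}" by (metis Diff_eq_empty_iff card_mono finite.emptyI finite.insertI leD)
      then obtain k where "k \<in> {1..r}" "k \<noteq> i" "k \<noteq> j" by blast
      then show ?thesis using that tri_nz[of i j k] i j by auto
    qed
    ultimately have gx: "g x = g w / tri (p i) (p j) w * tri (p i) (p j) x" for x
      using line_unique[OF g1 _ _ form_tri(1)[of "p i" "p j"], of i j w x] i j by simp
    show ?thesis
    proof (intro exI allI impI)
      fix x l assume x: "generic x" "l \<noteq> 0" "pair l x = 0" and nz: "tri (p i) (p j) x \<noteq> 0"
      have "tri x (p i) (p j) = tri (p i) (p j) x" by (simp add: tri_expand algebra_simps)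
      then have "s (exc i) (lift r p x l) * tri (p i) (p j) x = g w / tri (p i) (p j) w * tri (p i) (p j) x"
        using eq[OF x] gx[of x] by simp
      then show "s (exc i) (lift r p x l) = g w / tri (p i) (p j) w" by (rule mult_right_cancel[OF nz, THEN iffD1])
    qed
  qed
  obtain j where j: "j \<in> {1..r}" "j \<noteq> i"
  proof -
    have "card {i} < card {1..r}" using r6 i by simp
    then have "{1..r} - {i} \<noteq> {}" by (metis Diff_eq_empty_iff card_mono finite.emptyI finite.insertI leD)
    then show ?thesis using that by blast
  qed
  obtain m where m: "m \<in> {1..r}" "m \<noteq> i" "m \<noteq> j"
  proof -
    have "card {i, j} < card {1..r}" using r6 i j by simp
    then have "{1..r} - {i, j} \<noteq> {}" by (metis Diff_eq_empty_iff card_mono finite.emptyI finite.insertI leD)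
    then show ?thesis using that by blast
  qed
  obtain c where c: "\<And>x l. generic x \<Longrightarrow> l \<noteq> 0 \<Longrightarrow> pair l x = 0 \<Longrightarrow> tri (p i) (p j) x \<noteq> 0 \<Longrightarrow> s (exc i) (lift r p x l) = c"
    using coef[OF j] by blast
  obtain c' where c': "\<And>x l. generic x \<Longrightarrow> l \<noteq> 0 \<Longrightarrow> pair l x = 0 \<Longrightarrow> tri (p i) (p m) x \<noteq> 0 \<Longrightarrow> s (exc i) (lift r p x l) = c'"
    using coef[OF m(1,2)] by blast
  have nz: "tri (p i) (p j) (p m) \<noteq> 0" using tri_nz i j m by metis
  have "c = c'"
  proof -
    \<comment> \<open>A generic point off both exceptional lines.\<close>
    let ?x = "p j + 1 *s p m"
    have "generic ?x" using generic_on_line[OF j(1) m(1) m(3)[symmetric], of 1] by simp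
    moreover obtain l where "l \<noteq> 0" "pair l ?x = 0" using orthogonal_exists by blast
    moreover have "tri (p i) (p j) ?x = tri (p i) (p j) (p m)" "tri (p i) (p m) ?x = - tri (p i) (p j) (p m)"
      by (simp_all add: tri_expand algebra_simps)
    ultimately show ?thesis using c[of ?x l] c'[of ?x l] nz by simp
  qed
  have all: "s (exc i) (lift r p x l) = c" if x: "generic x" "l \<noteq> 0" "pair l x = 0" for x l
  proof (cases "tri (p i) (p j) x = 0 \<and> tri (p i) (p m) x = 0")
    case True
    then have t: "tri (p i) (p j) x = 0" "tri (p i) x (p m) = 0" using tri_rotate(3)[of "p i" x "p m"] by simp_all
    have "x = (tri x (p j) (p m) / tri (p i) (p j) (p m)) *s p i"
      by (subst tri_basis[OF nz, of x]) (simp add: t)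
    then have "cross x (p i) = 0" by (metis cross_simps(1,2) vector_smult_rzero)
    then show ?thesis using x(1) i by (auto simp: generic_def)
  next
    case False
    then show ?thesis using c[OF x] c'[OF x] \<open>c = c'\<close> by auto
  qed
  have "c \<noteq> 0"
  proof
    assume "c = 0"
    then have "s (exc i) = 0" using section_density[OF s_H0[OF E]] all by auto
    then show False using s_nz[OF E] by simp
  qed
  then show ?thesis using that all by blast
qed

text \<open>The plane curve of the generator of \<open>E\<close>. For \<open>E = E\<^sub>i\<close> it is a nonzero constant, and the vanishing
  conditions are void.\<close>

definition curve_form :: "pic \<Rightarrow> ('a^3 \<Rightarrow> 'a) \<Rightarrow> bool" where
  "curve_form E g \<longleftrightarrow> ternary_form (nat (cf E 0)) g \<and> (\<forall>k\<in>{1..r}. cf E k < 0 \<longrightarrow> g (p k) = 0) \<and>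
     (\<forall>k\<in>{1..r}. cf E k = -2 \<longrightarrow> double_at g (p k)) \<and> (\<exists>z. g z \<noteq> 0) \<and>
     (\<forall>x l. generic x \<longrightarrow> l \<noteq> 0 \<longrightarrow> pair l x = 0 \<longrightarrow> s E (lift r p x l) = g x)"

lemma curve_form_exists: assumes E: "E \<in> neg_curves r" shows "\<exists>g. curve_form E g"
  using E
proof (cases rule: neg_curve_cases)
  case (1 i)
  obtain c where c: "c \<noteq> 0" "\<And>x l. generic x \<Longrightarrow> l \<noteq> 0 \<Longrightarrow> pair l x = 0 \<Longrightarrow> s (exc i) (lift r p x l) = c"
    using exc_section_constant[OF 1(1)] by blast
  have "cf E 0 = 0" "\<not> cf E k < 0" "cf E k \<noteq> -2" for k using 1 by (auto simp: lookup_class)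
  then show ?thesis using c 1(2) unfolding curve_form_def
    by (intro exI[of _ "\<lambda>_. c"]) (simp add: form_const)
next
  case 2
  have D: "cf E k \<le> 0" if "k \<in> {1..r}" for k using 2(2) that by simp
  obtain g where "ternary_form (nat (cf E 0)) g" "\<And>k. k \<in> {1..r} \<Longrightarrow> cf E k < 0 \<Longrightarrow> g (p k) = 0"
    "\<And>k. k \<in> {1..r} \<Longrightarrow> cf E k = -2 \<Longrightarrow> double_at g (p k)"
    "\<exists>z. g z \<noteq> 0" "\<And>x l. generic x \<Longrightarrow> l \<noteq> 0 \<Longrightarrow> pair l x = 0 \<Longrightarrow> s E (lift r p x l) = g x"
    by (rule section_form[OF s_H0[OF E] s_nz[OF E] D 2(1)]) blast+
  then show ?thesis unfolding curve_form_def by blast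
qed

definition G :: "pic \<Rightarrow> 'a^3 \<Rightarrow> 'a" where "G E = (SOME g. curve_form E g)"

lemma G: "E \<in> neg_curves r \<Longrightarrow> curve_form E (G E)"
  unfolding G_def by (rule someI_ex[OF curve_form_exists])

lemma cox_single: "D \<in> Pic r \<Longrightarrow> \<sigma> \<in> H0 r p D \<Longrightarrow> Poly_Mapping.single D \<sigma> \<in> Cox r p"
  unfolding Cox_def using H0_zero[of r p] by (auto simp: lookup_single when_def)

lemma cox_const_mult: "\<sigma> \<in> H0 r p D \<Longrightarrow> cox_const r p c * Poly_Mapping.single D \<sigma> = Poly_Mapping.single D (\<lambda>y. c * \<sigma> y)"
  unfolding cox_const_def mult_single
  by (rule arg_cong2[where f = Poly_Mapping.single]) (auto simp: fun_eq_iff H0_outside)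

lemma cox_const_in: "cox_const r p c \<in> Cox r p"
  unfolding cox_const_def by (intro cox_single H0_const) (simp add: Pic_def)

text \<open>Being homogeneous, the quadric evaluated at the rescaled generators is the image of a single section
  of degree \<open>D\<close>. That section vanishes at general points and hence is zero by \<open>section_density\<close>, so a
  homomorphism from the Cox ring maps it to zero.\<close>

lemma quad_transfer:
  assumes Q: "quad_rel r D Q" and \<phi>: "\<phi> \<in> cox_points r p"
    and gen: "\<And>x. generic x \<Longrightarrow> Q (\<lambda>E. f E * G E x) = 0"
    and \<xi>: "\<And>E. E \<in> neg_curves r \<Longrightarrow> \<xi> E = f E * \<phi> (Poly_Mapping.single E (s E))"
  shows "Q \<xi> = 0"
proof -
  have phi: "\<phi> (cox_const r p c) = c" "\<And>F G. F \<in> Cox r p \<Longrightarrow> G \<in> Cox r p \<Longrightarrow> \<phi> (F + G) = \<phi> F + \<phi> G"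
    "\<And>F G. F \<in> Cox r p \<Longrightarrow> G \<in> Cox r p \<Longrightarrow> \<phi> (F * G) = \<phi> F * \<phi> G" for c
    using \<phi> unfolding cox_points_def by blast+
  have "D \<in> Pic r \<and> (\<exists>\<sigma>\<in>H0 r p D. \<phi> (Poly_Mapping.single D \<sigma>) = Q \<xi> \<and>
      (\<forall>x l. generic x \<longrightarrow> l \<noteq> 0 \<longrightarrow> pair l x = 0 \<longrightarrow> \<sigma> (lift r p x l) = Q (\<lambda>E. f E * G E x)))"
    using Q
  proof induction
    case (quad_term A B c)
    let ?A = "Poly_Mapping.single A (s A)" and ?B = "Poly_Mapping.single B (s B)"
    let ?\<sigma> = "\<lambda>y. s A y * s B y"
    have pic: "A \<in> Pic r" "B \<in> Pic r" "D \<in> Pic r" using quad_term neg_curves_Pic Pic_add by blast+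
    have H: "?\<sigma> \<in> H0 r p D" using H0_mult[OF s_H0 s_H0] quad_term by blast
    have c0: "cox_const r p (c * f A * f B) * Poly_Mapping.single D ?\<sigma> = Poly_Mapping.single D (\<lambda>y. c * f A * f B * ?\<sigma> y)"
      by (rule cox_const_mult[OF H])
    have AB: "?A * ?B = Poly_Mapping.single D ?\<sigma>" unfolding mult_single quad_term(3)
      by (rule arg_cong2[where f = Poly_Mapping.single]) (auto simp: fun_eq_iff)
    have "\<phi> (Poly_Mapping.single D (\<lambda>y. c * f A * f B * ?\<sigma> y)) = c * f A * f B * (\<phi> ?A * \<phi> ?B)"
      unfolding c0[symmetric] using phi(3)[OF cox_const_in cox_single[OF pic(3) H]]
        phi(3)[OF cox_single[OF pic(1) s_H0[OF quad_term(1)]] cox_single[OF pic(2) s_H0[OF quad_term(2)]]]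
      by (simp add: phi(1) AB)
    moreover have "(\<lambda>y. c * f A * f B * ?\<sigma> y) \<in> H0 r p D"
    proof -
      have "(\<lambda>y. c * f A * f B * ?\<sigma> y) = (\<lambda>y. (if y \<in> X then c * f A * f B else 0) * ?\<sigma> y)"
        using H0_outside[OF H] by (auto simp: fun_eq_iff)
      then show ?thesis using H0_mult[OF H0_const H, of "c * f A * f B"] by simp
    qed
    moreover have "c * f A * f B * (\<phi> ?A * \<phi> ?B) = c * (\<xi> A * \<xi> B)"
      using \<xi> quad_term(1,2) by simp
    moreover have "\<forall>x l. generic x \<longrightarrow> l \<noteq> 0 \<longrightarrow> pair l x = 0 \<longrightarrow>
        c * f A * f B * ?\<sigma> (lift r p x l) = c * (f A * G A x * (f B * G B x))"
      using G[OF quad_term(1)] G[OF quad_term(2)] unfolding curve_form_def by simp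
    ultimately show ?case using pic(3) by auto
  next
    case (quad_add Q Q')
    from quad_add.IH(1) obtain \<sigma> where \<sigma>: "\<sigma> \<in> H0 r p D" "\<phi> (Poly_Mapping.single D \<sigma>) = Q \<xi>"
       "\<forall>x l. generic x \<longrightarrow> l \<noteq> 0 \<longrightarrow> pair l x = 0 \<longrightarrow> \<sigma> (lift r p x l) = Q (\<lambda>E. f E * G E x)"
       and pic: "D \<in> Pic r" by blast
    from quad_add.IH(2) obtain \<sigma>' where \<sigma>': "\<sigma>' \<in> H0 r p D" "\<phi> (Poly_Mapping.single D \<sigma>') = Q' \<xi>"
       "\<forall>x l. generic x \<longrightarrow> l \<noteq> 0 \<longrightarrow> pair l x = 0 \<longrightarrow> \<sigma>' (lift r p x l) = Q' (\<lambda>E. f E * G E x)" by blast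
    have "Poly_Mapping.single D (\<lambda>y. \<sigma> y + \<sigma>' y) = Poly_Mapping.single D \<sigma> + Poly_Mapping.single D \<sigma>'"
      unfolding single_add[symmetric] by (rule arg_cong2[where f = Poly_Mapping.single]) (auto simp: fun_eq_iff)
    then have "\<phi> (Poly_Mapping.single D (\<lambda>y. \<sigma> y + \<sigma>' y)) = Q \<xi> + Q' \<xi>"
      using phi(2)[OF cox_single[OF pic \<sigma>(1)] cox_single[OF pic \<sigma>'(1)]] \<sigma>(2) \<sigma>'(2) by simp
    then show ?case using pic H0_add[OF \<sigma>(1) \<sigma>'(1)] \<sigma>(3) \<sigma>'(3) by (intro conjI bexI[of _ "\<lambda>y. \<sigma> y + \<sigma>' y"]) auto
  qed
  then obtain \<sigma> where \<sigma>: "\<sigma> \<in> H0 r p D" "\<phi> (Poly_Mapping.single D \<sigma>) = Q \<xi>"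
       "\<And>x l. generic x \<Longrightarrow> l \<noteq> 0 \<Longrightarrow> pair l x = 0 \<Longrightarrow> \<sigma> (lift r p x l) = Q (\<lambda>E. f E * G E x)" by blast
  have "\<sigma> = 0" using section_density[OF \<sigma>(1)] \<sigma>(3) gen by simp
  moreover have "\<phi> 0 = 0"
  proof -
    have "cox_const r p 0 = 0" unfolding cox_const_def by (simp add: zero_fun_def[symmetric])
    then show ?thesis using phi(1)[of 0] by simp
  qed
  ultimately show ?thesis using \<sigma>(2) by simp
qed

end

section \<open>Rational families of factors\<close>

lemma polyfun_prod: "(\<And>i. i \<in> A \<Longrightarrow> f i \<in> polyfun C) \<Longrightarrow> (\<lambda>y. \<Prod>i\<in>A. f i y) \<in> polyfun C"
proof (induction A rule: infinite_finite_induct)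
  case (insert i A) then show ?case using polyfun_mult[of "f i" C "\<lambda>y. \<Prod>i\<in>A. f i y"] by simp
qed (simp_all add: polyfun_const)

lemma polyfun_power: "f \<in> polyfun C \<Longrightarrow> (\<lambda>y. f y ^ n) \<in> polyfun C"
  by (induction n) (auto intro: polyfun_const polyfun_mult)

lemma polyfun_affine_line:
  assumes "P \<in> polyfun (affine_coords T)"
  obtains R where "\<And>\<tau>. P (\<lambda>i. t i + \<tau> * (t' i - t i)) = poly R \<tau>"
proof -
  have "\<exists>R. \<forall>\<tau>. P (\<lambda>i. t i + \<tau> * (t' i - t i)) = poly R \<tau>"
    using assms
  proof induction
    case (polyfun_const c) then show ?case by (intro exI[of _ "[:c:]"]) simp
  next
    case (polyfun_coord f)
    then obtain i where "f = (\<lambda>t. t i)" unfolding affine_coords_def by blast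
    then show ?case by (intro exI[of _ "[:t i, t' i - t i:]"]) simp
  next
    case (polyfun_add f g)
    then obtain P Q where "\<forall>\<tau>. f (\<lambda>i. t i + \<tau> * (t' i - t i)) = poly P \<tau>" "\<forall>\<tau>. g (\<lambda>i. t i + \<tau> * (t' i - t i)) = poly Q \<tau>" by blast
    then show ?case by (intro exI[of _ "P + Q"]) simp
  next
    case (polyfun_mult f g)
    then obtain P Q where "\<forall>\<tau>. f (\<lambda>i. t i + \<tau> * (t' i - t i)) = poly P \<tau>" "\<forall>\<tau>. g (\<lambda>i. t i + \<tau> * (t' i - t i)) = poly Q \<tau>" by blast
    then show ?case by (intro exI[of _ "P * Q"]) simp
  qed
  then show ?thesis using that by blast
qed

text \<open>On the line joining the two points where they do not vanish, both functions are nonzero polynomials in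
  one variable.\<close>

lemma polyfun_no_zero_divisors:
  fixes P :: "('i \<Rightarrow> 'a::field_char_0) \<Rightarrow> 'a"
  assumes "P \<in> polyfun (affine_coords T)" "Q \<in> polyfun (affine_coords T)" "P t \<noteq> 0" "Q t' \<noteq> 0"
  obtains u where "P u \<noteq> 0" "Q u \<noteq> 0"
proof -
  obtain R where R: "\<And>\<tau>. P (\<lambda>i. t i + \<tau> * (t' i - t i)) = poly R \<tau>" using polyfun_affine_line[OF assms(1)] by blast
  obtain S where S: "\<And>\<tau>. Q (\<lambda>i. t i + \<tau> * (t' i - t i)) = poly S \<tau>" using polyfun_affine_line[OF assms(2)] by blast
  have "R \<noteq> 0" using R[of 0] assms(3) by auto
  moreover have "S \<noteq> 0" using S[of 1] assms(4) by auto
  ultimately have "R * S \<noteq> 0" by simp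
  then obtain \<tau> where "poly (R * S) \<tau> \<noteq> 0" using poly_all_0_iff_0 by blast
  then show ?thesis using that[of "\<lambda>i. t i + \<tau> * (t' i - t i)"] R S by simp
qed

lemma polyfun_common_nonzero:
  fixes P :: "'k \<Rightarrow> ('i \<Rightarrow> 'a::field_char_0) \<Rightarrow> 'a"
  assumes "finite K" "\<And>k. k \<in> K \<Longrightarrow> P k \<in> polyfun (affine_coords T)" "\<And>k. k \<in> K \<Longrightarrow> \<exists>t. P k t \<noteq> 0"
  shows "\<exists>t. (\<Prod>k\<in>K. P k t) \<noteq> 0"
  using assms
proof (induction K rule: finite_induct)
  case (insert k K)
  then obtain t where t: "(\<Prod>k\<in>K. P k t) \<noteq> 0" by auto
  obtain t' where t': "P k t' \<noteq> 0" using insert by blast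
  have "(\<lambda>t. \<Prod>k\<in>K. P k t) \<in> polyfun (affine_coords T)" using insert by (intro polyfun_prod) auto
  moreover have "P k \<in> polyfun (affine_coords T)" using insert by blast
  ultimately obtain u where "(\<Prod>k\<in>K. P k u) \<noteq> 0" "P k u \<noteq> 0" using polyfun_no_zero_divisors t t' by blast
  then show ?case using insert by (intro exI[of _ u]) simp
qed simp

lemma polyfun_restrict: "P \<in> polyfun (affine_coords T) \<Longrightarrow> P (restrict t T) = P t"
  by (induction rule: polyfun.induct) (auto simp: affine_coords_def)

text \<open>Rational functions whose only denominators are powers of \<open>\<delta>\<close>. Values where \<open>\<delta>\<close> vanishes are left
  free.\<close>

definition ratfun :: "'i set \<Rightarrow> (('i \<Rightarrow> 'a::field) \<Rightarrow> 'a) \<Rightarrow> (('i \<Rightarrow> 'a) \<Rightarrow> 'a) \<Rightarrow> bool" where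
  "ratfun T \<delta> g \<longleftrightarrow> \<delta> \<in> polyfun (affine_coords T) \<and>
     (\<exists>P\<in>polyfun (affine_coords T). \<exists>N. \<forall>t. \<delta> t \<noteq> 0 \<longrightarrow> g t = P t / \<delta> t ^ N)"

lemma ratfunI:
  "\<delta> \<in> polyfun (affine_coords T) \<Longrightarrow> P \<in> polyfun (affine_coords T) \<Longrightarrow> (\<And>t. \<delta> t \<noteq> 0 \<Longrightarrow> g t = P t / \<delta> t ^ N) \<Longrightarrow> ratfun T \<delta> g"
  unfolding ratfun_def by blast

lemma ratfun_polyfun: "\<delta> \<in> polyfun (affine_coords T) \<Longrightarrow> P \<in> polyfun (affine_coords T) \<Longrightarrow> ratfun T \<delta> P"
  unfolding ratfun_def by (intro conjI bexI[of _ P] exI[of _ 0]) auto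

lemma ratfun_const: "\<delta> \<in> polyfun (affine_coords T) \<Longrightarrow> ratfun T \<delta> (\<lambda>_. c)"
  by (rule ratfun_polyfun) (auto intro: polyfun_const)

lemma ratfun_coord: "\<delta> \<in> polyfun (affine_coords T) \<Longrightarrow> i \<in> T \<Longrightarrow> ratfun T \<delta> (\<lambda>t. t i)"
  by (rule ratfun_polyfun) (auto intro!: polyfun_coord simp: affine_coords_def)

lemma ratfun_add:
  assumes "ratfun T \<delta> f" "ratfun T \<delta> g" shows "ratfun T \<delta> (\<lambda>t. f t + g t)"
proof -
  obtain P N where P: "P \<in> polyfun (affine_coords T)" "\<forall>t. \<delta> t \<noteq> 0 \<longrightarrow> f t = P t / \<delta> t ^ N"
    using assms(1) unfolding ratfun_def by blast
  obtain Q M where Q: "Q \<in> polyfun (affine_coords T)" "\<forall>t. \<delta> t \<noteq> 0 \<longrightarrow> g t = Q t / \<delta> t ^ M"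
    using assms(2) unfolding ratfun_def by blast
  have d: "\<delta> \<in> polyfun (affine_coords T)" using assms(1) unfolding ratfun_def by blast
  have "(\<lambda>t. P t * \<delta> t ^ M + Q t * \<delta> t ^ N) \<in> polyfun (affine_coords T)"
    by (intro polyfun_add polyfun_mult polyfun_power P Q d)
  then show ?thesis
    by (rule ratfunI[OF d, where N = "N + M"]) (use P(2) Q(2) in \<open>simp add: add_frac_eq power_add\<close>)
qed

lemma ratfun_mult:
  assumes "ratfun T \<delta> f" "ratfun T \<delta> g" shows "ratfun T \<delta> (\<lambda>t. f t * g t)"
proof -
  obtain P N where P: "P \<in> polyfun (affine_coords T)" "\<forall>t. \<delta> t \<noteq> 0 \<longrightarrow> f t = P t / \<delta> t ^ N"
    using assms(1) unfolding ratfun_def by blast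
  obtain Q M where Q: "Q \<in> polyfun (affine_coords T)" "\<forall>t. \<delta> t \<noteq> 0 \<longrightarrow> g t = Q t / \<delta> t ^ M"
    using assms(2) unfolding ratfun_def by blast
  have d: "\<delta> \<in> polyfun (affine_coords T)" using assms(1) unfolding ratfun_def by blast
  have "(\<lambda>t. P t * Q t) \<in> polyfun (affine_coords T)" by (intro polyfun_mult P Q)
  then show ?thesis
    by (rule ratfunI[OF d, where N = "N + M"]) (use P(2) Q(2) in \<open>simp add: power_add\<close>)
qed

lemma ratfun_minus: "ratfun T \<delta> f \<Longrightarrow> ratfun T \<delta> (\<lambda>t. - f t)"
proof -
  assume f: "ratfun T \<delta> f"
  then have "\<delta> \<in> polyfun (affine_coords T)" unfolding ratfun_def by blast
  then show ?thesis using ratfun_mult[OF ratfun_const[of \<delta> T "-1"] f] by simp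
qed

lemma ratfun_diff: "ratfun T \<delta> f \<Longrightarrow> ratfun T \<delta> g \<Longrightarrow> ratfun T \<delta> (\<lambda>t. f t - g t)"
  using ratfun_add[of T \<delta> f "\<lambda>t. - g t"] ratfun_minus[of T \<delta> g] by simp

lemma ratfun_sum: "\<delta> \<in> polyfun (affine_coords T) \<Longrightarrow> (\<And>i. i \<in> A \<Longrightarrow> ratfun T \<delta> (f i)) \<Longrightarrow> ratfun T \<delta> (\<lambda>t. \<Sum>i\<in>A. f i t)"
proof (induction A rule: infinite_finite_induct)
  case (insert i A) then show ?case using ratfun_add[of T \<delta> "f i" "\<lambda>t. \<Sum>i\<in>A. f i t"] by simp
qed (simp_all add: ratfun_const)

lemma ratfun_divide_const: "ratfun T \<delta> f \<Longrightarrow> ratfun T \<delta> (\<lambda>t. f t / c)"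
proof -
  assume f: "ratfun T \<delta> f"
  then have "\<delta> \<in> polyfun (affine_coords T)" unfolding ratfun_def by blast
  then show ?thesis using ratfun_mult[OF f ratfun_const[of \<delta> T "inverse c"]] by (simp add: divide_inverse)
qed

lemma ratfun_divide_coord:
  assumes "i \<in> T" "j \<in> T" "ratfun T (\<lambda>t. t i * t j) f"
  shows "ratfun T (\<lambda>t. t i * t j) (\<lambda>t. f t / t i)" "ratfun T (\<lambda>t. t i * t j) (\<lambda>t. f t / t j)"
proof -
  let ?d = "\<lambda>t. t i * t j"
  have c: "(\<lambda>t. t k) \<in> polyfun (affine_coords T)" if "k \<in> T" for k
    using that by (auto intro!: polyfun_coord simp: affine_coords_def)
  have d: "?d \<in> polyfun (affine_coords T)" by (intro polyfun_mult c assms)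
  obtain P N where P: "P \<in> polyfun (affine_coords T)" "\<forall>t. ?d t \<noteq> 0 \<longrightarrow> f t = P t / ?d t ^ N"
    using assms(3) unfolding ratfun_def by blast
  have e: "f t / t i = (P t * t j) / ?d t ^ (Suc N)" "f t / t j = (P t * t i) / ?d t ^ (Suc N)" if "?d t \<noteq> 0" for t
    using P(2) that by (simp_all add: field_simps)
  show "ratfun T ?d (\<lambda>t. f t / t i)"
    by (rule ratfunI[OF d polyfun_mult[OF P(1) c[OF assms(2)]]]) (rule e(1))
  show "ratfun T ?d (\<lambda>t. f t / t j)"
    by (rule ratfunI[OF d polyfun_mult[OF P(1) c[OF assms(1)]]]) (rule e(2))
qed

text \<open>The parameters range over the set where neither \<open>\<delta>\<close> nor the numerator of any factor vanishes. It is
  nonempty as soon as no single numerator vanishes identically.\<close>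

lemma parameter_family_of_ratfun:
  fixes f :: "pic \<Rightarrow> (pic \<Rightarrow> 'a::field_char_0) \<Rightarrow> 'a"
  assumes T: "T \<subseteq> neg_curves r" and fin: "finite (neg_curves r)" and f: "\<And>E. E \<in> neg_curves r \<Longrightarrow> ratfun T \<delta> (f E)"
    and fT: "\<And>E t. E \<in> T \<Longrightarrow> f E t = t E"
    and nz: "\<And>E. E \<in> neg_curves r \<Longrightarrow> \<exists>t. \<delta> t \<noteq> 0 \<and> f E t \<noteq> 0" and ne: "neg_curves r \<noteq> {}"
  shows "\<exists>U. parameter_family (card T) r T U (\<lambda>t E. f E t) \<and>
     (\<forall>t\<in>U. \<delta> t \<noteq> 0 \<and> (\<forall>E\<in>neg_curves r. f E t \<noteq> 0))"
proof -
  have d: "\<delta> \<in> polyfun (affine_coords T)" using f ne unfolding ratfun_def by blast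
  have "\<forall>E\<in>neg_curves r. \<exists>P\<in>polyfun (affine_coords T). \<exists>N. \<forall>t. \<delta> t \<noteq> 0 \<longrightarrow> f E t = P t / \<delta> t ^ N"
    using f unfolding ratfun_def by blast
  then obtain P N where P: "\<And>E. E \<in> neg_curves r \<Longrightarrow> P E \<in> polyfun (affine_coords T)"
    "\<And>E t. E \<in> neg_curves r \<Longrightarrow> \<delta> t \<noteq> 0 \<Longrightarrow> f E t = P E t / \<delta> t ^ N E" by metis
  define g where "g t = \<delta> t * (\<Prod>E\<in>neg_curves r. P E t)" for t
  have g: "g \<in> polyfun (affine_coords T)" unfolding g_def[abs_def] by (intro polyfun_mult polyfun_prod d P)
  have "\<exists>t. P E t \<noteq> 0" if "E \<in> neg_curves r" for E
    using nz[OF that] P(2)[OF that] by (metis div_0)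
  then obtain t1 where "(\<Prod>E\<in>neg_curves r. P E t1) \<noteq> 0" using polyfun_common_nonzero[of "neg_curves r" P T] fin P(1) by blast
  moreover have "(\<lambda>t. \<Prod>E\<in>neg_curves r. P E t) \<in> polyfun (affine_coords T)" by (intro polyfun_prod P)
  moreover obtain t2 where "\<delta> t2 \<noteq> 0" using nz ne by blast
  ultimately obtain u where u: "\<delta> u \<noteq> 0" "(\<Prod>E\<in>neg_curves r. P E u) \<noteq> 0" using polyfun_no_zero_divisors[OF d] by blast
  define U where "U = {t \<in> T \<rightarrow>\<^sub>E UNIV. g t \<noteq> 0}"
  have "g (restrict u T) \<noteq> 0" unfolding polyfun_restrict[OF g] using u by (simp add: g_def)
  then have "U \<noteq> {}" unfolding U_def by (auto intro!: exI[of _ "restrict u T"])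
  moreover have "zariski_open T U" unfolding zariski_open_def U_def using g by (intro exI[of _ "{g}"]) auto
  moreover have dU: "\<delta> t \<noteq> 0 \<and> (\<forall>E\<in>neg_curves r. P E t \<noteq> 0)" if "t \<in> U" for t
    using that fin unfolding U_def g_def by (auto simp: prod_zero_iff)
  then have "rational_on T U (f E)" if "E \<in> neg_curves r" for E
    unfolding rational_on_def using P[OF that]
    by (intro bexI[of _ "P E"] bexI[OF _ polyfun_power[OF d, of "N E"]]) auto
  moreover have "finite T" using fin T finite_subset by blast
  ultimately have "parameter_family (card T) r T U (\<lambda>t E. f E t)"
    unfolding parameter_family_def using T fT by auto
  moreover have "f E t \<noteq> 0" if "t \<in> U" "E \<in> neg_curves r" for t E
    using dU[OF that(1)] P(2)[OF that(2)] that(2) by simp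
  ultimately show ?thesis using dU by blast
qed

section \<open>The lines and conics through six of the points\<close>

lemma labelling_sign_unique: "labelling \<sigma> i j k l m n \<Longrightarrow> labelling \<sigma>' i j k l m n \<Longrightarrow> \<sigma> = \<sigma>'"
proof -
  assume "labelling \<sigma> i j k l m n" "labelling \<sigma>' i j k l m n"
  then obtain \<tau> \<tau>' where \<tau>: "\<tau> permutes {1..6}" "\<sigma> = of_int (sign \<tau>)"
     "\<tau> 1 = i" "\<tau> 2 = j" "\<tau> 3 = k" "\<tau> 4 = l" "\<tau> 5 = m" "\<tau> 6 = n"
    and \<tau>': "\<tau>' permutes {1..6}" "\<sigma>' = of_int (sign \<tau>')"
     "\<tau>' 1 = i" "\<tau>' 2 = j" "\<tau>' 3 = k" "\<tau>' 4 = l" "\<tau>' 5 = m" "\<tau>' 6 = n" unfolding labelling_def by blast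
  have "\<tau> q = \<tau>' q" for q
  proof (cases "q \<in> {1..6}")
    case True
    moreover have "{1..6} = {1,2,3,4,5,6::nat}" by auto
    ultimately have "q \<in> {1,2,3,4,5,6}" by blast
    then show ?thesis by (elim insertE emptyE) (simp_all only: \<tau>(3-8) \<tau>'(3-8))
  next
    case False
    show ?thesis using permutes_not_in[OF \<tau>(1) False] permutes_not_in[OF \<tau>'(1) False] by simp
  qed
  then have "\<tau> = \<tau>'" by (rule ext)
  then show ?thesis using \<tau>(2) \<tau>'(2) by simp
qed

text \<open>The signed complementary Pfaffian depends only on \<open>i\<close> and \<open>j\<close>.\<close>

lemma labelling_pf4_unique:
  assumes L: "labelling \<sigma> i j k l m n" and L': "labelling \<sigma>' i j k' l' m' n'" and y: "alternating y"
  shows "\<sigma> * pf4 y k l m n = \<sigma>' * pf4 y k' l' m' (n'::nat) "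
proof -
  have alt: "y j i = - y i j" for i j using y unfolding alternating_def by blast
  note s = labelling_swap
  have d: "i \<noteq> n'" "j \<noteq> n'" "n' \<in> {1..6}" using labelling_distinct[OF L'] labelling_range[OF L'] by auto
  obtain \<sigma>1 k1 l1 m1 where L1: "labelling \<sigma>1 i j k1 l1 m1 n'" and e1: "\<sigma>1 * pf4 y k1 l1 m1 n' = \<sigma> * pf4 y k l m n"
    by (rule labelling_last[OF L d]) (use y in auto)
  have "m' \<in> {i, j, k1, l1, m1, n'}" using labelling_UN[OF L1] labelling_range[OF L'] by auto
  then consider "m' = k1" | "m' = l1" | "m' = m1" using labelling_distinct[OF L'] by auto
  then obtain \<sigma>2 k2 l2 where L2: "labelling \<sigma>2 i j k2 l2 m' n'" and e2: "\<sigma>2 * pf4 y k2 l2 m' n' = \<sigma>1 * pf4 y k1 l1 m1 n'"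
  proof cases
    case 1
    have "labelling \<sigma>1 i j l1 m1 k1 n'" using s(4)[OF s(3)[OF L1]] by simp
    moreover have "pf4 y l1 m1 k1 n' = pf4 y k1 l1 m1 n'"
      unfolding pf4_def alt[of l1 k1] alt[of m1 k1] by (simp add: algebra_simps)
    ultimately show ?thesis using that 1 by metis
  next
    case 2
    have "pf4 y k1 m1 l1 n' = - pf4 y k1 l1 m1 n'"
      unfolding pf4_def alt[of m1 l1] by (simp add: algebra_simps)
    then show ?thesis using that[of "-\<sigma>1" k1 m1] s(4)[OF L1] 2 by simp
  next
    case 3 then show ?thesis using that L1 by metis
  qed
  have "k' \<in> {i, j, k2, l2, m', n'}" "l' \<in> {i, j, k2, l2, m', n'}" using labelling_UN[OF L2] labelling_range[OF L'] by auto
  then have "k' = k2 \<and> l' = l2 \<or> k' = l2 \<and> l' = k2" using labelling_distinct[OF L'] by auto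
  then show ?thesis
  proof
    assume a: "k' = k2 \<and> l' = l2"
    then have "\<sigma>' = \<sigma>2" using labelling_sign_unique[OF L'] L2 by blast
    then show ?thesis using a e1 e2 by simp
  next
    assume a: "k' = l2 \<and> l' = k2"
    then have "\<sigma>' = - \<sigma>2" using labelling_sign_unique[OF L'] s(3)[OF L2] by blast
    moreover have "pf4 y l2 k2 m' n' = - pf4 y k2 l2 m' n'"
      unfolding pf4_def alt[of l2 k2] by (simp add: algebra_simps)
    ultimately show ?thesis using a e1 e2 by simp
  qed
qed

text \<open>The signed Pfaffian of the matrix that is left after deleting the rows and columns \<open>i\<close> and \<open>j\<close>, which
  is the derivative of the Pfaffian with respect to \<open>y\<^sub>i\<^sub>j\<close>.\<close>

definition cofactor :: "(nat \<Rightarrow> nat \<Rightarrow> 'a::field) \<Rightarrow> nat \<Rightarrow> nat \<Rightarrow> 'a" where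
  "cofactor y i j = (SOME v. \<exists>\<sigma> k l m n. labelling \<sigma> i j k l m n \<and> v = \<sigma> * pf4 y k l m n)"

lemma cofactor_eq:
  assumes L: "labelling \<sigma> i j k l m n" and y: "alternating y"
  shows "cofactor y i j = \<sigma> * pf4 y k l m n"
proof -
  have "\<exists>\<sigma> k l m n. labelling \<sigma> i j k l m n \<and> cofactor y i j = \<sigma> * pf4 y k l m n"
    unfolding cofactor_def by (rule someI_ex) (use L in blast)
  then obtain \<sigma>' k' l' m' n' where "labelling \<sigma>' i j k' l' m' n'" "cofactor y i j = \<sigma>' * pf4 y k' l' m' n'" by blast
  then show ?thesis using labelling_pf4_unique[OF _ L y] by simp
qed

lemma cofactor_swap:
  assumes "i \<in> {1..6}" "j \<in> {1..6}" "i \<noteq> j" and y: "alternating y"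
  shows "cofactor y j i = - cofactor y i j"
proof -
  obtain \<sigma> k l m n where L: "labelling (\<sigma>::'a::field) i j k l m n" using labelling_exists assms(1-3) by metis
  show ?thesis unfolding cofactor_eq[OF L y] cofactor_eq[OF labelling_swap(1)[OF L] y] by simp
qed

definition sg :: "nat \<Rightarrow> nat \<Rightarrow> 'a::field" where
  "sg i j = (if i < j then 1 else if j < i then -1 else 0)"

lemma sg_nz: "i \<noteq> j \<Longrightarrow> sg i j \<noteq> 0" and sg_refl: "sg i i = 0"
  by (auto simp: sg_def)

lemma alternating_sg: "(\<And>i j. M i j = M j i) \<Longrightarrow> alternating (\<lambda>i j. sg i j * M i j)"
  unfolding alternating_def by (auto simp: sg_def)

lemma m_class_commute: "m_class i j = m_class j i" and Q7_class_commute: "Q7_class i j = Q7_class j i"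
  by (simp_all add: m_class_def Q7_class_def algebra_simps)

text \<open>The \<open>(-1)\<close>-curves of the four types can be told apart by their coefficients, so a function on classes
  may be prescribed type by type.\<close>

lemma class_function:
  fixes e c :: "nat \<Rightarrow> 'b" and M Q :: "nat \<Rightarrow> nat \<Rightarrow> 'b"
  obtains h :: "pic \<Rightarrow> 'b" where "\<And>i. i \<in> {1..7} \<Longrightarrow> h (exc i) = e i"
    "\<And>i j. i \<in> {1..7} \<Longrightarrow> j \<in> {1..7} \<Longrightarrow> i < j \<Longrightarrow> h (m_class i j) = M i j"
    "\<And>i j. i \<in> {1..7} \<Longrightarrow> j \<in> {1..7} \<Longrightarrow> i < j \<Longrightarrow> h (Q7_class i j) = Q i j"
    "\<And>i. i \<in> {1..7} \<Longrightarrow> h (C_class i) = c i"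
proof -
  define I where "I E v = {k\<in>{1..7}. cf E k = v}" for E v
  define h where "h E = (if cf E 0 = 0 then e (Min (I E 1)) else if cf E 0 = 1 then M (Min (I E (-1))) (Max (I E (-1)))
    else if cf E 0 = 2 then Q (Min (I E 0)) (Max (I E 0)) else c (Min (I E (-2))))" for E
  have "h (exc i) = e i" if "i \<in> {1..7}" for i
  proof -
    have "I (exc i) 1 = {i}" using that by (auto simp: I_def lookup_class split: if_splits)
    then show ?thesis using that by (simp add: h_def lookup_class)
  qed
  moreover have "h (m_class i j) = M i j" if "i \<in> {1..7}" "j \<in> {1..7}" "i < j" for i j
  proof -
    have "I (m_class i j) (-1) = {i, j}" using that by (auto simp: I_def lookup_class split: if_splits)
    then show ?thesis using that by (simp add: h_def lookup_class)
  qed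
  moreover have "h (Q7_class i j) = Q i j" if "i \<in> {1..7}" "j \<in> {1..7}" "i < j" for i j
  proof -
    have "I (Q7_class i j) 0 = {i, j}" using that by (auto simp: I_def lookup_class split: if_splits)
    then show ?thesis using that by (simp add: h_def lookup_class)
  qed
  moreover have "h (C_class i) = c i" if "i \<in> {1..7}" for i
  proof -
    have "I (C_class i) (-2) = {i}" using that by (auto simp: I_def lookup_class split: if_splits)
    then show ?thesis using that by (simp add: h_def lookup_class)
  qed
  ultimately show ?thesis by (rule that)
qed

lemma exc_in: "i \<in> {1..r} \<Longrightarrow> exc i \<in> neg_curves r"
  unfolding neg_curves_def by blast

lemma m_in: "i \<in> {1..r} \<Longrightarrow> j \<in> {1..r} \<Longrightarrow> i \<noteq> j \<Longrightarrow> m_class i j \<in> neg_curves r"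
proof -
  assume a: "i \<in> {1..r}" "j \<in> {1..r}" "i \<noteq> j"
  then have "m_class i j = hyp 1 - exc_sum {i, j} \<and> {i, j} \<subseteq> {1..r} \<and> card {i, j} = 2"
    by (simp add: exc_sum_pair)
  then show ?thesis unfolding neg_curves_def by blast
qed

text \<open>The conics for six points are those of the classes \<open>Q7_class i 7\<close>, so that both cases share one notation.\<close>

lemma Q6_in: "i \<in> {1..6} \<Longrightarrow> Q7_class i 7 \<in> neg_curves 6"
proof -
  assume i: "i \<in> {1..6}"
  have "{1..7} = insert 7 {1..6::nat}" by auto
  then have "exc_sum {1..7} = exc 7 + exc_sum {1..6}" by (simp add: exc_sum_insert)
  then have "Q7_class i 7 = Q6_class i" by (simp add: Q7_class_def Q6_class_def)
  then show ?thesis using i unfolding neg_curves_6 by blast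
qed

lemma Q7_in: "i \<in> {1..7} \<Longrightarrow> j \<in> {1..7} \<Longrightarrow> i \<noteq> j \<Longrightarrow> Q7_class i j \<in> neg_curves 7"
proof -
  assume a: "i \<in> {1..7}" "j \<in> {1..7}" "i \<noteq> j"
  show ?thesis
  proof (cases "i < j")
    case True then show ?thesis using a unfolding neg_curves_7 by auto
  next
    case False
    then have "j < i" using a by simp
    then show ?thesis using a unfolding neg_curves_7 Q7_class_commute[of i j] by auto
  qed
qed

lemma C7_in: "i \<in> {1..7} \<Longrightarrow> C_class i \<in> neg_curves 7"
  unfolding neg_curves_7 by blast

locale sections67 = sections +
  assumes r67: "r \<in> {6, 7}"
begin

lemma six: "i \<in> {1..6} \<Longrightarrow> i \<in> {1..r}"
  using r67 by auto

lemma G_exc: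
  assumes "i \<in> {1..r}"
  obtains c where "c \<noteq> 0" "\<And>x. G (exc i) x = c"
proof -
  have g: "curve_form (exc i) (G (exc i))" by (rule G[OF exc_in[OF assms]])
  then have "ternary_form 0 (G (exc i))" unfolding curve_form_def using assms by (simp add: lookup_class)
  then obtain c where c: "\<And>x. G (exc i) x = c" using form_0 by blast
  moreover have "c \<noteq> 0" using g c unfolding curve_form_def by auto
  ultimately show ?thesis using that by blast
qed

lemma G_nz: "E \<in> neg_curves r \<Longrightarrow> \<exists>z. G E z \<noteq> 0"
  using G unfolding curve_form_def by blast

lemma G_m:
  assumes "i \<in> {1..r}" "j \<in> {1..r}" "i \<noteq> j"
  shows "ternary_form 1 (G (m_class i j))" "G (m_class i j) (p i) = 0" "G (m_class i j) (p j) = 0"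
    "k \<in> {1..r} \<Longrightarrow> k \<noteq> i \<Longrightarrow> k \<noteq> j \<Longrightarrow> G (m_class i j) (p k) \<noteq> 0"
proof -
  have g: "curve_form (m_class i j) (G (m_class i j))" by (rule G[OF m_in[OF assms]])
  have "cf (m_class i j) 0 = 1" "cf (m_class i j) i = -1" "cf (m_class i j) j = -1"
    using assms by (auto simp: lookup_class)
  then show *: "ternary_form 1 (G (m_class i j))" "G (m_class i j) (p i) = 0" "G (m_class i j) (p j) = 0"
    using g assms unfolding curve_form_def by auto
  obtain z where "G (m_class i j) z \<noteq> 0" using g unfolding curve_form_def by blast
  then show "k \<in> {1..r} \<Longrightarrow> k \<noteq> i \<Longrightarrow> k \<noteq> j \<Longrightarrow> G (m_class i j) (p k) \<noteq> 0"
    using line_nz[OF *] assms by blast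
qed

lemma G_Q_aux:
  assumes E: "Q7_class i j \<in> neg_curves r" and i: "i \<in> {1..7}" "j \<in> {1..7}" "i \<noteq> j"
  shows "ternary_form 2 (G (Q7_class i j))" "\<And>k. k \<in> {1..r} - {i, j} \<Longrightarrow> G (Q7_class i j) (p k) = 0"
proof -
  have g: "curve_form (Q7_class i j) (G (Q7_class i j))" by (rule G[OF E])
  have "cf (Q7_class i j) 0 = 2" using i by (auto simp: lookup_class)
  then show "ternary_form 2 (G (Q7_class i j))" using g unfolding curve_form_def by auto
  fix k assume k: "k \<in> {1..r} - {i, j}"
  then have "k \<in> {1..7}" using r67 by auto
  then have "cf (Q7_class i j) k = -1" using k by (auto simp: lookup_class)
  then show "G (Q7_class i j) (p k) = 0" using g k unfolding curve_form_def by auto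
qed

lemma Q_in: "i \<in> {1..6} \<Longrightarrow> Q7_class i 7 \<in> neg_curves r"
  using r67 Q6_in[of i] Q7_in[of i 7] by auto

lemma conic_points: assumes "i \<in> {1..6}" shows "{1..6} - {i} \<subseteq> {1..r}" "card ({1..6} - {i}) = 5" "i \<in> {1..r}" "i \<notin> {1..6} - {i}"
  using assms six by auto

lemma G_Q:
  assumes i: "i \<in> {1..6}"
  shows "ternary_form 2 (G (Q7_class i 7))" "\<And>k. k \<in> {1..6} - {i} \<Longrightarrow> G (Q7_class i 7) (p k) = 0"
    "G (Q7_class i 7) (p i) \<noteq> 0" "r = 7 \<Longrightarrow> G (Q7_class i 7) (p 7) \<noteq> 0"
    "\<And>j k \<alpha> \<beta>. j \<in> {1..6} - {i} \<Longrightarrow> k \<in> {1..6} - {i} \<Longrightarrow> j \<noteq> k \<Longrightarrow> \<alpha> \<noteq> 0 \<Longrightarrow> \<beta> \<noteq> 0 \<Longrightarrow> G (Q7_class i 7) (\<alpha> *s p j + \<beta> *s p k) \<noteq> 0"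
proof -
  have i7: "i \<in> {1..7}" "7 \<in> {1..7::nat}" "i \<noteq> 7" using i by auto
  show f: "ternary_form 2 (G (Q7_class i 7))" by (rule G_Q_aux(1)[OF Q_in[OF i] i7])
  show z: "G (Q7_class i 7) (p k) = 0" if "k \<in> {1..6} - {i}" for k
    by (rule G_Q_aux(2)[OF Q_in[OF i] i7]) (use that six in auto)
  obtain w where w: "G (Q7_class i 7) w \<noteq> 0" using G_nz[OF Q_in[OF i]] by blast
  show "G (Q7_class i 7) (p i) \<noteq> 0" using conic_nz[OF f z w conic_points[OF i]] .
  show "G (Q7_class i 7) (p 7) \<noteq> 0" if "r = 7"
    by (rule conic_nz[OF f z w conic_points(1,2)[OF i]]) (use that in auto)
  show "G (Q7_class i 7) (\<alpha> *s p j + \<beta> *s p k) \<noteq> 0"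
    if "j \<in> {1..6} - {i}" "k \<in> {1..6} - {i}" "j \<noteq> k" "\<alpha> \<noteq> 0" "\<beta> \<noteq> 0" for j k \<alpha> \<beta>
    by (rule conic_no_line[OF f z w conic_points(1,2)[OF i] that])
qed

text \<open>The alternating matrix of the lines through two of the first six points, rescaled by \<open>M\<close> and evaluated
  at \<open>x\<close>.\<close>

definition lines :: "(nat \<Rightarrow> nat \<Rightarrow> 'a) \<Rightarrow> 'a^3 \<Rightarrow> nat \<Rightarrow> nat \<Rightarrow> 'a" where
  "lines M x i j = sg i j * (M i j * G (m_class i j) x)"

definition conics :: "(nat \<Rightarrow> 'a) \<Rightarrow> 'a^3 \<Rightarrow> nat \<Rightarrow> 'a" where
  "conics A x i = A i * G (Q7_class i 7) x"

lemma lines_alternating: "(\<And>i j. M i j = M j i) \<Longrightarrow> alternating (lines M x)"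
  unfolding lines_def[abs_def] by (rule alternating_sg) (simp add: m_class_commute)

lemma lines_form: "i \<in> {1..6} \<Longrightarrow> j \<in> {1..6} \<Longrightarrow> ternary_form 1 (\<lambda>x. lines M x i j)"
proof (cases "i = j")
  case True then show ?thesis by (simp add: lines_def sg_refl form_zero)
next
  case False
  assume "i \<in> {1..6}" "j \<in> {1..6}"
  then show ?thesis unfolding lines_def by (intro form_scale G_m six False)
qed

lemma lines_zero: assumes "i \<in> {1..6}" "j \<in> {1..6}" "k = i \<or> k = j" shows "lines M (p k) i j = 0"
  using assms G_m(2,3)[of i j] six by (cases "i = j") (auto simp: lines_def sg_refl)

lemma conics_form: "i \<in> {1..6} \<Longrightarrow> ternary_form 2 (\<lambda>x. conics A x i)"
  unfolding conics_def by (intro form_scale G_Q)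

lemma conics_zero: "i \<in> {1..6} \<Longrightarrow> k \<in> {1..6} \<Longrightarrow> k \<noteq> i \<Longrightarrow> conics A (p k) i = 0"
  unfolding conics_def using G_Q(2)[of i k] by simp

lemma form11: "ternary_form 1 f \<Longrightarrow> ternary_form 1 g \<Longrightarrow> ternary_form 2 (\<lambda>x. f x * g x)"
  using form_mult[of 1 f 1 g] by (simp only: one_add_one)

text \<open>Each product of two complementary lines contains all four points different from \<open>p\<^sub>i\<close> and \<open>p\<^sub>j\<close>.\<close>

lemma cofactor_form:
  assumes M: "\<And>i j. M i j = M j i" and ij: "i \<in> {1..6}" "j \<in> {1..6}" "i \<noteq> j"
  shows "ternary_form 2 (\<lambda>x. cofactor (lines M x) i j)"
    "\<And>q. q \<in> {1..6} - {i, j} \<Longrightarrow> cofactor (lines M (p q)) i j = 0"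
proof -
  obtain \<sigma> k l m n where L: "labelling (\<sigma>::'a) i j k l m n" using labelling_exists ij by metis
  note e = cofactor_eq[OF L lines_alternating[OF M]] and r = labelling_range[OF L]
  show "ternary_form 2 (\<lambda>x. cofactor (lines M x) i j)"
    unfolding e pf4_def by (intro form_scale form_add form_diff form11 lines_form r)
  fix q assume q: "q \<in> {1..6} - {i, j}"
  then have "q \<in> {i, j, k, l, m, n}" unfolding labelling_UN[OF L] by blast
  then have "q \<in> {k, l, m, n}" using q by blast
  then show "cofactor (lines M (p q)) i j = 0"
  proof (elim insertE emptyE)
    note z = lines_zero[OF r(3,4)] lines_zero[OF r(3,5)] lines_zero[OF r(3,6)] lines_zero[OF r(4,5)] lines_zero[OF r(4,6)] lines_zero[OF r(5,6)]
    show "q = k \<Longrightarrow> ?thesis" "q = l \<Longrightarrow> ?thesis" "q = m \<Longrightarrow> ?thesis" "q = n \<Longrightarrow> ?thesis"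
      unfolding e pf4_def by (simp_all add: z)
  qed
qed

end

section \<open>The quadrics of the cone over the Freudenthal variety\<close>

lemma quad_scale: "quad_rel r D Q \<Longrightarrow> quad_rel r D (\<lambda>\<xi>. c * Q \<xi>)"
proof (induction rule: quad_rel.induct)
  case (quad_term A B d)
  then show ?case using quad_rel.quad_term[of A r B D "c * d"] by (simp add: mult.assoc)
next
  case (quad_add Q Q')
  then show ?case using quad_rel.quad_add by (simp add: distrib_left)
qed

lemma quad_minus: "quad_rel r D Q \<Longrightarrow> quad_rel r D (\<lambda>\<xi>. - Q \<xi>)"
  using quad_scale[of r D Q "-1"] by simp

lemma quad_diff: "quad_rel r D Q \<Longrightarrow> quad_rel r D Q' \<Longrightarrow> quad_rel r D (\<lambda>\<xi>. Q \<xi> - Q' \<xi>)"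
  using quad_add[of r D Q "\<lambda>\<xi>. - Q' \<xi>"] quad_minus[of r D Q'] by simp

lemma quad_sum:
  "finite A \<Longrightarrow> A \<noteq> {} \<Longrightarrow> (\<And>i. i \<in> A \<Longrightarrow> quad_rel r D (Q i)) \<Longrightarrow> quad_rel r D (\<lambda>\<xi>. \<Sum>i\<in>A. Q i \<xi>)"
proof (induction A rule: finite_ne_induct)
  case (insert i A)
  then show ?case using quad_add[of r D "Q i" "\<lambda>\<xi>. \<Sum>i\<in>A. Q i \<xi>"] by simp
qed simp

lemma quad_signed_term:
  assumes "A \<in> neg_curves r" "B \<in> neg_curves r" "A + B = D"
  shows "quad_rel r D (\<lambda>\<xi>. (c * \<xi> A) * (d * \<xi> B))"
  using quad_term[OF assms, of "c * d"] by (simp add: mult_ac)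

definition x_curve :: "nat \<Rightarrow> nat \<Rightarrow> pic" where
  "x_curve i j = (if j = 8 then exc i else if i = 8 then exc j else Q7_class i j)"

definition y_curve :: "nat \<Rightarrow> nat \<Rightarrow> pic" where
  "y_curve i j = (if j = 8 then C_class i else if i = 8 then C_class j else m_class i j)"

text \<open>With the eighth class \<open>eps8 8\<close>, the 56 classes become the differences \<open>H - \<epsilon>\<^sub>i - \<epsilon>\<^sub>j\<close> and their
  duals for \<open>i, j \<le> 8\<close>, symmetric under permutations of eight indices.\<close>

definition eps8 :: "nat \<Rightarrow> pic" where
  "eps8 i = (if i = 8 then exc_sum {1..7} - hyp 2 else exc i)"

lemma x7_x_curve: "i \<in> {1..8} \<Longrightarrow> j \<in> {1..8} \<Longrightarrow> x7 \<xi> i j = sg i j * \<xi> (x_curve i j)"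
  unfolding x7_def x_curve_def sg_def by (auto simp: Let_def Q7_class_commute)

lemma y7_y_curve: "i \<in> {1..8} \<Longrightarrow> j \<in> {1..8} \<Longrightarrow> y7 \<xi> i j = sg i j * \<xi> (y_curve i j)"
  unfolding y7_def y_curve_def sg_def by (auto simp: Let_def m_class_commute)

lemma x_curve_in: "i \<in> {1..8} \<Longrightarrow> j \<in> {1..8} \<Longrightarrow> i \<noteq> j \<Longrightarrow> x_curve i j \<in> neg_curves 7"
  unfolding x_curve_def by (auto intro!: exc_in Q7_in)

lemma y_curve_in: "i \<in> {1..8} \<Longrightarrow> j \<in> {1..8} \<Longrightarrow> i \<noteq> j \<Longrightarrow> y_curve i j \<in> neg_curves 7"
  unfolding y_curve_def by (auto intro!: C7_in m_in)

lemma hyp_add: "hyp a + hyp b = hyp (a + b)"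
  by (simp add: hyp_def single_add)

lemma x_curve_eps: "i \<noteq> j \<Longrightarrow> x_curve i j = (hyp 2 - exc_sum {1..7}) + eps8 i + eps8 j"
  unfolding x_curve_def eps8_def by (auto simp: Q7_class_def)

lemma y_curve_eps: "i \<noteq> j \<Longrightarrow> y_curve i j = hyp 1 - eps8 i - eps8 j"
proof -
  have "hyp 3 = hyp 1 + hyp 2" by (simp add: hyp_add)
  then show "i \<noteq> j \<Longrightarrow> y_curve i j = hyp 1 - eps8 i - eps8 j"
    unfolding y_curve_def eps8_def by (auto simp: m_class_def C_class_def)
qed

lemma eps8_sum: "(\<Sum>i\<in>{1..8}. eps8 i) = exc_sum {1..7} + exc_sum {1..7} - hyp 2"
proof -
  have "{1..8} = insert 8 {1..7::nat}" by auto
  moreover have "(\<Sum>i\<in>{1..7}. eps8 i) = exc_sum {1..7}" unfolding exc_sum_def by (rule sum.cong) (auto simp: eps8_def)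
  ultimately show ?thesis by (simp add: eps8_def)
qed

text \<open>In the symmetric notation all six products have the same degree, because the \<open>eps8 i\<close> add up to
  a fixed class.\<close>

lemma u7_quad:
  assumes \<tau>: "\<tau> permutes {1..8}"
  shows "quad_rel 7 (hyp 2 - eps8 (\<tau> 5) - eps8 (\<tau> 6) - eps8 (\<tau> 7) - eps8 (\<tau> 8)) (u7 \<tau>)"
    (is "quad_rel 7 ?D _")
proof -
  have inj: "inj \<tau>" by (rule permutes_inj[OF \<tau>])
  have rg: "\<tau> i \<in> {1..8}" if "i \<in> {1..8}" for i using permutes_in_image[OF \<tau>] that by blast
  have ne: "\<tau> i \<noteq> \<tau> j" if "i \<noteq> j" for i j using inj that by (simp add: inj_eq)
  have "(\<Sum>i\<in>{1..8}. eps8 (\<tau> i)) = (\<Sum>i\<in>{1..8}. eps8 i)"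
    by (rule sum.permute[OF \<tau>, symmetric, unfolded comp_def])
  moreover have "{1..8} = {1,2,3,4,5,6,7,8::nat}" by auto
  ultimately have sum: "eps8 (\<tau> 1) + eps8 (\<tau> 2) + eps8 (\<tau> 3) + eps8 (\<tau> 4) + (eps8 (\<tau> 5) + eps8 (\<tau> 6) + eps8 (\<tau> 7) + eps8 (\<tau> 8))
     = exc_sum {1..7} + exc_sum {1..7} - hyp 2" using eps8_sum by (simp add: add.assoc)
  have h2: "hyp 1 + hyp 1 = hyp 2" by (simp add: hyp_add)
  have X: "x_curve (\<tau> i) (\<tau> j) + x_curve (\<tau> k) (\<tau> l) = ?D"
    if "eps8 (\<tau> i) + eps8 (\<tau> j) + eps8 (\<tau> k) + eps8 (\<tau> l) = eps8 (\<tau> 1) + eps8 (\<tau> 2) + eps8 (\<tau> 3) + eps8 (\<tau> 4)" "i \<noteq> j" "k \<noteq> l" for i j k l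
  proof -
    have "x_curve (\<tau> i) (\<tau> j) + x_curve (\<tau> k) (\<tau> l) = (hyp 2 - exc_sum {1..7}) + (hyp 2 - exc_sum {1..7})
       + (eps8 (\<tau> i) + eps8 (\<tau> j) + eps8 (\<tau> k) + eps8 (\<tau> l))"
      unfolding x_curve_eps[OF ne[OF that(2)]] x_curve_eps[OF ne[OF that(3)]] by (simp add: algebra_simps)
    also have "\<dots> = ?D + (eps8 (\<tau> 1) + eps8 (\<tau> 2) + eps8 (\<tau> 3) + eps8 (\<tau> 4) + (eps8 (\<tau> 5) + eps8 (\<tau> 6) + eps8 (\<tau> 7) + eps8 (\<tau> 8)))
        + hyp 2 - exc_sum {1..7} - exc_sum {1..7}" unfolding that(1) by (simp add: algebra_simps)
    also have "\<dots> = ?D" unfolding sum by (simp add: algebra_simps)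
    finally show ?thesis .
  qed
  have Y: "y_curve (\<tau> i) (\<tau> j) + y_curve (\<tau> k) (\<tau> l) = ?D"
    if "eps8 (\<tau> i) + eps8 (\<tau> j) + eps8 (\<tau> k) + eps8 (\<tau> l) = eps8 (\<tau> 5) + eps8 (\<tau> 6) + eps8 (\<tau> 7) + eps8 (\<tau> 8)" "i \<noteq> j" "k \<noteq> l" for i j k l
  proof -
    have "y_curve (\<tau> i) (\<tau> j) + y_curve (\<tau> k) (\<tau> l) = (hyp 1 + hyp 1) - (eps8 (\<tau> i) + eps8 (\<tau> j) + eps8 (\<tau> k) + eps8 (\<tau> l))"
      unfolding y_curve_eps[OF ne[OF that(2)]] y_curve_eps[OF ne[OF that(3)]] by (simp add: algebra_simps)
    also have "\<dots> = ?D" unfolding that(1) h2 by (simp add: algebra_simps)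
    finally show ?thesis .
  qed
  have tx: "quad_rel 7 ?D (\<lambda>\<xi>. x7 \<xi> (\<tau> i) (\<tau> j) * x7 \<xi> (\<tau> k) (\<tau> l))"
    if "eps8 (\<tau> i) + eps8 (\<tau> j) + eps8 (\<tau> k) + eps8 (\<tau> l) = eps8 (\<tau> 1) + eps8 (\<tau> 2) + eps8 (\<tau> 3) + eps8 (\<tau> 4)"
      "i \<noteq> j" "k \<noteq> l" "i \<in> {1..8}" "j \<in> {1..8}" "k \<in> {1..8}" "l \<in> {1..8}" for i j k l
    unfolding x7_x_curve[OF rg[OF that(4)] rg[OF that(5)]] x7_x_curve[OF rg[OF that(6)] rg[OF that(7)]]
    by (intro quad_signed_term x_curve_in rg that ne X)
  have ty: "quad_rel 7 ?D (\<lambda>\<xi>. y7 \<xi> (\<tau> i) (\<tau> j) * y7 \<xi> (\<tau> k) (\<tau> l))"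
    if "eps8 (\<tau> i) + eps8 (\<tau> j) + eps8 (\<tau> k) + eps8 (\<tau> l) = eps8 (\<tau> 5) + eps8 (\<tau> 6) + eps8 (\<tau> 7) + eps8 (\<tau> 8)"
      "i \<noteq> j" "k \<noteq> l" "i \<in> {1..8}" "j \<in> {1..8}" "k \<in> {1..8}" "l \<in> {1..8}" for i j k l
    unfolding y7_y_curve[OF rg[OF that(4)] rg[OF that(5)]] y7_y_curve[OF rg[OF that(6)] rg[OF that(7)]]
    by (intro quad_signed_term y_curve_in rg that ne Y)
  show ?thesis
    unfolding u7_def[abs_def] pf4_def
    by (intro quad_add quad_diff quad_scale tx ty) (simp_all add: ac_simps)
qed

lemma v7_quad_off:
  assumes ij: "i \<in> {1..8}" "j \<in> {1..8}" "i \<noteq> j"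
  shows "quad_rel 7 (hyp 2 - exc_sum {1..7} + hyp 1 + eps8 i - eps8 j) (v7 i j)"
proof -
  have v: "v7 i j = (\<lambda>\<xi>. \<Sum>k\<in>{1..8} - {i, j}. x7 \<xi> i k * y7 \<xi> k j)" unfolding v7_def using ij by auto
  show ?thesis unfolding v
  proof (rule quad_sum)
    have "card {i, j} < card {1..8::nat}" using ij by simp
    then show "{1..8} - {i, j} \<noteq> {}" by (metis Diff_eq_empty_iff card_mono finite.emptyI finite.insertI leD)
    fix k assume k: "k \<in> {1..8} - {i, j}"
    then have "k \<in> {1..8}" "i \<noteq> k" "k \<noteq> j" by auto
    then show "quad_rel 7 (hyp 2 - exc_sum {1..7} + hyp 1 + eps8 i - eps8 j) (\<lambda>\<xi>. x7 \<xi> i k * y7 \<xi> k j)"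
      unfolding x7_x_curve[OF ij(1) \<open>k \<in> {1..8}\<close>] y7_y_curve[OF \<open>k \<in> {1..8}\<close> ij(2)]
      by (intro quad_signed_term x_curve_in y_curve_in ij) (simp_all add: x_curve_eps y_curve_eps algebra_simps)
  qed simp
qed

lemma v7_quad_diag:
  assumes i: "i \<in> {1..8}"
  shows "quad_rel 7 (hyp 2 - exc_sum {1..7} + hyp 1) (v7 i i)"
proof -
  have t: "quad_rel 7 (hyp 2 - exc_sum {1..7} + hyp 1) (\<lambda>\<xi>. x7 \<xi> j k * y7 \<xi> j k)"
    if jk: "j \<in> {1..8}" "k \<in> {1..8}" "j \<noteq> k" for j k
    unfolding x7_x_curve[OF jk(1,2)] y7_y_curve[OF jk(1,2)]
    by (intro quad_signed_term x_curve_in y_curve_in jk) (simp_all add: x_curve_eps[OF jk(3)] y_curve_eps[OF jk(3)] algebra_simps)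
  let ?P = "{(j, k). j \<in> {1..8} - {i} \<and> k \<in> {1..8} - {i} \<and> j < k}"
  have ne1: "{1..8} - {i} \<noteq> {}"
  proof -
    have "card {i} < card {1..8::nat}" by simp
    then show ?thesis by (metis Diff_eq_empty_iff card_mono finite.emptyI finite.insertI leD)
  qed
  have ne2: "?P \<noteq> {}"
  proof -
    have "(1, 2) \<in> ?P \<or> (3, 4) \<in> ?P" by auto
    then show ?thesis by blast
  qed
  have fin: "finite ?P" by (rule finite_subset[of _ "{1..8} \<times> {1..8}"]) auto
  have P: "quad_rel 7 (hyp 2 - exc_sum {1..7} + hyp 1) (\<lambda>\<xi>. \<Sum>q\<in>?P. (case q of (j, k) \<Rightarrow> x7 \<xi> j k * y7 \<xi> j k))"
  proof (rule quad_sum[OF fin ne2])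
    fix q assume "q \<in> ?P"
    then obtain j k where q: "q = (j, k)" "j \<in> {1..8} - {i}" "k \<in> {1..8} - {i}" "j < k" by blast
    then show "quad_rel 7 (hyp 2 - exc_sum {1..7} + hyp 1) (\<lambda>\<xi>. (case q of (j, k) \<Rightarrow> x7 \<xi> j k * y7 \<xi> j k))"
      using t[of j k] by auto
  qed
  have R: "quad_rel 7 (hyp 2 - exc_sum {1..7} + hyp 1) (\<lambda>\<xi>. \<Sum>j\<in>{1..8} - {i}. x7 \<xi> i j * y7 \<xi> i j)"
  proof (rule quad_sum[OF _ ne1])
    fix j assume "j \<in> {1..8} - {i}"
    then show "quad_rel 7 (hyp 2 - exc_sum {1..7} + hyp 1) (\<lambda>\<xi>. x7 \<xi> i j * y7 \<xi> i j)" using t[OF i, of j] by auto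
  qed simp
  have v: "v7 i i = (\<lambda>\<xi>. - (3 / 4) * (\<Sum>j\<in>{1..8} - {i}. x7 \<xi> i j * y7 \<xi> i j) + (1 / 4) * (\<Sum>q\<in>?P. (case q of (j, k) \<Rightarrow> x7 \<xi> j k * y7 \<xi> j k)))"
    unfolding v7_def by auto
  show ?thesis unfolding v by (intro quad_add quad_scale P R)
qed

text \<open>All equations of \<open>H7\<close> are homogeneous quadrics.\<close>

lemma (in sections) rescaling_into_H7:
  assumes r: "r = 7" and f: "\<And>x. generic x \<Longrightarrow> (\<lambda>E. f E * G E x) \<in> H7"
  shows "rescale f ` A_S r p s \<subseteq> H7"
proof
  fix \<xi> assume "\<xi> \<in> rescale f ` A_S r p s"
  then obtain \<phi> where \<phi>: "\<phi> \<in> cox_points r p"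
    and \<xi>: "\<xi> = rescale f (\<lambda>E. if E \<in> neg_curves r then \<phi> (Poly_Mapping.single E (s E)) else 0)"
    unfolding A_S_def by blast
  have xi: "\<xi> E = f E * \<phi> (Poly_Mapping.single E (s E))" if "E \<in> neg_curves r" for E
    unfolding \<xi> rescale_def using that by simp
  have "u7 \<tau> \<xi> = 0" if "\<tau> permutes {1..8} \<and> \<tau> 1 < \<tau> 2 \<and> \<tau> 2 < \<tau> 3 \<and> \<tau> 3 < \<tau> 4 \<and> \<tau> 5 < \<tau> 6 \<and> \<tau> 6 < \<tau> 7 \<and> \<tau> 7 < \<tau> 8" for \<tau>
    using that f by (intro quad_transfer[OF _ \<phi> _ xi, of _ "u7 \<tau>"]) (auto intro: u7_quad simp: r H7_def)
  moreover have "v7 i j \<xi> = 0" if "i \<in> {1..8}" "j \<in> {1..8}" for i j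
  proof (cases "i = j")
    case True
    then show ?thesis using that f v7_quad_diag[of i]
      by (intro quad_transfer[OF _ \<phi> _ xi, of _ "v7 i j"]) (auto simp: r H7_def)
  next
    case False
    then show ?thesis using that f v7_quad_off[of i j]
      by (intro quad_transfer[OF _ \<phi> _ xi, of _ "v7 i j"]) (auto simp: r H7_def)
  qed
  ultimately show "\<xi> \<in> H7" unfolding H7_def by blast
qed

section \<open>The cubic invariant and its singular points\<close>

lemma labelling_id: "labelling 1 1 2 3 4 5 6"
  unfolding labelling_def by (rule exI[of _ id]) (simp add: permutes_id)

lemma E6rel_sorted:
  assumes "E6rel b a y"
  shows "b 1 * a 2 - b 2 * a 1 + (y 3 4 * y 5 6 - y 3 5 * y 4 6 + y 3 6 * y 4 5) = 0" "b 1 * a 3 - b 3 * a 1 - (y 2 4 * y 5 6 - y 2 5 * y 4 6 + y 2 6 * y 4 5) = 0"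
    "b 1 * a 4 - b 4 * a 1 + (y 2 3 * y 5 6 - y 2 5 * y 3 6 + y 2 6 * y 3 5) = 0" "b 1 * a 5 - b 5 * a 1 - (y 2 3 * y 4 6 - y 2 4 * y 3 6 + y 2 6 * y 3 4) = 0"
    "b 1 * a 6 - b 6 * a 1 + (y 2 3 * y 4 5 - y 2 4 * y 3 5 + y 2 5 * y 3 4) = 0" "b 2 * a 3 - b 3 * a 2 + (y 1 4 * y 5 6 - y 1 5 * y 4 6 + y 1 6 * y 4 5) = 0"
    "b 2 * a 4 - b 4 * a 2 - (y 1 3 * y 5 6 - y 1 5 * y 3 6 + y 1 6 * y 3 5) = 0" "b 2 * a 5 - b 5 * a 2 + (y 1 3 * y 4 6 - y 1 4 * y 3 6 + y 1 6 * y 3 4) = 0"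
    "b 2 * a 6 - b 6 * a 2 - (y 1 3 * y 4 5 - y 1 4 * y 3 5 + y 1 5 * y 3 4) = 0" "b 3 * a 4 - b 4 * a 3 + (y 1 2 * y 5 6 - y 1 5 * y 2 6 + y 1 6 * y 2 5) = 0"
    "b 3 * a 5 - b 5 * a 3 - (y 1 2 * y 4 6 - y 1 4 * y 2 6 + y 1 6 * y 2 4) = 0" "b 3 * a 6 - b 6 * a 3 + (y 1 2 * y 4 5 - y 1 4 * y 2 5 + y 1 5 * y 2 4) = 0"
    "b 4 * a 5 - b 5 * a 4 + (y 1 2 * y 3 6 - y 1 3 * y 2 6 + y 1 6 * y 2 3) = 0" "b 4 * a 6 - b 6 * a 4 - (y 1 2 * y 3 5 - y 1 3 * y 2 5 + y 1 5 * y 2 3) = 0"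
    "b 5 * a 6 - b 6 * a 5 + (y 1 2 * y 3 4 - y 1 3 * y 2 4 + y 1 4 * y 2 3) = 0"
proof -
  have R: "b i * a j - b j * a i + \<sigma> * pf4 y k l m n = 0" if "labelling \<sigma> i j k l m n" for \<sigma> i j k l m n
    using assms that unfolding E6rel_def by blast
  note s = labelling_swap and lab0 = labelling_id
  show "b 1 * a 2 - b 2 * a 1 + (y 3 4 * y 5 6 - y 3 5 * y 4 6 + y 3 6 * y 4 5) = 0"
    using R[OF lab0] unfolding pf4_def by (simp add: algebra_simps)
  show "b 1 * a 3 - b 3 * a 1 - (y 2 4 * y 5 6 - y 2 5 * y 4 6 + y 2 6 * y 4 5) = 0"
    using R[OF s(2)[OF lab0]] unfolding pf4_def by (simp add: algebra_simps)
  show "b 1 * a 4 - b 4 * a 1 + (y 2 3 * y 5 6 - y 2 5 * y 3 6 + y 2 6 * y 3 5) = 0"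
    using R[OF s(2)[OF s(3)[OF lab0]]] unfolding pf4_def by (simp add: algebra_simps)
  show "b 1 * a 5 - b 5 * a 1 - (y 2 3 * y 4 6 - y 2 4 * y 3 6 + y 2 6 * y 3 4) = 0"
    using R[OF s(2)[OF s(3)[OF s(4)[OF lab0]]]] unfolding pf4_def by (simp add: algebra_simps)
  show "b 1 * a 6 - b 6 * a 1 + (y 2 3 * y 4 5 - y 2 4 * y 3 5 + y 2 5 * y 3 4) = 0"
    using R[OF s(2)[OF s(3)[OF s(4)[OF s(5)[OF lab0]]]]] unfolding pf4_def by (simp add: algebra_simps)
  show "b 2 * a 3 - b 3 * a 2 + (y 1 4 * y 5 6 - y 1 5 * y 4 6 + y 1 6 * y 4 5) = 0"
    using R[OF s(2)[OF s(1)[OF lab0]]] unfolding pf4_def by (simp add: algebra_simps)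
  show "b 2 * a 4 - b 4 * a 2 - (y 1 3 * y 5 6 - y 1 5 * y 3 6 + y 1 6 * y 3 5) = 0"
    using R[OF s(2)[OF s(3)[OF s(1)[OF lab0]]]] unfolding pf4_def by (simp add: algebra_simps)
  show "b 2 * a 5 - b 5 * a 2 + (y 1 3 * y 4 6 - y 1 4 * y 3 6 + y 1 6 * y 3 4) = 0"
    using R[OF s(2)[OF s(3)[OF s(4)[OF s(1)[OF lab0]]]]] unfolding pf4_def by (simp add: algebra_simps)
  show "b 2 * a 6 - b 6 * a 2 - (y 1 3 * y 4 5 - y 1 4 * y 3 5 + y 1 5 * y 3 4) = 0"
    using R[OF s(2)[OF s(3)[OF s(4)[OF s(5)[OF s(1)[OF lab0]]]]]] unfolding pf4_def by (simp add: algebra_simps)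
  show "b 3 * a 4 - b 4 * a 3 + (y 1 2 * y 5 6 - y 1 5 * y 2 6 + y 1 6 * y 2 5) = 0"
    using R[OF s(2)[OF s(3)[OF s(1)[OF s(2)[OF lab0]]]]] unfolding pf4_def by (simp add: algebra_simps)
  show "b 3 * a 5 - b 5 * a 3 - (y 1 2 * y 4 6 - y 1 4 * y 2 6 + y 1 6 * y 2 4) = 0"
    using R[OF s(2)[OF s(3)[OF s(4)[OF s(1)[OF s(2)[OF lab0]]]]]] unfolding pf4_def by (simp add: algebra_simps)
  show "b 3 * a 6 - b 6 * a 3 + (y 1 2 * y 4 5 - y 1 4 * y 2 5 + y 1 5 * y 2 4) = 0"
    using R[OF s(2)[OF s(3)[OF s(4)[OF s(5)[OF s(1)[OF s(2)[OF lab0]]]]]]] unfolding pf4_def by (simp add: algebra_simps)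
  show "b 4 * a 5 - b 5 * a 4 + (y 1 2 * y 3 6 - y 1 3 * y 2 6 + y 1 6 * y 2 3) = 0"
    using R[OF s(2)[OF s(3)[OF s(4)[OF s(1)[OF s(2)[OF s(3)[OF lab0]]]]]]] unfolding pf4_def by (simp add: algebra_simps)
  show "b 4 * a 6 - b 6 * a 4 - (y 1 2 * y 3 5 - y 1 3 * y 2 5 + y 1 5 * y 2 3) = 0"
    using R[OF s(2)[OF s(3)[OF s(4)[OF s(5)[OF s(1)[OF s(2)[OF s(3)[OF lab0]]]]]]]] unfolding pf4_def by (simp add: algebra_simps)
  show "b 5 * a 6 - b 6 * a 5 + (y 1 2 * y 3 4 - y 1 3 * y 2 4 + y 1 4 * y 2 3) = 0"
    using R[OF s(2)[OF s(3)[OF s(4)[OF s(5)[OF s(1)[OF s(2)[OF s(3)[OF s(4)[OF lab0]]]]]]]]] unfolding pf4_def by (simp add: algebra_simps)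
qed

lemma sum_six: "(\<Sum>k\<in>{1..6::nat}. f k) = f 1 + f 2 + f 3 + f 4 + f 5 + (f 6 :: 'a::comm_ring_1)"
  by (rule labelling_sum[OF labelling_id])

lemma alternating_double_sum:
  fixes d :: "nat \<Rightarrow> nat \<Rightarrow> 'a::comm_ring_1"
  assumes "alternating d"
  shows "(\<Sum>j\<in>{1..6}. \<Sum>k\<in>{1..6}. a j * b k * d k j) =
    (b 1 * a 2 - b 2 * a 1) * d 1 2 + (b 1 * a 3 - b 3 * a 1) * d 1 3 + (b 1 * a 4 - b 4 * a 1) * d 1 4 + (b 1 * a 5 - b 5 * a 1) * d 1 5 + (b 1 * a 6 - b 6 * a 1) * d 1 6 + (b 2 * a 3 - b 3 * a 2) * d 2 3 + (b 2 * a 4 - b 4 * a 2) * d 2 4 + (b 2 * a 5 - b 5 * a 2) * d 2 5 + (b 2 * a 6 - b 6 * a 2) * d 2 6 + (b 3 * a 4 - b 4 * a 3) * d 3 4 + (b 3 * a 5 - b 5 * a 3) * d 3 5 + (b 3 * a 6 - b 6 * a 3) * d 3 6 + (b 4 * a 5 - b 5 * a 4) * d 4 5 + (b 4 * a 6 - b 6 * a 4) * d 4 6 + (b 5 * a 6 - b 6 * a 5) * d 5 6"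
proof -
  have d: "d j i = - d i j" "d i i = 0" for i j using assms unfolding alternating_def by blast+
  show ?thesis unfolding sum_six d(2) d(1)[of 2 1] d(1)[of 3 1] d(1)[of 4 1] d(1)[of 5 1] d(1)[of 6 1] d(1)[of 3 2] d(1)[of 4 2] d(1)[of 5 2] d(1)[of 6 2] d(1)[of 4 3] d(1)[of 5 3] d(1)[of 6 3] d(1)[of 5 4] d(1)[of 6 4] d(1)[of 6 5]
    by (simp add: algebra_simps)
qed

lemma pderiv_sum': "pderiv (\<Sum>i\<in>A. f i) = (\<Sum>i\<in>A. pderiv (f i))"
  by (induction A rule: infinite_finite_induct) (simp_all add: pderiv_add)

text \<open>By the chain rule the derivative of the cubic along a curve is a combination of its partial
  derivatives, which vanish by hypothesis; by homogeneity so does the value.\<close>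

lemma E7_cubic_pderiv:
  fixes A B :: "nat \<Rightarrow> 'a::field_char_0 poly" and Y :: "nat \<Rightarrow> nat \<Rightarrow> 'a poly"
  assumes E: "E6rel (\<lambda>j. poly (B j) c) (\<lambda>j. poly (A j) c) (\<lambda>i j. poly (Y i j) c)" and Y: "alternating Y"
  shows "poly (E7_cubic B A Y) c = 0" "poly (pderiv (E7_cubic B A Y)) c = 0"
proof -
  define a b y d a' b' where "a j = poly (A j) c" and "b j = poly (B j) c" and "y i j = poly (Y i j) c"
    and "d i j = poly (pderiv (Y i j)) c" and "a' j = poly (pderiv (A j)) c" and "b' j = poly (pderiv (B j)) c" for i j
  note R = E6rel_sorted[OF E, folded a_def b_def y_def]
  have bcol: "(\<Sum>k\<in>{1..6}. b k * y k j) = 0" and acol: "(\<Sum>k\<in>{1..6}. a k * y k j) = 0" if "j \<in> {1..6}" for j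
    using E that unfolding E6rel_def a_def b_def y_def by blast+
  have "Y j i = - Y i j" "Y i i = 0" for i j using Y unfolding alternating_def by blast+
  then have d: "alternating d" and yalt: "alternating y"
    unfolding alternating_def d_def y_def by (metis pderiv_0 poly_0 pderiv_minus poly_minus)+
  have y': "y j i = - y i j" "y i i = 0" for i j using yalt unfolding alternating_def by blast+
  have "poly (E7_cubic B A Y) c = (\<Sum>j\<in>{1..6}. a j * (\<Sum>k\<in>{1..6}. b k * y k j)) + (y 1 2 * (y 3 4 * y 5 6 - y 3 5 * y 4 6 + y 3 6 * y 4 5)
      - y 1 3 * (y 2 4 * y 5 6 - y 2 5 * y 4 6 + y 2 6 * y 4 5)
      + y 1 4 * (y 2 3 * y 5 6 - y 2 5 * y 3 6 + y 2 6 * y 3 5)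
      - y 1 5 * (y 2 3 * y 4 6 - y 2 4 * y 3 6 + y 2 6 * y 3 4)
      + y 1 6 * (y 2 3 * y 4 5 - y 2 4 * y 3 5 + y 2 5 * y 3 4))"
    unfolding E7_cubic_def by (simp add: poly_sum a_def b_def y_def sum_distrib_left mult_ac del: One_nat_def)
  also have "(\<Sum>j\<in>{1..6}. a j * (\<Sum>k\<in>{1..6}. b k * y k j)) = 0" by (rule sum.neutral) (use bcol in simp)
  also have "0 + (y 1 2 * (y 3 4 * y 5 6 - y 3 5 * y 4 6 + y 3 6 * y 4 5)
      - y 1 3 * (y 2 4 * y 5 6 - y 2 5 * y 4 6 + y 2 6 * y 4 5)
      + y 1 4 * (y 2 3 * y 5 6 - y 2 5 * y 3 6 + y 2 6 * y 3 5)
      - y 1 5 * (y 2 3 * y 4 6 - y 2 4 * y 3 6 + y 2 6 * y 3 4)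
      + y 1 6 * (y 2 3 * y 4 5 - y 2 4 * y 3 5 + y 2 5 * y 3 4)) =
     y 1 2 * (b 1 * a 2 - b 2 * a 1 + (y 3 4 * y 5 6 - y 3 5 * y 4 6 + y 3 6 * y 4 5))
     + y 1 3 * (b 1 * a 3 - b 3 * a 1 - (y 2 4 * y 5 6 - y 2 5 * y 4 6 + y 2 6 * y 4 5))
     + y 1 4 * (b 1 * a 4 - b 4 * a 1 + (y 2 3 * y 5 6 - y 2 5 * y 3 6 + y 2 6 * y 3 5))
     + y 1 5 * (b 1 * a 5 - b 5 * a 1 - (y 2 3 * y 4 6 - y 2 4 * y 3 6 + y 2 6 * y 3 4))
     + y 1 6 * (b 1 * a 6 - b 6 * a 1 + (y 2 3 * y 4 5 - y 2 4 * y 3 5 + y 2 5 * y 3 4))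
     - a 1 * (\<Sum>k\<in>{1..6}. b k * y k 1) + b 1 * (\<Sum>k\<in>{1..6}. a k * y k 1)"
    unfolding sum_six y'(2) y'(1)[of 2 1] y'(1)[of 3 1] y'(1)[of 4 1] y'(1)[of 5 1] y'(1)[of 6 1]
    by (simp add: algebra_simps)
  also have "\<dots> = 0" using bcol[of 1] acol[of 1] unfolding R by simp
  finally show "poly (E7_cubic B A Y) c = 0" .
  have "poly (pderiv (E7_cubic B A Y)) c =
     (\<Sum>j\<in>{1..6}. \<Sum>k\<in>{1..6}. b' k * (a j * y k j)) + (\<Sum>j\<in>{1..6}. a' j * (\<Sum>k\<in>{1..6}. b k * y k j)) + (\<Sum>j\<in>{1..6}. \<Sum>k\<in>{1..6}. a j * b k * d k j)
     + (d 1 2 * (y 3 4 * y 5 6 - y 3 5 * y 4 6 + y 3 6 * y 4 5) - d 1 3 * (y 2 4 * y 5 6 - y 2 5 * y 4 6 + y 2 6 * y 4 5) + d 1 4 * (y 2 3 * y 5 6 - y 2 5 * y 3 6 + y 2 6 * y 3 5) - d 1 5 * (y 2 3 * y 4 6 - y 2 4 * y 3 6 + y 2 6 * y 3 4) + d 1 6 * (y 2 3 * y 4 5 - y 2 4 * y 3 5 + y 2 5 * y 3 4) + d 2 3 * (y 1 4 * y 5 6 - y 1 5 * y 4 6 + y 1 6 * y 4 5) - d 2 4 * (y 1 3 * y 5 6 - y 1 5 * y 3 6 + y 1 6 * y 3 5) + d 2 5 * (y 1 3 * y 4 6 - y 1 4 * y 3 6 + y 1 6 * y 3 4) - d 2 6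 * (y 1 3 * y 4 5 - y 1 4 * y 3 5 + y 1 5 * y 3 4) + d 3 4 * (y 1 2 * y 5 6 - y 1 5 * y 2 6 + y 1 6 * y 2 5) - d 3 5 * (y 1 2 * y 4 6 - y 1 4 * y 2 6 + y 1 6 * y 2 4) + d 3 6 * (y 1 2 * y 4 5 - y 1 4 * y 2 5 + y 1 5 * y 2 4) + d 4 5 * (y 1 2 * y 3 6 - y 1 3 * y 2 6 + y 1 6 * y 2 3) - d 4 6 * (y 1 2 * y 3 5 - y 1 3 * y 2 5 + y 1 5 * y 2 3) + d 5 6 * (y 1 2 * y 3 4 - y 1 3 * y 2 4 + y 1 4 * y 2 3))"
    unfolding E7_cubic_def pderiv_add pderiv_diff pderiv_sum' pderiv_mult
    unfolding poly_add poly_diff poly_sum poly_mult a_def[symmetric] b_def[symmetric] y_def[symmetric] d_def[symmetric] a'_def[symmetric] b'_def[symmetric]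
    by (simp add: sum.distrib sum_distrib_left del: One_nat_def) (simp add: algebra_simps sum.distrib del: One_nat_def)
  also have "(\<Sum>j\<in>{1..6}. a' j * (\<Sum>k\<in>{1..6}. b k * y k j)) = 0" by (rule sum.neutral) (use bcol in simp)
  also have "(\<Sum>j\<in>{1..6}. \<Sum>k\<in>{1..6}. b' k * (a j * y k j)) = (\<Sum>k\<in>{1..6}. b' k * - (\<Sum>j\<in>{1..6}. a j * y j k))"
  proof (subst sum.swap, rule sum.cong[OF refl])
    fix k :: nat assume "k \<in> {1..6}"
    have "y k j = - y j k" for j by (rule y'(1))
    then show "(\<Sum>j\<in>{1..6}. b' k * (a j * y k j)) = b' k * - (\<Sum>j\<in>{1..6}. a j * y j k)"
      by (simp only: sum_distrib_left mult_minus_right sum_negf)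
  qed
  also have "\<dots> = 0" by (rule sum.neutral) (use acol in simp)
  also have "0 + 0 + (\<Sum>j\<in>{1..6}. \<Sum>k\<in>{1..6}. a j * b k * d k j)
     + (d 1 2 * (y 3 4 * y 5 6 - y 3 5 * y 4 6 + y 3 6 * y 4 5) - d 1 3 * (y 2 4 * y 5 6 - y 2 5 * y 4 6 + y 2 6 * y 4 5) + d 1 4 * (y 2 3 * y 5 6 - y 2 5 * y 3 6 + y 2 6 * y 3 5) - d 1 5 * (y 2 3 * y 4 6 - y 2 4 * y 3 6 + y 2 6 * y 3 4) + d 1 6 * (y 2 3 * y 4 5 - y 2 4 * y 3 5 + y 2 5 * y 3 4) + d 2 3 * (y 1 4 * y 5 6 - y 1 5 * y 4 6 + y 1 6 * y 4 5) - d 2 4 * (y 1 3 * y 5 6 - y 1 5 * y 3 6 + y 1 6 * y 3 5) + d 2 5 * (y 1 3 * y 4 6 - y 1 4 * y 3 6 + y 1 6 * y 3 4) - d 2 6 * (y 1 3 * y 4 5 - y 1 4 * y 3 5 + y 1 5 * y 3 4) + d 3 4 * (y 1 2 * y 5 6 - y 1 5 * y 2 6 + y 1 6 * y 2 5) - d 3 5 * (y 1 2 * y 4 6 - y 1 4 * y 2 6 + y 1 6 * y 2 4) + d 3 6 * (y 1 2 * y 4 5 - y 1 4 * y 2 5 + y 1 5 * y 2 4) + d 4 5 * (y 1 2 * y 3 6 - y 1 3 * y 2 6 + y 1 6 * y 2 3) - d 4 6 * (y 1 2 * y 3 5 - y 1 3 * y 2 5 + y 1 5 * y 2 3) + d 5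 6 * (y 1 2 * y 3 4 - y 1 3 * y 2 4 + y 1 4 * y 2 3)) =
     d 1 2 * (b 1 * a 2 - b 2 * a 1 + (y 3 4 * y 5 6 - y 3 5 * y 4 6 + y 3 6 * y 4 5))
       + d 1 3 * (b 1 * a 3 - b 3 * a 1 - (y 2 4 * y 5 6 - y 2 5 * y 4 6 + y 2 6 * y 4 5))
       + d 1 4 * (b 1 * a 4 - b 4 * a 1 + (y 2 3 * y 5 6 - y 2 5 * y 3 6 + y 2 6 * y 3 5))
       + d 1 5 * (b 1 * a 5 - b 5 * a 1 - (y 2 3 * y 4 6 - y 2 4 * y 3 6 + y 2 6 * y 3 4))
       + d 1 6 * (b 1 * a 6 - b 6 * a 1 + (y 2 3 * y 4 5 - y 2 4 * y 3 5 + y 2 5 * y 3 4))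
       + d 2 3 * (b 2 * a 3 - b 3 * a 2 + (y 1 4 * y 5 6 - y 1 5 * y 4 6 + y 1 6 * y 4 5))
       + d 2 4 * (b 2 * a 4 - b 4 * a 2 - (y 1 3 * y 5 6 - y 1 5 * y 3 6 + y 1 6 * y 3 5))
       + d 2 5 * (b 2 * a 5 - b 5 * a 2 + (y 1 3 * y 4 6 - y 1 4 * y 3 6 + y 1 6 * y 3 4))
       + d 2 6 * (b 2 * a 6 - b 6 * a 2 - (y 1 3 * y 4 5 - y 1 4 * y 3 5 + y 1 5 * y 3 4))
       + d 3 4 * (b 3 * a 4 - b 4 * a 3 + (y 1 2 * y 5 6 - y 1 5 * y 2 6 + y 1 6 * y 2 5))
       + d 3 5 * (b 3 * a 5 - b 5 * a 3 - (y 1 2 * y 4 6 - y 1 4 * y 2 6 + y 1 6 * y 2 4))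
       + d 3 6 * (b 3 * a 6 - b 6 * a 3 + (y 1 2 * y 4 5 - y 1 4 * y 2 5 + y 1 5 * y 2 4))
       + d 4 5 * (b 4 * a 5 - b 5 * a 4 + (y 1 2 * y 3 6 - y 1 3 * y 2 6 + y 1 6 * y 2 3))
       + d 4 6 * (b 4 * a 6 - b 6 * a 4 - (y 1 2 * y 3 5 - y 1 3 * y 2 5 + y 1 5 * y 2 3))
       + d 5 6 * (b 5 * a 6 - b 6 * a 5 + (y 1 2 * y 3 4 - y 1 3 * y 2 4 + y 1 4 * y 2 3))"
    unfolding alternating_double_sum[OF d] by (simp add: algebra_simps)
  also have "\<dots> = 0" unfolding R by simp
  finally show "poly (pderiv (E7_cubic B A Y)) c = 0" .
qed

lemma poly_double_root:
  fixes R :: "'a::field_char_0 poly"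
  assumes "poly R 0 = 0" "poly (pderiv R) 0 = 0"
  obtains S where "\<And>t. poly R t = t\<^sup>2 * poly S t"
proof -
  obtain R' where R': "R = [:0, 1:] * R'" using assms(1) poly_eq_0_iff_dvd[of R 0] by (auto simp: dvd_def)
  have "pderiv R = R' + [:0, 1:] * pderiv R'" unfolding R' pderiv_mult by (simp add: pderiv_pCons)
  then have "poly R' 0 = 0" using assms(2) by simp
  then obtain S where S: "R' = [:0, 1:] * S" using poly_eq_0_iff_dvd[of R' 0] by (auto simp: dvd_def)
  have "poly R t = t\<^sup>2 * poly S t" for t unfolding R' S by (simp add: power2_eq_square)
  then show ?thesis by (rule that)
qed

section \<open>Parameters, factors of the lines, and sparse test parameters\<close>

lemma witness:
  obtains t :: "pic \<Rightarrow> 'a::zero_neq_one" where "\<And>i. i \<in> {1..7} \<Longrightarrow> t (exc i) = (if i \<in> B then 1 else 0)"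
    "\<And>i j. i \<in> {1..7} \<Longrightarrow> j \<in> {1..7} \<Longrightarrow> i \<noteq> j \<Longrightarrow> t (m_class i j) = (if {i, j} \<in> S then 1 else 0)"
    "t (Q7_class 6 7) = q"
proof -
  obtain h :: "pic \<Rightarrow> 'a" where h: "\<And>i. i \<in> {1..7} \<Longrightarrow> h (exc i) = (if i \<in> B then 1 else 0)"
    "\<And>i j. i \<in> {1..7} \<Longrightarrow> j \<in> {1..7} \<Longrightarrow> i < j \<Longrightarrow> h (m_class i j) = (if {i, j} \<in> S then 1 else 0)"
    "\<And>i j. i \<in> {1..7} \<Longrightarrow> j \<in> {1..7} \<Longrightarrow> i < j \<Longrightarrow> h (Q7_class i j) = q"
    by (rule class_function[of "\<lambda>i. if i \<in> B then 1 else 0" "\<lambda>i j. if {i, j} \<in> S then 1 else 0" "\<lambda>i j. q" "\<lambda>_. 0"]) blast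
  have "h (m_class i j) = (if {i, j} \<in> S then 1 else 0)" if "i \<in> {1..7}" "j \<in> {1..7}" "i \<noteq> j" for i j
  proof (cases "i < j")
    case False
    then have "j < i" using that by simp
    then show ?thesis using h(2)[OF that(2,1)] by (simp add: m_class_commute insert_commute)
  qed (use h that in simp)
  then show ?thesis using that[of h] h(1) h(3)[of 6 7] by simp
qed

lemma cofactor_zero:
  assumes "i \<in> {1..6}" "j \<in> {1..6}" "i \<noteq> j" "alternating y"
    and z: "\<And>a b. a \<in> {1..6} - {i, j} \<Longrightarrow> b \<in> {1..6} - {i, j} \<Longrightarrow> y a b = 0"
  shows "cofactor y i j = (0 :: 'a::field)"
proof -
  obtain \<sigma> k l m n where L: "labelling (\<sigma>::'a) i j k l m n" using labelling_exists assms(1-3) by metis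
  have "k \<in> {1..6} - {i, j}" "l \<in> {1..6} - {i, j}" "m \<in> {1..6} - {i, j}" "n \<in> {1..6} - {i, j}"
    using labelling_range[OF L] labelling_distinct[OF L] by auto
  then show ?thesis unfolding cofactor_eq[OF L assms(4)] pf4_def by (simp add: z)
qed

lemma exc_lines_degree: "E \<in> exc ` {1..n} \<union> {m_class i j | i j. 1 \<le> i \<and> i < j \<and> j \<le> k} \<Longrightarrow> cf E 0 < 2"
  by (auto simp: lookup_class)

lemma card_exc_lines:
  "card (exc ` {1..n} \<union> {m_class i j | i j. 1 \<le> i \<and> i < j \<and> j \<le> k}) = n + (k choose 2)"
  "finite (exc ` {1..n} \<union> {m_class i j | i j. 1 \<le> i \<and> i < j \<and> j \<le> k})"
proof -
  let ?M = "{m_class i j | i j. 1 \<le> i \<and> i < j \<and> j \<le> k}"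
  have c: "card ?M = k choose 2" "finite ?M"
    unfolding line_classes[symmetric] by (rule card_classes finite_classes)+
  have "exc ` {1..n} \<inter> ?M = {}"
  proof (rule equals0I)
    fix E assume "E \<in> exc ` {1..n} \<inter> ?M"
    then have E: "E \<in> exc ` {1..n}" "E \<in> ?M" by blast+
    have "cf E 0 = 0" using E(1) by (auto simp: lookup_class)
    moreover have "cf E 0 = 1" using E(2) by (auto simp: lookup_class)
    ultimately show False by simp
  qed
  then show "card (exc ` {1..n} \<union> ?M) = n + (k choose 2)" using c card_exc[of n] by (subst card_Un_disjoint) simp_all
  show "finite (exc ` {1..n} \<union> ?M)" using c by simp
qed

context sections67 begin

definition exc_value :: "nat \<Rightarrow> 'a" where "exc_value i = G (exc i) 0"

lemma exc_value_r: "i \<in> {1..r} \<Longrightarrow> G (exc i) x = exc_value i" "i \<in> {1..r} \<Longrightarrow> exc_value i \<noteq> 0"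
  using G_exc[of i] unfolding exc_value_def by metis+

text \<open>The rescaled section of \<open>E\<^sub>i\<close>, a constant.\<close>

definition bb :: "(pic \<Rightarrow> 'a) \<Rightarrow> nat \<Rightarrow> 'a" where "bb t i = t (exc i) * exc_value i"

text \<open>An arbitrary point off the curve \<open>E\<close>, at which the factor between two proportional curves is read
  off.\<close>

definition nonzero_point :: "pic \<Rightarrow> 'a^3" where "nonzero_point E = (SOME z. G E z \<noteq> 0)"

lemma nonzero_point: "E \<in> neg_curves r \<Longrightarrow> G E (nonzero_point E) \<noteq> 0"
  unfolding nonzero_point_def by (rule someI_ex[OF G_nz])

text \<open>Sparse parameters, for which most terms in the formulas for the dependent factors disappear.\<close>

definition adapted :: "nat set \<Rightarrow> nat set set \<Rightarrow> 'a \<Rightarrow> (pic \<Rightarrow> 'a) \<Rightarrow> bool" where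
  "adapted B S q t \<longleftrightarrow> (\<forall>i\<in>{1..7}. t (exc i) = (if i \<in> B then 1 else 0)) \<and>
     (\<forall>i\<in>{1..7}. \<forall>j\<in>{1..7}. i \<noteq> j \<longrightarrow> t (m_class i j) = (if {i, j} \<in> S then 1 else 0)) \<and> t (Q7_class 6 7) = q"

lemma adapted_exists: obtains t where "adapted B S q t"
proof -
  obtain t :: "pic \<Rightarrow> 'a" where "\<And>i. i \<in> {1..7} \<Longrightarrow> t (exc i) = (if i \<in> B then 1 else 0)"
    "\<And>i j. i \<in> {1..7} \<Longrightarrow> j \<in> {1..7} \<Longrightarrow> i \<noteq> j \<Longrightarrow> t (m_class i j) = (if {i, j} \<in> S then 1 else 0)"
    "t (Q7_class 6 7) = q" by (rule witness) blast
  then show ?thesis using that unfolding adapted_def by blast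
qed

lemma adapted_bb_r: "adapted B S q t \<Longrightarrow> i \<in> {1..r} \<Longrightarrow> bb t i = (if i \<in> B then exc_value i else 0)"
proof -
  assume "adapted B S q t" "i \<in> {1..r}"
  moreover have "r \<le> 7" using r67 by auto
  ultimately show ?thesis unfolding adapted_def bb_def by simp
qed

end

context sections67 begin

lemma pivot: "r - 1 \<in> {1..6}" "r - 1 \<in> {1..r}" "r \<in> {1..r}" "r - 1 \<noteq> r"
  using r67 by auto

lemma inner: "i \<in> {1..r - 2} \<Longrightarrow> i \<in> {1..6} \<and> i \<in> {1..7} \<and> i \<in> {1..r} \<and> i \<in> {1..r - 1} \<and> i \<noteq> r - 1 \<and> i \<noteq> r"
  using r67 by auto

text \<open>The curves whose factors are the parameters: 12 for \<open>r = 6\<close> and 18 for \<open>r = 7\<close>.\<close>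

definition T :: "pic set" where
  "T = exc ` {1..r} \<union> {m_class i j | i j. 1 \<le> i \<and> i < j \<and> j \<le> r - 2} \<union> (if r = 7 then {Q7_class 6 7} else {})"

text \<open>Up to constants, the denominators of all factors are powers of this product.\<close>

definition \<delta> :: "(pic \<Rightarrow> 'a) \<Rightarrow> 'a" where "\<delta> t = t (exc r) * t (exc (r - 1))"

text \<open>The factor of the line through \<open>p\<^sub>i\<close> and \<open>p\<^sub>r\<^sub>-\<^sub>1\<close> that makes the \<open>i\<close>th entry of the row vector \<open>b y\<close> vanish
  at \<open>p\<^sub>r\<close>.\<close>

definition pivot_factor :: "(pic \<Rightarrow> 'a) \<Rightarrow> nat \<Rightarrow> 'a" where
  "pivot_factor t i = (\<Sum>k\<in>{1..r - 2}. bb t k * (sg k i * (t (m_class k i) * G (m_class k i) (p r))))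
     / bb t (r - 1) / G (m_class i (r - 1)) (p r)"

text \<open>Factors of the lines that do not pass through \<open>p\<^sub>r\<close>. The value 0 for other indices lets sums run over
  \<open>{1..6}\<close> in both cases.\<close>

definition line_factor :: "(pic \<Rightarrow> 'a) \<Rightarrow> nat \<Rightarrow> nat \<Rightarrow> 'a" where
  "line_factor t i j = (if i \<in> {1..r - 1} \<and> j \<in> {1..r - 1}
     then if i = r - 1 then pivot_factor t j else if j = r - 1 then pivot_factor t i else t (m_class i j) else 0)"

abbreviation YY :: "(pic \<Rightarrow> 'a) \<Rightarrow> 'a^3 \<Rightarrow> nat \<Rightarrow> nat \<Rightarrow> 'a" where "YY t x \<equiv> lines (line_factor t) x"

text \<open>The entry \<open>j\<close> of the row vector \<open>b y\<close>. As a function of \<open>x\<close> it is a line.\<close>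

definition by_form :: "(pic \<Rightarrow> 'a) \<Rightarrow> 'a^3 \<Rightarrow> nat \<Rightarrow> 'a" where
  "by_form t x j = (\<Sum>k\<in>{1..6}. bb t k * YY t x k j)"

lemma line_factor_sym: "line_factor t i j = line_factor t j i"
  by (auto simp: line_factor_def m_class_commute)

lemma YY_alt: "alternating (YY t x)"
  by (rule lines_alternating) (rule line_factor_sym)

lemma YY_swap: "YY t x j i = - YY t x i j" and YY_refl: "YY t x i i = 0"
  using YY_alt[of t x] unfolding alternating_def by blast+

lemma line_factor_inner: "i \<in> {1..r - 2} \<Longrightarrow> j \<in> {1..r - 2} \<Longrightarrow> line_factor t i j = t (m_class i j)"
  using inner[of i] inner[of j] by (simp add: line_factor_def)

lemma YY_inner: "i \<in> {1..r - 2} \<Longrightarrow> j \<in> {1..r - 2} \<Longrightarrow> YY t x i j = sg i j * (t (m_class i j) * G (m_class i j) x)"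
  by (simp add: lines_def line_factor_inner del: atLeastAtMost_iff)

lemma YY_pivot: "i \<in> {1..r - 2} \<Longrightarrow> YY t x i (r - 1) = pivot_factor t i * G (m_class i (r - 1)) x"
proof -
  assume i: "i \<in> {1..r - 2}"
  then have "i < r - 1" by auto
  then show ?thesis using inner[OF i] by (auto simp: lines_def line_factor_def sg_def)
qed

lemma YY_outside: "i \<notin> {1..r - 1} \<Longrightarrow> YY t x i j = 0 \<and> YY t x j i = 0"
  unfolding lines_def line_factor_def by (simp del: atLeastAtMost_iff)

lemma \<delta>_nz_r: "\<delta> t \<noteq> 0 \<Longrightarrow> bb t (r - 1) \<noteq> 0 \<and> bb t r \<noteq> 0"
  unfolding \<delta>_def bb_def using exc_value_r(2)[OF pivot(2)] exc_value_r(2)[OF pivot(3)] by auto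

lemma by_form_split:
  assumes "j \<in> {1..r - 2}"
  shows "by_form t x j = bb t (r - 1) * YY t x (r - 1) j + (\<Sum>k\<in>{1..r - 2}. bb t k * YY t x k j)"
proof -
  have "by_form t x j = (\<Sum>k\<in>{1..r - 1}. bb t k * YY t x k j)"
    unfolding by_form_def using r67 YY_outside by (intro sum.mono_neutral_right) auto
  also have "{1..r - 1} = insert (r - 1) {1..r - 2}" using r67 by auto
  finally show ?thesis using r67 by auto
qed

lemma by_form_zero: "j \<in> {1..6} \<Longrightarrow> by_form t (p j) j = 0"
  unfolding by_form_def by (rule sum.neutral) (use lines_zero in auto)

text \<open>The factors \<open>pivot_factor t j\<close> were chosen for this; the entry at the index \<open>r - 1\<close> itself is covered by
  \<open>alternating_kernel\<close>.\<close>

lemma by_form_last: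
  assumes d: "\<delta> t \<noteq> 0" and j: "j \<in> {1..6}"
  shows "by_form t (p r) j = 0"
  unfolding by_form_def
proof (rule alternating_kernel[OF YY_alt _ pivot(1) _ _ j])
  show b: "bb t (r - 1) \<noteq> 0" using \<delta>_nz_r[OF d] by simp
  fix j assume j: "j \<in> {1..6}" "j \<noteq> r - 1"
  show "(\<Sum>k\<in>{1..6}. bb t k * YY t (p r) k j) = 0"
  proof (cases "j \<in> {1..r - 2}")
    case True
    note i = inner[OF True]
    have nz: "G (m_class j (r - 1)) (p r) \<noteq> 0" using G_m(4)[of j "r - 1" r] i pivot by auto
    have "(\<Sum>k\<in>{1..r - 2}. bb t k * YY t (p r) k j) = bb t (r - 1) * (pivot_factor t j * G (m_class j (r - 1)) (p r))"
      unfolding pivot_factor_def using b nz YY_inner[OF _ True] by simp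
    moreover have "YY t (p r) (r - 1) j = - (pivot_factor t j * G (m_class j (r - 1)) (p r))"
      unfolding YY_swap[of t "p r" "r - 1" j] YY_pivot[OF True] ..
    ultimately show ?thesis using by_form_split[OF True, of t "p r"] unfolding by_form_def by simp
  next
    case False
    then have "j \<notin> {1..r - 1}" using j r67 by auto
    then show ?thesis by (simp add: YY_outside)
  qed
qed simp

lemma by_form_form: "j \<in> {1..6} \<Longrightarrow> ternary_form 1 (\<lambda>x. by_form t x j)"
  unfolding by_form_def by (intro form_sum form_scale lines_form)

text \<open>The line passes through \<open>p\<^sub>j\<close> and \<open>p\<^sub>r\<close>.\<close>

lemma by_form_multiple:
  assumes d: "\<delta> t \<noteq> 0" and j: "j \<in> {1..r - 1}" and z: "G (m_class j r) z \<noteq> 0"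
  shows "by_form t x j = by_form t z j / G (m_class j r) z * G (m_class j r) x"
proof (rule line_unique[where i = j and j = r])
  have jr: "j \<in> {1..r}" "r \<in> {1..r}" "j \<noteq> r" "j \<in> {1..6}" using j r67 by auto
  show "ternary_form 1 (\<lambda>x. by_form t x j)" "by_form t (p j) j = 0" "by_form t (p r) j = 0"
    by (rule by_form_form[OF jr(4)] by_form_zero[OF jr(4)] by_form_last[OF d jr(4)])+
  show "ternary_form 1 (G (m_class j r))" "G (m_class j r) (p j) = 0" "G (m_class j r) (p r) = 0"
    by (rule G_m[OF jr(1-3)])+
  show "j \<in> {1..r}" "r \<in> {1..r}" "j \<noteq> r" by (rule jr)+
qed (rule z)

lemma coord_poly: "E \<in> T \<Longrightarrow> (\<lambda>t. t E) \<in> polyfun (affine_coords T)"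
  by (auto intro!: polyfun_coord simp: affine_coords_def)

lemma T_mem: "i \<in> {1..r} \<Longrightarrow> exc i \<in> T"
  "i \<in> {1..r - 2} \<Longrightarrow> j \<in> {1..r - 2} \<Longrightarrow> i \<noteq> j \<Longrightarrow> m_class i j \<in> T"
proof -
  show "i \<in> {1..r} \<Longrightarrow> exc i \<in> T" unfolding T_def by blast
  have *: "m_class i j \<in> T" if "i \<in> {1..r - 2}" "j \<in> {1..r - 2}" "i < j" for i j
    using that unfolding T_def by fastforce
  assume "i \<in> {1..r - 2}" "j \<in> {1..r - 2}" "i \<noteq> j"
  then show "m_class i j \<in> T" using *[of i j] *[of j i] m_class_commute[of i j] by (cases "i < j") auto
qed

abbreviation RF where "RF \<equiv> ratfun T \<delta>"

lemma \<delta>_poly: "\<delta> \<in> polyfun (affine_coords T)"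
  unfolding \<delta>_def[abs_def] by (intro polyfun_mult coord_poly T_mem pivot)

lemma RF_coord: "E \<in> T \<Longrightarrow> RF (\<lambda>t. t E)"
  by (rule ratfun_coord[OF \<delta>_poly])

lemma RF_const: "RF (\<lambda>t. c)"
  by (rule ratfun_const[OF \<delta>_poly])

lemma RF_divide_r: "RF f \<Longrightarrow> RF (\<lambda>t. f t / bb t (r - 1))" "RF f \<Longrightarrow> RF (\<lambda>t. f t / bb t r)"
proof -
  have T: "exc r \<in> T" "exc (r - 1) \<in> T" by (rule T_mem pivot)+
  assume f: "RF f"
  show "RF (\<lambda>t. f t / bb t (r - 1))" unfolding bb_def divide_divide_eq_left[symmetric]
    by (rule ratfun_divide_const) (use f ratfun_divide_coord(2)[OF T, of f] in \<open>simp add: \<delta>_def[abs_def]\<close>)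
  show "RF (\<lambda>t. f t / bb t r)" unfolding bb_def divide_divide_eq_left[symmetric]
    by (rule ratfun_divide_const) (use f ratfun_divide_coord(1)[OF T, of f] in \<open>simp add: \<delta>_def[abs_def]\<close>)
qed

lemma RF_bb: "i \<in> {1..6} \<Longrightarrow> RF (\<lambda>t. bb t i)"
  unfolding bb_def by (intro ratfun_mult RF_coord RF_const T_mem six)

lemma RF_pivot_factor: "i \<in> {1..r - 2} \<Longrightarrow> RF (\<lambda>t. pivot_factor t i)"
  unfolding pivot_factor_def
proof (intro ratfun_divide_const RF_divide_r ratfun_sum[OF \<delta>_poly])
  fix k :: nat assume i: "i \<in> {1..r - 2}" and k: "k \<in> {1..r - 2}"
  show "RF (\<lambda>t. bb t k * (sg k i * (t (m_class k i) * G (m_class k i) (p r))))"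
  proof (cases "k = i")
    case True then show ?thesis by (simp add: sg_refl RF_const)
  next
    case False then show ?thesis using i k inner[OF k] by (intro ratfun_mult RF_bb RF_const RF_coord T_mem) auto
  qed
qed

lemma RF_line_factor: "i \<noteq> j \<Longrightarrow> RF (\<lambda>t. line_factor t i j)"
proof -
  assume ij: "i \<noteq> j"
  consider "i \<notin> {1..r - 1} \<or> j \<notin> {1..r - 1}" | "i = r - 1" "j \<in> {1..r - 2}" | "j = r - 1" "i \<in> {1..r - 2}"
    | "i \<in> {1..r - 2}" "j \<in> {1..r - 2}" using ij r67 by force
  then show ?thesis
  proof cases
    case 1 then show ?thesis by (auto simp: line_factor_def RF_const)
  next
    case 2 then show ?thesis using RF_pivot_factor[of j] inner[of j] RF_const by (simp add: line_factor_def)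
  next
    case 3 then show ?thesis using RF_pivot_factor[of i] inner[of i] RF_const by (simp add: line_factor_def)
  next
    case 4
    then show ?thesis using RF_coord[OF T_mem(2)[OF 4 ij]] inner[OF 4(1)] inner[OF 4(2)] by (simp add: line_factor_def)
  qed
qed

lemma RF_YY: "RF (\<lambda>t. YY t x i j)"
proof (cases "i = j")
  case True then show ?thesis by (simp add: lines_def sg_refl RF_const)
next
  case False
  then show ?thesis unfolding lines_def by (intro ratfun_mult RF_const RF_line_factor False)
qed

lemma RF_cofactor: assumes "i \<in> {1..6}" "j \<in> {1..6}" "i \<noteq> j" shows "RF (\<lambda>t. cofactor (YY t x) i j)"
proof -
  obtain \<sigma> k l m n where L: "labelling (\<sigma>::'a) i j k l m n" using labelling_exists assms by metis
  show ?thesis unfolding cofactor_eq[OF L YY_alt] pf4_def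
    by (intro ratfun_mult ratfun_add ratfun_diff RF_const RF_YY)
qed

lemma RF_by_form: "RF (\<lambda>t. by_form t x j)"
  unfolding by_form_def by (intro ratfun_sum[OF \<delta>_poly] ratfun_mult RF_bb RF_YY)

lemma adapted_\<delta>_r: "adapted B S q t \<Longrightarrow> r - 1 \<in> B \<Longrightarrow> r \<in> B \<Longrightarrow> \<delta> t \<noteq> 0"
  unfolding adapted_def \<delta>_def using r67 by auto

lemma adapted_m: "adapted B S q t \<Longrightarrow> i \<in> {1..r - 2} \<Longrightarrow> j \<in> {1..r - 2} \<Longrightarrow> i \<noteq> j \<Longrightarrow>
    t (m_class i j) = (if {i, j} \<in> S then 1 else 0)"
  using inner[of i] inner[of j] unfolding adapted_def by blast

lemma adapted_YY_r:
  assumes t: "adapted B S q t" and i: "i \<in> {1..r - 2}" and j: "j \<in> {1..r - 2}"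
  shows "YY t x i j = (if {i, j} \<in> S then sg i j * G (m_class i j) x else 0)"
  using adapted_m[OF t i j] YY_inner[OF i j] by (cases "i = j") (simp_all add: sg_refl)

lemma adapted_pivot_factor_zero_r:
  assumes t: "adapted B S q t" and i: "i \<in> {1..r - 2}"
    and o: "\<And>l. l \<in> {1..r - 2} - {i} \<Longrightarrow> l \<notin> B \<or> {l, i} \<notin> S"
  shows "pivot_factor t i = 0"
proof -
  have "bb t l * (sg l i * (t (m_class l i) * G (m_class l i) (p r))) = 0" if l: "l \<in> {1..r - 2}" for l
    using o[of l] l adapted_bb_r[OF t, of l] inner[OF l] adapted_m[OF t l i] by (cases "l = i") (auto simp: sg_refl)
  then have "(\<Sum>l\<in>{1..r - 2}. bb t l * (sg l i * (t (m_class l i) * G (m_class l i) (p r)))) = 0" by (intro sum.neutral ballI)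
  then show ?thesis unfolding pivot_factor_def by (simp only: div_0)
qed

lemma adapted_pivot_factor_nz_r:
  assumes t: "adapted B S q t" and i: "i \<in> {1..r - 2}" and k: "k \<in> {1..r - 2}" "k \<noteq> i" "k \<in> B" "{k, i} \<in> S" "r - 1 \<in> B"
    and o: "\<And>l. l \<in> {1..r - 2} - {k} \<Longrightarrow> l \<notin> B \<or> {l, i} \<notin> S"
  shows "pivot_factor t i \<noteq> 0"
proof -
  let ?f = "\<lambda>l. bb t l * (sg l i * (t (m_class l i) * G (m_class l i) (p r)))"
  note I = inner[OF i] and K = inner[OF k(1)]
  have "?f l = 0" if l: "l \<in> {1..r - 2} - {k}" for l
    using o[OF l] l adapted_bb_r[OF t, of l] inner[of l] adapted_m[OF t _ i, of l] by (cases "l = i") (auto simp: sg_refl)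
  then have "(\<Sum>l\<in>{1..r - 2} - {k}. ?f l) = 0" by (intro sum.neutral ballI)
  then have s: "(\<Sum>l\<in>{1..r - 2}. ?f l) = ?f k" using sum.remove[OF _ k(1), of ?f] by simp
  have "G (m_class k i) (p r) \<noteq> 0" "G (m_class i (r - 1)) (p r) \<noteq> 0"
    by (rule G_m(4); use I K k(2) pivot in metis)+
  moreover have "bb t k \<noteq> 0" "bb t (r - 1) \<noteq> 0"
    using adapted_bb_r[OF t, of k] adapted_bb_r[OF t pivot(2)] exc_value_r(2)[of k] exc_value_r(2)[OF pivot(2)] K k by simp_all
  ultimately show ?thesis unfolding pivot_factor_def s using adapted_m[OF t k(1) i k(2)] k(4) sg_nz[OF k(2)] by simp
qed

lemma other_inner: obtains k where "k \<in> {1..r - 2}" "k \<noteq> j"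
proof (cases "j = 1")
  case True then show ?thesis using that[of 2] r67 by auto
qed (use that[of 1] r67 in auto)

lemma pivot_factor_witness: assumes i: "i \<in> {1..r - 2}" shows "\<exists>t. \<delta> t \<noteq> 0 \<and> pivot_factor t i \<noteq> 0"
proof -
  obtain k where k: "k \<in> {1..r - 2}" "k \<noteq> i" using other_inner by blast
  obtain t where t: "adapted {k, r - 1, r} {{k, i}} 0 t" by (rule adapted_exists)
  have "pivot_factor t i \<noteq> 0" by (rule adapted_pivot_factor_nz_r[OF t i k]) (use k i inner in \<open>auto simp: doubleton_eq_iff\<close>)
  then show ?thesis using adapted_\<delta>_r[OF t] by auto
qed

text \<open>With sparse parameters one term of the sum survives at a suitable point: at \<open>p\<^sub>1\<close> for the last index,
  where the lines through \<open>p\<^sub>1\<close> drop out, and at \<open>p\<^sub>r\<^sub>-\<^sub>1\<close> otherwise.\<close>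

lemma by_form_witness:
  assumes j: "j \<in> {1..r - 1}"
  shows "\<exists>t. \<delta> t \<noteq> 0 \<and> (\<exists>x. by_form t x j \<noteq> 0)"
proof (cases "j = r - 1")
  case True
  have r12: "1 \<in> {1..r - 2}" "2 \<in> {1..r - 2}" using r67 by auto
  obtain t where t: "adapted {1, 2, r - 1, r} {{1, 2}} 0 t" by (rule adapted_exists)
  have f: "pivot_factor t 2 \<noteq> 0" by (rule adapted_pivot_factor_nz_r[OF t r12(2,1)]) (use r67 in \<open>auto simp: doubleton_eq_iff\<close>)
  \<comment> \<open>At \<open>p\<^sub>1\<close> only the term of the line joining \<open>p\<^sub>2\<close> to the pivot survives.\<close>
  have "(\<Sum>k\<in>{1..6} - {2}. bb t k * YY t (p 1) k j) = 0"
  proof (rule sum.neutral, rule ballI)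
    fix k :: nat assume k: "k \<in> {1..6} - {2}"
    then have kr: "k \<in> {1..r}" "k \<noteq> 2" using six by auto
    show "bb t k * YY t (p 1) k j = 0"
    proof (cases "k \<in> {1, r - 1, r}")
      case True
      have "YY t (p 1) 1 j = 0" using lines_zero[of 1 j 1 "line_factor t"] pivot(1) \<open>j = r - 1\<close> by simp
      moreover have "YY t (p 1) (r - 1) j = 0" unfolding \<open>j = r - 1\<close> by (rule YY_refl)
      moreover have "r \<notin> {1..r - 1}" using pivot by auto
      then have "YY t (p 1) r j = 0" using YY_outside by blast
      ultimately show ?thesis using True by auto
    next
      case False
      then have "k \<notin> {1, 2, r - 1, r}" using kr(2) by blast
      then show ?thesis using adapted_bb_r[OF t kr(1)] by simp
    qed
  qed
  then have "by_form t (p 1) j = bb t 2 * YY t (p 1) 2 (r - 1)"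
    unfolding by_form_def True using sum.remove[of "{1..6}" 2 "\<lambda>k. bb t k * YY t (p 1) k (r - 1)"] by simp
  moreover have "YY t (p 1) 2 (r - 1) \<noteq> 0" unfolding YY_pivot[OF r12(2)] using f G_m(4)[of 2 "r - 1" 1] r67 by auto
  moreover have "bb t 2 \<noteq> 0" using adapted_bb_r[OF t, of 2] exc_value_r(2)[of 2] inner[OF r12(2)] by simp
  ultimately have "by_form t (p 1) j \<noteq> 0" by simp
  then show ?thesis using adapted_\<delta>_r[OF t] by blast
next
  case False
  then have j2: "j \<in> {1..r - 2}" using j by auto
  obtain k where k: "k \<in> {1..r - 2}" "k \<noteq> j" using other_inner by blast
  obtain t where t: "adapted {k, r - 1, r} {{k, j}} 0 t" by (rule adapted_exists)
  note J = inner[OF j2] and K = inner[OF k(1)]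
  have "(\<Sum>l\<in>{1..r - 2} - {k}. bb t l * YY t (p (r - 1)) l j) = 0"
    by (rule sum.neutral) (use adapted_bb_r[OF t] inner in auto)
  moreover have "YY t (p (r - 1)) (r - 1) j = 0" using lines_zero[OF pivot(1), of j "r - 1" "line_factor t"] J by simp
  ultimately have "by_form t (p (r - 1)) j = bb t k * YY t (p (r - 1)) k j"
    unfolding by_form_split[OF j2] using sum.remove[OF _ k(1), of "\<lambda>l. bb t l * YY t (p (r - 1)) l j"] by simp
  moreover have "YY t (p (r - 1)) k j \<noteq> 0"
    unfolding adapted_YY_r[OF t k(1) j2] using G_m(4)[of k j "r - 1"] sg_nz[OF k(2)] k J K pivot by auto
  moreover have "bb t k \<noteq> 0" using adapted_bb_r[OF t, of k] exc_value_r(2)[of k] K by simp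
  ultimately have "by_form t (p (r - 1)) j \<noteq> 0" by simp
  then show ?thesis using adapted_\<delta>_r[OF t] by blast
qed

lemma coord_witness: "\<exists>t::pic \<Rightarrow> 'a. \<delta> t \<noteq> 0 \<and> t E \<noteq> 0"
  by (rule exI[of _ "\<lambda>_. 1"]) (simp add: \<delta>_def)

lemma line_factor_witness:
  assumes "i \<in> {1..r - 1}" "j \<in> {1..r - 1}" "i < j"
  shows "\<exists>t. \<delta> t \<noteq> 0 \<and> line_factor t i j \<noteq> 0"
proof -
  have i: "i \<in> {1..r - 2}" using assms by auto
  consider "j = r - 1" | "j \<noteq> r - 1" by blast
  then show ?thesis
  proof cases
    case 1 then show ?thesis using pivot_factor_witness[OF i] assms by (simp add: line_factor_def)
  next
    case 2 then show ?thesis using coord_witness assms by (simp add: line_factor_def)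
  qed
qed

lemma T_sub: "T \<subseteq> neg_curves r"
proof
  fix E assume "E \<in> T"
  then consider i where "i \<in> {1..r}" "E = exc i" | i j where "1 \<le> i" "i < j" "j \<le> r - 2" "E = m_class i j" | "E = Q7_class 6 7" "r = 7"
    unfolding T_def by (auto split: if_splits)
  then show "E \<in> neg_curves r"
  proof cases
    case (1 i) then show ?thesis by (simp add: exc_in)
  next
    case (2 i j) then show ?thesis by (simp add: m_in)
  next
    case 3 then show ?thesis using Q_in[of 6] by simp
  qed
qed

lemma card_T: "card T = num_neg_curves (r - 2) + 2"
proof -
  let ?A = "exc ` {1..r} \<union> {m_class i j | i j. 1 \<le> i \<and> i < j \<and> j \<le> r - 2}"
  have A: "card ?A = r + ((r - 2) choose 2)" "finite ?A" by (rule card_exc_lines)+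
  have Q: "Q7_class 6 7 \<notin> ?A"
  proof
    assume "Q7_class 6 7 \<in> ?A"
    then have "cf (Q7_class 6 7) 0 < 2" by (rule exc_lines_degree)
    then show False by (simp add: lookup_class)
  qed
  have "(5::nat) choose 2 = 10" "(4::nat) choose 2 = 6" by code_simp+
  then show ?thesis using r67 A Q num_neg_curves_values(2,3) unfolding T_def by auto
qed

lemma family_of_factors:
  assumes f: "\<And>E. E \<in> neg_curves r \<Longrightarrow> RF (f E)" "\<And>E t. E \<in> T \<Longrightarrow> f E t = t E"
    and nz: "\<And>E. E \<in> neg_curves r \<Longrightarrow> \<exists>t. \<delta> t \<noteq> 0 \<and> f E t \<noteq> 0"
  obtains U where "parameter_family (num_neg_curves (r - 2) + 2) r T U (\<lambda>t E. f E t)"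
    "\<And>t. t \<in> U \<Longrightarrow> \<delta> t \<noteq> 0" "\<And>t. t \<in> U \<Longrightarrow> rescaling r (\<lambda>E. f E t)"
proof -
  have "card (neg_curves r) \<noteq> 0"
    using num_neg_curves_values(4,5) r67 unfolding num_neg_curves_def by auto
  then have "finite (neg_curves r)" "neg_curves r \<noteq> {}" by (auto simp: card_eq_0_iff)
  from parameter_family_of_ratfun[OF T_sub this(1) f nz this(2)] show ?thesis
    using that unfolding card_T rescaling_def by blast
qed

end

section \<open>Seven points: the curves given by the derivatives of the cubic\<close>

locale sections7 = sections +
  assumes r7: "r = 7"

sublocale sections7 \<subseteq> sections67
  by unfold_locales (simp add: r7)

context sections7 begin

lemma in7: "(i::nat) \<in> {1..6} \<Longrightarrow> i \<in> {1..7}" by auto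

lemma exc_value: "i \<in> {1..7} \<Longrightarrow> G (exc i) x = exc_value i" "i \<in> {1..7} \<Longrightarrow> exc_value i \<noteq> 0"
  using exc_value_r r7 by blast+

lemma r_minus: "r - 1 = 6" "r - 2 = 5"
  using r7 by simp_all

lemma at_r: "p r = p 7" "bb t r = bb t 7" "m_class j r = m_class j 7"
  by (simp_all only: r7)

definition ee :: "(pic \<Rightarrow> 'a) \<Rightarrow> 'a" where "ee t = bb t 7"
text \<open>The factor of the conic \<open>Q7_class i 7\<close> for which \<open>b\<^sub>i a\<^sub>6 - b\<^sub>6 a\<^sub>i\<close> plus the cofactor vanishes at \<open>p\<^sub>7\<close>.\<close>

definition conic_factor_aux :: "(pic \<Rightarrow> 'a) \<Rightarrow> nat \<Rightarrow> 'a" where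
  "conic_factor_aux t i = (bb t i * (t (Q7_class 6 7) * G (Q7_class 6 7) (p 7)) + cofactor (YY t (p 7)) i 6) / bb t 6 / G (Q7_class i 7) (p 7)"
definition conic_factor :: "(pic \<Rightarrow> 'a) \<Rightarrow> nat \<Rightarrow> 'a" where
  "conic_factor t i = (if i = 6 then t (Q7_class 6 7) else conic_factor_aux t i)"
abbreviation aa :: "(pic \<Rightarrow> 'a) \<Rightarrow> 'a^3 \<Rightarrow> nat \<Rightarrow> 'a" where "aa t x \<equiv> conics (conic_factor t) x"

lemma \<delta>_nz: "\<delta> t \<noteq> 0 \<Longrightarrow> ee t \<noteq> 0 \<and> bb t 6 \<noteq> 0"
  using \<delta>_nz_r[of t] unfolding r_minus at_r ee_def by blast

text \<open>Lines and conics were scaled so that the equations solved in \<open>E6_chart\<close> hold at \<open>p\<^sub>7\<close>.\<close>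

lemma E6_at_7:
  assumes "\<delta> t \<noteq> 0"
  shows "E6rel (bb t) (aa t (p 7)) (YY t (p 7))"
proof (rule E6_chart[OF YY_alt])
  show b6: "bb t 6 \<noteq> 0" using \<delta>_nz[OF assms] by simp
  show "(\<Sum>k\<in>{1..6}. bb t k * YY t (p 7) k j) = 0" if "j \<in> {1..6}" "j \<noteq> 6" for j
    using by_form_last[OF assms that(1)] unfolding by_form_def at_r .
  show "bb t i * aa t (p 7) 6 - bb t 6 * aa t (p 7) i + \<sigma> * pf4 (YY t (p 7)) k l m n = 0"
    if L: "labelling \<sigma> i 6 k l m n" for \<sigma> i k l m n
  proof -
    have i: "i \<in> {1..6}" "i \<noteq> 6" using labelling_range[OF L] labelling_distinct[OF L] by auto
    have nz: "G (Q7_class i 7) (p 7) \<noteq> 0" by (rule G_Q(4)[OF i(1) r7])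
    have "bb t 6 * aa t (p 7) i = bb t i * aa t (p 7) 6 + cofactor (YY t (p 7)) i 6"
      unfolding conics_def conic_factor_def conic_factor_aux_def using i b6 nz by simp
    then show ?thesis unfolding cofactor_eq[OF L YY_alt] by simp
  qed
qed

text \<open>The form \<open>- \<partial>N/\<partial>y\<^sub>i\<^sub>j\<close>, which is \<open>e x\<^sub>i\<^sub>j\<close> on \<open>H7\<close>.\<close>

definition x_form :: "(pic \<Rightarrow> 'a) \<Rightarrow> 'a^3 \<Rightarrow> nat \<Rightarrow> nat \<Rightarrow> 'a" where
  "x_form t x i j = - (bb t i * aa t x j - bb t j * aa t x i + cofactor (YY t x) i j)"
definition ay_form :: "(pic \<Rightarrow> 'a) \<Rightarrow> 'a^3 \<Rightarrow> nat \<Rightarrow> 'a" where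
  "ay_form t x j = (\<Sum>k\<in>{1..6}. aa t x k * YY t x k j)"
definition cubic_form :: "(pic \<Rightarrow> 'a) \<Rightarrow> 'a^3 \<Rightarrow> 'a" where
  "cubic_form t x = E7_cubic (bb t) (aa t x) (YY t x)"

lemma form12: "ternary_form 1 f \<Longrightarrow> ternary_form 2 g \<Longrightarrow> ternary_form 3 (\<lambda>x. f x * g x)"
proof -
  have "(1::nat) + 2 = 3" by simp
  then show "ternary_form 1 f \<Longrightarrow> ternary_form 2 g \<Longrightarrow> ternary_form 3 (\<lambda>x. f x * g x)"
    using form_mult[of 1 f 2 g] by (simp only:)
qed

text \<open>The conic contains \<open>p\<^sub>7\<close> and the four other points: at \<open>p\<^sub>7\<close> by \<open>E6_at_7\<close>, and at the others term by term.\<close>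

lemma x_form_multiple:
  assumes d: "\<delta> t \<noteq> 0" and ij: "i \<in> {1..6}" "j \<in> {1..6}" "i \<noteq> j" and z: "G (Q7_class i j) z \<noteq> 0"
  shows "x_form t x i j = x_form t z i j / G (Q7_class i j) z * G (Q7_class i j) x"
proof (rule conic_unique[where I = "{1..7} - {i, j}"])
  have Q: "Q7_class i j \<in> neg_curves r" unfolding r7 by (rule Q7_in[OF in7[OF ij(1)] in7[OF ij(2)] ij(3)])
  show "ternary_form 2 (\<lambda>x. x_form t x i j)" unfolding x_form_def
    by (intro form_minus form_add form_diff form_scale conics_form cofactor_form(1) line_factor_sym ij)
  show "ternary_form 2 (G (Q7_class i j))" by (rule G_Q_aux(1)[OF Q in7[OF ij(1)] in7[OF ij(2)] ij(3)])
  show "G (Q7_class i j) (p q) = 0" if "q \<in> {1..7} - {i, j}" for q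
    by (rule G_Q_aux(2)[OF Q in7[OF ij(1)] in7[OF ij(2)] ij(3)]) (use that r7 in simp)
  show "x_form t (p q) i j = 0" if q: "q \<in> {1..7} - {i, j}" for q
  proof (cases "q = 7")
    case True
    obtain \<sigma> k l m n where L: "labelling (\<sigma>::'a) i j k l m n" using labelling_exists ij by metis
    then show ?thesis using E6_at_7[OF d] unfolding x_form_def True E6rel_def cofactor_eq[OF L YY_alt] by simp
  next
    case False
    then have q6: "q \<in> {1..6} - {i, j}" using q by auto
    have "cofactor (YY t (p q)) i j = 0" by (rule cofactor_form(2)[OF line_factor_sym ij q6])
    moreover have "aa t (p q) i = 0" "aa t (p q) j = 0" using q6 ij by (intro conics_zero; simp)+
    ultimately show ?thesis unfolding x_form_def by simp
  qed
  show "{1..7} - {i, j} \<subseteq> {1..r}" using r7 by auto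
  show "card ({1..7} - {i, j}) = 5" using ij by (simp add: card_Diff_subset)
qed (rule z)

lemmas by_form_multiple7 = by_form_multiple[unfolded r_minus at_r]

lemma G_C:
  assumes i: "i \<in> {1..7}"
  shows "ternary_form 3 (G (C_class i))" "double_at (G (C_class i)) (p i)" "\<And>q. q \<in> {1..7} \<Longrightarrow> G (C_class i) (p q) = 0"
proof -
  have g: "curve_form (C_class i) (G (C_class i))" by (rule G) (simp only: r7 C7_in[OF i])
  have "cf (C_class i) 0 = 3" "cf (C_class i) i = -2" using i by (auto simp: lookup_class)
  then show "ternary_form 3 (G (C_class i))" "double_at (G (C_class i)) (p i)" using g i r7 unfolding curve_form_def by auto
  fix q assume q: "q \<in> {1..7::nat}"
  then have "cf (C_class i) q < 0" by (auto simp: lookup_class)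
  then show "G (C_class i) (p q) = 0" using g q r7 unfolding curve_form_def by auto
qed

text \<open>The cubic is double at \<open>p\<^sub>j\<close>, since each term is a product of a line and a conic through \<open>p\<^sub>j\<close>, and it
  contains all points, \<open>p\<^sub>7\<close> by \<open>E6_at_7\<close>.\<close>

lemma ay_form_multiple:
  assumes d: "\<delta> t \<noteq> 0" and j: "j \<in> {1..6}" and z: "G (C_class j) z \<noteq> 0"
  shows "ay_form t x j = ay_form t z j / G (C_class j) z * G (C_class j) x"
proof (rule cubic_unique[where I = "{1..7}" and i = j])
  show "ternary_form 3 (\<lambda>x. ay_form t x j)" unfolding ay_form_def mult.commute[of "aa _ _ _"]
    by (intro form_sum form12 lines_form conics_form j)
  show "double_at (\<lambda>x. ay_form t x j) (p j)" unfolding ay_form_def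
  proof (rule double_at_sum)
    fix k :: nat assume k: "k \<in> {1..6}"
    show "double_at (\<lambda>x. aa t x k * YY t x k j) (p j)"
    proof (cases "k = j")
      case True
      have "YY t x k j = 0" for x using True by (simp add: lines_def sg_refl)
      then show ?thesis unfolding double_at_def by (auto intro: exI[of _ 0])
    next
      case False
      then show ?thesis using conics_zero[OF k j] lines_zero[OF k j]
        by (intro double_at_mult[OF conics_form[OF k] lines_form[OF k j]]) auto
    qed
  qed
  show "ay_form t (p q) j = 0" if q: "q \<in> {1..7}" for q
  proof (cases "q = 7")
    case True then show ?thesis using E6_at_7[OF d] j unfolding ay_form_def E6rel_def by blast
  next
    case False
    then have q6: "q \<in> {1..6}" using q by auto
    show ?thesis unfolding ay_form_def
    proof (rule sum.neutral, rule ballI)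
      fix k :: nat assume k: "k \<in> {1..6}"
      show "aa t (p q) k * YY t (p q) k j = 0"
        using conics_zero[OF k q6] lines_zero[OF k j, of q] by (cases "q = k") auto
    qed
  qed
  show "ternary_form 3 (G (C_class j))" "double_at (G (C_class j)) (p j)" by (rule G_C[OF in7[OF j]])+
  show "G (C_class j) (p q) = 0" if "q \<in> {1..7}" for q by (rule G_C(3)[OF in7[OF j] that])
  show "{1..7} \<subseteq> {1..r}" "card {1..7::nat} = 7" "j \<in> {1..7}" using r7 j by auto
qed (rule z)

lemma cubic_form_form: "ternary_form 3 (cubic_form t)"
proof -
  have P: "ternary_form 3 (\<lambda>x. YY t x i j * g x)" if "i \<in> {1..6}" "j \<in> {1..6}" "ternary_form 2 g" for i j g
    by (rule form12[OF lines_form[OF that(1,2)] that(3)])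
  have A: "ternary_form 3 (\<lambda>x. aa t x i * bb t k * YY t x k i)" if "i \<in> {1..6}" "k \<in> {1..6}" for i k
  proof -
    have "ternary_form 3 (\<lambda>x. bb t k * (YY t x k i * aa t x i))" by (intro form_scale P conics_form that)
    then show ?thesis by (simp add: mult_ac)
  qed
  show ?thesis unfolding cubic_form_def[abs_def] E7_cubic_def
    by (intro form_add form_diff form_sum A P form11 lines_form; simp)
qed

lemma cubic_form_zero:
  assumes l: "l \<in> {1..6}"
  shows "cubic_form t (p l) = 0"
proof -
  have "(\<Sum>j\<in>{1..6}. \<Sum>k\<in>{1..6}. aa t (p l) j * bb t k * YY t (p l) k j) = 0"
  proof (intro sum.neutral ballI)
    fix j k :: nat assume jk: "j \<in> {1..6}" "k \<in> {1..6}"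
    show "aa t (p l) j * bb t k * YY t (p l) k j = 0"
      using conics_zero[OF jk(1) l] lines_zero[OF jk(2,1), of l] by (cases "l = j") auto
  qed
  moreover have z: "YY t (p q) i j = 0" if "q = i \<or> q = j" "i \<in> {1..6}" "j \<in> {1..6}" for i j q
    by (rule lines_zero[OF that(2,3,1)])
  have "l = 1 \<or> l = 2 \<or> l = 3 \<or> l = 4 \<or> l = 5 \<or> l = 6" using l by auto
  ultimately show ?thesis unfolding cubic_form_def E7_cubic_def by (elim disjE) (simp_all add: z del: One_nat_def)
qed

text \<open>By \<open>E6_at_7\<close> the point of coordinates \<open>a, b, y\<close> over \<open>p\<^sub>7\<close> is a singular point of the cubic form, so
  along every line through \<open>p\<^sub>7\<close> the cubic has a double root.\<close>

lemma cubic_form_double: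
  assumes d: "\<delta> t \<noteq> 0"
  shows "double_at (cubic_form t) (p 7)"
  unfolding double_at_def
proof
  fix v
  have "\<exists>R. \<forall>u. aa t (p 7 + u *s v) j = poly R u" if "j \<in> {1..6}" for j
    using form_line[OF conics_form[OF that]] by metis
  then obtain A where A: "\<And>j u. j \<in> {1..6} \<Longrightarrow> aa t (p 7 + u *s v) j = poly (A j) u" by metis
  have "\<exists>R. \<forall>u. YY t (p 7 + u *s v) i j = poly R u" if "i \<in> {1..6}" "j \<in> {1..6}" for i j
    using form_line[OF lines_form[OF that]] by metis
  then obtain Y' where Y': "\<And>i j u. i \<in> {1..6} \<Longrightarrow> j \<in> {1..6} \<Longrightarrow> YY t (p 7 + u *s v) i j = poly (Y' i j) u" by metis
  define Y where "Y i j = (if i < j then Y' i j else if j < i then - Y' j i else 0)" for i j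
  have Y_alt: "alternating Y" unfolding alternating_def Y_def by auto
  have Y: "YY t (p 7 + u *s v) i j = poly (Y i j) u" if "i \<in> {1..6}" "j \<in> {1..6}" for i j u
  proof -
    have "YY t x j i = - YY t x i j" "YY t x i i = 0" for x i j using YY_alt unfolding alternating_def by blast+
    note a = this
    consider "i < j" | "j < i" | "i = j" by linarith
    then show ?thesis
    proof cases
      case 1 then show ?thesis using Y'[OF that, of u] by (simp add: Y_def)
    next
      case 2 then show ?thesis using Y'[OF that(2,1), of u] a(1)[of "p 7 + u *s v" i j] by (simp add: Y_def)
    next
      case 3 then show ?thesis using a(2) by (simp add: Y_def)
    qed
  qed
  have "E6rel (bb t) (\<lambda>j. poly (A j) 0) (\<lambda>i j. poly (Y i j) 0)"
  proof -
    have "p 7 + 0 *s v = p 7" by simp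
    then have a0: "poly (A j) 0 = aa t (p 7) j" if "j \<in> {1..6}" for j using A[OF that, of 0] by simp
    have y0: "poly (Y i j) 0 = YY t (p 7) i j" if "i \<in> {1..6}" "j \<in> {1..6}" for i j
      using Y[OF that, of 0] \<open>p 7 + 0 *s v = p 7\<close> by simp
    note E = E6_at_7[OF d, unfolded E6rel_def]
    have "bb t i * poly (A j) 0 - bb t j * poly (A i) 0 + \<sigma> * pf4 (\<lambda>i j. poly (Y i j) 0) k l m n = 0"
      if L: "labelling \<sigma> i j k l m n" for \<sigma> i j k l m n
    proof -
      note r = labelling_range[OF L]
      show ?thesis using E L unfolding pf4_def a0[OF r(1)] a0[OF r(2)] y0[OF r(3,4)] y0[OF r(5,6)] y0[OF r(3,5)]
         y0[OF r(4,6)] y0[OF r(3,6)] y0[OF r(4,5)] by blast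
    qed
    moreover have "(\<Sum>k\<in>{1..6}. bb t k * poly (Y k j) 0) = 0" if j: "j \<in> {1..6}" for j
    proof -
      have "(\<Sum>k\<in>{1..6}. bb t k * poly (Y k j) 0) = (\<Sum>k\<in>{1..6}. bb t k * YY t (p 7) k j)"
        by (rule sum.cong) (use y0 j in auto)
      then show ?thesis using E j by simp
    qed
    moreover have "(\<Sum>k\<in>{1..6}. poly (A k) 0 * poly (Y k j) 0) = 0" if j: "j \<in> {1..6}" for j
    proof -
      have "(\<Sum>k\<in>{1..6}. poly (A k) 0 * poly (Y k j) 0) = (\<Sum>k\<in>{1..6}. aa t (p 7) k * YY t (p 7) k j)"
        by (rule sum.cong) (use a0 y0 j in auto)
      then show ?thesis using E j by simp
    qed
    ultimately show ?thesis unfolding E6rel_def by blast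
  qed
  then have "E6rel (\<lambda>k. poly [:bb t k:] 0) (\<lambda>j. poly (A j) 0) (\<lambda>i j. poly (Y i j) 0)" by simp
  from E7_cubic_pderiv[OF this Y_alt] obtain S
    where S: "\<And>u. poly (E7_cubic (\<lambda>k. [:bb t k:]) A Y) u = u\<^sup>2 * poly S u" by (rule poly_double_root) blast
  have "cubic_form t (p 7 + u *s v) = poly (E7_cubic (\<lambda>k. [:bb t k:]) A Y) u" for u
  proof -
    have "(\<Sum>j\<in>{1..6}. \<Sum>k\<in>{1..6}. aa t (p 7 + u *s v) j * bb t k * YY t (p 7 + u *s v) k j)
       = (\<Sum>j\<in>{1..6}. \<Sum>k\<in>{1..6}. poly (A j) u * bb t k * poly (Y k j) u)"
      by (intro sum.cong refl) (simp add: A Y)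
    then show ?thesis unfolding cubic_form_def E7_cubic_def by (simp add: poly_sum Y mult.commute[of "bb t _"] mult.assoc)
  qed
  then show "\<exists>R. \<forall>u. cubic_form t (p 7 + u *s v) = u\<^sup>2 * poly R u" using S by auto
qed

lemma cubic_form_multiple:
  assumes d: "\<delta> t \<noteq> 0" and z: "G (C_class 7) z \<noteq> 0"
  shows "cubic_form t x = cubic_form t z / G (C_class 7) z * G (C_class 7) x"
proof (rule cubic_unique[where I = "{1..7}" and i = 7])
  show "cubic_form t (p q) = 0" if q: "q \<in> {1..7}" for q
    using cubic_form_zero[of q t] double_at_zero[OF cubic_form_double[OF d]] q by (cases "q = 7") auto
  show "ternary_form 3 (G (C_class 7))" "double_at (G (C_class 7)) (p 7)" by (rule G_C; simp)+
  show "G (C_class 7) (p q) = 0" if "q \<in> {1..7}" for q by (rule G_C(3)[OF _ that]) simp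
  show "{1..7} \<subseteq> {1..r}" "card {1..7::nat} = 7" "(7::nat) \<in> {1..7}" using r7 by auto
qed (rule cubic_form_form cubic_form_double[OF d] z)+

end

section \<open>Seven points: the factors and the equations\<close>

context sections7 begin

text \<open>The factors of the rescaling with parameters \<open>t\<close>. Dependent factors are read off from the proportional
  curves at a point where the generator does not vanish.\<close>

definition factor :: "pic \<Rightarrow> (pic \<Rightarrow> 'a) \<Rightarrow> 'a" where
  "factor = (SOME h. (\<forall>i\<in>{1..7}. h (exc i) = (\<lambda>t. t (exc i))) \<and>
     (\<forall>i\<in>{1..7}. \<forall>j\<in>{1..7}. i < j \<longrightarrow> h (m_class i j) =
        (if j = 7 then (\<lambda>t. by_form t (nonzero_point (m_class i j)) i / G (m_class i j) (nonzero_point (m_class i j)) / ee t) else (\<lambda>t. line_factor t i j))) \<and>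
     (\<forall>i\<in>{1..7}. \<forall>j\<in>{1..7}. i < j \<longrightarrow> h (Q7_class i j) =
        (if j = 7 then (\<lambda>t. conic_factor t i) else (\<lambda>t. x_form t (nonzero_point (Q7_class i j)) i j / G (Q7_class i j) (nonzero_point (Q7_class i j)) / ee t))) \<and>
     (\<forall>i\<in>{1..7}. h (C_class i) =
        (if i = 7 then (\<lambda>t. - (cubic_form t (nonzero_point (C_class i)) / G (C_class i) (nonzero_point (C_class i)) / ee t / ee t))
         else (\<lambda>t. - (ay_form t (nonzero_point (C_class i)) i / G (C_class i) (nonzero_point (C_class i)) / ee t)))))"

lemma factor:
  "\<And>i. i \<in> {1..7} \<Longrightarrow> factor (exc i) = (\<lambda>t. t (exc i))"
  "\<And>i j. i \<in> {1..7} \<Longrightarrow> j \<in> {1..7} \<Longrightarrow> i < j \<Longrightarrow> factor (m_class i j) =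
        (if j = 7 then (\<lambda>t. by_form t (nonzero_point (m_class i j)) i / G (m_class i j) (nonzero_point (m_class i j)) / ee t) else (\<lambda>t. line_factor t i j))"
  "\<And>i j. i \<in> {1..7} \<Longrightarrow> j \<in> {1..7} \<Longrightarrow> i < j \<Longrightarrow> factor (Q7_class i j) =
        (if j = 7 then (\<lambda>t. conic_factor t i) else (\<lambda>t. x_form t (nonzero_point (Q7_class i j)) i j / G (Q7_class i j) (nonzero_point (Q7_class i j)) / ee t))"
  "\<And>i. i \<in> {1..7} \<Longrightarrow> factor (C_class i) =
        (if i = 7 then (\<lambda>t. - (cubic_form t (nonzero_point (C_class i)) / G (C_class i) (nonzero_point (C_class i)) / ee t / ee t))
         else (\<lambda>t. - (ay_form t (nonzero_point (C_class i)) i / G (C_class i) (nonzero_point (C_class i)) / ee t)))"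
proof -
  have "\<exists>h. (\<forall>i\<in>{1..7}. h (exc i) = (\<lambda>t. t (exc i))) \<and>
     (\<forall>i\<in>{1..7}. \<forall>j\<in>{1..7}. i < j \<longrightarrow> h (m_class i j) =
        (if j = 7 then (\<lambda>t. by_form t (nonzero_point (m_class i j)) i / G (m_class i j) (nonzero_point (m_class i j)) / ee t) else (\<lambda>t. line_factor t i j))) \<and>
     (\<forall>i\<in>{1..7}. \<forall>j\<in>{1..7}. i < j \<longrightarrow> h (Q7_class i j) =
        (if j = 7 then (\<lambda>t. conic_factor t i) else (\<lambda>t. x_form t (nonzero_point (Q7_class i j)) i j / G (Q7_class i j) (nonzero_point (Q7_class i j)) / ee t))) \<and>
     (\<forall>i\<in>{1..7}. h (C_class i) =
        (if i = 7 then (\<lambda>t. - (cubic_form t (nonzero_point (C_class i)) / G (C_class i) (nonzero_point (C_class i)) / ee t / ee t))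
         else (\<lambda>t. - (ay_form t (nonzero_point (C_class i)) i / G (C_class i) (nonzero_point (C_class i)) / ee t))))" (is "\<exists>h. ?P h")
    by (rule class_function[of "\<lambda>i t. t (exc i)"
        "\<lambda>i j. if j = 7 then (\<lambda>t. by_form t (nonzero_point (m_class i j)) i / G (m_class i j) (nonzero_point (m_class i j)) / ee t) else (\<lambda>t. line_factor t i j)"
        "\<lambda>i j. if j = 7 then (\<lambda>t. conic_factor t i) else (\<lambda>t. x_form t (nonzero_point (Q7_class i j)) i j / G (Q7_class i j) (nonzero_point (Q7_class i j)) / ee t)"
        "\<lambda>i. if i = 7 then (\<lambda>t. - (cubic_form t (nonzero_point (C_class i)) / G (C_class i) (nonzero_point (C_class i)) / ee t / ee t))
         else (\<lambda>t. - (ay_form t (nonzero_point (C_class i)) i / G (C_class i) (nonzero_point (C_class i)) / ee t))"]) blast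
  then have P: "?P factor" unfolding factor_def by (rule someI_ex)
  show "\<And>i. i \<in> {1..7} \<Longrightarrow> factor (exc i) = (\<lambda>t. t (exc i))" using P by blast
  show "\<And>i j. i \<in> {1..7} \<Longrightarrow> j \<in> {1..7} \<Longrightarrow> i < j \<Longrightarrow> factor (m_class i j) =
        (if j = 7 then (\<lambda>t. by_form t (nonzero_point (m_class i j)) i / G (m_class i j) (nonzero_point (m_class i j)) / ee t) else (\<lambda>t. line_factor t i j))"
    using P by blast
  show "\<And>i j. i \<in> {1..7} \<Longrightarrow> j \<in> {1..7} \<Longrightarrow> i < j \<Longrightarrow> factor (Q7_class i j) =
        (if j = 7 then (\<lambda>t. conic_factor t i) else (\<lambda>t. x_form t (nonzero_point (Q7_class i j)) i j / G (Q7_class i j) (nonzero_point (Q7_class i j)) / ee t))"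
    using P by blast
  show "\<And>i. i \<in> {1..7} \<Longrightarrow> factor (C_class i) =
        (if i = 7 then (\<lambda>t. - (cubic_form t (nonzero_point (C_class i)) / G (C_class i) (nonzero_point (C_class i)) / ee t / ee t))
         else (\<lambda>t. - (ay_form t (nonzero_point (C_class i)) i / G (C_class i) (nonzero_point (C_class i)) / ee t)))"
    using P by blast
qed

text \<open>The rescaled generators at \<open>x\<close> satisfy the hypotheses of \<open>H7_chart\<close>: the dependent factors were defined
  by exactly these equations, valid for all \<open>x\<close> by uniqueness of the curves.\<close>

lemma point_in_H7:
  assumes d: "\<delta> t \<noteq> 0"
  shows "(\<lambda>E. factor E t * G E x) \<in> H7"
proof -
  define \<xi> where "\<xi> E = factor E t * G E x" for E
  note nz = \<delta>_nz[OF d]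
  have b: "x7 \<xi> i 8 = bb t i" if "i \<in> {1..6}" for i
    using that exc_value(1)[of i x] by (simp add: x7_x_curve x_curve_def sg_def \<xi>_def factor bb_def)
  have e78: "x7 \<xi> 7 8 = ee t" using exc_value(1)[of 7 x] by (simp add: x7_x_curve x_curve_def sg_def \<xi>_def factor ee_def bb_def)
  have a: "x7 \<xi> i 7 = aa t x i" if "i \<in> {1..6}" for i
    using that by (simp add: x7_x_curve x_curve_def sg_def \<xi>_def factor conics_def)
  have mm: "factor (m_class i j) t = line_factor t i j" if "i \<in> {1..6}" "j \<in> {1..6}" "i \<noteq> j" for i j
  proof (cases "i < j")
    case True then show ?thesis using that by (simp add: factor)
  next
    case False
    then have "j < i" using that by simp
    then show ?thesis using that factor(2)[of j i] by (simp add: m_class_commute[of i j] line_factor_sym[of t i j])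
  qed
  have y: "y7 \<xi> i j = YY t x i j" if "i \<in> {1..6}" "j \<in> {1..6}" for i j
  proof (cases "i = j")
    case False
    have "y7 \<xi> i j = sg i j * \<xi> (y_curve i j)" by (rule y7_y_curve) (use that in auto)
    also have "y_curve i j = m_class i j" using that by (simp add: y_curve_def)
    also have "\<xi> (m_class i j) = line_factor t i j * G (m_class i j) x" using mm[OF that False] by (simp add: \<xi>_def)
    finally show ?thesis unfolding lines_def .
  qed (simp add: y7_def lines_def sg_def)
  have bY: "(\<Sum>k\<in>{1..6}. x7 \<xi> k 8 * y7 \<xi> k j) = by_form t x j" if j: "j \<in> {1..6}" for j
    unfolding by_form_def by (rule sum.cong) (use b y j in auto)
  have aY: "(\<Sum>k\<in>{1..6}. x7 \<xi> k 7 * y7 \<xi> k j) = ay_form t x j" if j: "j \<in> {1..6}" for j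
    unfolding ay_form_def by (rule sum.cong) (use a y j in auto)
  have x_form_swap: "x_form t x j i = - x_form t x i j" if "i \<in> {1..6}" "j \<in> {1..6}" "i \<noteq> j" for i j
    unfolding x_form_def cofactor_swap[OF that YY_alt] by (simp add: algebra_simps)
  have xless: "ee t * x7 \<xi> i j = x_form t x i j" if ij: "i \<in> {1..6}" "j \<in> {1..6}" "i < j" for i j
  proof -
    have Q: "Q7_class i j \<in> neg_curves r" unfolding r7 using ij by (intro Q7_in) auto
    have "x7 \<xi> i j = \<xi> (Q7_class i j)" using ij by (simp add: x7_x_curve x_curve_def sg_def)
    also have "ee t * \<dots> = x_form t (nonzero_point (Q7_class i j)) i j / G (Q7_class i j) (nonzero_point (Q7_class i j)) * G (Q7_class i j) x"
      using ij nz by (simp add: \<xi>_def factor)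
    also have "\<dots> = x_form t x i j" using x_form_multiple[OF d ij(1,2) _ nonzero_point[OF Q], of x] ij(3) by simp
    finally show ?thesis .
  qed
  have xx: "ee t * x7 \<xi> i j = x_form t x i j" if ij: "i \<in> {1..6}" "j \<in> {1..6}" "i \<noteq> j" for i j
  proof (cases "i < j")
    case True then show ?thesis using xless ij by blast
  next
    case False
    then have "j < i" using ij by simp
    moreover have "x7 \<xi> i j = - x7 \<xi> j i" using x7_alternating[of \<xi>] unfolding alternating_def by blast
    ultimately show ?thesis using xless[OF ij(2,1)] x_form_swap[OF ij(2,1)] ij by simp
  qed
  have "H7_chart (x7 \<xi>) (y7 \<xi>) (ee t) (\<lambda>i. x7 \<xi> i 7) (\<lambda>i. x7 \<xi> i 8)"
  proof
    show "alternating (x7 \<xi>)" "alternating (y7 \<xi>)" by (rule x7_alternating y7_alternating)+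
    show "x7 \<xi> 7 8 = ee t" "ee t \<noteq> 0" using e78 nz by auto
    show "ee t * x7 \<xi> i j = - (x7 \<xi> i 8 * x7 \<xi> j 7 - x7 \<xi> j 8 * x7 \<xi> i 7 + \<sigma> * pf4 (y7 \<xi>) k l m n)"
      if L: "labelling \<sigma> i j k l m n" for \<sigma> i j k l m n
    proof -
      note r = labelling_range[OF L]
      have "i \<noteq> j" using labelling_distinct[OF L] by simp
      then show ?thesis unfolding xx[OF r(1,2) \<open>i \<noteq> j\<close>] b[OF r(1)] b[OF r(2)] a[OF r(1)] a[OF r(2)] x_form_def
          cofactor_eq[OF L YY_alt] pf4_def y[OF r(3,4)] y[OF r(5,6)] y[OF r(3,5)] y[OF r(4,6)] y[OF r(3,6)] y[OF r(4,5)] by simp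
    qed
    show "ee t * y7 \<xi> 7 j = - (\<Sum>k\<in>{1..6}. x7 \<xi> k 8 * y7 \<xi> k j)" if j: "j \<in> {1..6}" for j
    proof -
      have m: "m_class j 7 \<in> neg_curves r" unfolding r7 using j by (intro m_in) auto
      have "y7 \<xi> 7 j = - \<xi> (m_class j 7)" using j by (simp add: y7_y_curve y_curve_def sg_def m_class_commute[of 7 j])
      then have "ee t * y7 \<xi> 7 j = - (by_form t (nonzero_point (m_class j 7)) j / G (m_class j 7) (nonzero_point (m_class j 7)) * G (m_class j 7) x)"
        using j nz by (simp add: \<xi>_def factor)
      also have "\<dots> = - by_form t x j" using by_form_multiple7[OF d j nonzero_point[OF m], of x] by simp
      finally show ?thesis unfolding bY[OF j] .
    qed
    show "ee t * y7 \<xi> 8 j = (\<Sum>k\<in>{1..6}. x7 \<xi> k 7 * y7 \<xi> k j)" if j: "j \<in> {1..6}" for j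
    proof -
      have m: "C_class j \<in> neg_curves r" unfolding r7 using j by (intro C7_in) auto
      have "y7 \<xi> 8 j = - \<xi> (C_class j)" using j by (simp add: y7_y_curve y_curve_def sg_def)
      then have "ee t * y7 \<xi> 8 j = ay_form t (nonzero_point (C_class j)) j / G (C_class j) (nonzero_point (C_class j)) * G (C_class j) x"
        using j nz by (simp add: \<xi>_def factor)
      also have "\<dots> = ay_form t x j" using ay_form_multiple[OF d j nonzero_point[OF m], of x] by simp
      finally show ?thesis unfolding aY[OF j] .
    qed
    show "ee t * (ee t * y7 \<xi> 7 8) = - E7_cubic (\<lambda>i. x7 \<xi> i 8) (\<lambda>i. x7 \<xi> i 7) (y7 \<xi>)"
    proof -
      have m: "C_class 7 \<in> neg_curves r" unfolding r7 by (intro C7_in) auto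
      have "y7 \<xi> 7 8 = \<xi> (C_class 7)" by (simp add: y7_y_curve y_curve_def sg_def)
      then have "ee t * (ee t * y7 \<xi> 7 8) = - (cubic_form t (nonzero_point (C_class 7)) / G (C_class 7) (nonzero_point (C_class 7)) * G (C_class 7) x)"
        using nz by (simp add: \<xi>_def factor)
      also have "\<dots> = - cubic_form t x" using cubic_form_multiple[OF d nonzero_point[OF m], of x] by simp
      also have "cubic_form t x = E7_cubic (\<lambda>i. x7 \<xi> i 8) (\<lambda>i. x7 \<xi> i 7) (y7 \<xi>)"
      proof -
        have "(\<Sum>j\<in>{1..6}. \<Sum>k\<in>{1..6}. aa t x j * bb t k * YY t x k j) = (\<Sum>j\<in>{1..6}. \<Sum>k\<in>{1..6}. x7 \<xi> j 7 * x7 \<xi> k 8 * y7 \<xi> k j)"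
          by (intro sum.cong refl) (simp only: a b y)
        then show ?thesis unfolding cubic_form_def E7_cubic_def by (simp add: y)
      qed
      finally show ?thesis .
    qed
  qed (rule refl)+
  then have "\<xi> \<in> H7" by (rule H7_of_chart)
  then show ?thesis unfolding \<xi>_def[abs_def] .
qed

lemma Q_in_T: "Q7_class 6 7 \<in> T"
  unfolding T_def using r7 by simp

lemma RF_divide: "RF f \<Longrightarrow> RF (\<lambda>t. f t / bb t 6)" "RF f \<Longrightarrow> RF (\<lambda>t. f t / ee t)"
  using RF_divide_r[of f] unfolding r_minus at_r ee_def by blast+

lemma RF_conic_factor: "i \<in> {1..6} \<Longrightarrow> RF (\<lambda>t. conic_factor t i)"
proof (cases "i = 6")
  case True then show ?thesis by (simp add: conic_factor_def RF_coord Q_in_T)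
next
  case False
  assume i: "i \<in> {1..6}"
  have "RF (\<lambda>t. conic_factor_aux t i)" unfolding conic_factor_aux_def
    by (intro ratfun_divide_const RF_divide ratfun_add ratfun_mult RF_bb RF_const RF_coord RF_cofactor Q_in_T False i) simp
  then show ?thesis using False by (simp add: conic_factor_def)
qed

lemma RF_aa: "i \<in> {1..6} \<Longrightarrow> RF (\<lambda>t. aa t x i)"
  unfolding conics_def by (intro ratfun_mult RF_conic_factor RF_const)

lemma RF_x_form: "i \<in> {1..6} \<Longrightarrow> j \<in> {1..6} \<Longrightarrow> i \<noteq> j \<Longrightarrow> RF (\<lambda>t. x_form t x i j)"
  unfolding x_form_def by (intro ratfun_minus ratfun_add ratfun_diff ratfun_mult RF_aa RF_bb RF_cofactor in7)

lemma RF_ay_form: "j \<in> {1..6} \<Longrightarrow> RF (\<lambda>t. ay_form t x j)"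
  unfolding ay_form_def by (intro ratfun_sum[OF \<delta>_poly] ratfun_mult RF_aa RF_YY)

lemma RF_cubic_form: "RF (\<lambda>t. cubic_form t x)"
  unfolding cubic_form_def E7_cubic_def
  by (intro ratfun_add ratfun_diff ratfun_sum[OF \<delta>_poly] ratfun_mult RF_aa RF_bb RF_YY; simp)

lemma neg_curves7:
  assumes "E \<in> neg_curves r"
  obtains i where "i \<in> {1..7}" "E = exc i" | i j where "i \<in> {1..6}" "i \<in> {1..7}" "j \<in> {1..7}" "i < j" "E = m_class i j"
    | i j where "i \<in> {1..6}" "i \<in> {1..7}" "j \<in> {1..7}" "i < j" "E = Q7_class i j" | i where "i \<in> {1..7}" "E = C_class i"
proof -
  have "E \<in> exc ` {1..7} \<union> {m_class i j | i j. 1 \<le> i \<and> i < j \<and> j \<le> 7}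
     \<union> {Q7_class i j | i j. 1 \<le> i \<and> i < j \<and> j \<le> 7} \<union> C_class ` {1..7}"
    using assms unfolding r7 neg_curves_7 .
  then consider i where "i \<in> {1..7}" "E = exc i" | i j where "1 \<le> i" "i < j" "j \<le> 7" "E = m_class i j"
    | i j where "1 \<le> i" "i < j" "j \<le> 7" "E = Q7_class i j" | i where "i \<in> {1..7}" "E = C_class i" by blast
  then show ?thesis
  proof cases
    case (2 i j) then show ?thesis using that(2)[of i j] by auto
  next
    case (3 i j) then show ?thesis using that(3)[of i j] by auto
  qed (use that in blast)+
qed

lemma RF_factor: assumes "E \<in> neg_curves r" shows "RF (factor E)"
  using assms
proof (cases rule: neg_curves7)
  case (1 i)
  then have "exc i \<in> T" by (intro T_mem) (simp only: r7)
  then show ?thesis using 1 by (simp add: factor RF_coord)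
next
  case (2 i j)
  note f = factor(2)[OF 2(2-4)]
  show ?thesis
  proof (cases "j = 7")
    case True
    show ?thesis unfolding 2(5) f if_P[OF True] by (intro RF_divide ratfun_divide_const RF_by_form)
  next
    case False
    then show ?thesis unfolding 2(5) f if_not_P[OF False] by (intro RF_line_factor) (use 2 in simp)
  qed
next
  case (3 i j)
  note f = factor(3)[OF 3(2-4)]
  show ?thesis
  proof (cases "j = 7")
    case True
    show ?thesis unfolding 3(5) f if_P[OF True] by (rule RF_conic_factor[OF 3(1)])
  next
    case False
    then have "j \<in> {1..6}" using 3 by auto
    then show ?thesis unfolding 3(5) f if_not_P[OF False]
      by (intro RF_divide ratfun_divide_const RF_x_form[OF 3(1)]) (use 3 in auto)
  qed
next
  case (4 i)
  show ?thesis
  proof (cases "i = 7")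
    case True
    show ?thesis unfolding 4(2) factor(4)[OF 4(1)] if_P[OF True]
      by (intro RF_divide ratfun_divide_const ratfun_minus RF_cubic_form)
  next
    case False
    then have "i \<in> {1..6}" using 4 by auto
    then show ?thesis unfolding 4(2) factor(4)[OF 4(1)] if_not_P[OF False]
      by (intro RF_divide ratfun_divide_const ratfun_minus RF_ay_form)
  qed
qed

end

section \<open>Seven points: no factor vanishes identically\<close>

context sections7 begin

lemma adapted_bb: "adapted B S q t \<Longrightarrow> i \<in> {1..7} \<Longrightarrow> bb t i = (if i \<in> B then exc_value i else 0)"
  using adapted_bb_r r7 by blast

lemma adapted_\<delta>: "adapted B S q t \<Longrightarrow> 6 \<in> B \<Longrightarrow> 7 \<in> B \<Longrightarrow> \<delta> t \<noteq> 0"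
  using adapted_\<delta>_r[of B S q t] unfolding r_minus using r7 by blast

lemmas adapted_YY = adapted_YY_r[unfolded r_minus] and adapted_pivot_factor_zero = adapted_pivot_factor_zero_r[unfolded r_minus]
  and adapted_pivot_factor_nz = adapted_pivot_factor_nz_r[unfolded r_minus] and YY_6 = YY_pivot[unfolded r_minus]
  and other5 = other_inner[unfolded r_minus]

lemma G_m_nz: "i \<in> {1..7} \<Longrightarrow> j \<in> {1..7} \<Longrightarrow> k \<in> {1..7} \<Longrightarrow> i \<noteq> j \<Longrightarrow> k \<noteq> i \<Longrightarrow> k \<noteq> j \<Longrightarrow> G (m_class i j) (p k) \<noteq> 0"
  using G_m(4)[of i j k] r7 by blast

lemma YY_sum:
  assumes ij: "i \<in> {1..6}" "j \<in> {1..6}"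
  shows "YY t (p k + p l) i j = YY t (p k) i j + YY t (p l) i j"
  using form1_basis[OF lines_form[OF ij], of "line_factor t" 1 "p k" 1 "p l" 0 0] by simp

text \<open>If every pair in \<open>S\<close> contains \<open>i\<close>, the cofactor of \<open>(i, 6)\<close> has no nonzero term and only \<open>b\<^sub>i a\<^sub>6\<close> remains.\<close>

lemma conic_factor_nz:
  assumes i: "i \<in> {1..5}" "i \<in> B" "6 \<in> B" and t: "adapted B S q t" "q \<noteq> 0"
    and S: "\<And>s. s \<in> S \<Longrightarrow> i \<in> s"
  shows "conic_factor t i \<noteq> 0"
proof -
  have r: "i \<in> {1..7}" "(6::nat) \<in> {1..7}" "i \<in> {1..6}" "(6::nat) \<in> {1..6}" "i \<noteq> 6" using i by auto
  have "cofactor (YY t (p 7)) i 6 = 0"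
  proof (rule cofactor_zero[OF r(3-5) YY_alt])
    fix a b assume ab: "a \<in> {1..6} - {i, 6}" "b \<in> {1..6} - {i, 6::nat}"
    then have "a \<in> {1..5}" "b \<in> {1..5}" "i \<notin> {a, b}" by auto
    then show "YY t (p 7) a b = 0" using adapted_YY[OF t(1)] S by (metis)
  qed
  then have "conic_factor_aux t i = bb t i * (q * G (Q7_class 6 7) (p 7)) / bb t 6 / G (Q7_class i 7) (p 7)"
    using t(1) unfolding conic_factor_aux_def adapted_def by simp
  then show ?thesis using adapted_bb[OF t(1) r(1)] adapted_bb[OF t(1) r(2)] exc_value(2)[OF r(1)] exc_value(2)[OF r(2)] i
     G_Q(4)[OF r(3) r7] G_Q(4)[OF r(4) r7] t(2) r(5) by (simp add: conic_factor_def)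
qed

lemma conic_factor_witness: assumes i: "i \<in> {1..6}" shows "\<exists>t. \<delta> t \<noteq> 0 \<and> conic_factor t i \<noteq> 0"
proof -
  obtain t where t: "adapted {i, 6, 7} {} 1 t" by (rule adapted_exists)
  have "conic_factor t i \<noteq> 0"
  proof (cases "i = 6")
    case True then show ?thesis using t by (simp add: conic_factor_def adapted_def)
  next
    case False then have "i \<in> {1..5}" using i by auto
    then show ?thesis by (rule conic_factor_nz[OF _ _ _ t]) auto
  qed
  then show ?thesis using adapted_\<delta>[OF t] by auto
qed

text \<open>Without lines the form is \<open>b\<^sub>j a\<^sub>i - b\<^sub>i a\<^sub>j\<close>. At \<open>p\<^sub>i\<close> the conic \<open>a\<^sub>j\<close> vanishes and \<open>a\<^sub>i\<close> does not.\<close>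

lemma x_form_witness:
  assumes ij: "i \<in> {1..6}" "j \<in> {1..6}" "i < j"
  shows "\<exists>t. \<delta> t \<noteq> 0 \<and> (\<exists>x. x_form t x i j \<noteq> 0)"
proof -
  obtain t where t: "adapted {i, j, 6, 7} {} 1 t" by (rule adapted_exists)
  have i5: "i \<in> {1..5}" "i \<in> {1..7}" "j \<in> {1..7}" "i \<noteq> j" using ij by auto
  have A: "conic_factor t i \<noteq> 0" by (rule conic_factor_nz[OF i5(1) _ _ t]) auto
  have pivot_factor: "pivot_factor t l = 0" if "l \<in> {1..5}" for l by (rule adapted_pivot_factor_zero[OF t that]) simp
  have "cofactor (YY t (p i)) i j = 0"
  proof (rule cofactor_zero[OF ij(1,2) i5(4) YY_alt])
    fix a b assume "a \<in> {1..6} - {i, j}" "b \<in> {1..6} - {i, j}"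
    then consider "a = 6 \<and> b = 6" | "a = 6" "b \<in> {1..5}" | "b = 6" "a \<in> {1..5}" | "a \<in> {1..5}" "b \<in> {1..5}" by force
    then show "YY t (p i) a b = 0"
    proof cases
      case 1 then show ?thesis by (simp add: YY_refl)
    next
      case 2 then show ?thesis using YY_swap[of t "p i" 6 b] pivot_factor by (simp add: YY_6)
    next
      case 3 then show ?thesis using pivot_factor by (simp add: YY_6)
    next
      case 4 then show ?thesis using adapted_YY[OF t 4] by simp
    qed
  qed
  moreover have "aa t (p i) j = 0" by (rule conics_zero[OF ij(2,1) i5(4)])
  moreover have "aa t (p i) i \<noteq> 0" using A G_Q(3)[OF ij(1)] by (simp add: conics_def)
  moreover have "bb t j \<noteq> 0" using adapted_bb[OF t i5(3)] exc_value(2)[OF i5(3)] by simp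
  ultimately have "x_form t (p i) i j \<noteq> 0" unfolding x_form_def by simp
  then show ?thesis using adapted_\<delta>[OF t] by blast
qed

text \<open>The parameters leave two lines through \<open>p\<^sub>j\<close>, joining it to \<open>p\<^sub>k\<close> and to \<open>p\<^sub>6\<close> (to \<open>p\<^sub>1\<close> and to \<open>p\<^sub>2\<close> if
  \<open>j = 6\<close>). A point on the second one that is not among the \<open>p\<^sub>i\<close> leaves one product of a line and a conic,
  and \<open>conic_no_line\<close> shows that the conic does not vanish there.\<close>

lemma ay_form_witness:
  assumes j: "j \<in> {1..6}"
  shows "\<exists>t. \<delta> t \<noteq> 0 \<and> (\<exists>x. ay_form t x j \<noteq> 0)"
proof (cases "j = 6")
  case True
  obtain t where t: "adapted {1, 2, 6, 7} {{1, 2}} 1 t" by (rule adapted_exists)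
  have f1: "pivot_factor t 1 \<noteq> 0" by (rule adapted_pivot_factor_nz[OF t, of _ 2]) (auto simp: doubleton_eq_iff)
  have f: "pivot_factor t 3 = 0" "pivot_factor t 4 = 0" "pivot_factor t 5 = 0" by (rule adapted_pivot_factor_zero[OF t]; auto simp: doubleton_eq_iff)+
  let ?x = "p 6 + p 2"
  have z: "YY t ?x 2 6 = 0" using YY_sum[of 2 6 t 6 2] lines_zero[of 2 6 _ "line_factor t"] by simp
  have "ay_form t ?x 6 = aa t ?x 1 * YY t ?x 1 6"
    unfolding ay_form_def sum_six using z by (simp add: YY_refl YY_6 f del: One_nat_def)
  moreover have "YY t ?x 1 6 \<noteq> 0"
    using YY_sum[of 1 6 t 6 2] lines_zero[of 1 6 6 "line_factor t"] YY_6[of 1 t "p 2"] f1 G_m_nz[of 1 6 2] by (simp del: One_nat_def)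
  moreover have "conic_factor t 1 \<noteq> 0" by (rule conic_factor_nz[OF _ _ _ t]) auto
  then have "aa t ?x 1 \<noteq> 0" unfolding conics_def using G_Q(5)[of 1 6 2 1 1] by simp
  ultimately have "ay_form t ?x j \<noteq> 0" using True by simp
  then show ?thesis using adapted_\<delta>[OF t] by blast
next
  case False
  then have j5: "j \<in> {1..5}" using j by auto
  obtain k where k: "k \<in> {1..5}" "k \<noteq> j" using other5 by blast
  obtain t where t: "adapted {k, 6, 7} {{k, j}} 1 t" by (rule adapted_exists)
  have k6: "k \<in> {1..6}" "k \<in> {1..7}" "j \<in> {1..7}" using k j by auto
  let ?x = "p j + p 6"
  have "ay_form t ?x j = aa t ?x k * YY t ?x k j"
    unfolding ay_form_def
  proof (subst sum.remove[OF _ k6(1)])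
    have "(\<Sum>l\<in>{1..6} - {k}. aa t ?x l * YY t ?x l j) = 0"
    proof (rule sum.neutral, rule ballI)
      fix l assume l: "l \<in> {1..6} - {k}"
      show "aa t ?x l * YY t ?x l j = 0"
      proof (cases "l = 6")
        case True
        then show ?thesis using YY_sum[of 6 j t j 6] lines_zero[of 6 j _ "line_factor t"] j by simp
      next
        case False
        then have "l \<in> {1..5}" using l by auto
        then show ?thesis using adapted_YY[OF t _ j5, of l ?x] l k by (auto simp: doubleton_eq_iff)
      qed
    qed
    then show "aa t ?x k * YY t ?x k j + (\<Sum>l\<in>{1..6} - {k}. aa t ?x l * YY t ?x l j) = aa t ?x k * YY t ?x k j" by simp
  qed simp
  moreover have "YY t ?x k j \<noteq> 0"
  proof -
    have "YY t ?x k j = YY t (p 6) k j" using YY_sum[OF k6(1) j, of t j 6] lines_zero[OF k6(1) j, of j "line_factor t"] by simp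
    then show ?thesis using adapted_YY[OF t k(1) j5, of "p 6"] G_m_nz[OF k6(2,3), of 6] sg_nz[OF k(2)] k j5 by auto
  qed
  moreover have "conic_factor t k \<noteq> 0" by (rule conic_factor_nz[OF k(1) _ _ t]) auto
  then have "aa t ?x k \<noteq> 0" unfolding conics_def using G_Q(5)[OF k6(1), of j 6 1 1] j5 k by auto
  ultimately have "ay_form t ?x j \<noteq> 0" by simp
  then show ?thesis using adapted_\<delta>[OF t] by blast
qed

text \<open>The parameters annihilate \<open>a\<^sub>1, a\<^sub>4, a\<^sub>5, a\<^sub>6\<close>. At the intersection \<open>z\<close> of the line through \<open>p\<^sub>4, p\<^sub>5\<close> with
  the line through \<open>p\<^sub>2, p\<^sub>7\<close>, the Pfaffian and the entry 2 of \<open>b y\<close> vanish as well. What remains is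
  \<open>a\<^sub>3 (b y)\<^sub>3\<close>, a conic that meets the line through \<open>p\<^sub>4, p\<^sub>5\<close> only in these points, times the line through
  \<open>p\<^sub>3, p\<^sub>7\<close>, which does not contain \<open>z\<close>.\<close>

lemma cubic_form_witness: "\<exists>t. \<delta> t \<noteq> 0 \<and> (\<exists>x. cubic_form t x \<noteq> 0)"
proof -
  \<comment> \<open>The only nonzero lines are then 12, 13, 45, 26 and 36.\<close>
  obtain t where t: "adapted {1, 6, 7} {{1, 2}, {1, 3}, {4, 5}} 0 t" by (rule adapted_exists)
  have d: "\<delta> t \<noteq> 0" by (rule adapted_\<delta>[OF t]) auto
  have f3: "pivot_factor t 3 \<noteq> 0" by (rule adapted_pivot_factor_nz[OF t, of _ 1]) (auto simp: doubleton_eq_iff)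
  have f0: "pivot_factor t 1 = 0" "pivot_factor t 4 = 0" "pivot_factor t 5 = 0" by (rule adapted_pivot_factor_zero[OF t]; auto simp: doubleton_eq_iff)+
  have Y0: "YY t x 1 4 = 0" "YY t x 1 5 = 0" "YY t x 2 3 = 0" "YY t x 2 4 = 0" "YY t x 2 5 = 0" "YY t x 3 4 = 0" "YY t x 3 5 = 0"
    "YY t x 1 6 = 0" "YY t x 4 6 = 0" "YY t x 5 6 = 0" for x
    using adapted_YY[OF t] f0 by (simp_all add: doubleton_eq_iff YY_6 del: One_nat_def)
  have Y1: "YY t x 1 2 = G (m_class 1 2) x" "YY t x 1 3 = G (m_class 1 3) x" "YY t x 4 5 = G (m_class 4 5) x" for x
    using adapted_YY[OF t] by (simp_all add: sg_def del: One_nat_def)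
  have b: "bb t 2 = 0" "bb t 3 = 0" "bb t 4 = 0" "bb t 5 = 0" "bb t 1 = exc_value 1" "bb t 6 = exc_value 6"
    using adapted_bb[OF t] by (simp_all del: One_nat_def)
  have c: "exc_value 6 \<noteq> 0" by (rule exc_value(2)) simp
  have last_conic_factor: "conic_factor t 6 = 0" using t by (simp add: conic_factor_def adapted_def)
  have a6: "aa t x 6 = 0" for x by (simp add: conics_def last_conic_factor)
  note R = E6rel_sorted[OF E6_at_7[OF d], unfolded a6 Y0]
  have "aa t (p 7) 1 = 0" "aa t (p 7) 4 = 0" "aa t (p 7) 5 = 0" using R(5,14,15) c by (simp_all add: b)
  then have A0: "conic_factor t 1 = 0" "conic_factor t 4 = 0" "conic_factor t 5 = 0"
    using G_Q(4)[OF _ r7, of 1] G_Q(4)[OF _ r7, of 4] G_Q(4)[OF _ r7, of 5] by (simp_all add: conics_def)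
  have "exc_value 6 * aa t (p 7) 3 = G (m_class 1 2) (p 7) * G (m_class 4 5) (p 7)"
    using R(12) unfolding b Y1 by (simp add: algebra_simps)
  then have A3: "conic_factor t 3 \<noteq> 0" using G_m_nz[of 1 2 7] G_m_nz[of 4 5 7] by (auto simp: conics_def)
  \<comment> \<open>By Cramer's rule this combination of \<open>p\<^sub>4\<close> and \<open>p\<^sub>5\<close> is also one of \<open>p\<^sub>2\<close> and \<open>p\<^sub>7\<close>.\<close>
  define z where "z = tri (p 5) (p 2) (p 7) *s p 4 + (- tri (p 4) (p 2) (p 7)) *s p 5"
  have tr: "tri (p i) (p j) (p k) \<noteq> 0" if "i \<in> {1..7}" "j \<in> {1..7}" "k \<in> {1..7}" "i \<noteq> j" "i \<noteq> k" "j \<noteq> k" for i j k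
    by (rule tri_nz) (use that r7 in simp_all)
  have y45: "YY t z 4 5 = 0"
    using form1_basis[OF lines_form[of 4 5], of "line_factor t" "tri (p 5) (p 2) (p 7)" "p 4" "- tri (p 4) (p 2) (p 7)" "p 5" 0 0]
      lines_zero[of 4 5 4 "line_factor t"] lines_zero[of 4 5 5 "line_factor t"] by (simp add: z_def)
  have multiple: "by_form t x j = by_form t (p 1) j / tri (p 1) (p j) (p 7) * tri x (p j) (p 7)" if j: "j \<in> {2..6}" for j x
  proof (rule line_unique[where i = j and j = 7 and g = "\<lambda>x. tri x (p j) (p 7)"])
    have j6: "j \<in> {1..6}" using j by auto
    show "ternary_form 1 (\<lambda>x. by_form t x j)" unfolding by_form_def by (intro form_sum form_scale lines_form j6)
    show "by_form t (p j) j = 0" unfolding by_form_def by (rule sum.neutral) (use lines_zero j6 in auto)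
    show "by_form t (p 7) j = 0" using E6_at_7[OF d] j6 unfolding by_form_def E6rel_def by blast
    show "ternary_form 1 (\<lambda>x. tri x (p j) (p 7))" by (rule form_tri)
    show "tri (p 1) (p j) (p 7) \<noteq> 0" by (rule tr) (use j in auto)
    show "j \<in> {1..r}" "7 \<in> {1..r}" "j \<noteq> 7" using j r7 by auto
    show "tri (p j) (p j) (p 7) = 0" "tri (p 7) (p j) (p 7) = 0" by simp_all
  qed
  have z2: "tri z (p 2) (p 7) = 0" and z3: "tri z (p 3) (p 7) = - (tri (p 4) (p 5) (p 7) * tri (p 2) (p 3) (p 7))"
    unfolding z_def by (simp_all add: tri_expand algebra_simps)
  have W2: "by_form t z 2 = 0" using multiple[of 2 z] z2 by simp
  have "by_form t (p 1) 3 = exc_value 6 * YY t (p 1) 6 3"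
    unfolding by_form_def sum_six b using lines_zero[of 1 3 1 "line_factor t"] by simp
  then have "by_form t (p 1) 3 \<noteq> 0" using YY_swap[of t "p 1" 6 3] YY_6[of 3 t "p 1"] f3 G_m_nz[of 3 6 1] c by simp
  then have W3: "by_form t z 3 \<noteq> 0" using multiple[of 3 z] z3 tr[of 1 3 7] tr[of 4 5 7] tr[of 2 3 7] by simp
  have a3: "aa t z 3 \<noteq> 0"
    unfolding conics_def z_def using A3 G_Q(5)[of 3 4 5 "tri (p 5) (p 2) (p 7)" "- tri (p 4) (p 2) (p 7)"] tr[of 5 2 7] tr[of 4 2 7] by simp
  have "(\<Sum>j\<in>{1..6}. \<Sum>k\<in>{1..6}. aa t z j * bb t k * YY t z k j) = (\<Sum>j\<in>{1..6}. aa t z j * by_form t z j)"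
    unfolding by_form_def sum_distrib_left by (simp add: mult.assoc)
  also have "\<dots> = aa t z 3 * by_form t z 3"
    unfolding sum_six W2 a6 by (simp add: conics_def A0 del: One_nat_def)
  finally have "cubic_form t z = aa t z 3 * by_form t z 3"
    unfolding cubic_form_def E7_cubic_def Y0 y45 by simp
  then show ?thesis using d W3 a3 by (intro exI[of _ t] conjI exI[of _ z]) simp_all
qed

lemma factor_nz:
  assumes E: "E \<in> neg_curves r" shows "\<exists>t. \<delta> t \<noteq> 0 \<and> factor E t \<noteq> 0"
  using E
proof (cases rule: neg_curves7)
  case (1 i) then show ?thesis using coord_witness by (simp add: factor)
next
  case (2 i j)
  note i = 2(1) and f = factor(2)[OF 2(2-4)]
  show ?thesis
  proof (cases "j = 7")
    case True
    obtain t x where t: "\<delta> t \<noteq> 0" "by_form t x i \<noteq> 0" using by_form_witness[unfolded r_minus, OF i] by blast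
    have z: "G (m_class i 7) (nonzero_point (m_class i 7)) \<noteq> 0" using nonzero_point[OF E] 2(5) True by simp
    have "by_form t (nonzero_point (m_class i 7)) i \<noteq> 0" using by_form_multiple7[OF t(1) i z, of x] t(2) by auto
    then have "factor E t \<noteq> 0" unfolding 2(5) f using True z \<delta>_nz[OF t(1)] by simp
    then show ?thesis using t(1) by blast
  next
    case False
    then have "j \<in> {1..6}" using 2 by auto
    from line_factor_witness[unfolded r_minus, OF i this 2(4)] show ?thesis unfolding 2(5) f using False by simp
  qed
next
  case (3 i j)
  note i = 3(1) and f = factor(3)[OF 3(2-4)]
  show ?thesis
  proof (cases "j = 7")
    case True
    then show ?thesis unfolding 3(5) f using conic_factor_witness[OF i] by simp
  next
    case False
    then have j: "j \<in> {1..6}" using 3 by auto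
    obtain t x where t: "\<delta> t \<noteq> 0" "x_form t x i j \<noteq> 0" using x_form_witness[OF i j 3(4)] by blast
    have z: "G (Q7_class i j) (nonzero_point (Q7_class i j)) \<noteq> 0" using nonzero_point[OF E] 3(5) by simp
    have "x_form t (nonzero_point (Q7_class i j)) i j \<noteq> 0" using x_form_multiple[OF t(1) i j _ z, of x] t(2) 3(4) by auto
    then have "factor E t \<noteq> 0" unfolding 3(5) f using False z \<delta>_nz[OF t(1)] by simp
    then show ?thesis using t(1) by blast
  qed
next
  case (4 i)
  note f = factor(4)[OF 4(1)]
  have z: "G (C_class i) (nonzero_point (C_class i)) \<noteq> 0" using nonzero_point[OF E] 4(2) by simp
  show ?thesis
  proof (cases "i = 7")
    case True
    obtain t x where t: "\<delta> t \<noteq> 0" "cubic_form t x \<noteq> 0" using cubic_form_witness by blast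
    have "cubic_form t (nonzero_point (C_class 7)) \<noteq> 0" using cubic_form_multiple[OF t(1) z[unfolded True], of x] t(2) by auto
    then have "factor E t \<noteq> 0" unfolding 4(2) f using True z \<delta>_nz[OF t(1)] by simp
    then show ?thesis using t(1) by blast
  next
    case False
    then have i: "i \<in> {1..6}" using 4 by auto
    obtain t x where t: "\<delta> t \<noteq> 0" "ay_form t x i \<noteq> 0" using ay_form_witness[OF i] by blast
    have "ay_form t (nonzero_point (C_class i)) i \<noteq> 0" using ay_form_multiple[OF t(1) i z, of x] t(2) by auto
    then have "factor E t \<noteq> 0" unfolding 4(2) f using False z \<delta>_nz[OF t(1)] by simp
    then show ?thesis using t(1) by blast
  qed
qed

lemma factor_T: "E \<in> T \<Longrightarrow> factor E t = t E"
proof -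
  assume "E \<in> T"
  then consider i where "i \<in> {1..7}" "E = exc i" | i j where "1 \<le> i" "i < j" "j \<le> 5" "E = m_class i j" | "E = Q7_class 6 7"
    unfolding T_def r_minus using r7 by auto
  then show ?thesis
  proof cases
    case (1 i) then show ?thesis by (simp add: factor)
  next
    case (2 i j)
    then have "i \<in> {1..7}" "j \<in> {1..7}" "j \<noteq> 7" "i \<in> {1..r - 2}" "j \<in> {1..r - 2}" unfolding r_minus by auto
    then show ?thesis using factor(2)[of i j] line_factor_inner[of i j t] 2 by simp
  next
    case 3 then show ?thesis using factor(3)[of 6 7] by (simp add: conic_factor_def)
  qed
qed

theorem family7: "\<exists>T U f. parameter_family (num_neg_curves (r - 2) + 2) r T U f \<and>
    (\<forall>t\<in>U. good_rescaling r p s (f t))"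
proof -
  obtain U where U: "parameter_family (num_neg_curves (r - 2) + 2) r T U (\<lambda>t E. factor E t)"
    "\<And>t. t \<in> U \<Longrightarrow> \<delta> t \<noteq> 0" "\<And>t. t \<in> U \<Longrightarrow> rescaling r (\<lambda>E. factor E t)"
    using family_of_factors[OF RF_factor factor_T factor_nz] by blast
  have "good_rescaling r p s (\<lambda>E. factor E t)" if t: "t \<in> U" for t
  proof -
    have "rescale (\<lambda>E. factor E t) ` A_S r p s \<subseteq> H7"
      by (rule rescaling_into_H7[OF r7]) (rule point_in_H7[OF U(2)[OF t]])
    then show ?thesis using U(3)[OF t] unfolding good_rescaling_def H_cone_def by (simp add: r7)
  qed
  then show ?thesis using U(1) by (intro exI[of _ T] exI[of _ U] exI[of _ "\<lambda>t E. factor E t"]) simp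
qed

end

section \<open>Six points: the cubic form and its partial derivatives\<close>

text \<open>The signs \<open>eps6\<close> and \<open>eta6\<close> convert the cubic written with three \<open>3 \<times> 3\<close> matrices into \<open>E7_cubic\<close>.\<close>

definition eps6 :: "nat \<Rightarrow> nat \<Rightarrow> 'a::comm_ring_1" where
  "eps6 i j = (if (i, j) \<in> {(1,2),(2,3),(4,5),(5,6)} then 1 else -1)"

definition eta6 :: "nat \<Rightarrow> 'a::comm_ring_1" where
  "eta6 i = (if i \<le> 3 then 1 else -1)"

definition Y6 :: "(pic \<Rightarrow> 'a::comm_ring_1) \<Rightarrow> nat \<Rightarrow> nat \<Rightarrow> 'a" where
  "Y6 P i j = (if i < j then eps6 i j * P (m_class i j) else if j < i then - (eps6 j i * P (m_class j i)) else 0)"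

lemma Q6_Q7: "Q6_class i = Q7_class i 7"
proof -
  have "{1..7} = insert 7 {1..6::nat}" by auto
  then have "exc_sum {1..7} = exc 7 + exc_sum {1..6}" by (simp add: exc_sum_insert)
  then show "Q6_class i = Q7_class i 7" by (simp add: Q7_class_def Q6_class_def)
qed

lemma Y6_alt: "alternating (Y6 P)"
  unfolding alternating_def Y6_def by auto

lemma F6_cubic: "F6 P = E7_cubic (\<lambda>i. eta6 i * P (exc i)) (\<lambda>i. P (Q6_class i)) (Y6 P)"
  unfolding E7_cubic_def alternating_double_sum[OF Y6_alt]
  unfolding F6_def Let_def det_3 trace_def matrix_matrix_mult_def sum_3
  by (simp add: vector_3 Y6_def eps6_def eta6_def algebra_simps del: One_nat_def)

text \<open>Over \<open>'a poly\<close> the cubic is again \<open>E7_cubic\<close>, so its derivative with respect to any one variable is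
  covered by the chain rule \<open>E7_cubic_pderiv\<close>.\<close>

lemma H6_of_E6rel:
  fixes \<xi> :: "pic \<Rightarrow> 'a::field_char_0"
  assumes E: "E6rel (\<lambda>i. eta6 i * \<xi> (exc i)) (\<lambda>i. \<xi> (Q6_class i)) (Y6 \<xi>)"
  shows "\<xi> \<in> H6"
  unfolding H6_def
proof (intro CollectI ballI)
  fix E
  define P where "P = ((\<lambda>E'. [:\<xi> E':])(E := [:0, 1:]))"
  have P: "poly (P E') (\<xi> E) = \<xi> E'" for E' by (simp add: P_def)
  have e: "poly (eps6 i j) c = eps6 i j" "poly (eta6 i) c = eta6 i" for c :: 'a and i j by (simp_all add: eps6_def eta6_def)
  have Y: "poly (Y6 P i j) (\<xi> E) = Y6 \<xi> i j" for i j by (simp add: Y6_def P e)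
  have "E6rel (\<lambda>i. poly (eta6 i * P (exc i)) (\<xi> E)) (\<lambda>i. poly (P (Q6_class i)) (\<xi> E)) (\<lambda>i j. poly (Y6 P i j) (\<xi> E))"
    unfolding Y poly_mult P e by (rule assms)
  from E7_cubic_pderiv(2)[OF this Y6_alt] show "partial_F6 E \<xi> = 0"
    unfolding partial_F6_def P_def[symmetric] F6_cubic .
qed

text \<open>The equations of \<open>H6\<close> up to the signs of \<open>F6_cubic\<close>.\<close>

definition E6_point :: "(pic \<Rightarrow> 'a::field) \<Rightarrow> bool" where
  "E6_point \<xi> \<longleftrightarrow> E6rel (\<lambda>i. \<xi> (exc i)) (\<lambda>i. \<xi> (Q7_class i 7)) (\<lambda>i j. sg i j * \<xi> (m_class i j))"

lemma exc_sum_labelling: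
  assumes L: "labelling \<sigma> i j k l m n"
  shows "exc_sum {1..7} = exc i + exc j + exc k + exc l + exc m + exc n + exc 7"
proof -
  have "{1..7} = insert 7 {1..6::nat}" by auto
  then have "exc_sum {1..7} = exc 7 + exc_sum {1..6}" by (simp add: exc_sum_insert)
  then show ?thesis unfolding exc_sum_def labelling_sum[OF L] by (simp add: ac_simps)
qed

lemma quad_alternating:
  assumes L: "labelling \<sigma> i j k l m n"
  shows "quad_rel 6 (hyp 2 - exc k - exc l - exc m - exc n)
    (\<lambda>\<xi>. \<xi> (exc i) * \<xi> (Q7_class j 7) - \<xi> (exc j) * \<xi> (Q7_class i 7)
       + \<sigma> * pf4 (\<lambda>i j. sg i j * \<xi> (m_class i j)) k l m n)"
proof -
  note r = labelling_range[OF L] and d = labelling_distinct[OF L]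
  have h2: "hyp 2 = hyp 1 + hyp 1" by (simp add: hyp_add)
  have Q: "quad_rel 6 (hyp 2 - exc k - exc l - exc m - exc n) (\<lambda>\<xi>. \<xi> (exc i) * \<xi> (Q7_class j 7))"
    if "exc i + exc j + exc k + exc l + exc m + exc n + exc 7 = exc_sum {1..7}" "i \<in> {1..6}" "j \<in> {1..6}" for i j :: nat
  proof -
    have "exc i + Q7_class j 7 = hyp 2 - exc k - exc l - exc m - exc n"
      unfolding Q7_class_def that(1)[symmetric] by (simp add: algebra_simps)
    then show ?thesis using quad_term[of "exc i" 6 "Q7_class j 7" _ 1] Q6_in[OF that(3)] exc_in[OF that(2)] by simp
  qed
  have M: "quad_rel 6 (hyp 2 - exc k - exc l - exc m - exc n)
      (\<lambda>\<xi>. (sg q u * \<xi> (m_class q u)) * (sg v w * \<xi> (m_class v w)))"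
    if "exc q + exc u + exc v + exc w = exc k + exc l + exc m + exc n" "q \<in> {1..6}" "u \<in> {1..6}" "v \<in> {1..6}" "w \<in> {1..6}" "q \<noteq> u" "v \<noteq> w" for q u v w
  proof -
    have "hyp 2 - exc k - exc l - exc m - exc n = hyp 2 - (exc k + exc l + exc m + exc n)" by (simp add: algebra_simps)
    also have "\<dots> = m_class q u + m_class v w" unfolding that(1)[symmetric] m_class_def h2 by (simp add: algebra_simps)
    finally show ?thesis by (intro quad_signed_term m_in that) simp
  qed
  have s: "exc i + exc j + exc k + exc l + exc m + exc n + exc 7 = exc_sum {1..7}"
    "exc j + exc i + exc k + exc l + exc m + exc n + exc 7 = exc_sum {1..7}"
    unfolding exc_sum_labelling[OF L] by (simp_all add: ac_simps)
  show ?thesis unfolding pf4_def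
    by (intro quad_add quad_diff quad_scale Q M s r) (use d in \<open>auto simp: ac_simps\<close>)
qed

text \<open>The term with \<open>k = j\<close> has coefficient 0 and must be dropped, as \<open>m_class j j\<close> is not a \<open>(-1)\<close>-curve.\<close>

lemma quad_column:
  assumes j: "j \<in> {1..6}"
    and c: "\<And>k. k \<in> {1..6} \<Longrightarrow> c k \<in> neg_curves 6" "\<And>k. k \<in> {1..6} \<Longrightarrow> c k = D + exc k"
  shows "quad_rel 6 (D + hyp 1 - exc j) (\<lambda>\<xi>. \<Sum>k\<in>{1..6}. \<xi> (c k) * (sg k j * \<xi> (m_class k j)))"
proof -
  have "(\<Sum>k\<in>{1..6}. \<xi> (c k) * (sg k j * \<xi> (m_class k j))) = (\<Sum>k\<in>{1..6} - {j}. (1 * \<xi> (c k)) * (sg k j * \<xi> (m_class k j)))" for \<xi> :: "pic \<Rightarrow> 'a"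
    using sum.remove[OF _ j, of "\<lambda>k. \<xi> (c k) * (sg k j * \<xi> (m_class k j))"] by (simp add: sg_refl)
  moreover have "quad_rel 6 (D + hyp 1 - exc j) (\<lambda>\<xi>::pic \<Rightarrow> 'a. \<Sum>k\<in>{1..6} - {j}. (1 * \<xi> (c k)) * (sg k j * \<xi> (m_class k j)))"
  proof (rule quad_sum)
    have "card {j} < card {1..6::nat}" by simp
    then show "{1..6} - {j} \<noteq> {}" by (metis Diff_eq_empty_iff card_mono finite.emptyI finite.insertI leD)
    show "quad_rel 6 (D + hyp 1 - exc j) (\<lambda>\<xi>::pic \<Rightarrow> 'a. (1 * \<xi> (c k)) * (sg k j * \<xi> (m_class k j)))" if "k \<in> {1..6} - {j}" for k
      using that j c by (intro quad_signed_term m_in) (auto simp: m_class_def)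
  qed simp
  ultimately show ?thesis by simp
qed

text \<open>The 27 quadrics are homogeneous, so it suffices to test them at general points.\<close>

lemma (in sections) E6_point_transfer:
  assumes r: "r = 6" and \<phi>: "\<phi> \<in> cox_points r p" and f: "\<And>x. generic x \<Longrightarrow> E6_point (\<lambda>E. f E * G E x)"
    and \<xi>: "\<And>E. E \<in> neg_curves r \<Longrightarrow> \<xi> E = f E * \<phi> (Poly_Mapping.single E (s E))"
  shows "E6_point \<xi>"
  unfolding E6_point_def E6rel_def
proof (intro conjI allI impI ballI)
  fix \<sigma> :: 'a and i j k l m n :: nat assume L: "labelling \<sigma> i j k l m n"
  show "\<xi> (exc i) * \<xi> (Q7_class j 7) - \<xi> (exc j) * \<xi> (Q7_class i 7)
       + \<sigma> * pf4 (\<lambda>i j. sg i j * \<xi> (m_class i j)) k l m n = 0"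
    by (rule quad_transfer[OF quad_alternating[OF L, folded r] \<phi> _ \<xi>])
       (use f L in \<open>unfold E6_point_def E6rel_def, blast\<close>)
next
  fix j :: nat assume j: "j \<in> {1..6}"
  have "quad_rel r (0 + hyp 1 - exc j) (\<lambda>\<xi>::pic \<Rightarrow> 'a. \<Sum>k\<in>{1..6}. \<xi> (exc k) * (sg k j * \<xi> (m_class k j)))"
    unfolding r by (rule quad_column[OF j]) (auto intro: exc_in)
  from quad_transfer[OF this \<phi> _ \<xi>]
  show "(\<Sum>k\<in>{1..6}. \<xi> (exc k) * (sg k j * \<xi> (m_class k j))) = 0"
    using f j unfolding E6_point_def E6rel_def by blast
  have "quad_rel r ((hyp 2 - exc_sum {1..7} + exc 7) + hyp 1 - exc j) (\<lambda>\<xi>::pic \<Rightarrow> 'a. \<Sum>k\<in>{1..6}. \<xi> (Q7_class k 7) * (sg k j * \<xi> (m_class k j)))"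
    unfolding r by (rule quad_column[OF j Q6_in]) (auto simp: Q7_class_def algebra_simps)
  from quad_transfer[OF this \<phi> _ \<xi>]
  show "(\<Sum>k\<in>{1..6}. \<xi> (Q7_class k 7) * (sg k j * \<xi> (m_class k j))) = 0"
    using f j unfolding E6_point_def E6rel_def by blast
qed

text \<open>The signs can be absorbed into a rescaling \<open>\<kappa>\<close>.\<close>

lemma signs6: obtains \<kappa> :: "pic \<Rightarrow> 'a::field_char_0"
  where "\<And>E. \<kappa> E \<noteq> 0" "\<And>\<xi>. E6_point (\<lambda>E. \<kappa> E * \<xi> E) \<Longrightarrow> \<xi> \<in> H6"
proof -
  obtain h :: "pic \<Rightarrow> 'a" where h: "\<And>i. i \<in> {1..7} \<Longrightarrow> h (exc i) = eta6 i"
    "\<And>i j. i \<in> {1..7} \<Longrightarrow> j \<in> {1..7} \<Longrightarrow> i < j \<Longrightarrow> h (m_class i j) = eps6 i j"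
    "\<And>i j. i \<in> {1..7} \<Longrightarrow> j \<in> {1..7} \<Longrightarrow> i < j \<Longrightarrow> h (Q7_class i j) = 1"
    by (rule class_function[of eta6 eps6 "\<lambda>i j. 1" "\<lambda>_. 1"]) blast
  define \<kappa> where "\<kappa> E = (if h E = 0 then 1 else h E)" for E
  have k: "\<kappa> (exc i) = eta6 i" "\<kappa> (Q7_class i 7) = 1" if "i \<in> {1..6}" for i
    using that h by (auto simp: \<kappa>_def eta6_def)
  have km: "\<kappa> (m_class i j) = eps6 i j" if "i \<in> {1..6}" "j \<in> {1..6}" "i < j" for i j
    using that h by (auto simp: \<kappa>_def eps6_def)
  have "\<xi> \<in> H6" if S: "E6_point (\<lambda>E. \<kappa> E * \<xi> E)" for \<xi>
  proof (rule H6_of_E6rel)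
    have Y: "sg i j * (\<kappa> (m_class i j) * \<xi> (m_class i j)) = Y6 \<xi> i j" if ij: "i \<in> {1..6}" "j \<in> {1..6}" for i j
    proof -
      consider "i < j" | "j < i" | "i = j" by linarith
      then show ?thesis
      proof cases
        case 1 then show ?thesis using km ij by (simp add: sg_def Y6_def)
      next
        case 2 then show ?thesis using km[of j i] ij by (simp add: sg_def Y6_def m_class_commute[of i j])
      qed (simp add: sg_def Y6_def)
    qed
    note D = S[unfolded E6_point_def E6rel_def]
    show "E6rel (\<lambda>i. eta6 i * \<xi> (exc i)) (\<lambda>i. \<xi> (Q6_class i)) (Y6 \<xi>)"
      unfolding E6rel_def Q6_Q7
    proof (intro conjI allI impI ballI)
      fix \<sigma> :: 'a and i j k l m n :: nat assume L: "labelling \<sigma> i j k l m n"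
      note r = labelling_range[OF L]
      show "eta6 i * \<xi> (exc i) * \<xi> (Q7_class j 7) - eta6 j * \<xi> (exc j) * \<xi> (Q7_class i 7) + \<sigma> * pf4 (Y6 \<xi>) k l m n = 0"
        using conjunct1[OF D, rule_format, OF L]
        unfolding pf4_def Y[OF r(3,4)] Y[OF r(5,6)] Y[OF r(3,5)] Y[OF r(4,6)] Y[OF r(3,6)] Y[OF r(4,5)] k(1)[OF r(1)] k(1)[OF r(2)] k(2)[OF r(1)] k(2)[OF r(2)]
        by simp
    next
      fix j :: nat assume j: "j \<in> {1..6}"
      have "(\<Sum>k\<in>{1..6}. eta6 k * \<xi> (exc k) * Y6 \<xi> k j) = (\<Sum>k\<in>{1..6}. \<kappa> (exc k) * \<xi> (exc k) * (sg k j * (\<kappa> (m_class k j) * \<xi> (m_class k j))))"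
        by (rule sum.cong[OF refl]) (simp only: Y j k)
      then show "(\<Sum>k\<in>{1..6}. eta6 k * \<xi> (exc k) * Y6 \<xi> k j) = 0" using D j by simp
      have "(\<Sum>k\<in>{1..6}. \<xi> (Q7_class k 7) * Y6 \<xi> k j) = (\<Sum>k\<in>{1..6}. \<kappa> (Q7_class k 7) * \<xi> (Q7_class k 7) * (sg k j * (\<kappa> (m_class k j) * \<xi> (m_class k j))))"
        by (rule sum.cong[OF refl]) (simp only: Y j k mult_1)
      then show "(\<Sum>k\<in>{1..6}. \<xi> (Q7_class k 7) * Y6 \<xi> k j) = 0" using D j by simp
    qed
  qed
  moreover have "\<kappa> E \<noteq> 0" for E by (simp add: \<kappa>_def)
  ultimately show ?thesis by (rule that[rotated])
qed

section \<open>Six points: the factors and the equations\<close>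

locale sections6 = sections +
  assumes r6': "r = 6"

sublocale sections6 \<subseteq> sections67
  by unfold_locales (simp add: r6')

context sections6 begin

lemma r_minus: "r - 1 = 5" "r - 2 = 4"
  using r6' by simp_all

lemma at_r: "p r = p 6" "bb t r = bb t 6" "m_class j r = m_class j 6"
  by (simp_all only: r6')

text \<open>At \<open>p\<^sub>6\<close> only the conic of the class \<open>Q7_class 6 7\<close> is nonzero; its factor is determined by the equation
  \<open>b\<^sub>5 a\<^sub>6 + cofactor = 0\<close>.\<close>

definition last_conic_factor :: "(pic \<Rightarrow> 'a) \<Rightarrow> 'a" where
  "last_conic_factor t = - cofactor (YY t (p 6)) 5 6 / bb t 5 / G (Q7_class 6 7) (p 6)"

text \<open>The form that has to agree with \<open>b\<^sub>6 a\<^sub>i\<close>.\<close>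

definition x_form :: "(pic \<Rightarrow> 'a) \<Rightarrow> 'a^3 \<Rightarrow> nat \<Rightarrow> 'a" where
  "x_form t x i = bb t i * (last_conic_factor t * G (Q7_class 6 7) x) + cofactor (YY t x) i 6"

definition last_line_factor :: "(pic \<Rightarrow> 'a) \<Rightarrow> nat \<Rightarrow> 'a" where
  "last_line_factor t j = by_form t (nonzero_point (m_class j 6)) j / G (m_class j 6) (nonzero_point (m_class j 6)) / bb t 6"

text \<open>Besides the lines that avoid \<open>p\<^sub>6\<close>, those through \<open>p\<^sub>6\<close>, with factors chosen such that \<open>b y = 0\<close> for every \<open>x\<close>.\<close>

definition all_line_factor :: "(pic \<Rightarrow> 'a) \<Rightarrow> nat \<Rightarrow> nat \<Rightarrow> 'a" where
  "all_line_factor t i j = (if i = 6 then last_line_factor t j else if j = 6 then last_line_factor t i else line_factor t i j)"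

definition conic_factor :: "(pic \<Rightarrow> 'a) \<Rightarrow> nat \<Rightarrow> 'a" where
  "conic_factor t i = (if i = 6 then last_conic_factor t else x_form t (nonzero_point (Q7_class i 7)) i / G (Q7_class i 7) (nonzero_point (Q7_class i 7)) / bb t 6)"

abbreviation all_lines :: "(pic \<Rightarrow> 'a) \<Rightarrow> 'a^3 \<Rightarrow> nat \<Rightarrow> nat \<Rightarrow> 'a" where "all_lines t x \<equiv> lines (all_line_factor t) x"
abbreviation aa :: "(pic \<Rightarrow> 'a) \<Rightarrow> 'a^3 \<Rightarrow> nat \<Rightarrow> 'a" where "aa t x \<equiv> conics (conic_factor t) x"

lemma all_line_factor_sym: "all_line_factor t i j = all_line_factor t j i"
  using line_factor_sym[of t i j] by (simp add: all_line_factor_def)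

lemma all_lines_alt: "alternating (all_lines t x)"
  by (rule lines_alternating) (rule all_line_factor_sym)

lemma YY_6: "YY t x k 6 = 0" "YY t x 6 k = 0"
  using YY_outside[of 6 t x k] r_minus by auto

lemma \<delta>_nz: "\<delta> t \<noteq> 0 \<Longrightarrow> bb t 5 \<noteq> 0 \<and> bb t 6 \<noteq> 0"
  using \<delta>_nz_r[of t] unfolding r_minus at_r .

lemma G_m_nz: "i \<in> {1..6} \<Longrightarrow> j \<in> {1..6} \<Longrightarrow> k \<in> {1..6} \<Longrightarrow> i \<noteq> j \<Longrightarrow> k \<noteq> i \<Longrightarrow> k \<noteq> j \<Longrightarrow> G (m_class i j) (p k) \<noteq> 0"
  using G_m(4)[of i j k] r6' by blast

lemma x_form_at_6:
  assumes d: "\<delta> t \<noteq> 0" and i: "i \<in> {1..5}"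
  shows "x_form t (p 6) i = 0"
proof -
  have b5: "bb t 5 \<noteq> 0" using \<delta>_nz[OF d] by simp
  have bcol: "(\<Sum>k\<in>{1..6}. bb t k * YY t (p 6) k j) = 0" if "j \<in> {1..6}" for j
    using by_form_last[OF d that] unfolding by_form_def at_r .
  have ba: "bb t 5 * (last_conic_factor t * G (Q7_class 6 7) (p 6)) + \<sigma> * pf4 (YY t (p 6)) k l m n = 0"
    if L: "labelling \<sigma> 5 6 k l m n" for \<sigma> k l m n
    using b5 G_Q(3)[of 6] cofactor_eq[OF L YY_alt, of t "p 6"] unfolding last_conic_factor_def by simp
  have "i \<in> {1..6}" "(6::nat) \<in> {1..6}" "i \<noteq> 6" using i by auto
  then obtain \<sigma> k l m n where L: "labelling (\<sigma>::'a) i 6 k l m n" using labelling_exists by metis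
  show ?thesis unfolding x_form_def cofactor_eq[OF L YY_alt]
    by (rule H5_chart[OF YY_alt YY_6(1) b5 bcol ba]) (assumption | rule L)+
qed

lemmas by_form_multiple6 = by_form_multiple[unfolded r_minus at_r]

text \<open>The conic contains \<open>p\<^sub>6\<close> by \<open>x_form_at_6\<close> and the four other points term by term.\<close>

lemma x_form_multiple:
  assumes d: "\<delta> t \<noteq> 0" and i: "i \<in> {1..5}" and z: "G (Q7_class i 7) z \<noteq> 0"
  shows "x_form t x i = x_form t z i / G (Q7_class i 7) z * G (Q7_class i 7) x"
proof (rule conic_unique[where I = "{1..6} - {i}"])
  have i6: "i \<in> {1..6}" "(6::nat) \<in> {1..6}" "i \<noteq> 6" using i by auto
  show "ternary_form 2 (\<lambda>x. x_form t x i)" unfolding x_form_def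
    by (intro form_add form_scale G_Q cofactor_form(1) line_factor_sym i6)
  show "ternary_form 2 (G (Q7_class i 7))" by (rule G_Q(1)[OF i6(1)])
  show "G (Q7_class i 7) (p q) = 0" if "q \<in> {1..6} - {i}" for q by (rule G_Q(2)[OF i6(1) that])
  show "x_form t (p q) i = 0" if q: "q \<in> {1..6} - {i}" for q
  proof (cases "q = 6")
    case True then show ?thesis using x_form_at_6[OF d i] by simp
  next
    case False
    then have q6: "q \<in> {1..6} - {i, 6}" using q by auto
    have "cofactor (YY t (p q)) i 6 = 0" by (rule cofactor_form(2)[OF line_factor_sym i6 q6])
    moreover have "G (Q7_class 6 7) (p q) = 0" by (rule G_Q(2)) (use q6 in auto)
    ultimately show ?thesis unfolding x_form_def by simp
  qed
  show "{1..6} - {i} \<subseteq> {1..r}" "card ({1..6} - {i}) = 5" by (rule conic_points[OF i6(1)])+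
qed (rule z)

text \<open>The factors of the lines through \<open>p\<^sub>6\<close> and of the conics other than \<open>a\<^sub>6\<close> solve the equations of
  \<open>E6_chart\<close> identically in \<open>x\<close>.\<close>

lemma E6_everywhere:
  assumes d: "\<delta> t \<noteq> 0"
  shows "E6rel (bb t) (aa t x) (all_lines t x)"
proof (rule E6_chart[OF all_lines_alt])
  show b6: "bb t 6 \<noteq> 0" using \<delta>_nz[OF d] by simp
  have Y5: "all_lines t x i j = YY t x i j" if "i \<noteq> 6" "j \<noteq> 6" for i j using that by (simp add: lines_def all_line_factor_def)
  show "(\<Sum>k\<in>{1..6}. bb t k * all_lines t x k j) = 0" if j: "j \<in> {1..6}" "j \<noteq> 6" for j
  proof -
    have j5: "j \<in> {1..5}" using j by auto
    have m: "m_class j 6 \<in> neg_curves r" using j r6' by (intro m_in) auto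
    have "{1..6} = insert 6 {1..5::nat}" by auto
    then have s: "(\<Sum>k\<in>{1..6}. f k) = f 6 + (\<Sum>k\<in>{1..5}. f k)" for f :: "nat \<Rightarrow> 'a" by simp
    have "(\<Sum>k\<in>{1..5}. bb t k * all_lines t x k j) = (\<Sum>k\<in>{1..5}. bb t k * YY t x k j)"
      by (rule sum.cong) (use Y5 j in auto)
    also have "\<dots> = by_form t x j" unfolding by_form_def s by (simp add: YY_6)
    also have "\<dots> = bb t 6 * (last_line_factor t j * G (m_class j 6) x)"
      using by_form_multiple6[OF d j5 nonzero_point[OF m], of x] b6 unfolding last_line_factor_def by simp
    also have "last_line_factor t j * G (m_class j 6) x = - all_lines t x 6 j" using j5 by (simp add: lines_def all_line_factor_def sg_def m_class_commute[of 6 j])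
    finally show ?thesis unfolding s by simp
  qed
  show "bb t i * aa t x 6 - bb t 6 * aa t x i + \<sigma> * pf4 (all_lines t x) k l m n = 0"
    if L: "labelling \<sigma> i 6 k l m n" for \<sigma> i k l m n
  proof -
    have n6: "i \<noteq> 6" "k \<noteq> 6" "l \<noteq> 6" "m \<noteq> 6" "n \<noteq> 6" and i: "i \<in> {1..6}" using labelling_range[OF L] labelling_distinct[OF L] by auto
    then have i5: "i \<in> {1..5}" by auto
    have "\<sigma> * pf4 (all_lines t x) k l m n = cofactor (YY t x) i 6"
      unfolding cofactor_eq[OF L YY_alt] pf4_def by (simp add: Y5 n6)
    then have "bb t i * aa t x 6 + \<sigma> * pf4 (all_lines t x) k l m n = x_form t x i" by (simp add: conics_def conic_factor_def x_form_def)
    also have "\<dots> = bb t 6 * aa t x i"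
      using x_form_multiple[OF d i5 nonzero_point[OF Q_in[OF i]], of x] b6 n6 unfolding conics_def conic_factor_def by simp
    finally show ?thesis by (simp only: add_diff_eq diff_add_eq) simp
  qed
qed

definition factor :: "pic \<Rightarrow> (pic \<Rightarrow> 'a) \<Rightarrow> 'a" where
  "factor = (SOME h. (\<forall>i\<in>{1..7}. h (exc i) = (\<lambda>t. t (exc i))) \<and>
     (\<forall>i\<in>{1..7}. \<forall>j\<in>{1..7}. i < j \<longrightarrow> h (m_class i j) = (\<lambda>t. all_line_factor t i j)) \<and>
     (\<forall>i\<in>{1..7}. \<forall>j\<in>{1..7}. i < j \<longrightarrow> h (Q7_class i j) = (\<lambda>t. conic_factor t i)))"

lemma factor:
  "\<And>i. i \<in> {1..6} \<Longrightarrow> factor (exc i) = (\<lambda>t. t (exc i))"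
  "\<And>i j. i \<in> {1..6} \<Longrightarrow> j \<in> {1..6} \<Longrightarrow> i \<noteq> j \<Longrightarrow> factor (m_class i j) = (\<lambda>t. all_line_factor t i j)"
  "\<And>i. i \<in> {1..6} \<Longrightarrow> factor (Q7_class i 7) = (\<lambda>t. conic_factor t i)"
proof -
  have "\<exists>h. (\<forall>i\<in>{1..7}. h (exc i) = (\<lambda>t. t (exc i))) \<and>
     (\<forall>i\<in>{1..7}. \<forall>j\<in>{1..7}. i < j \<longrightarrow> h (m_class i j) = (\<lambda>t. all_line_factor t i j)) \<and>
     (\<forall>i\<in>{1..7}. \<forall>j\<in>{1..7}. i < j \<longrightarrow> h (Q7_class i j) = (\<lambda>t. conic_factor t i))" (is "\<exists>h. ?P h")
    by (rule class_function[of "\<lambda>i t. t (exc i)" "\<lambda>i j t. all_line_factor t i j" "\<lambda>i j t. conic_factor t i" "\<lambda>_ _. 0"]) blast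
  then have P: "?P factor" unfolding factor_def by (rule someI_ex)
  show "\<And>i. i \<in> {1..6} \<Longrightarrow> factor (exc i) = (\<lambda>t. t (exc i))" using P by auto
  have m: "factor (m_class i j) = (\<lambda>t. all_line_factor t i j)" if "i \<in> {1..6}" "j \<in> {1..6}" "i < j" for i j using P that by auto
  show "factor (m_class i j) = (\<lambda>t. all_line_factor t i j)" if "i \<in> {1..6}" "j \<in> {1..6}" "i \<noteq> j" for i j
  proof (cases "i < j")
    case True then show ?thesis using m that by blast
  next
    case False
    then have "j < i" using that by simp
    then show ?thesis using m[of j i] that by (simp add: m_class_commute[of i j] all_line_factor_sym[of _ i j])
  qed
  show "\<And>i. i \<in> {1..6} \<Longrightarrow> factor (Q7_class i 7) = (\<lambda>t. conic_factor t i)" using P by auto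
qed

lemma factor_E6_point:
  assumes d: "\<delta> t \<noteq> 0"
  shows "E6_point (\<lambda>E. factor E t * G E x)"
proof -
  define b a y where "b i = factor (exc i) t * G (exc i) x" and "a i = factor (Q7_class i 7) t * G (Q7_class i 7) x"
    and "y i j = sg i j * (factor (m_class i j) t * G (m_class i j) x)" for i j
  have b: "b i = bb t i" if "i \<in> {1..6}" for i
  proof -
    have "i \<in> {1..r}" using that r6' by simp
    then show ?thesis by (simp add: b_def bb_def factor(1)[OF that] exc_value_r(1))
  qed
  have a: "a i = aa t x i" if "i \<in> {1..6}" for i
    using factor(3)[OF that] by (simp add: a_def conics_def)
  have y: "y i j = all_lines t x i j" if "i \<in> {1..6}" "j \<in> {1..6}" for i j
    using factor(2)[OF that] by (cases "i = j") (simp_all add: y_def lines_def sg_refl)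
  note D = E6_everywhere[OF d, of x, unfolded E6rel_def]
  have "E6rel b a y"
    unfolding E6rel_def
  proof (intro conjI allI impI ballI)
    fix \<sigma> :: 'a and i j k l m n :: nat assume L: "labelling \<sigma> i j k l m n"
    note r = labelling_range[OF L]
    show "b i * a j - b j * a i + \<sigma> * pf4 y k l m n = 0"
      using conjunct1[OF D, rule_format, OF L]
      unfolding pf4_def y[OF r(3,4)] y[OF r(5,6)] y[OF r(3,5)] y[OF r(4,6)] y[OF r(3,6)] y[OF r(4,5)] b[OF r(1)] b[OF r(2)] a[OF r(1)] a[OF r(2)] .
  next
    fix j :: nat assume j: "j \<in> {1..6}"
    have "(\<Sum>k\<in>{1..6}. b k * y k j) = (\<Sum>k\<in>{1..6}. bb t k * all_lines t x k j)"
      by (rule sum.cong[OF refl]) (simp only: b y j)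
    then show "(\<Sum>k\<in>{1..6}. b k * y k j) = 0" using D j by simp
    have "(\<Sum>k\<in>{1..6}. a k * y k j) = (\<Sum>k\<in>{1..6}. aa t x k * all_lines t x k j)"
      by (rule sum.cong[OF refl]) (simp only: a y j)
    then show "(\<Sum>k\<in>{1..6}. a k * y k j) = 0" using D j by simp
  qed
  then show ?thesis unfolding E6_point_def b_def[abs_def] a_def[abs_def] y_def[abs_def] .
qed

lemma RF_divide: "RF f \<Longrightarrow> RF (\<lambda>t. f t / bb t 5)" "RF f \<Longrightarrow> RF (\<lambda>t. f t / bb t 6)"
  using RF_divide_r[of f] unfolding r_minus at_r by blast+

lemma RF_last_conic_factor: "RF last_conic_factor"
  unfolding last_conic_factor_def[abs_def] by (intro ratfun_divide_const RF_divide ratfun_minus RF_cofactor) simp_all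

lemma RF_x_form: "i \<in> {1..5} \<Longrightarrow> RF (\<lambda>t. x_form t x i)"
  unfolding x_form_def by (intro ratfun_add ratfun_mult RF_bb RF_last_conic_factor RF_const RF_cofactor) auto

lemma RF_all_line_factor: "i \<noteq> j \<Longrightarrow> RF (\<lambda>t. all_line_factor t i j)"
proof -
  assume ij: "i \<noteq> j"
  have "RF (\<lambda>t. last_line_factor t j)" for j unfolding last_line_factor_def by (intro RF_divide ratfun_divide_const RF_by_form)
  then show ?thesis using RF_line_factor[OF ij] by (cases "i = 6"; cases "j = 6") (simp_all add: all_line_factor_def)
qed

lemma RF_conic_factor: assumes i: "i \<in> {1..6}" shows "RF (\<lambda>t. conic_factor t i)"
proof (cases "i = 6")
  case True then show ?thesis by (simp add: conic_factor_def RF_last_conic_factor)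
next
  case False
  then have "i \<in> {1..5}" using i by auto
  then show ?thesis unfolding conic_factor_def if_not_P[OF False] by (intro RF_divide ratfun_divide_const RF_x_form)
qed

lemma neg_curves6:
  assumes "E \<in> neg_curves r"
  obtains i where "i \<in> {1..6}" "E = exc i" | i j where "i \<in> {1..6}" "j \<in> {1..6}" "i < j" "E = m_class i j"
    | i where "i \<in> {1..6}" "E = Q7_class i 7"
proof -
  have "E \<in> exc ` {1..6} \<union> {m_class i j | i j. 1 \<le> i \<and> i < j \<and> j \<le> 6} \<union> Q6_class ` {1..6}"
    using assms unfolding r6' neg_curves_6 .
  then consider i where "i \<in> {1..6}" "E = exc i" | i j where "1 \<le> i" "i < j" "j \<le> 6" "E = m_class i j"
    | i where "i \<in> {1..6}" "E = Q7_class i 7" unfolding Q6_Q7 by blast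
  then show ?thesis
  proof cases
    case (2 i j)
    then have "i \<in> {1..6}" "j \<in> {1..6}" by auto
    then show ?thesis using that(2) 2 by blast
  qed (use that in blast)+
qed

lemma RF_factor: assumes "E \<in> neg_curves r" shows "RF (factor E)"
  using assms
proof (cases rule: neg_curves6)
  case (1 i) then show ?thesis using T_mem(1)[OF six] by (simp add: factor RF_coord del: atLeastAtMost_iff)
next
  case (2 i j) then have "i \<noteq> j" by simp
  then show ?thesis using factor(2)[of i j] 2 RF_all_line_factor by simp
next
  case (3 i) then show ?thesis using factor(3)[of i] RF_conic_factor by simp
qed

section \<open>Six points: no factor vanishes identically\<close>

lemma adapted_\<delta>: "adapted B S q t \<Longrightarrow> 5 \<in> B \<Longrightarrow> 6 \<in> B \<Longrightarrow> \<delta> t \<noteq> 0"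
  using adapted_\<delta>_r[of B S q t] unfolding r_minus using r6' by blast

lemmas adapted_YY = adapted_YY_r[unfolded r_minus] and adapted_pivot_factor_zero = adapted_pivot_factor_zero_r[unfolded r_minus]
  and adapted_pivot_factor_nz = adapted_pivot_factor_nz_r[unfolded r_minus] and YY_5 = YY_pivot[unfolded r_minus]

text \<open>Of the Pfaffian on the indices 1 to 4, these parameters leave the product of two lines.\<close>

lemma pf4_56_witness:
  obtains t where "\<delta> t \<noteq> 0" "\<And>x. cofactor (YY t x) 5 6 = G (m_class 1 2) x * G (m_class 3 4) x"
proof -
  obtain t where t: "adapted {5, 6} {{1, 2}, {3, 4}} 0 t" by (rule adapted_exists)
  note s = labelling_swap
  have rot: "labelling (-\<sigma>) n i j k l m" if L: "labelling (\<sigma>::'a) i j k l m n" for \<sigma> i j k l m n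
    using s(1)[OF s(2)[OF s(3)[OF s(4)[OF s(5)[OF L]]]]] by simp
  have L: "labelling (1::'a) 5 6 1 2 3 4" using rot[OF rot[OF labelling_id]] by simp
  have "cofactor (YY t x) 5 6 = G (m_class 1 2) x * G (m_class 3 4) x" for x
    unfolding cofactor_eq[OF L YY_alt] pf4_def using adapted_YY[OF t]
    by (simp add: doubleton_eq_iff sg_def del: One_nat_def)
  moreover have "\<delta> t \<noteq> 0" by (rule adapted_\<delta>[OF t]) auto
  ultimately show ?thesis using that by blast
qed

lemma last_conic_factor_witness: "\<exists>t. \<delta> t \<noteq> 0 \<and> last_conic_factor t \<noteq> 0"
proof -
  obtain t where t: "\<delta> t \<noteq> 0" "\<And>x. cofactor (YY t x) 5 6 = G (m_class 1 2) x * G (m_class 3 4) x"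
    by (rule pf4_56_witness) blast
  have "last_conic_factor t \<noteq> 0" unfolding last_conic_factor_def t(2)
    using \<delta>_nz[OF t(1)] G_Q(3)[of 6] G_m_nz[of 1 2 6] G_m_nz[of 3 4 6] by simp
  then show ?thesis using t(1) by blast
qed

text \<open>At \<open>p\<^sub>i\<close> the term with \<open>a\<^sub>6\<close> vanishes, and the parameters leave in the Pfaffian one product of two lines
  that avoid \<open>p\<^sub>i\<close>.\<close>

lemma x_form_witness:
  assumes i: "i \<in> {1..5}"
  shows "\<exists>t. \<delta> t \<noteq> 0 \<and> (\<exists>x. x_form t x i \<noteq> 0)"
proof (cases "i = 5")
  case True
  obtain t where t: "\<delta> t \<noteq> 0" "\<And>x. cofactor (YY t x) 5 6 = G (m_class 1 2) x * G (m_class 3 4) x"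
    by (rule pf4_56_witness) blast
  have "x_form t (p 5) 5 \<noteq> 0" unfolding x_form_def t(2)
    using G_Q(2)[of 6 5] G_m_nz[of 1 2 5] G_m_nz[of 3 4 5] by simp
  then show ?thesis using t(1) True by blast
next
  case False
  then have i4: "i \<in> {1..4}" "i \<in> {1..6}" "(6::nat) \<in> {1..6}" "i \<noteq> 6" "i \<noteq> 5" using i by auto
  obtain \<sigma>0 k0 l0 m0 n0 where L0: "labelling (\<sigma>0::'a) i 6 k0 l0 m0 n0" using labelling_exists i4(2-4) by metis
  have "(6::nat) \<noteq> 5" "(5::nat) \<in> {1..6}" by auto
  then obtain \<sigma> j k l where L: "labelling (\<sigma>::'a) i 6 j k l 5" by (rule labelling_last[OF L0 i4(5)]) blast
  note r = labelling_range[OF L] and d = labelling_distinct[OF L]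
  have small: "q \<in> {1..4}" if "q \<in> {1..6}" "q \<noteq> 5" "q \<noteq> 6" for q :: nat
    using that unfolding atLeastAtMost_iff by arith
  have jkl: "j \<in> {1..4}" "k \<in> {1..4}" "l \<in> {1..4}"
    by (rule small[OF r(3)], use d in simp, use d in simp, rule small[OF r(4)], use d in simp, use d in simp,
        rule small[OF r(5)], use d in simp, use d in simp)
  \<comment> \<open>The pair \<open>{i, l}\<close> makes the line from \<open>p\<^sub>l\<close> to the pivot \<open>p\<^sub>5\<close> nonzero, the pair \<open>{j, k}\<close> is its partner.\<close>
  obtain t where t: "adapted {i, 5, 6} {{j, k}, {i, l}} 0 t" by (rule adapted_exists)
  have fl: "pivot_factor t l \<noteq> 0" by (rule adapted_pivot_factor_nz[OF t jkl(3) i4(1)]) (use d jkl in auto)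
  have fj: "pivot_factor t j = 0" "pivot_factor t k = 0"
    by (rule adapted_pivot_factor_zero[OF t jkl(1)], use d jkl in \<open>auto simp: doubleton_eq_iff\<close>)
       (rule adapted_pivot_factor_zero[OF t jkl(2)], use d jkl in \<open>auto simp: doubleton_eq_iff\<close>)
  have "G (Q7_class 6 7) (p i) = 0" by (rule G_Q(2)) (use i4 in auto)
  then have "x_form t (p i) i = \<sigma> * pf4 (YY t (p i)) j k l 5" unfolding x_form_def cofactor_eq[OF L YY_alt] by simp
  also have "pf4 (YY t (p i)) j k l 5 = YY t (p i) j k * YY t (p i) l 5"
    unfolding pf4_def YY_5[OF jkl(1)] YY_5[OF jkl(2)] fj by simp
  finally have "x_form t (p i) i = \<sigma> * (YY t (p i) j k * YY t (p i) l 5)" .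
  moreover have "YY t (p i) j k \<noteq> 0"
    using adapted_YY[OF t jkl(1,2), of "p i"] G_m_nz[OF r(3,4) i4(2)] sg_nz[of j k] d by auto
  moreover have "YY t (p i) l 5 \<noteq> 0" unfolding YY_5[OF jkl(3)] using fl G_m_nz[OF r(5,6) i4(2)] d by auto
  moreover have "\<sigma> \<noteq> 0" by (rule labelling_nonzero[OF L])
  ultimately have "x_form t (p i) i \<noteq> 0" by simp
  then show ?thesis using adapted_\<delta>[OF t] by blast
qed

lemma factor_nz:
  assumes E: "E \<in> neg_curves r" shows "\<exists>t. \<delta> t \<noteq> 0 \<and> factor E t \<noteq> 0"
  using E
proof (cases rule: neg_curves6)
  case (1 i) then show ?thesis using coord_witness by (simp add: factor)
next
  case (2 i j)
  then have f: "factor E = (\<lambda>t. all_line_factor t i j)" and i5: "i \<in> {1..5}" and i6: "i \<noteq> 6" using factor(2)[of i j] by auto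
  show ?thesis
  proof (cases "j = 6")
    case True
    obtain t x where t: "\<delta> t \<noteq> 0" "by_form t x i \<noteq> 0" using by_form_witness[unfolded r_minus, OF i5] by blast
    have z: "G (m_class i 6) (nonzero_point (m_class i 6)) \<noteq> 0" using nonzero_point[OF E] 2(4) True by simp
    have "by_form t (nonzero_point (m_class i 6)) i \<noteq> 0" using by_form_multiple6[OF t(1) i5 z, of x] t(2) by auto
    then have "factor E t \<noteq> 0" unfolding f using True i6 z \<delta>_nz[OF t(1)] by (simp add: all_line_factor_def last_line_factor_def)
    then show ?thesis using t(1) by blast
  next
    case False
    then have "j \<in> {1..5}" using 2 by auto
    from line_factor_witness[unfolded r_minus, OF i5 this 2(3)] show ?thesis unfolding f using False i6 by (simp add: all_line_factor_def)
  qed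
next
  case (3 i)
  then have f: "factor E = (\<lambda>t. conic_factor t i)" using factor(3)[of i] by simp
  show ?thesis
  proof (cases "i = 6")
    case True then show ?thesis using last_conic_factor_witness unfolding f by (simp add: conic_factor_def)
  next
    case False
    then have i5: "i \<in> {1..5}" using 3 by auto
    obtain t x where t: "\<delta> t \<noteq> 0" "x_form t x i \<noteq> 0" using x_form_witness[OF i5] by blast
    have z: "G (Q7_class i 7) (nonzero_point (Q7_class i 7)) \<noteq> 0" using nonzero_point[OF E] 3(2) by simp
    have "x_form t (nonzero_point (Q7_class i 7)) i \<noteq> 0" using x_form_multiple[OF t(1) i5 z, of x] t(2) by auto
    then have "factor E t \<noteq> 0" unfolding f using False z \<delta>_nz[OF t(1)] by (simp add: conic_factor_def)
    then show ?thesis using t(1) by blast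
  qed
qed

lemma factor_T: "E \<in> T \<Longrightarrow> factor E t = t E"
proof -
  assume "E \<in> T"
  then consider i where "i \<in> {1..6}" "E = exc i" | i j where "1 \<le> i" "i < j" "j \<le> 4" "E = m_class i j"
    unfolding T_def r_minus using r6' by auto
  then show ?thesis
  proof cases
    case (1 i) then show ?thesis by (simp add: factor)
  next
    case (2 i j)
    then have "i \<in> {1..6}" "j \<in> {1..6}" "i \<noteq> 6" "j \<noteq> 6" "i \<in> {1..r - 2}" "j \<in> {1..r - 2}" unfolding r_minus by auto
    then show ?thesis using factor(2)[of i j] line_factor_inner[of i j t] 2 by (simp add: all_line_factor_def)
  qed
qed

theorem family6: "\<exists>U. parameter_family (num_neg_curves (r - 2) + 2) r T U (\<lambda>t E. factor E t) \<and>
    (\<forall>t\<in>U. rescaling r (\<lambda>E. factor E t) \<and> (\<forall>\<xi>\<in>A_S r p s. E6_point (rescale (\<lambda>E. factor E t) \<xi>)))"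
proof -
  obtain U where U: "parameter_family (num_neg_curves (r - 2) + 2) r T U (\<lambda>t E. factor E t)"
    "\<And>t. t \<in> U \<Longrightarrow> \<delta> t \<noteq> 0" "\<And>t. t \<in> U \<Longrightarrow> rescaling r (\<lambda>E. factor E t)"
    using family_of_factors[OF RF_factor factor_T factor_nz] by blast
  have "E6_point (rescale (\<lambda>E. factor E t) \<xi>)" if t: "t \<in> U" and \<xi>: "\<xi> \<in> A_S r p s" for t \<xi>
  proof -
    obtain \<phi> where \<phi>: "\<phi> \<in> cox_points r p" "\<xi> = (\<lambda>E. if E \<in> neg_curves r then \<phi> (Poly_Mapping.single E (s E)) else 0)"
      using \<xi> unfolding A_S_def by blast
    show ?thesis
    proof (rule E6_point_transfer[OF r6' \<phi>(1)])
      show "E6_point (\<lambda>E. factor E t * G E x)" for x by (rule factor_E6_point[OF U(2)[OF t]])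
      show "rescale (\<lambda>E. factor E t) \<xi> E = factor E t * \<phi> (Poly_Mapping.single E (s E))" if "E \<in> neg_curves r" for E
        using that by (simp add: rescale_def \<phi>(2))
    qed
  qed
  then show ?thesis using U by blast
qed

end

section \<open>The theorem\<close>

text \<open>Rescaling the generators by constants is another choice of generating sections, which rescales the
  embedding.\<close>

lemma (in sections) scaled_section_choice:
  assumes \<kappa>: "\<And>E. \<kappa> E \<noteq> 0"
  shows "section_choice r p (\<lambda>E y. \<kappa> E * s E y)"
    and "\<xi> \<in> A_S r p s \<Longrightarrow> (\<lambda>E. \<kappa> E * \<xi> E) \<in> A_S r p (\<lambda>E y. \<kappa> E * s E y)"
proof -
  have H: "(\<lambda>y. \<kappa> E * s E y) \<in> H0 r p E" if E: "E \<in> neg_curves r" for E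
  proof -
    have "(\<lambda>y. (if y \<in> X then \<kappa> E else 0) * s E y) = (\<lambda>y. \<kappa> E * s E y)"
      using H0_outside[OF s_H0[OF E]] by (auto simp: fun_eq_iff)
    then show ?thesis using H0_mult[OF H0_const s_H0[OF E], of "\<kappa> E"] by simp
  qed
  have "(\<lambda>y. \<kappa> E * s E y) \<noteq> 0" if "E \<in> neg_curves r" for E
    using s_nz[OF that] \<kappa>[of E] by (auto simp: fun_eq_iff)
  then show "section_choice r p (\<lambda>E y. \<kappa> E * s E y)" using H unfolding section_choice_def by blast
  assume "\<xi> \<in> A_S r p s"
  then obtain \<phi> where \<phi>: "\<phi> \<in> cox_points r p"
    and \<xi>: "\<xi> = (\<lambda>E. if E \<in> neg_curves r then \<phi> (Poly_Mapping.single E (s E)) else 0)"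
    unfolding A_S_def by blast
  have "\<kappa> E * \<phi> (Poly_Mapping.single E (s E)) = \<phi> (Poly_Mapping.single E (\<lambda>y. \<kappa> E * s E y))"
    if E: "E \<in> neg_curves r" for E
    unfolding cox_const_mult[OF s_H0[OF E], symmetric]
    using \<phi> cox_const_in cox_single[OF subsetD[OF neg_curves_Pic E] s_H0[OF E]] unfolding cox_points_def by simp
  then have "(\<lambda>E. \<kappa> E * \<xi> E) = (\<lambda>E. if E \<in> neg_curves r then \<phi> (Poly_Mapping.single E (\<lambda>y. \<kappa> E * s E y)) else 0)"
    by (simp add: \<xi> fun_eq_iff)
  then show "(\<lambda>E. \<kappa> E * \<xi> E) \<in> A_S r p (\<lambda>E y. \<kappa> E * s E y)" using \<phi> unfolding A_S_def by blast
qed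

theorem theorem1:
  fixes p :: "nat \<Rightarrow> ('a::{alg_closed_field, field_char_0})^3"
    and s :: "pic \<Rightarrow> (nat \<Rightarrow> 'a^3) \<Rightarrow> 'a"
    and r :: nat
  assumes "r \<in> {6, 7}"
    and "general_position r p"
    and "section_choice r p s"
  shows "\<exists>T U f. parameter_family (num_neg_curves (r - 2) + 2) r T U f \<and>
    (\<forall>t\<in>U. good_rescaling r p s (f t))"
proof (cases "r = 7")
  case True
  interpret sections7 r p s
    by unfold_locales (use assms True in auto)
  show ?thesis by (rule family7)
next
  case False
  then have r: "r = 6" using assms(1) by simp
  obtain \<kappa> :: "pic \<Rightarrow> 'a" where \<kappa>: "\<And>E. \<kappa> E \<noteq> 0" "\<And>\<xi>. E6_point (\<lambda>E. \<kappa> E * \<xi> E) \<Longrightarrow> \<xi> \<in> H6"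
    by (rule signs6) blast
  interpret S: sections r p s
    by unfold_locales (use assms r in auto)
  \<comment> \<open>The signs \<open>\<kappa>\<close> are moved into the choice of sections, so that the family is built without signs.\<close>
  interpret sections6 r p "\<lambda>E y. \<kappa> E * s E y"
    by unfold_locales (use assms r S.scaled_section_choice(1)[of \<kappa>, OF \<kappa>(1)] in auto)
  obtain U where U: "parameter_family (num_neg_curves (r - 2) + 2) r T U (\<lambda>t E. factor E t)"
    "\<And>t. t \<in> U \<Longrightarrow> rescaling r (\<lambda>E. factor E t)"
    "\<And>t \<xi>. t \<in> U \<Longrightarrow> \<xi> \<in> A_S r p (\<lambda>E y. \<kappa> E * s E y) \<Longrightarrow> E6_point (rescale (\<lambda>E. factor E t) \<xi>)"
    using family6 by blast
  have "good_rescaling r p s (\<lambda>E. factor E t)" if t: "t \<in> U" for t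
  proof -
    have "rescale (\<lambda>E. factor E t) \<xi> \<in> H6" if \<xi>: "\<xi> \<in> A_S r p s" for \<xi>
    proof (rule \<kappa>(2))
      have "(\<lambda>E. \<kappa> E * rescale (\<lambda>E. factor E t) \<xi> E) = rescale (\<lambda>E. factor E t) (\<lambda>E. \<kappa> E * \<xi> E)"
        by (simp add: rescale_def fun_eq_iff mult_ac)
      then show "E6_point (\<lambda>E. \<kappa> E * rescale (\<lambda>E. factor E t) \<xi> E)"
        using U(3)[OF t S.scaled_section_choice(2)[of \<kappa>, OF \<kappa>(1) \<xi>]] by simp
    qed
    then show ?thesis using U(2)[OF t] unfolding good_rescaling_def H_cone_def using r by auto
  qed
  then show ?thesis using U(1) by blast
qed

end
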